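(* Let $K$ be an algebraically closed field. For every $n\ge 3$, the compactified camera space $\Gamma_n$ is an irreducible component of the multigraded Hilbert scheme $\mathcal{H}_n$.
   Context: $K[x,y,z]$ is the polynomial ring in $3n$ unknowns $x_i,y_i,z_i$ ($1\le i\le n$) with $\mathbb{Z}^n$-grading $\deg x_i=\deg y_i=\deg z_i=e_i$. $\mathcal{H}_n$ is the multigraded Hilbert scheme (in the sense of Haiman and Sturmfels; a projective scheme over $K$) parametrizing all $\mathbb{Z}^n$-homogeneous ideals $I\subset K[x,y,z]$ such that $K[x,y,z]/I$ has the Hilbert function $$\mathbb{N}^n\to\mathbb{N},\quad (u_1,\dots,u_n)\mapsto\binom{u_1+\cdots+u_n+3}{3}-\sum_{i=1}^n\binom{u_i+2}{3}.$$ For an $n$-tuple $A=(A_1,\dots,A_n)$ of $3\times4$-matrices of rank $3$ over $K$, the multiview ideal $J_A\subset K[x,y,z]$ is the prime ideal of all polynomials vanishing on the closure in $(\mathbb{P}^2)^n$ (coordinates $(x_i:y_i:z_i)$ on the $i$-th factor) of the image of the rational map $\mathbb{P}^3\dashrightarrow(\mathbb{P}^2)^n$, $\mathbf{x}\mapsto(A_1\mathbf{x},\dots,A_n\mathbf{x})$. If the kernels of the $A_i$ are pairwise distinct points of $\mathbb{P}^3$, then $J_A$ is a point of $\mathcal{H}_n$. Let $\mathrm{Gr}(4,3n)$ be the Grassmannian of $4$-dimensional subspaces of $K^{3n}$, whose points are represented as row spaces of $4\times3n$-matrices $[A_1^T\ A_2^T\ \cdots\ A_n^T]$; the torus $(K^*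 )^n$ acts on it by sending this matrix to $[\lambda_1A_1^T\ \lambda_2A_2^T\ \cdots\ \lambda_nA_n^T]$. The ideal $J_A$ depends only on the $(K^* )^n$-orbit of the row space, so $A\mapsto J_A$ gives a rational map $\gamma$ from a GIT quotient $\mathrm{Gr}(4,3n)/\!/(K^* )^n$ to $\mathcal{H}_n$ (the choice of linearization does not matter). The compactified camera space is $\Gamma_n:=\overline{\gamma(\mathrm{Gr}(4,3n)/\!/(K^* )^n)}\subseteq\mathcal{H}_n$, the Zariski closure of the image of $\gamma$. *)

theory Defs
  imports
    "HOL-Analysis.Analysis"
    "HOL-Library.Poly_Mapping"
    "HOL-Library.Numeral_Type"
    "HOL-Combinatorics.Permutations"
    "HOL-Computational_Algebra.Polynomial"
begin

section \<open>Multigraded polynomials\<close>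

text \<open>
  A polynomial over \<open>'k\<close> in variables of type \<open>'v\<close> is a finitely supported function from
  monomials (themselves finitely supported functions, the exponent vectors) to coefficients.
\<close>

type_synonym 'v monom = "'v \<Rightarrow>\<^sub>0 nat"
type_synonym ('v, 'k) mpoly = "'v monom \<Rightarrow>\<^sub>0 'k"

definition scale :: "'k::field \<Rightarrow> ('v, 'k) mpoly \<Rightarrow> ('v, 'k) mpoly" where
  "scale c p = Poly_Mapping.single 0 c * p"

interpretation pm: vector_space "scale :: 'k::field \<Rightarrow> ('v, 'k) mpoly \<Rightarrow> ('v, 'k) mpoly"
  by unfold_locales
    (simp_all add: scale_def distrib_left distrib_right single_add mult_single
      flip: mult.assoc)

lemma lookup_scale: "Poly_Mapping.lookup (scale c p) m = c * Poly_Mapping.lookup p m"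
  unfolding scale_def mult_map_scale_conv_mult[symmetric] by (simp add: map.rep_eq when_def)

lemma keys_scale: "Poly_Mapping.keys (scale c p) \<subseteq> Poly_Mapping.keys p"
  by (auto simp: in_keys_iff lookup_scale)

definition peval :: "('v, 'k::field) mpoly \<Rightarrow> ('v \<Rightarrow> 'k) \<Rightarrow> 'k" where
  "peval f p = (\<Sum>m\<in>Poly_Mapping.keys f. Poly_Mapping.lookup f m *
                  (\<Prod>v\<in>Poly_Mapping.keys m. p v ^ Poly_Mapping.lookup m v))"

text \<open>
  A map \<open>\<delta> :: 'v \<Rightarrow> 'i\<close> gives the grading in which the variable \<open>v\<close> has degree
  the standard basis vector indexed by \<open>\<delta> v\<close>. All degrees that occur are nonnegative, so they
  are taken in \<open>'i \<Rightarrow> nat\<close>.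
\<close>

definition multideg :: "('v \<Rightarrow> 'i) \<Rightarrow> 'v monom \<Rightarrow> 'i \<Rightarrow> nat" where
  "multideg \<delta> m i = (\<Sum>v | v \<in> Poly_Mapping.keys m \<and> \<delta> v = i. Poly_Mapping.lookup m v)"

definition graded_part :: "('v \<Rightarrow> 'i) \<Rightarrow> ('i \<Rightarrow> nat) \<Rightarrow> ('v, 'k::field) mpoly set" where
  "graded_part \<delta> u = {f. \<forall>m\<in>Poly_Mapping.keys f. multideg \<delta> m = u}"

definition multihomogeneous :: "('v \<Rightarrow> 'i) \<Rightarrow> ('v, 'k::field) mpoly \<Rightarrow> bool" where
  "multihomogeneous \<delta> f \<longleftrightarrow> (\<exists>u. f \<in> graded_part \<delta> u)"

definition is_ideal :: "'a::comm_ring_1 set \<Rightarrow> bool" where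
  "is_ideal I \<longleftrightarrow> 0 \<in> I \<and> (\<forall>f\<in>I. \<forall>g\<in>I. f + g \<in> I) \<and> (\<forall>h. \<forall>f\<in>I. h * f \<in> I)"

text \<open>An ideal is homogeneous if it contains the graded components of its elements.\<close>

definition homogeneous_ideal :: "('v \<Rightarrow> 'i) \<Rightarrow> ('v, 'k::field) mpoly set \<Rightarrow> bool" where
  "homogeneous_ideal \<delta> I \<longleftrightarrow> is_ideal I \<and>
     (\<forall>f\<in>I. \<forall>u. \<exists>g\<in>I. \<forall>m. Poly_Mapping.lookup g m =
        (if multideg \<delta> m = u then Poly_Mapping.lookup f m else 0))"

text \<open>
  The residue classes of the elements of \<open>B\<close> form a basis of the quotient space
  \<open>V / (I \<inter> V)\<close>; they are pairwise distinct because coefficients are unique.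
\<close>

definition quotient_basis ::
  "('v, 'k::field) mpoly set \<Rightarrow> ('v, 'k) mpoly set \<Rightarrow> ('v, 'k) mpoly set \<Rightarrow> bool" where
  "quotient_basis V I B \<longleftrightarrow> finite B \<and> B \<subseteq> V \<and>
     (\<forall>p\<in>V. \<exists>!c. (\<forall>b. b \<notin> B \<longrightarrow> c b = 0) \<and> p - (\<Sum>b\<in>B. scale (c b) b) \<in> I)"

definition has_hilbert_function ::
  "('v \<Rightarrow> 'i) \<Rightarrow> ('v, 'k::field) mpoly set \<Rightarrow> (('i \<Rightarrow> nat) \<Rightarrow> int) \<Rightarrow> bool" where
  "has_hilbert_function \<delta> I h \<longleftrightarrow>
     (\<forall>u. \<exists>B. quotient_basis (graded_part \<delta> u) I B \<and> int (card B) = h u)"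


section \<open>The multigraded Hilbert scheme\<close>

text \<open>
  The index type \<open>'n\<close> plays the role of \<open>{1, \<dots>, n}\<close>, and \<open>(i, r)\<close> with \<open>r :: 3\<close> stands
  for \<open>x\<^sub>i, y\<^sub>i, z\<^sub>i\<close>. The grading is given by \<open>fst\<close>.
\<close>

type_synonym ('n, 'k) xyz_poly = "('n \<times> 3, 'k) mpoly"

definition mv_hilbert_function :: "('n::finite \<Rightarrow> nat) \<Rightarrow> int" where
  "mv_hilbert_function u =
     int (((\<Sum>i\<in>UNIV. u i) + 3) choose 3) - (\<Sum>i\<in>UNIV. int ((u i + 2) choose 3))"

text \<open>The set of closed points of the Hilbert scheme (over an algebraically closed field).\<close>

definition hilbert_points :: "('n::finite, 'k::field) xyz_poly set set" where
  "hilbert_points = {I. homogeneous_ideal fst I \<and> has_hilbert_function fst I mv_hilbert_function}"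

text \<open>
  Pluecker coordinates of the subspaces \<open>I\<^sub>u\<close> of \<open>K[x,y,z]\<^sub>u\<close>, for all degrees \<open>u\<close> at once.
  The coordinate \<open>(u, [m\<^sub>1, \<dots>, m\<^sub>r])\<close> is the minor (in Leibniz form) with columns
  \<open>m\<^sub>1, \<dots>, m\<^sub>r\<close> of the coefficient matrix of a basis of \<open>I\<^sub>u\<close>. A different choice of bases
  rescales, for each \<open>u\<close>, all coordinates of degree \<open>u\<close> by a common nonzero factor.
\<close>

definition minor :: "('v, 'k::field) mpoly list \<Rightarrow> 'v monom list \<Rightarrow> 'k" where
  "minor fs ms = (\<Sum>\<pi> | \<pi> permutes {..<length fs}.
     of_int (sign \<pi>) * (\<Prod>i<length fs. Poly_Mapping.lookup (fs ! i) (ms ! \<pi> i)))"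

definition pluecker_vector ::
  "('n::finite, 'k::field) xyz_poly set \<Rightarrow>
   (('n \<Rightarrow> nat) \<times> ('n \<times> 3) monom list \<Rightarrow> 'k) \<Rightarrow> bool" where
  "pluecker_vector I P \<longleftrightarrow> (\<forall>u. \<exists>fs. distinct fs \<and> pm.independent (set fs) \<and>
     pm.span (set fs) = I \<inter> graded_part fst u \<and>
     (\<forall>ms. P (u, ms) =
       (if length ms = length fs \<and> (\<forall>m\<in>set ms. multideg fst m = u) then minor fs ms else 0)))"

text \<open>
  The Zariski topology on the closed points: the basic open sets are the nonvanishing loci of
  polynomials in the Pluecker coordinates that are homogeneous separately in the coordinates of
  each \<open>I\<^sub>u\<close>. Each such polynomial involves finitely many degrees only, and for every
  sufficiently large finite set \<open>D\<close> of degrees the map \<open>I \<mapsto> (I\<^sub>u)\<^sub>u\<^sub>\<in>\<^sub>D\<close> is the closed embedding of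
  the Hilbert scheme into a product of Grassmannians due to Haiman and Sturmfels. So this is the
  topology induced by that embedding.
\<close>

definition hilbert_basic_open ::
  "(('n \<Rightarrow> nat) \<times> ('n \<times> 3) monom list, 'k) mpoly \<Rightarrow>
   ('n::finite, 'k::field) xyz_poly set set" where
  "hilbert_basic_open F = {I \<in> hilbert_points. \<exists>P. pluecker_vector I P \<and> peval F P \<noteq> 0}"

definition hilbert_scheme :: "('n::finite, 'k::field) xyz_poly set topology" where
  "hilbert_scheme = topology_generated_by {hilbert_basic_open F | F. multihomogeneous fst F}"

lemma finite_multideg: "finite {m :: ('n::finite \<times> 3) monom. multideg fst m = u}"
proof -
  define N where "N = (\<Sum>i\<in>UNIV. u i)"
  have le: "Poly_Mapping.lookup m v \<le> N" if "multideg fst m = u" for m :: "('n \<times> 3) monom" and v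
  proof (cases "v \<in> Poly_Mapping.keys m")
    case True
    then have "Poly_Mapping.lookup m v \<le> multideg fst m (fst v)"
      unfolding multideg_def by (intro member_le_sum) auto
    also have "\<dots> \<le> N" unfolding that N_def by (intro member_le_sum) auto
    finally show ?thesis .
  qed (simp add: in_keys_iff)
  have "Poly_Mapping.lookup ` {m. multideg fst m = u} \<subseteq> (UNIV :: ('n \<times> 3) set) \<rightarrow>\<^sub>E {..N}"
    using le by auto
  then have "finite (Poly_Mapping.lookup ` {m :: ('n \<times> 3) monom. multideg fst m = u})"
    by (rule finite_subset) (auto intro: finite_PiE)
  then show ?thesis
    by (rule finite_imageD) (auto simp: inj_on_def intro: poly_mapping_eqI)
qed

lemma pluecker_vector_exists:
  fixes I :: "('n::finite, 'k::field) xyz_poly set"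
  assumes "is_ideal I"
  shows "\<exists>P. pluecker_vector I P"
proof -
  have "\<exists>fs. distinct fs \<and> pm.independent (set fs) \<and> pm.span (set fs) = I \<inter> graded_part fst u" for u
  proof -
    let ?V = "I \<inter> graded_part fst u"
    define M :: "('n, 'k) xyz_poly set"
      where "M = (\<lambda>m. Poly_Mapping.single m 1) ` {m. multideg fst m = u}"
    have "graded_part fst u \<subseteq> pm.span M"
    proof
      fix f :: "('n, 'k) xyz_poly" assume f: "f \<in> graded_part fst u"
      have "f = (\<Sum>m\<in>Poly_Mapping.keys f. Poly_Mapping.single m (Poly_Mapping.lookup f m))"
        by (intro poly_mapping_eqI)
          (simp add: lookup_sum lookup_single when_def in_keys_iff sum.delta')
      also have "\<dots> = (\<Sum>m\<in>Poly_Mapping.keys f. scale (Poly_Mapping.lookup f m) (Poly_Mapping.single m 1))"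
        by (simp add: scale_def mult_single)
      also have "\<dots> \<in> pm.span M"
        using f by (intro pm.span_sum pm.span_scale pm.span_base) (auto simp: M_def graded_part_def)
      finally show "f \<in> pm.span M" .
    qed
    moreover obtain B where B: "B \<subseteq> ?V" "pm.independent B" "?V \<subseteq> pm.span B"
      using pm.maximal_independent_subset[of ?V] by auto
    moreover have "finite M" unfolding M_def using finite_multideg by auto
    ultimately have "finite B"
      using pm.independent_span_bound[of M B] by blast
    have "pm.subspace ?V"
      unfolding pm.subspace_def
    proof (intro conjI ballI allI)
      show "0 \<in> ?V" using assms by (auto simp: is_ideal_def graded_part_def)
    next
      fix f g assume "f \<in> ?V" "g \<in> ?V"
      then show "f + g \<in> ?V"
        using assms Poly_Mapping.keys_add[of f g] unfolding is_ideal_def graded_part_def by blast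
    next
      fix c f assume "f \<in> ?V"
      then show "scale c f \<in> ?V"
        using assms keys_scale[of c f] unfolding is_ideal_def graded_part_def
        by (auto simp: scale_def)
    qed
    then have "pm.span B = ?V" using B by (intro antisym pm.span_minimal) auto
    with \<open>finite B\<close> B(2) show ?thesis using finite_distinct_list by metis
  qed
  then obtain fs where fs: "\<And>u. distinct (fs u) \<and> pm.independent (set (fs u)) \<and>
      pm.span (set (fs u)) = I \<inter> graded_part fst u" by metis
  show ?thesis
    unfolding pluecker_vector_def
    by (rule exI[of _ "\<lambda>(u, ms). if length ms = length (fs u) \<and> (\<forall>m\<in>set ms. multideg fst m = u)
          then minor (fs u) ms else 0"]) (use fs in auto)
qed

lemma topspace_hilbert_scheme: "topspace hilbert_scheme = hilbert_points"
proof -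
  have "I \<in> hilbert_basic_open 1" if "I \<in> hilbert_points" for I :: "('n::finite, 'k::field) xyz_poly set"
    using that pluecker_vector_exists[of I]
    by (auto simp: hilbert_basic_open_def hilbert_points_def homogeneous_ideal_def peval_def)
  moreover have "multihomogeneous fst (1 :: (('n \<Rightarrow> nat) \<times> ('n \<times> 3) monom list, 'k::field) mpoly)"
    by (auto simp: multihomogeneous_def graded_part_def)
  ultimately show ?thesis
    unfolding hilbert_scheme_def topology_generated_by_topspace
    by (auto simp: hilbert_basic_open_def)
qed


section \<open>Multiview ideals\<close>

type_synonym ('n, 'k) cameras = "'n \<Rightarrow> 'k ^ 4 ^ 3"

text \<open>
  Sets of points of \<open>(\<P>\<^sup>2)\<^sup>n\<close> are represented by the sets of all their homogeneous coordinate
  vectors \<open>p\<close>, where \<open>p (i, r)\<close> is the coordinate \<open>r\<close> of the point in the factor \<open>i\<close>.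
\<close>

definition camera_image :: "('n::finite, 'k::field) cameras \<Rightarrow> ('n \<times> 3 \<Rightarrow> 'k) set" where
  "camera_image A = {p. \<exists>x t. (\<forall>i. A i *v x \<noteq> 0) \<and> (\<forall>i. t i \<noteq> 0) \<and>
     (\<forall>i r. p (i, r) = t i * (A i *v x) $ r)}"

definition multiprojective_closure :: "('n::finite \<times> 3 \<Rightarrow> 'k::field) set \<Rightarrow> ('n \<times> 3 \<Rightarrow> 'k) set" where
  "multiprojective_closure X = {p. (\<forall>i. \<exists>r. p (i, r) \<noteq> 0) \<and>
     (\<forall>f. multihomogeneous fst f \<and> (\<forall>q\<in>X. peval f q = 0) \<longrightarrow> peval f p = 0)}"

definition multiview_ideal :: "('n::finite, 'k::field) cameras \<Rightarrow> ('n, 'k) xyz_poly set" where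
  "multiview_ideal A = {f. \<forall>p\<in>multiprojective_closure (camera_image A). peval f p = 0}"


section \<open>The compactified camera space\<close>

definition grassmannian :: "nat \<Rightarrow> ('k::field ^ 'm) set set" where
  "grassmannian d = {L. vec.subspace L \<and> vec.dim L = d}"

text \<open>The row space of the \<open>4 \<times> 3n\<close> matrix \<open>[A\<^sub>1\<^sup>T \<dots> A\<^sub>n\<^sup>T]\<close>.\<close>

definition camera_matrix :: "('n::finite, 'k::field) cameras \<Rightarrow> 'k ^ ('n \<times> 3) ^ 4" where
  "camera_matrix A = (\<chi> j v. A (fst v) $ snd v $ j)"

definition row_space :: "('n::finite, 'k::field) cameras \<Rightarrow> ('k ^ ('n \<times> 3)) set" where
  "row_space A = vec.span (rows (camera_matrix A))"

definition torus_act ::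
  "('n::finite \<Rightarrow> 'k::field) \<Rightarrow> 'k ^ ('n \<times> 3) \<Rightarrow> 'k ^ ('n \<times> 3)" where
  "torus_act t w = (\<chi> v. t (fst v) * w $ v)"

definition torus_orbit :: "('k::field ^ ('n::finite \<times> 3)) set \<Rightarrow> ('k ^ ('n \<times> 3)) set set" where
  "torus_orbit L = {torus_act t ` L | t. \<forall>i. t i \<noteq> 0}"

definition generic_cameras :: "('n::finite, 'k::field) cameras \<Rightarrow> bool" where
  "generic_cameras A \<longleftrightarrow> (\<forall>i. rank (A i) = 3) \<and>
     (\<forall>i j. i \<noteq> j \<longrightarrow> {x. A i *v x = 0} \<noteq> {x. A j *v x = 0}) \<and>
     row_space A \<in> grassmannian 4"

text \<open>
  The rational map \<open>\<gamma>\<close> is defined on the orbits of the row spaces of generic cameras. These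
  contain a dense open subset of the GIT quotient for every linearization with stable points, and
  the closure of the image does not depend on which such set of orbits is used.
\<close>

definition gamma_domain :: "('k::field ^ ('n::finite \<times> 3)) set set set" where
  "gamma_domain = {torus_orbit (row_space A) | A. generic_cameras A}"

definition gamma ::
  "('k::field ^ ('n::finite \<times> 3)) set set \<Rightarrow> ('n, 'k) xyz_poly set" where
  "gamma \<Omega> = (THE J. \<exists>A. generic_cameras A \<and> row_space A \<in> \<Omega> \<and> J = multiview_ideal A)"

lemma row_space_eq:
  fixes A :: "('b::finite, 'a::field) cameras"
  shows "row_space A = range (\<lambda>x. \<chi> v. (A (fst v) *v x) $ snd v)"
proof -
  have "row_space A = vec.span (columns (transpose (camera_matrix A)))"
    by (simp add: row_space_def columns_transpose)
  also have "\<dots> = range (\<lambda>x. transpose (camera_matrix A) *v x)"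
  proof -
    have "column j M = M *v axis j 1" for j and M :: "'a ^ 4 ^ ('b \<times> 3)"
      by (simp add: vec_eq_iff column_def matrix_vector_mult_def axis_def if_distrib sum.delta
          cong: if_cong)
    then have "columns (transpose (camera_matrix A)) = (*v) (transpose (camera_matrix A)) ` cart_basis"
      by (auto simp: columns_def cart_basis_def simp del: transpose_matrix_vector)
    moreover have "vec.span ((*v) (transpose (camera_matrix A)) ` cart_basis) =
        (*v) (transpose (camera_matrix A)) ` vec.span cart_basis"
      by (rule vec.span_image)
    ultimately show ?thesis by simp
  qed
  also have "(\<lambda>x. transpose (camera_matrix A) *v x) = (\<lambda>x. \<chi> v. (A (fst v) *v x) $ snd v)"
    by (auto simp: fun_eq_iff vec_eq_iff matrix_vector_mult_def transpose_def camera_matrix_def)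
  finally show ?thesis .
qed

lemma camera_image_eq:
  "camera_image A = {p. \<exists>w\<in>row_space A. \<exists>t. (\<forall>i. \<exists>r. w $ (i, r) \<noteq> 0) \<and> (\<forall>i. t i \<noteq> 0) \<and>
     (\<forall>i r. p (i, r) = t i * w $ (i, r))}"
  by (auto simp: camera_image_def row_space_eq vec_eq_iff)

lemma camera_image_subset:
  assumes "row_space A = torus_act s ` row_space B" "\<And>i. s i \<noteq> 0"
  shows "camera_image A \<subseteq> camera_image B"
proof
  fix p assume "p \<in> camera_image A"
  then obtain w t where w: "w \<in> row_space B"
    and nz: "\<forall>i. \<exists>r. torus_act s w $ (i, r) \<noteq> 0" "\<forall>i. t i \<noteq> 0"
    and p: "\<forall>i r. p (i, r) = t i * torus_act s w $ (i, r)"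
    unfolding camera_image_eq assms(1) by auto
  have "\<forall>i. \<exists>r. w $ (i, r) \<noteq> 0"
    using nz(1) by (auto simp: torus_act_def)
  moreover have "\<forall>i. t i * s i \<noteq> 0" using nz(2) assms(2) by simp
  moreover have "\<forall>i r. p (i, r) = (t i * s i) * w $ (i, r)"
    using p by (simp add: torus_act_def mult.assoc)
  ultimately show "p \<in> camera_image B"
    using w unfolding camera_image_eq by (intro CollectI bexI[of _ w] exI[of _ "\<lambda>i. t i * s i"]) auto
qed

lemma multiview_ideal_torus_orbit:
  assumes "row_space A \<in> torus_orbit (row_space B)"
  shows "multiview_ideal A = multiview_ideal B"
proof -
  from assms obtain s where s: "row_space A = torus_act s ` row_space B" "\<And>i. s i \<noteq> 0"
    by (auto simp: torus_orbit_def)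
  have "torus_act (\<lambda>i. inverse (s i)) ` row_space A = row_space B"
  proof -
    have "torus_act (\<lambda>i. inverse (s i)) (torus_act s w) = w" for w
      using s(2) by (simp add: vec_eq_iff torus_act_def flip: mult.assoc)
    then show ?thesis by (simp add: s(1) image_image)
  qed
  then have "camera_image B \<subseteq> camera_image A"
    using s(2) by (intro camera_image_subset[of _ "\<lambda>i. inverse (s i)"]) auto
  with camera_image_subset[OF s] have "camera_image A = camera_image B" by simp
  then show ?thesis by (simp add: multiview_ideal_def)
qed

lemma gamma_eq_multiview_ideal:
  assumes "generic_cameras A"
  shows "gamma (torus_orbit (row_space A)) = multiview_ideal A"
proof -
  have "row_space A \<in> torus_orbit (row_space A)"
    unfolding torus_orbit_def
    by (rule CollectI, rule exI[of _ "\<lambda>_. 1"]) (simp add: torus_act_def)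
  then show ?thesis
    unfolding gamma_def using assms multiview_ideal_torus_orbit
    by (intro the_equality) blast+
qed

lemma gamma_image: "gamma ` gamma_domain = {multiview_ideal A | A. generic_cameras A}"
  by (force simp: gamma_domain_def gamma_eq_multiview_ideal)

definition camera_space :: "('n::finite, 'k::field) xyz_poly set set" where
  "camera_space = hilbert_scheme closure_of (gamma ` gamma_domain)"


section \<open>Irreducible components\<close>

definition irreducible_in :: "'a topology \<Rightarrow> 'a set \<Rightarrow> bool" where
  "irreducible_in X S \<longleftrightarrow> S \<subseteq> topspace X \<and> S \<noteq> {} \<and>
     (\<forall>C D. closedin X C \<and> closedin X D \<and> S \<subseteq> C \<union> D \<longrightarrow> S \<subseteq> C \<or> S \<subseteq> D)"

definition irreducible_component :: "'a topology \<Rightarrow> 'a set \<Rightarrow> bool" where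
  "irreducible_component X S \<longleftrightarrow>
     irreducible_in X S \<and> (\<forall>T. irreducible_in X T \<and> S \<subseteq> T \<longrightarrow> T = S)"

end

theory Submission
  imports Defs "HOL-Library.Function_Algebras"
begin

text \<open>
  Tuples of cameras form an affine space, and a nonempty open condition on the ideals meets a line of
  cameras in all but finitely many of its points; so the multiview ideals form an irreducible set.
  Its closure is a component as soon as it contains a nonempty open subset of the Hilbert scheme.

  An ideal \<open>I\<close> of the Hilbert scheme contains, up to scalars, a unique form \<open>F\<^sub>i\<^sub>j\<close> of degree
  \<open>e\<^sub>i + e\<^sub>j\<close>. If these forms satisfy a suitable open nondegeneracy condition, the Hilbert function in
  degrees supported on three views forces a relation between \<open>F\<^sub>i\<^sub>j\<close>, \<open>F\<^sub>i\<^sub>k\<close> and \<open>F\<^sub>j\<^sub>k\<close>, which makes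
  them bilinear forms of rank 2 with compatible epipoles. Cameras \<open>A\<close> can then be reconstructed such
  that all \<open>F\<^sub>i\<^sub>j\<close> vanish on their image. Expressing the further views in terms of two of them turns any
  \<open>f \<in> I\<close> of degree \<open>u\<close> into a form \<open>\<phi>\<close> in two views that multiplies every monomial of degree \<open>u\<close>
  into \<open>I\<close>. If \<open>f\<close> did not vanish on the image of \<open>A\<close>, neither would \<open>\<phi>\<close>, and the Hilbert function
  of \<open>I\<close> would grow too slowly. Hence \<open>I \<subseteq> J\<^sub>A\<close>, and the ideals agree since their Hilbert functions do.
\<close>

section \<open>Linear algebra over a field\<close>

text \<open>A polynomial of degree u pulls back along the cameras to a form in four variables that
  vanishes to order \<open>u i\<close> at the centre of camera i, because the coordinates of view i
  vanish there. The subtracted binomials of the Hilbert function count these conditions. The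
  relation between three bilinear forms is found by counting. In degree e_i + e_j + e_k the ideal
  has dimension 10, one more than the multiples of the bilinear forms can account for, so there is a
  further form T. In degree e_i + e_j + 2 e_k it has dimension 25, but 26 products are available.
  Expressing further views through two of them leads out of the ideal: only the products of the new
  form with monomials of degree u return to I, and these monomials cannot be cancelled, since I is
  not known to be prime. Hence the comparison of cubic with quadratic growth. The final comparison
  of Hilbert functions makes generators of J_A unnecessary. Topology on the space of cameras is
  replaced by lines of cameras and by the fact that a polynomial function of one parameter has
  finitely many zeros or none but zeros.\<close>

lemma infinite_UNIV_alg_closed: "infinite (UNIV :: 'k::alg_closed_field set)"
proof
  assume fin: "finite (UNIV :: 'k set)"
  \<comment> \<open>Adding 1 to the product over all field elements gives a polynomial of positive
    degree whose value is 1 everywhere.\<close>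
  define p :: "'k poly" where "p = (\<Prod>a\<in>UNIV. [:-a, 1:]) + 1"
  have "degree (\<Prod>a\<in>(UNIV::'k set). [:-a, 1:]) = card (UNIV :: 'k set)"
    by (subst degree_prod_eq_sum_degree) auto
  moreover have "card (UNIV :: 'k set) > 0"
    using fin by (simp add: card_gt_0_iff)
  ultimately have "degree p > 0"
    unfolding p_def by (subst degree_add_eq_left) auto
  then obtain x where "poly p x = 0"
    using alg_closed_imp_poly_has_root by blast
  moreover have "poly (\<Prod>a\<in>(UNIV::'k set). [:-a, 1:]) x = 0"
    using fin by (auto simp: poly_prod prod_zero_iff intro!: bexI[of _ x])
  ultimately show False by (simp add: p_def)
qed

text \<open>Gaussian elimination: a pivot \<open>j0\<close> removes the equation \<open>t0\<close>
  together with one unknown, so the surplus of unknowns survives. The Steinitz bound and the kernel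
  computations in small dimension rest on this.\<close>

lemma homogeneous_system_solution:
  fixes a :: "'j \<Rightarrow> 't \<Rightarrow> 'k::field"
  assumes "finite T" "finite J" "card T < card J"
  shows "\<exists>c. (\<exists>j\<in>J. c j \<noteq> 0) \<and> (\<forall>t\<in>T. (\<Sum>j\<in>J. c j * a j t) = 0)"
  using assms
proof (induction T arbitrary: J a rule: finite_induct)
  case empty
  then obtain j where "j \<in> J" by fastforce
  then show ?case by (intro exI[of _ "\<lambda>_. 1"]) auto
next
  case (insert t0 T)
  show ?case
  proof (cases "\<forall>j\<in>J. a j t0 = 0")
    case True
    have "card T < card J" using insert by simp
    then obtain c where "\<exists>j\<in>J. c j \<noteq> 0" "\<forall>t\<in>T. (\<Sum>j\<in>J. c j * a j t) = 0"
      using insert.IH[of J a] insert.prems by blast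
    then show ?thesis using True by (intro exI[of _ c]) auto
  next
    case False
    then obtain j0 where j0: "j0 \<in> J" "a j0 t0 \<noteq> 0" by blast
    define J' where "J' = J - {j0}"
    \<comment> \<open>Substituting the value of the unknown \<open>j0\<close> forced by the equation
      \<open>t0\<close> turns the other coefficients into \<open>a'\<close>; \<open>s\<close> below
      is that forced value.\<close>
    define a' where "a' j t = a j t - a j t0 / a j0 t0 * a j0 t" for j t
    have "finite J'" "card T < card J'"
      using insert.prems insert.hyps j0 by (auto simp: J'_def)
    then obtain c where c: "\<exists>j\<in>J'. c j \<noteq> 0" "\<forall>t\<in>T. (\<Sum>j\<in>J'. c j * a' j t) = 0"
      using insert.IH[of J' a'] by blast
    define s where "s = - (\<Sum>j\<in>J'. c j * a j t0) / a j0 t0"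
    have sum: "(\<Sum>j\<in>J. (c(j0 := s)) j * a j t) = s * a j0 t + (\<Sum>j\<in>J'. c j * a j t)" for t
    proof -
      have "(\<Sum>j\<in>J'. (c(j0 := s)) j * a j t) = (\<Sum>j\<in>J'. c j * a j t)"
        by (rule sum.cong) (auto simp: J'_def)
      then show ?thesis
        using j0 insert.prems by (simp add: J'_def sum.remove[of J j0])
    qed
    have "(\<Sum>j\<in>J. (c(j0 := s)) j * a j t) = 0" if "t \<in> insert t0 T" for t
    proof (cases "t = t0")
      case True
      then show ?thesis using j0 by (simp only: sum) (simp add: s_def)
    next
      case False
      then have "(\<Sum>j\<in>J'. c j * a' j t) = 0" using c that by auto
      moreover have "(\<Sum>j\<in>J'. c j * a' j t) =
          (\<Sum>j\<in>J'. c j * a j t) - (\<Sum>j\<in>J'. c j * a j t0) / a j0 t0 * a j0 t"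
        by (simp add: a'_def sum_subtractf sum_distrib_right sum_distrib_left
          sum_divide_distrib algebra_simps)
      ultimately show ?thesis by (simp only: sum) (simp add: s_def)
    qed
    moreover have "\<exists>j\<in>J. (c(j0 := s)) j \<noteq> 0" using c(1) by (auto simp: J'_def)
    ultimately show ?thesis by blast
  qed
qed

section \<open>Independence and spanning modulo a subspace\<close>

locale field_vector_space = vector_space scale
  for scale :: "'a::field \<Rightarrow> 'b::ab_group_add \<Rightarrow> 'b"
begin

text \<open>Independence of the classes in the quotient by \<open>U\<close>, without forming the
  quotient. Families are indexed, so that two of them can be joined over a disjoint sum of index
  sets even if members coincide.\<close>

definition indep_mod :: "'b set \<Rightarrow> 'j set \<Rightarrow> ('j \<Rightarrow> 'b) \<Rightarrow> bool" where
  "indep_mod U J v \<longleftrightarrow> (\<forall>c. (\<Sum>j\<in>J. scale (c j) (v j)) \<in> U \<longrightarrow> (\<forall>j\<in>J. c j = 0))"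

text \<open>The members \<open>v j\<close> may lie outside \<open>V\<close>; it is only the elements
  of \<open>V\<close> that have to be reached.\<close>

definition spans_mod :: "'b set \<Rightarrow> 'j set \<Rightarrow> ('j \<Rightarrow> 'b) \<Rightarrow> 'b set \<Rightarrow> bool" where
  "spans_mod U J v V \<longleftrightarrow> (\<forall>p\<in>V. \<exists>c. p - (\<Sum>j\<in>J. scale (c j) (v j)) \<in> U)"

lemma indep_modI:
  "(\<And>c j. (\<Sum>j\<in>J. scale (c j) (v j)) \<in> U \<Longrightarrow> j \<in> J \<Longrightarrow> c j = 0) \<Longrightarrow> indep_mod U J v"
  unfolding indep_mod_def by blast

lemma indep_modD:
  "indep_mod U J v \<Longrightarrow> (\<Sum>j\<in>J. scale (c j) (v j)) \<in> U \<Longrightarrow> j \<in> J \<Longrightarrow> c j = 0"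
  unfolding indep_mod_def by blast

lemma spans_modE:
  assumes "spans_mod U J v V" "p \<in> V"
  obtains c where "p - (\<Sum>j\<in>J. scale (c j) (v j)) \<in> U"
  using assms unfolding spans_mod_def by blast

lemma sum_scale_indicator:
  "finite J \<Longrightarrow> i \<in> J \<Longrightarrow> (\<Sum>j\<in>J. scale (if j = i then 1 else 0) (v j)) = v i"
  by (simp add: if_distrib[of "\<lambda>c. scale c _"] cong: if_cong)

text \<open>Writing each \<open>v j\<close> in terms of the \<open>w t\<close> turns a relation
  among the \<open>v j\<close> into \<open>card T\<close> equations for \<open>card J\<close>
  unknowns. With more unknowns than equations there is a nontrivial relation modulo
  \<open>U\<close>.\<close>

lemma steinitz_mod:
  assumes U: "subspace U" and fin: "finite J" "finite T"
    and ind: "indep_mod U J v" and span: "spans_mod U T w V" and sub: "v ` J \<subseteq> V"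
  shows "card J \<le> card T"
proof (rule ccontr)
  assume "\<not> card J \<le> card T"
  have "\<forall>j\<in>J. \<exists>a. v j - (\<Sum>t\<in>T. scale (a t) (w t)) \<in> U"
    using span sub by (auto simp: spans_mod_def)
  then obtain a where a: "\<And>j. j \<in> J \<Longrightarrow> v j - (\<Sum>t\<in>T. scale (a j t) (w t)) \<in> U"
    by metis
  obtain c where c: "\<exists>j\<in>J. c j \<noteq> 0" "\<forall>t\<in>T. (\<Sum>j\<in>J. c j * a j t) = 0"
    using homogeneous_system_solution[of T J a] fin \<open>\<not> card J \<le> card T\<close> by force
  have "(\<Sum>j\<in>J. scale (c j) (v j - (\<Sum>t\<in>T. scale (a j t) (w t)))) \<in> U"
    using a U by (intro subspace_sum subspace_scale) auto
  moreover have "(\<Sum>j\<in>J. scale (c j) (\<Sum>t\<in>T. scale (a j t) (w t))) = 0"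
  proof -
    have "(\<Sum>j\<in>J. scale (c j) (\<Sum>t\<in>T. scale (a j t) (w t))) =
        (\<Sum>t\<in>T. \<Sum>j\<in>J. scale (c j * a j t) (w t))"
      by (simp add: scale_sum_right sum.swap[of _ T J])
    also have "\<dots> = (\<Sum>t\<in>T. scale (\<Sum>j\<in>J. c j * a j t) (w t))"
      by (simp add: scale_sum_left)
    finally show ?thesis using c(2) by simp
  qed
  ultimately have "(\<Sum>j\<in>J. scale (c j) (v j)) \<in> U"
    by (simp add: scale_right_diff_distrib sum_subtractf)
  with ind c(1) show False by (auto simp: indep_mod_def)
qed

lemma indep_mod_inj_on:
  assumes "subspace U" "finite J" "indep_mod U J v"
  shows "inj_on v J"
proof
  fix i j assume ij: "i \<in> J" "j \<in> J" "v i = v j"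
  show "i = j"
  proof (rule ccontr)
    assume "i \<noteq> j"
    define c where "c l = (if l = i then 1 else 0) - (if l = j then 1 else 0 :: 'a)" for l
    have "(\<Sum>l\<in>J. scale (c l) (v l)) = v i - v j"
      using ij assms(2) by (simp add: c_def scale_left_diff_distrib sum_subtractf sum_scale_indicator)
    then have "(\<Sum>l\<in>J. scale (c l) (v l)) \<in> U" using ij assms(1) subspace_0 by simp
    then have "c i = 0" using assms(3) ij by (auto simp: indep_mod_def)
    with \<open>i \<noteq> j\<close> show False by (simp add: c_def)
  qed
qed

lemma exists_basis_mod:
  assumes U: "subspace U" and V: "subspace V" and fin: "finite T" and span: "spans_mod U T w V"
  shows "\<exists>B. finite B \<and> B \<subseteq> V \<and> indep_mod U B id \<and> spans_mod U B id V"
proof -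
  \<comment> \<open>Steinitz bounds the size of independent subsets by \<open>card T\<close>, so a
    largest one exists; a vector that it does not reach could be adjoined.\<close>
  define P where "P B \<longleftrightarrow> finite B \<and> B \<subseteq> V \<and> indep_mod U B id" for B
  have "P {}" by (simp add: P_def indep_mod_def)
  moreover have "card B < Suc (card T)" if "P B" for B
    using steinitz_mod[OF U _ fin _ span, of B id] that by (auto simp: P_def less_Suc_eq_le)
  ultimately obtain B where B: "P B" and max: "\<And>B'. P B' \<Longrightarrow> card B' \<le> card B"
    using ex_has_greatest_nat[of P "{}" card "Suc (card T)"] by blast
  have finB: "finite B" and BV: "B \<subseteq> V" and ind: "indep_mod U B id" using B by (auto simp: P_def)
  have "spans_mod U B id V"
    unfolding spans_mod_def
  proof
    fix p assume p: "p \<in> V"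
    show "\<exists>c. p - (\<Sum>j\<in>B. scale (c j) (id j)) \<in> U"
    proof (rule ccontr)
      assume none: "\<not> ?thesis"
      have pB: "p \<notin> B"
      proof
        assume "p \<in> B"
        then have "p - (\<Sum>j\<in>B. scale (if j = p then 1 else 0) (id j)) \<in> U"
          using sum_scale_indicator[of B p id] finB U subspace_0 by simp
        with none show False by (elim notE) (rule exI)
      qed
      have "indep_mod U (insert p B) id"
        unfolding indep_mod_def
      proof (intro allI impI)
        fix c assume "(\<Sum>j\<in>insert p B. scale (c j) (id j)) \<in> U"
        then have *: "scale (c p) p + (\<Sum>j\<in>B. scale (c j) j) \<in> U"
          using pB finB by simp
        have "c p = 0"
        proof (rule ccontr)
          assume "c p \<noteq> 0"
          have "scale (inverse (c p)) (scale (c p) p + (\<Sum>j\<in>B. scale (c j) j)) \<in> U"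
            using * U subspace_scale by blast
          also have "scale (inverse (c p)) (scale (c p) p + (\<Sum>j\<in>B. scale (c j) j)) =
              p - (\<Sum>j\<in>B. scale (- inverse (c p) * c j) (id j))"
            using \<open>c p \<noteq> 0\<close>
            by (simp add: scale_right_distrib scale_sum_right sum_negf)
          finally show False using none by (elim notE) (rule exI[of _ "\<lambda>j. - inverse (c p) * c j"])
        qed
        moreover from this * have "\<forall>j\<in>B. c j = 0"
          using ind by (simp add: indep_mod_def)
        ultimately show "\<forall>j\<in>insert p B. c j = 0" by simp
      qed
      then have "P (insert p B)" using p finB BV by (simp add: P_def)
      from max[OF this] show False using pB finB by simp
    qed
  qed
  with finB BV ind show ?thesis by blast
qed

lemma spans_mod_subset: "spans_mod U J v V \<Longrightarrow> V' \<subseteq> V \<Longrightarrow> spans_mod U J v V'"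
  by (auto simp: spans_mod_def)

text \<open>Together with \<open>spans_mod_Plus\<close> this is additivity of dimension along a
  chain of subspaces \<open>U'\<close>, \<open>U\<close>, \<open>V\<close>: one family is read
  modulo \<open>U\<close>, the other inside \<open>U\<close> modulo \<open>U'\<close>.\<close>

lemma indep_mod_Plus:
  assumes "finite J" "finite K" "indep_mod U J v" "indep_mod U' K w" "w ` K \<subseteq> U"
    "subspace U" "U' \<subseteq> U"
  shows "indep_mod U' (J <+> K) (case_sum v w)"
  unfolding indep_mod_def
proof (intro allI impI)
  fix c assume "(\<Sum>j\<in>J <+> K. scale (c j) (case_sum v w j)) \<in> U'"
  then have *: "(\<Sum>j\<in>J. scale (c (Inl j)) (v j)) + (\<Sum>j\<in>K. scale (c (Inr j)) (w j)) \<in> U'"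
    using assms(1,2) by (simp add: sum.Plus)
  have "(\<Sum>j\<in>K. scale (c (Inr j)) (w j)) \<in> U"
    using assms(5,6) by (intro subspace_sum subspace_scale) auto
  then have "(\<Sum>j\<in>J. scale (c (Inl j)) (v j)) \<in> U"
    using * assms(6,7) subspace_diff[of U "(\<Sum>j\<in>J. scale (c (Inl j)) (v j)) + (\<Sum>j\<in>K. scale (c (Inr j)) (w j))" "(\<Sum>j\<in>K. scale (c (Inr j)) (w j))"] by auto
  then have 1: "\<forall>j\<in>J. c (Inl j) = 0" using assms(3) by (auto simp: indep_mod_def)
  then have "\<forall>j\<in>K. c (Inr j) = 0" using * assms(4)
    unfolding indep_mod_def by (auto dest!: spec[of _ "\<lambda>k. c (Inr k)"])
  with 1 show "\<forall>j\<in>J <+> K. c j = 0" by auto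
qed

lemma spans_mod_Plus:
  assumes "finite J" "finite K" "spans_mod U J v V" "spans_mod U' K w U"
  shows "spans_mod U' (J <+> K) (case_sum v w) V"
  unfolding spans_mod_def
proof
  fix p assume "p \<in> V"
  then obtain c where "p - (\<Sum>j\<in>J. scale (c j) (v j)) \<in> U"
    using assms(3) by (auto simp: spans_mod_def)
  then obtain d where "p - (\<Sum>j\<in>J. scale (c j) (v j)) - (\<Sum>j\<in>K. scale (d j) (w j)) \<in> U'"
    using assms(4) by (auto simp: spans_mod_def)
  then show "\<exists>c. p - (\<Sum>j\<in>J <+> K. scale (c j) (case_sum v w j)) \<in> U'"
    using assms(1,2) by (intro exI[of _ "case_sum c d"]) (simp add: sum.Plus diff_diff_eq)
qed

end

interpretation pm: field_vector_space "scale :: 'k::field \<Rightarrow> ('v, 'k) mpoly \<Rightarrow> ('v, 'k) mpoly"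
  by unfold_locales

interpretation fs: field_vector_space "\<lambda>(c::'k::field) (f :: 'a \<Rightarrow> 'k) x. c * f x"
  by unfold_locales (simp_all add: fun_eq_iff algebra_simps)

section \<open>Polynomials as functions\<close>

abbreviation lookup :: "('a \<Rightarrow>\<^sub>0 'b::zero) \<Rightarrow> 'a \<Rightarrow> 'b" where
  "lookup \<equiv> Poly_Mapping.lookup"
abbreviation keys :: "('a \<Rightarrow>\<^sub>0 'b::zero) \<Rightarrow> 'a set" where
  "keys \<equiv> Poly_Mapping.keys"

definition Mon :: "'v monom \<Rightarrow> ('v, 'k::field) mpoly" where
  "Mon m = Poly_Mapping.single m 1"

definition Var :: "'v \<Rightarrow> ('v, 'k::field) mpoly" where
  "Var v = Mon (Poly_Mapping.single v 1)"

definition meval :: "'v monom \<Rightarrow> ('v \<Rightarrow> 'k::field) \<Rightarrow> 'k" where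
  "meval m p = (\<Prod>v\<in>keys m. p v ^ lookup m v)"

lemma meval_superset: "finite V \<Longrightarrow> keys m \<subseteq> V \<Longrightarrow> meval m p = (\<Prod>v\<in>V. p v ^ lookup m v)"
  unfolding meval_def by (rule prod.mono_neutral_left) (auto simp: in_keys_iff)

lemma meval_UNIV: "meval m (p :: 'v::finite \<Rightarrow> _) = (\<Prod>v\<in>UNIV. p v ^ lookup m v)"
  by (rule meval_superset) auto

lemma meval_0 [simp]: "meval 0 p = 1"
  by (simp add: meval_def)

lemma meval_add: "meval (m + m') p = meval m p * meval m' p"
proof -
  let ?V = "keys m \<union> keys m'"
  have "meval (m + m') p = (\<Prod>v\<in>?V. p v ^ lookup (m + m') v)"
    using Poly_Mapping.keys_add[of m m'] by (intro meval_superset) auto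
  also have "\<dots> = (\<Prod>v\<in>?V. p v ^ lookup m v) * (\<Prod>v\<in>?V. p v ^ lookup m' v)"
    by (simp add: lookup_add power_add prod.distrib)
  finally show ?thesis by (simp add: meval_superset[of ?V])
qed

lemma meval_single [simp]: "meval (Poly_Mapping.single v n) p = p v ^ n"
  by (cases "n = 0") (simp_all add: meval_def)

lemma peval_superset:
  "finite M \<Longrightarrow> keys f \<subseteq> M \<Longrightarrow> peval f p = (\<Sum>m\<in>M. lookup f m * meval m p)"
  unfolding peval_def meval_def[symmetric] by (rule sum.mono_neutral_left) (auto simp: in_keys_iff)

lemma peval_0 [simp]: "peval 0 p = 0"
  by (simp add: peval_def)

lemma peval_add: "peval (f + g) p = peval f p + peval g p"
proof -
  let ?M = "keys f \<union> keys g"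
  have "peval (f + g) p = (\<Sum>m\<in>?M. lookup (f + g) m * meval m p)"
    using Poly_Mapping.keys_add[of f g] by (intro peval_superset) auto
  also have "\<dots> = peval f p + peval g p"
    by (simp add: lookup_add distrib_right sum.distrib peval_superset[of ?M])
  finally show ?thesis .
qed

lemma peval_sum: "peval (sum f A) p = (\<Sum>a\<in>A. peval (f a) p)"
  by (induction A rule: infinite_finite_induct) (simp_all add: peval_add)

lemma peval_single: "peval (Poly_Mapping.single m c) p = c * meval m p"
  by (subst peval_superset[of "{m}"]) auto

lemma peval_Mon [simp]: "peval (Mon m) p = meval m p"
  by (simp add: Mon_def peval_single)

lemma peval_Var [simp]: "peval (Var v) p = p v"
  by (simp add: Var_def)

lemma mpoly_eq_sum_single: "f = (\<Sum>m\<in>keys f. Poly_Mapping.single m (lookup f m))"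
  by (intro poly_mapping_eqI) (simp add: lookup_sum lookup_single when_def in_keys_iff sum.delta')

lemma peval_mult: "peval (f * g) p = peval f p * peval g p"
proof -
  have "f * g = (\<Sum>m\<in>keys f. Poly_Mapping.single m (lookup f m)) * (\<Sum>m\<in>keys g. Poly_Mapping.single m (lookup g m))"
    by (rule arg_cong2[where f = times]) (rule mpoly_eq_sum_single)+
  also have "\<dots> = (\<Sum>m\<in>keys f. \<Sum>m'\<in>keys g. Poly_Mapping.single (m + m') (lookup f m * lookup g m'))"
    by (simp add: sum_product mult_single)
  also have "peval \<dots> p = peval f p * peval g p"
    by (simp add: peval_sum peval_single meval_add sum_product peval_superset[of "keys f" f]
        peval_superset[of "keys g" g] mult_ac)
  finally show ?thesis .
qed

lemma peval_1 [simp]: "peval 1 p = 1"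
  using peval_single[of 0 1 p] by simp

lemma peval_scale [simp]: "peval (scale c f) p = c * peval f p"
  by (simp add: scale_def peval_mult peval_single)

lemma peval_uminus: "peval (- f) p = - peval f p"
  using peval_add[of f "- f" p] by (simp add: eq_neg_iff_add_eq_0 add.commute)

lemma peval_diff: "peval (f - g) p = peval f p - peval g p"
  using peval_add[of f "- g" p] by (simp add: peval_uminus)

lemma peval_prod: "peval (prod f A) p = (\<Prod>a\<in>A. peval (f a) p)"
  by (induction A rule: infinite_finite_induct) (simp_all add: peval_mult)

lemma peval_power: "peval (f ^ n) p = peval f p ^ n"
  by (induction n) (simp_all add: peval_mult)

lemma mpoly_eq_sum_Mon: "f = (\<Sum>m\<in>keys f. scale (lookup f m) (Mon m))"
  using mpoly_eq_sum_single[of f] by (simp add: scale_def Mon_def mult_single)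

lemma Mon_add: "Mon (m + m') = Mon m * Mon m'"
  by (simp add: Mon_def mult_single)

lemma Mon_0: "Mon 0 = 1"
  by (simp add: Mon_def)

section \<open>Polynomials are determined by their values\<close>

lemma infinite_zeros_imp_poly_zero:
  fixes p :: "'k::idom poly"
  assumes "infinite {x. poly p x = 0}"
  shows "p = 0"
  using assms poly_roots_finite by blast

lemma coeffs_zero_of_sum_zero:
  fixes g :: "nat \<Rightarrow> 'k::alg_closed_field"
  assumes "\<And>t. (\<Sum>k\<in>K. t ^ k * g k) = 0" "finite K" "k \<in> K"
  shows "g k = 0"
proof -
  define p where "p = (\<Sum>k\<in>K. monom (g k) k)"
  have "poly p t = 0" for t
    using assms(1)[of t] by (simp add: p_def poly_sum poly_monom mult.commute)
  then have "p = 0"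
    by (intro infinite_zeros_imp_poly_zero) (simp add: infinite_UNIV_alg_closed)
  then have "coeff p k = 0" by simp
  then show ?thesis using assms(2,3) by (simp add: p_def coeff_sum sum.delta')
qed

text \<open>Induction on the variables: with all others fixed, the sum is a polynomial in the
  variable \<open>v\<close> with infinitely many zeros, so the coefficient of each power of
  \<open>v\<close> vanishes as a function of the others. Exponents are zero outside
  \<open>V\<close>, so that they are determined by their values on \<open>V\<close>.\<close>

lemma monomial_functions_independent:
  fixes c :: "('v \<Rightarrow> nat) \<Rightarrow> 'k::alg_closed_field"
  assumes "finite V" "finite M" "\<And>m v. m \<in> M \<Longrightarrow> v \<notin> V \<Longrightarrow> m v = 0"
    "\<And>p. (\<Sum>m\<in>M. c m * (\<Prod>v\<in>V. p v ^ m v)) = 0" "m \<in> M"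
  shows "c m = 0"
  using assms
proof (induction V arbitrary: M c m rule: finite_induct)
  case empty
  have "n = m" if "n \<in> M" for n using empty(2)[OF that] empty(2)[OF empty(4)] by (simp add: fun_eq_iff)
  then have M: "M = {m}" using empty(4) by blast
  show ?case using empty(3)[of undefined] unfolding M by simp
next
  case (insert v V)
  define K where "K = (\<lambda>m. m v) ` M"
  define Mk where "Mk k = {m\<in>M. m v = k}" for k
  have finK: "finite K" using insert.prems by (simp add: K_def)
  have decomp: "(\<Sum>m\<in>M. c m * (\<Prod>w\<in>insert v V. p w ^ m w)) =
      (\<Sum>k\<in>K. p v ^ k * (\<Sum>m\<in>Mk k. c m * (\<Prod>w\<in>V. p w ^ m w)))" for p
  proof -
    have "(\<Sum>k\<in>K. p v ^ k * (\<Sum>m\<in>Mk k. c m * (\<Prod>w\<in>V. p w ^ m w))) =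
        (\<Sum>k\<in>K. \<Sum>m\<in>Mk k. c m * (\<Prod>w\<in>insert v V. p w ^ m w))"
      using insert.hyps by (auto simp: Mk_def sum_distrib_left intro!: sum.cong)
    also have "\<dots> = (\<Sum>m\<in>M. c m * (\<Prod>w\<in>insert v V. p w ^ m w))"
      unfolding Mk_def using insert.prems(1) finK by (intro sum.group) (auto simp: K_def)
    finally show ?thesis by simp
  qed
  have zero: "(\<Sum>m\<in>Mk k. c m * (\<Prod>w\<in>V. p w ^ m w)) = 0" if "k \<in> K" for k p
  proof (rule coeffs_zero_of_sum_zero[where K = K and g = "\<lambda>k. (\<Sum>m\<in>Mk k. c m * (\<Prod>w\<in>V. p w ^ m w))"])
    fix t
    have "(\<Prod>w\<in>V. (p(v := t)) w ^ m w) = (\<Prod>w\<in>V. p w ^ m w)" for m :: "'v \<Rightarrow> nat"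
      using insert.hyps by (intro prod.cong) auto
    then show "(\<Sum>k\<in>K. t ^ k * (\<Sum>m\<in>Mk k. c m * (\<Prod>w\<in>V. p w ^ m w))) = 0"
      using insert.prems(3)[of "p(v := t)"] unfolding decomp by simp
  qed (use finK that in auto)
  define M' where "M' = (\<lambda>m. m(v := 0)) ` Mk (m v)"
  have inj: "inj_on (\<lambda>m. m(v := 0)) (Mk (m v))"
  proof
    fix a b assume "a \<in> Mk (m v)" "b \<in> Mk (m v)" and eq: "a(v := 0) = b(v := 0)"
    then have "a v = b v" by (auto simp: Mk_def)
    moreover have "a w = b w" if "w \<noteq> v" for w using fun_cong[OF eq, of w] that by simp
    ultimately show "a = b" by (metis ext)
  qed
  \<comment> \<open>All members of \<open>Mk (m v)\<close> have the same exponent at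
    \<open>v\<close>. It is erased for the induction hypothesis and put back to find the
    coefficient.\<close>
  define c' where "c' n = c (n(v := m v))" for n
  have "c' (m(v := 0)) = 0"
  proof (rule insert.IH[where M = M'])
    show "finite M'" using insert.prems(1) by (auto simp: M'_def Mk_def)
    show "m(v := 0) \<in> M'" using insert.prems(4) by (auto simp: M'_def Mk_def)
    show "n w = 0" if "n \<in> M'" "w \<notin> V" for n w
      using that insert.prems(2) by (auto simp: M'_def Mk_def)
    show "(\<Sum>n\<in>M'. c' n * (\<Prod>w\<in>V. p w ^ n w)) = 0" for p
    proof -
      have "(\<Sum>n\<in>M'. c' n * (\<Prod>w\<in>V. p w ^ n w)) =
          (\<Sum>n\<in>Mk (m v). c' (n(v := 0)) * (\<Prod>w\<in>V. p w ^ (n(v := 0)) w))"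
        unfolding M'_def by (subst sum.reindex[OF inj]) simp
      also have "\<dots> = (\<Sum>n\<in>Mk (m v). c n * (\<Prod>w\<in>V. p w ^ n w))"
      proof (rule sum.cong[OF refl])
        fix n assume "n \<in> Mk (m v)"
        then have "n(v := m v) = n" by (auto simp: Mk_def fun_eq_iff)
        then have "c' (n(v := 0)) = c n" by (simp add: c'_def)
        moreover have "(\<Prod>w\<in>V. p w ^ (n(v := 0)) w) = (\<Prod>w\<in>V. p w ^ n w)"
          using insert.hyps by (intro prod.cong) auto
        ultimately show "c' (n(v := 0)) * (\<Prod>w\<in>V. p w ^ (n(v := 0)) w) = c n * (\<Prod>w\<in>V. p w ^ n w)"
          by simp
      qed
      also have "\<dots> = 0" using zero[of "m v" p] insert.prems(4) by (auto simp: K_def)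
      finally show ?thesis .
    qed
  qed
  then show ?case by (simp add: c'_def)
qed

lemma peval_eq_0_imp:
  fixes f :: "('v::finite, 'k::alg_closed_field) mpoly"
  assumes "\<And>p. peval f p = 0"
  shows "f = 0"
proof (rule ccontr)
  assume "f \<noteq> 0"
  have "keys f \<noteq> {}"
  proof
    assume "keys f = {}"
    then have "lookup f m = lookup 0 m" for m by (metis empty_iff in_keys_iff lookup_zero)
    then have "f = 0" by (rule poly_mapping_eqI)
    with \<open>f \<noteq> 0\<close> show False ..
  qed
  then obtain m where m: "m \<in> keys f" by blast
  have inj: "inj_on lookup (keys f)" by (simp add: inj_on_def Poly_Mapping.lookup_inject)
  have "(\<lambda>n. lookup f (Abs_poly_mapping n)) (lookup m) = 0"
  proof (rule monomial_functions_independent[where V = UNIV and M = "lookup ` keys f"])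
    fix p
    show "(\<Sum>m\<in>lookup ` keys f. lookup f (Abs_poly_mapping m) * (\<Prod>v\<in>UNIV. p v ^ m v)) = 0"
      using assms[of p]
      unfolding sum.reindex[OF inj] peval_superset[OF finite_keys order.refl, of f p]
      by (simp add: meval_UNIV Poly_Mapping.lookup_inverse)
  qed (use m in simp_all)
  then show False using m by (simp add: Poly_Mapping.lookup_inverse in_keys_iff)
qed

lemma peval_inject:
  fixes f g :: "('v::finite, 'k::alg_closed_field) mpoly"
  shows "(\<And>p. peval f p = peval g p) \<Longrightarrow> f = g"
  using peval_eq_0_imp[of "f - g"] by (simp add: peval_diff)

section \<open>Gradings and Hilbert functions\<close>

lemma multideg_superset:
  assumes "finite V" "keys m \<subseteq> V"
  shows "multideg \<delta> m i = (\<Sum>v | v \<in> V \<and> \<delta> v = i. lookup m v)"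
  unfolding multideg_def using assms by (intro sum.mono_neutral_left) (auto simp: in_keys_iff)

lemma multideg_add: "multideg \<delta> (m + m') = multideg \<delta> m + multideg \<delta> m'"
proof
  fix i
  let ?V = "keys m \<union> keys m'"
  have "multideg \<delta> (m + m') i = (\<Sum>v | v \<in> ?V \<and> \<delta> v = i. lookup (m + m') v)"
    using Poly_Mapping.keys_add[of m m'] by (intro multideg_superset) auto
  then show "multideg \<delta> (m + m') i = (multideg \<delta> m + multideg \<delta> m') i"
    by (simp add: lookup_add sum.distrib multideg_superset[of ?V])
qed

definition unit_deg :: "'i \<Rightarrow> 'i \<Rightarrow> nat" where
  "unit_deg i j = (if j = i then 1 else 0)"

lemma multideg_0 [simp]: "multideg \<delta> 0 = 0"
  by (simp add: multideg_def fun_eq_iff)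

lemma multideg_single: "multideg \<delta> (Poly_Mapping.single v 1) = unit_deg (\<delta> v)"
proof
  fix i
  have "multideg \<delta> (Poly_Mapping.single v 1) i =
      (\<Sum>w | w \<in> {v} \<and> \<delta> w = i. lookup (Poly_Mapping.single v 1) w)"
    by (rule multideg_superset) auto
  also have "{w. w \<in> {v} \<and> \<delta> w = i} = (if i = \<delta> v then {v} else {})" by auto
  finally show "multideg \<delta> (Poly_Mapping.single v 1) i = unit_deg (\<delta> v) i"
    by (simp add: unit_deg_def)
qed

lemma gp_subspace: "pm.subspace (graded_part \<delta> u :: ('a, 'c::field) mpoly set)"
proof (rule pm.subspaceI)
  fix f g :: "('a, 'c) mpoly" assume "f \<in> graded_part \<delta> u" "g \<in> graded_part \<delta> u"
  then show "f + g \<in> graded_part \<delta> u"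
    using Poly_Mapping.keys_add[of f g] unfolding graded_part_def by blast
next
  fix c and f :: "('a, 'c) mpoly" assume "f \<in> graded_part \<delta> u"
  then show "scale c f \<in> graded_part \<delta> u"
    using keys_scale[of c f] unfolding graded_part_def by blast
qed (simp add: graded_part_def)

lemma gp_0 [simp]: "0 \<in> graded_part \<delta> u"
  using gp_subspace pm.subspace_0 by blast

lemma gp_mult:
  assumes "f \<in> graded_part \<delta> u" "g \<in> graded_part \<delta> u'"
  shows "f * g \<in> graded_part \<delta> (u + u')"
proof -
  have "multideg \<delta> m = u + u'" if m: "m \<in> keys (f * g)" for m
  proof -
    obtain a b where "a \<in> keys f" "b \<in> keys g" "m = a + b"
      using m Poly_Mapping.keys_mult[of f g] by blast
    then show ?thesis using assms by (simp add: multideg_add graded_part_def)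
  qed
  then show ?thesis by (simp add: graded_part_def)
qed

lemma gp_Mon: "Mon m \<in> graded_part \<delta> (multideg \<delta> m)"
  by (simp add: graded_part_def Mon_def)

lemma gp_Var: "Var v \<in> graded_part \<delta> (unit_deg (\<delta> v))"
  using gp_Mon[of "Poly_Mapping.single v 1" \<delta>] unfolding Var_def multideg_single .

lemma gp_1: "1 \<in> graded_part \<delta> 0"
  using gp_Mon[of 0 \<delta>] by (simp add: Mon_0)

lemma gp_1': "1 \<in> graded_part \<delta> (\<lambda>_. 0)"
  using gp_1[of \<delta>] by (simp add: zero_fun_def)

lemma gp_power: "f \<in> graded_part \<delta> u \<Longrightarrow> f ^ n \<in> graded_part \<delta> (\<lambda>i. n * u i)"
proof (induction n)
  case 0
  then show ?case using gp_1 by (simp add: zero_fun_def)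
next
  case (Suc n)
  have "(\<lambda>i. Suc n * u i) = u + (\<lambda>i. n * u i)" by (simp add: fun_eq_iff)
  with Suc gp_mult[of f \<delta> u "f ^ n"] show ?case by (simp del: mult_Suc)
qed

lemma gp_prod:
  "(\<And>a. a \<in> S \<Longrightarrow> f a \<in> graded_part \<delta> (u a)) \<Longrightarrow> prod f S \<in> graded_part \<delta> (\<Sum>a\<in>S. u a)"
proof (induction S rule: infinite_finite_induct)
  case (infinite A)
  then show ?case using gp_1 gp_1' by simp
next
  case empty
  then show ?case using gp_1 gp_1' by simp
next
  case (insert x F)
  then have "f x * prod f F \<in> graded_part \<delta> (u x + sum u F)" by (intro gp_mult) auto
  then show ?case using insert by (simp add: plus_fun_def)
qed

lemma peval_torus:
  fixes \<delta> :: "'v::finite \<Rightarrow> 'i::finite"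
  assumes "f \<in> graded_part \<delta> u"
  shows "peval f (\<lambda>v. t (\<delta> v) * p v) = (\<Prod>i\<in>UNIV. t i ^ u i) * peval f p"
proof -
  have "meval m (\<lambda>v. t (\<delta> v) * p v) = (\<Prod>i\<in>UNIV. t i ^ u i) * meval m p" if "m \<in> keys f" for m
  proof -
    have "(\<Prod>v\<in>UNIV. t (\<delta> v) ^ lookup m v) = (\<Prod>i\<in>UNIV. \<Prod>v | v \<in> UNIV \<and> \<delta> v = i. t (\<delta> v) ^ lookup m v)"
      by (rule prod.group[symmetric]) auto
    also have "\<dots> = (\<Prod>i\<in>UNIV. t i ^ multideg \<delta> m i)"
      by (intro prod.cong) (auto simp: multideg_superset[of UNIV] power_sum)
    finally show ?thesis
      using that assms by (simp add: meval_UNIV power_mult_distrib prod.distrib graded_part_def)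
  qed
  then show ?thesis
    by (simp add: peval_superset[of "keys f"] sum_distrib_left mult_ac)
qed

definition hcomp :: "('v \<Rightarrow> 'i) \<Rightarrow> ('i \<Rightarrow> nat) \<Rightarrow> ('v, 'k::field) mpoly \<Rightarrow> ('v, 'k) mpoly" where
  "hcomp \<delta> u f = (\<Sum>m | m \<in> keys f \<and> multideg \<delta> m = u. scale (lookup f m) (Mon m))"

lemma lookup_hcomp: "lookup (hcomp \<delta> u f) m = (if multideg \<delta> m = u then lookup f m else 0)"
  by (simp add: hcomp_def lookup_sum lookup_scale Mon_def lookup_single when_def in_keys_iff
      if_distrib[of "\<lambda>x. _ * x"] sum.delta' cong: if_cong)

lemma hcomp_in_gp: "hcomp \<delta> u f \<in> graded_part \<delta> u"
  by (auto simp: graded_part_def in_keys_iff lookup_hcomp split: if_splits)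

lemma sum_hcomp: "f = (\<Sum>u\<in>multideg \<delta> ` keys f. hcomp \<delta> u f)"
proof (rule poly_mapping_eqI)
  fix m
  have "lookup (\<Sum>u\<in>multideg \<delta> ` keys f. hcomp \<delta> u f) m =
      (\<Sum>u\<in>multideg \<delta> ` keys f. if u = multideg \<delta> m then lookup f m else 0)"
    unfolding lookup_sum lookup_hcomp by (rule sum.cong) auto
  also have "\<dots> = lookup f m" by (auto simp: sum.delta in_keys_iff)
  finally show "lookup f m = lookup (\<Sum>u\<in>multideg \<delta> ` keys f. hcomp \<delta> u f) m" ..
qed

lemma hcomp_ideal: "homogeneous_ideal \<delta> I \<Longrightarrow> f \<in> I \<Longrightarrow> hcomp \<delta> u f \<in> I"
proof -
  assume "homogeneous_ideal \<delta> I" "f \<in> I"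
  then obtain g where "g \<in> I" and g: "\<And>m. lookup g m = (if multideg \<delta> m = u then lookup f m else 0)"
    unfolding homogeneous_ideal_def by blast
  then have "g = hcomp \<delta> u f" by (intro poly_mapping_eqI) (simp add: lookup_hcomp)
  with \<open>g \<in> I\<close> show ?thesis by simp
qed

section \<open>Ideals, bases of their graded quotients and comparison of Hilbert functions\<close>

lemma ideal_subspace: "is_ideal I \<Longrightarrow> pm.subspace I"
  by (simp add: pm.subspace_def is_ideal_def scale_def)

lemma ideal_mult: "is_ideal I \<Longrightarrow> f \<in> I \<Longrightarrow> h * f \<in> I" "is_ideal I \<Longrightarrow> f \<in> I \<Longrightarrow> f * h \<in> I"
  by (auto simp: is_ideal_def mult.commute[of f])

lemma ideal_add: "is_ideal I \<Longrightarrow> f \<in> I \<Longrightarrow> g \<in> I \<Longrightarrow> f + g \<in> I"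
  by (simp add: is_ideal_def)

lemma gp_spans_Mon: "pm.spans_mod {0} {m. multideg \<delta> m = u} Mon (graded_part \<delta> u)"
  if "finite {m. multideg \<delta> m = u}"
  unfolding pm.spans_mod_def
proof
  fix p :: "('a, 'c::field) mpoly" assume p: "p \<in> graded_part \<delta> u"
  have "(\<Sum>m | multideg \<delta> m = u. scale (lookup p m) (Mon m)) = (\<Sum>m\<in>keys p. scale (lookup p m) (Mon m))"
    using p that by (intro sum.mono_neutral_right) (auto simp: graded_part_def in_keys_iff)
  also have "\<dots> = p" by (rule mpoly_eq_sum_Mon[symmetric])
  finally show "\<exists>c. p - (\<Sum>m | multideg \<delta> m = u. scale (c m) (Mon m)) \<in> {0}"
    by (intro exI[of _ "lookup p"]) simp
qed

lemma indep_Mon: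
  assumes "finite M"
  shows "pm.indep_mod {0} M (Mon :: 'v monom \<Rightarrow> ('v, 'k::field) mpoly)"
  unfolding pm.indep_mod_def
proof (intro allI impI ballI)
  fix c :: "'v monom \<Rightarrow> 'k" and m assume 0: "(\<Sum>m\<in>M. scale (c m) (Mon m)) \<in> {0}" and m: "m \<in> M"
  have "c m = lookup (\<Sum>m\<in>M. scale (c m) (Mon m)) m"
    using assms m by (simp add: lookup_sum lookup_scale Mon_def lookup_single when_def
      if_distrib[of "\<lambda>x. _ * x"] sum.delta' cong: if_cong)
  with 0 show "c m = 0" by simp
qed

text \<open>Uniqueness of the coefficients of the vector 0 is independence modulo \<open>I\<close>;
  conversely, two expansions of the same vector differ by a relation. Coefficients are cut off
  outside \<open>B\<close> because uniqueness in \<open>quotient_basis\<close> concerns functions on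
  all polynomials.\<close>

lemma quotient_basis_iff:
  fixes I V :: "('v, 'k::field) mpoly set"
  assumes I: "pm.subspace I" and V: "pm.subspace V"
  shows "quotient_basis V I B \<longleftrightarrow>
    finite B \<and> B \<subseteq> V \<and> pm.indep_mod I B id \<and> pm.spans_mod I B id V"
proof (cases "finite B \<and> B \<subseteq> V")
  case True
  have restrict: "(\<Sum>b\<in>B. scale (if b \<in> B then c b else 0) b) = (\<Sum>b\<in>B. scale (c b) b)" for c
    by (rule sum.cong) auto
  show ?thesis
  proof
    assume qb: "quotient_basis V I B"
    have "pm.indep_mod I B id"
      unfolding pm.indep_mod_def
    proof (intro allI impI)
      fix c assume c: "(\<Sum>j\<in>B. scale (c j) (id j)) \<in> I"
      have "\<exists>!c. (\<forall>b. b \<notin> B \<longrightarrow> c b = 0) \<and> 0 - (\<Sum>b\<in>B. scale (c b) b) \<in> I"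
        using qb V pm.subspace_0[OF V] unfolding quotient_basis_def by blast
      then obtain c0 where c0: "\<And>d. \<forall>b. b \<notin> B \<longrightarrow> d b = 0 \<Longrightarrow> 0 - (\<Sum>b\<in>B. scale (d b) b) \<in> I \<Longrightarrow> d = c0"
        by (elim ex1E) blast
      have "0 - (\<Sum>b\<in>B. scale (if b \<in> B then c b else 0) b) \<in> I"
        unfolding restrict using c pm.subspace_neg[OF I] by simp
      moreover have "0 - (\<Sum>b\<in>B. scale (0::'k) b) \<in> I" using pm.subspace_0[OF I] by simp
      ultimately have "(\<lambda>b. if b \<in> B then c b else 0) = (\<lambda>b. 0)"
        using c0[of "\<lambda>b. if b \<in> B then c b else 0"] c0[of "\<lambda>b. 0"] by simp
      then show "\<forall>j\<in>B. c j = 0" by (metis (full_types))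
    qed
    moreover have "pm.spans_mod I B id V"
      using qb unfolding quotient_basis_def pm.spans_mod_def by (auto dest!: bspec)
    ultimately show "finite B \<and> B \<subseteq> V \<and> pm.indep_mod I B id \<and> pm.spans_mod I B id V"
      using True by blast
  next
    assume *: "finite B \<and> B \<subseteq> V \<and> pm.indep_mod I B id \<and> pm.spans_mod I B id V"
    show "quotient_basis V I B"
      unfolding quotient_basis_def
    proof (intro conjI ballI)
      fix p assume "p \<in> V"
      then obtain c where c: "p - (\<Sum>j\<in>B. scale (c j) j) \<in> I"
        using * unfolding pm.spans_mod_def by fastforce
      show "\<exists>!c. (\<forall>b. b \<notin> B \<longrightarrow> c b = 0) \<and> p - (\<Sum>b\<in>B. scale (c b) b) \<in> I"
      proof (rule ex1I[of _ "\<lambda>b. if b \<in> B then c b else 0"])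
        show "(\<forall>b. b \<notin> B \<longrightarrow> (if b \<in> B then c b else 0) = 0) \<and>
            p - (\<Sum>b\<in>B. scale (if b \<in> B then c b else 0) b) \<in> I"
          unfolding restrict using c by simp
        fix d assume d: "(\<forall>b. b \<notin> B \<longrightarrow> d b = 0) \<and> p - (\<Sum>b\<in>B. scale (d b) b) \<in> I"
        have "p - (\<Sum>b\<in>B. scale (d b) b) - (p - (\<Sum>b\<in>B. scale (c b) b)) \<in> I"
          using c d I pm.subspace_diff by blast
        then have "(\<Sum>b\<in>B. scale (c b - d b) (id b)) \<in> I"
          by (simp add: pm.scale_left_diff_distrib sum_subtractf)
        then have "\<forall>b\<in>B. c b - d b = 0"
          using * pm.indep_modD[of I B id "\<lambda>b. c b - d b"] by blast
        then show "d = (\<lambda>b. if b \<in> B then c b else 0)" using d by (auto simp: fun_eq_iff)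
      qed
    qed (use True in auto)
  qed
qed (auto simp: quotient_basis_def)

lemma has_hilbert_functionE:
  assumes "is_ideal I" "has_hilbert_function \<delta> I h"
  obtains B where "finite B" "B \<subseteq> graded_part \<delta> u" "pm.indep_mod I B id"
    "pm.spans_mod I B id (graded_part \<delta> u)" "int (card B) = h u"
proof -
  obtain B where B: "quotient_basis (graded_part \<delta> u) I B" and "int (card B) = h u"
    using assms(2) unfolding has_hilbert_function_def by blast
  have "finite B \<and> B \<subseteq> graded_part \<delta> u \<and> pm.indep_mod I B id \<and> pm.spans_mod I B id (graded_part \<delta> u)"
    by (rule iffD1[OF quotient_basis_iff B]) (rule ideal_subspace[OF assms(1)] gp_subspace)+
  then show ?thesis using that[of B] \<open>int (card B) = h u\<close> by simp
qed

lemma hilbert_le: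
  assumes "is_ideal I" "has_hilbert_function \<delta> I h" "finite T"
    "pm.spans_mod I T w (graded_part \<delta> u)"
  shows "h u \<le> int (card T)"
proof -
  obtain B where "finite B" "B \<subseteq> graded_part \<delta> u" "pm.indep_mod I B id" "int (card B) = h u"
    using has_hilbert_functionE[OF assms(1,2)] by metis
  then show ?thesis
    using pm.steinitz_mod[OF ideal_subspace[OF assms(1)] _ assms(3) _ assms(4), of B id] by force
qed

lemma hilbert_ge:
  assumes "is_ideal I" "has_hilbert_function \<delta> I h" "finite J"
    "pm.indep_mod I J v" "v ` J \<subseteq> graded_part \<delta> u"
  shows "int (card J) \<le> h u"
proof -
  obtain B where "finite B" "pm.spans_mod I B id (graded_part \<delta> u)" "int (card B) = h u"
    using has_hilbert_functionE[OF assms(1,2)] by metis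
  then show ?thesis
    using pm.steinitz_mod[OF ideal_subspace[OF assms(1)] assms(3) _ assms(4) _ assms(5)] by force
qed

text \<open>If the \<open>v j\<close> were independent, they could be joined with a basis of the
  quotient to an independent family with more members than there are monomials of degree
  \<open>u\<close>.\<close>

lemma hilbert_relation:
  assumes "is_ideal I" "has_hilbert_function \<delta> I h" "finite J" "v ` J \<subseteq> I \<inter> graded_part \<delta> u"
    "finite {m. multideg \<delta> m = u}" "int (card {m. multideg \<delta> m = u}) < h u + int (card J)"
  shows "\<exists>c. (\<exists>j\<in>J. c j \<noteq> 0) \<and> (\<Sum>j\<in>J. scale (c j) (v j)) = 0"
proof (rule ccontr)
  assume "\<not> ?thesis"
  then have ind: "pm.indep_mod {0} J v" by (auto simp: pm.indep_mod_def)
  obtain B where B: "finite B" "B \<subseteq> graded_part \<delta> u" "pm.indep_mod I B id" "int (card B) = h u"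
    using has_hilbert_functionE[OF assms(1,2)] by metis
  have "pm.indep_mod {0} (B <+> J) (case_sum id v)"
    using assms B ind pm.subspace_0[OF ideal_subspace[OF assms(1)]]
    by (intro pm.indep_mod_Plus[where U = I] ideal_subspace) auto
  then have "card (B <+> J) \<le> card {m. multideg \<delta> m = u}"
    using assms B
    by (intro pm.steinitz_mod[OF pm.subspace_single_0 _ assms(5) _ gp_spans_Mon[OF assms(5)],
          where v = "case_sum id v"]) auto
  then show False using assms B by (simp add: card_Plus)
qed

text \<open>An element of \<open>J\<close> outside \<open>I\<close> could be adjoined to a basis
  modulo \<open>J\<close>, giving a family independent modulo the smaller ideal with one member too
  many.\<close>

lemma hilbert_eq_imp_supset:
  assumes "is_ideal I" "has_hilbert_function \<delta> I h" "is_ideal J" "has_hilbert_function \<delta> J h"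
    "I \<subseteq> J" "f \<in> J" "f \<in> graded_part \<delta> u"
  shows "f \<in> I"
proof (rule ccontr)
  assume "f \<notin> I"
  have ind: "pm.indep_mod I {f} id"
    unfolding pm.indep_mod_def
  proof (intro allI impI)
    fix c assume c: "(\<Sum>j\<in>{f}. scale (c j) (id j)) \<in> I"
    have "c f = 0"
    proof (rule ccontr)
      assume "c f \<noteq> 0"
      have "scale (c f) f \<in> I" using c by simp
      then have "scale (inverse (c f)) (scale (c f) f) \<in> I"
        by (rule pm.subspace_scale[OF ideal_subspace[OF assms(1)]])
      with \<open>c f \<noteq> 0\<close> \<open>f \<notin> I\<close> show False by simp
    qed
    then show "\<forall>j\<in>{f}. c j = 0" by simp
  qed
  obtain B where B: "finite B" "B \<subseteq> graded_part \<delta> u" "pm.indep_mod J B id" "int (card B) = h u"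
    using has_hilbert_functionE[OF assms(3,4)] by metis
  have "pm.indep_mod I (B <+> {f}) (case_sum id id)"
    using assms B ind
    by (intro pm.indep_mod_Plus[where U = J] ideal_subspace) auto
  then have "int (card (B <+> {f})) \<le> h u"
    using assms B by (intro hilbert_ge[OF assms(1,2), where v = "case_sum id id"]) auto
  with B show False by (simp add: card_Plus)
qed

section \<open>Numbers of monomials of a given degree\<close>

lemma card_exponents_3: "card {q :: 3 \<Rightarrow> nat. sum q UNIV = d} = (d + 2) choose 2"
proof -
  have "bij_betw (\<lambda>q :: 3 \<Rightarrow> nat. [q 1, q 2, q 3]) {q. sum q UNIV = d} {l. length l = 3 \<and> sum_list l = d}"
  proof (rule bij_betw_byWitness[where f' = "\<lambda>l r. if r = 1 then l ! 0 else if r = 2 then l ! 1 else l ! 2"])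
    show "(\<lambda>q :: 3 \<Rightarrow> nat. [q 1, q 2, q 3]) ` {q. sum q UNIV = d} \<subseteq> {l. length l = 3 \<and> sum_list l = d}"
      by (auto simp: sum_3)
    show "(\<lambda>l r :: 3. if r = 1 then l ! 0 else if r = 2 then l ! 1 else l ! 2) `
        {l. length l = 3 \<and> sum_list l = d} \<subseteq> {q. sum q UNIV = d}"
      by (auto simp: sum_3 numeral_3_eq_3 length_Suc_conv)
    show "\<forall>a\<in>{q. sum q UNIV = d}. (\<lambda>r :: 3. if r = 1 then [a 1, a 2, a 3] ! 0
        else if r = 2 then [a 1, a 2, a 3] ! 1 else [a 1, a 2, a 3] ! 2) = a"
    proof (intro ballI ext)
      fix a :: "3 \<Rightarrow> nat" and r :: 3
      show "(if r = 1 then [a 1, a 2, a 3] ! 0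
        else if r = 2 then [a 1, a 2, a 3] ! 1 else [a 1, a 2, a 3] ! 2) = a r"
        using exhaust_3[of r] by auto
    qed
  qed (auto simp: numeral_3_eq_3 length_Suc_conv)
  then have "card {q :: 3 \<Rightarrow> nat. sum q UNIV = d} = card {l :: nat list. length l = 3 \<and> sum_list l = d}"
    by (rule bij_betw_same_card)
  also have "\<dots> = (d + 2) choose d" by (subst card_length_sum_list) auto
  also have "\<dots> = (d + 2) choose 2" by (subst binomial_symmetric) auto
  finally show ?thesis .
qed

lemma card_exponents_4: "card {q :: 4 \<Rightarrow> nat. sum q UNIV = d} = (d + 3) choose 3"
proof -
  have "bij_betw (\<lambda>q :: 4 \<Rightarrow> nat. [q 1, q 2, q 3, q 4]) {q. sum q UNIV = d} {l. length l = 4 \<and> sum_list l = d}"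
  proof (rule bij_betw_byWitness[where f' = "\<lambda>l r. if r = 1 then l ! 0 else if r = 2 then l ! 1 else if r = 3 then l ! 2 else l ! 3"])
    show "(\<lambda>q :: 4 \<Rightarrow> nat. [q 1, q 2, q 3, q 4]) ` {q. sum q UNIV = d} \<subseteq> {l. length l = 4 \<and> sum_list l = d}"
      by (auto simp: sum_4)
    show "(\<lambda>l r :: 4. if r = 1 then l ! 0 else if r = 2 then l ! 1 else if r = 3 then l ! 2 else l ! 3) `
        {l. length l = 4 \<and> sum_list l = d} \<subseteq> {q. sum q UNIV = d}"
      by (auto simp: sum_4 eval_nat_numeral length_Suc_conv)
    show "\<forall>a\<in>{q. sum q UNIV = d}. (\<lambda>r :: 4. if r = 1 then [a 1, a 2, a 3, a 4] ! 0
        else if r = 2 then [a 1, a 2, a 3, a 4] ! 1 else if r = 3 then [a 1, a 2, a 3, a 4] ! 2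
        else [a 1, a 2, a 3, a 4] ! 3) = a"
    proof (intro ballI ext)
      fix a :: "4 \<Rightarrow> nat" and r :: 4
      show "(if r = 1 then [a 1, a 2, a 3, a 4] ! 0
        else if r = 2 then [a 1, a 2, a 3, a 4] ! 1 else if r = 3 then [a 1, a 2, a 3, a 4] ! 2
        else [a 1, a 2, a 3, a 4] ! 3) = a r"
        using exhaust_4[of r] by auto
    qed
  qed (auto simp: eval_nat_numeral length_Suc_conv)
  then have "card {q :: 4 \<Rightarrow> nat. sum q UNIV = d} = card {l :: nat list. length l = 4 \<and> sum_list l = d}"
    by (rule bij_betw_same_card)
  also have "\<dots> = (d + 3) choose d" by (simp add: card_length_sum_list add.commute)
  also have "\<dots> = (d + 3) choose 3" by (subst binomial_symmetric) auto
  finally show ?thesis .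
qed

lemma bij_lookup_finite: "bij (lookup :: ('v::finite \<Rightarrow>\<^sub>0 nat) \<Rightarrow> _)"
proof (rule bijI)
  show "inj (lookup :: ('v::finite \<Rightarrow>\<^sub>0 nat) \<Rightarrow> _)"
    by (simp add: inj_on_def Poly_Mapping.lookup_inject)
  have "lookup (Abs_poly_mapping f) = f" for f :: "'v \<Rightarrow> nat"
    by (rule Poly_Mapping.lookup_Abs_poly_mapping) simp
  then show "surj (lookup :: ('v::finite \<Rightarrow>\<^sub>0 nat) \<Rightarrow> _)" by (metis surjI)
qed

text \<open>A monomial of degree \<open>u\<close> amounts to independent choices, one for each view
  \<open>i\<close>, of three exponents with sum \<open>u i\<close>.\<close>

lemma card_multideg:
  "card {m :: ('n::finite \<times> 3) monom. multideg fst m = u} = (\<Prod>i\<in>UNIV. (u i + 2) choose 2)"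
proof -
  define C where "C g = (\<lambda>i r. g (i, r))" for g :: "'n \<times> 3 \<Rightarrow> nat"
  have "bij C" unfolding C_def
    by (rule bij_betw_byWitness[where f' = "\<lambda>h (i, r). h i r"]) auto
  then have bij: "bij (C \<circ> lookup)" using bij_lookup_finite by (intro bij_comp)
  have md: "multideg fst m i = sum ((C \<circ> lookup) m i) UNIV" for m i
  proof -
    have "{v. v \<in> UNIV \<and> fst v = i} = Pair i ` (UNIV :: 3 set)" by auto
    then show ?thesis
      by (simp add: multideg_superset[of UNIV] C_def sum.reindex inj_on_def)
  qed
  have "(C \<circ> lookup) ` {m. multideg fst m = u} = Pi UNIV (\<lambda>i. {q. sum q UNIV = u i})"
  proof (intro equalityI subsetI)
    fix h :: "'n \<Rightarrow> 3 \<Rightarrow> nat" assume h: "h \<in> Pi UNIV (\<lambda>i. {q. sum q UNIV = u i})"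
    obtain m where "h = (C \<circ> lookup) m" using bij by (metis bij_pointE)
    then have "multideg fst m i = u i" for i
      using h md[of m i] by (auto simp: Pi_iff)
    then have "m \<in> {m. multideg fst m = u}" by (simp add: fun_eq_iff)
    with \<open>h = (C \<circ> lookup) m\<close> show "h \<in> (C \<circ> lookup) ` {m. multideg fst m = u}" by (rule image_eqI)
  qed (auto simp: md[symmetric] simp del: comp_apply)
  then have "card {m :: ('n \<times> 3) monom. multideg fst m = u} = card (PiE UNIV (\<lambda>i. {q :: 3 \<Rightarrow> nat. sum q UNIV = u i}))"
    using card_image[of "C \<circ> lookup" "{m. multideg fst m = u}"] bij_is_inj[OF bij]
    by (simp add: PiE_UNIV_domain inj_on_subset)
  also have "\<dots> = (\<Prod>i\<in>UNIV. (u i + 2) choose 2)"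
    by (simp add: card_PiE card_exponents_3)
  finally show ?thesis .
qed

section \<open>Functions of one polynomial parameter\<close>

text \<open>Families are kept as functions of the parameter with this predicate, so that minors,
  determinants and evaluations can be treated pointwise without carrying out the computation in a
  polynomial ring.\<close>

definition polyfun :: "('k::field \<Rightarrow> 'k) \<Rightarrow> bool" where
  "polyfun g \<longleftrightarrow> (\<exists>p. \<forall>t. g t = poly p t)"

lemma polyfunI: "(\<And>t. g t = poly p t) \<Longrightarrow> polyfun g"
  by (auto simp: polyfun_def)

lemma polyfun_const [intro!, simp]: "polyfun (\<lambda>t. c)"
  by (rule polyfunI[of _ "[:c:]"]) simp

lemma polyfun_id [intro!, simp]: "polyfun (\<lambda>t. t)"
  by (rule polyfunI[of _ "[:0, 1:]"]) simp

lemma polyfun_add [intro!]: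
  assumes "polyfun f" "polyfun g" shows "polyfun (\<lambda>t. f t + g t)"
proof -
  obtain p q where "\<And>t. f t = poly p t" "\<And>t. g t = poly q t"
    using assms unfolding polyfun_def by blast
  then show ?thesis by (intro polyfunI[of _ "p + q"]) simp
qed

lemma polyfun_mult [intro!]:
  assumes "polyfun f" "polyfun g" shows "polyfun (\<lambda>t. f t * g t)"
proof -
  obtain p q where "\<And>t. f t = poly p t" "\<And>t. g t = poly q t"
    using assms unfolding polyfun_def by blast
  then show ?thesis by (intro polyfunI[of _ "p * q"]) simp
qed

lemma polyfun_diff [intro!]:
  assumes "polyfun f" "polyfun g" shows "polyfun (\<lambda>t. f t - g t)"
  using polyfun_add[OF assms(1) polyfun_mult[OF polyfun_const[of "-1"] assms(2)]] by simp

lemma polyfun_power [intro!]: "polyfun f \<Longrightarrow> polyfun (\<lambda>t. f t ^ n)"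
  by (induction n) auto

lemma polyfun_sum [intro!]: "(\<And>a. a \<in> S \<Longrightarrow> polyfun (f a)) \<Longrightarrow> polyfun (\<lambda>t. \<Sum>a\<in>S. f a t)"
  by (induction S rule: infinite_finite_induct) auto

lemma polyfun_prod [intro!]: "(\<And>a. a \<in> S \<Longrightarrow> polyfun (f a)) \<Longrightarrow> polyfun (\<lambda>t. \<Prod>a\<in>S. f a t)"
  by (induction S rule: infinite_finite_induct) auto

lemma polyfun_finite_zeros:
  assumes "polyfun g" "g t0 \<noteq> 0"
  shows "finite {t. g t = 0}"
proof -
  obtain p where p: "\<And>t. g t = poly p t" using assms(1) unfolding polyfun_def by blast
  then have "p \<noteq> 0" using assms(2) by auto
  then show ?thesis unfolding p by (rule poly_roots_finite)
qed

lemma polyfun_eq_0: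
  fixes g :: "'k::alg_closed_field \<Rightarrow> 'k"
  assumes "polyfun g" "finite E" "\<And>t. t \<notin> E \<Longrightarrow> g t = 0"
  shows "g t = 0"
proof (rule ccontr)
  assume "g t \<noteq> 0"
  then have "finite {t. g t = 0}" by (rule polyfun_finite_zeros[OF assms(1)])
  moreover have "UNIV \<subseteq> {t. g t = 0} \<union> E" using assms(3) by blast
  ultimately show False
    using assms(2) infinite_UNIV_alg_closed finite_subset by (metis finite_Un)
qed

lemma polyfun_peval:
  assumes "finite M" "\<And>t. keys (f t) \<subseteq> M" "\<And>m. polyfun (\<lambda>t. lookup (f t) m)"
    "\<And>v. polyfun (\<lambda>t. p t v)"
  shows "polyfun (\<lambda>t. peval (f t) (p t))"
proof -
  have eq: "(\<lambda>t. peval (f t) (p t)) = (\<lambda>t. \<Sum>m\<in>M. lookup (f t) m * (\<Prod>v\<in>keys m. p t v ^ lookup m v))"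
    using assms(1,2) by (simp add: peval_superset meval_def)
  show ?thesis unfolding eq
    using assms by (intro polyfun_sum polyfun_mult polyfun_prod polyfun_power)
qed

lemma polyfun_peval_const:
  assumes "\<And>v. polyfun (\<lambda>t. p t v)"
  shows "polyfun (\<lambda>t. peval f (p t))"
  by (rule polyfun_peval[of "keys f"]) (use assms in auto)

section \<open>Multiview ideals\<close>

definition cam_point :: "('n::finite, 'k::field) cameras \<Rightarrow> 'k ^ 4 \<Rightarrow> 'n \<times> 3 \<Rightarrow> 'k" where
  "cam_point A X v = (A (fst v) *v X) $ snd v"

lemma cam_point_alt: "cam_point A X v = (\<Sum>j\<in>UNIV. A (fst v) $ snd v $ j * X $ j)"
  by (simp add: cam_point_def matrix_vector_mult_def)

lemma camera_image_subset_closure: "camera_image A \<subseteq> multiprojective_closure (camera_image A)"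
proof
  fix p assume p: "p \<in> camera_image A"
  then obtain x t where "\<forall>i. A i *v x \<noteq> 0" "\<forall>i. t i \<noteq> 0" "\<forall>i r. p (i, r) = t i * (A i *v x) $ r"
    unfolding camera_image_def by blast
  then have "\<exists>r. p (i, r) \<noteq> 0" for i
    by (auto simp: vec_eq_iff)
  with p show "p \<in> multiprojective_closure (camera_image A)"
    unfolding multiprojective_closure_def by blast
qed

lemma camera_image_scale:
  assumes "p \<in> camera_image A" "\<And>i. s i \<noteq> 0"
  shows "(\<lambda>v. s (fst v) * p v) \<in> camera_image A"
proof -
  obtain x t where xt: "\<forall>i. A i *v x \<noteq> 0" "\<forall>i. t i \<noteq> 0" "\<forall>i r. p (i, r) = t i * (A i *v x) $ r"
    using assms(1) unfolding camera_image_def by blast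
  show ?thesis unfolding camera_image_def
    by (rule CollectI, rule exI[of _ x], rule exI[of _ "\<lambda>i. s i * t i"]) (use xt assms(2) in auto)
qed

text \<open>Along the torus orbit of \<open>p\<close> the component of degree \<open>u\<close> is
  multiplied by the character with exponents \<open>u\<close>, and distinct characters are linearly
  independent.\<close>

lemma hcomp_vanishes:
  fixes f :: "('n::finite, 'k::alg_closed_field) xyz_poly"
  assumes "\<And>s. (\<And>i. s i \<noteq> 0) \<Longrightarrow> peval f (\<lambda>v. s (fst v) * p v) = 0"
  shows "peval (hcomp fst u f) p = 0"
proof (cases "u \<in> multideg fst ` keys f")
  case True
  let ?D = "multideg fst ` keys f"
  \<comment> \<open>The hypothesis covers only parameters with all \<open>s i\<close> nonzero.
    Multiplying by the product of the \<open>s i\<close> gives an identity for every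
    \<open>s\<close> and raises all exponents by one.\<close>
  define sh :: "('n \<Rightarrow> nat) \<Rightarrow> 'n \<Rightarrow> nat" where "sh u i = Suc (u i)" for u i
  have inj: "inj sh" by (auto simp: inj_on_def sh_def fun_eq_iff)
  define c where "c n = peval (hcomp fst (\<lambda>i. n i - 1) f) p" for n
  have c: "c (sh u) = peval (hcomp fst u f) p" for u by (simp add: c_def sh_def)
  have "c (sh u) = 0"
  proof (rule monomial_functions_independent[where V = UNIV and M = "sh ` ?D"])
    fix s :: "'n \<Rightarrow> 'k"
    have "(\<Sum>m\<in>sh ` ?D. c m * (\<Prod>i\<in>UNIV. s i ^ m i)) =
        (\<Sum>u\<in>?D. peval (hcomp fst u f) p * (\<Prod>i\<in>UNIV. s i ^ Suc (u i)))"
      using inj_on_subset[OF inj] by (subst sum.reindex) (auto simp: c sh_def)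
    also have "\<dots> = (\<Prod>i\<in>UNIV. s i) * (\<Sum>u\<in>?D. (\<Prod>i\<in>UNIV. s i ^ u i) * peval (hcomp fst u f) p)"
      by (simp add: prod.distrib sum_distrib_left mult_ac)
    also have "(\<Sum>u\<in>?D. (\<Prod>i\<in>UNIV. s i ^ u i) * peval (hcomp fst u f) p) = peval f (\<lambda>v. s (fst v) * p v)"
      by (subst (3) sum_hcomp[of f fst]) (simp add: peval_sum peval_torus[OF hcomp_in_gp])
    also have "(\<Prod>i\<in>UNIV. s i) * \<dots> = 0"
      using assms[of s] by (cases "\<forall>i. s i \<noteq> 0") (auto intro: prod_zero)
    finally show "(\<Sum>m\<in>sh ` ?D. c m * (\<Prod>i\<in>UNIV. s i ^ m i)) = 0" .
  qed (use True in simp_all)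
  then show ?thesis by (simp add: c)
next
  case False
  then have "hcomp fst u f = 0"
    by (intro poly_mapping_eqI) (auto simp: lookup_hcomp in_keys_iff)
  then show ?thesis by simp
qed

text \<open>The closure is cut out by multihomogeneous polynomials, while \<open>f\<close> is
  arbitrary. Since the image is stable under the torus, the components of \<open>f\<close> vanish on
  it separately, and these extend to the closure.\<close>

lemma multiview_ideal_iff:
  fixes f :: "('n::finite, 'k::alg_closed_field) xyz_poly"
  shows "f \<in> multiview_ideal A \<longleftrightarrow> (\<forall>p\<in>camera_image A. peval f p = 0)"
proof
  assume "f \<in> multiview_ideal A"
  then show "\<forall>p\<in>camera_image A. peval f p = 0"
    using camera_image_subset_closure unfolding multiview_ideal_def by blast
next
  assume van: "\<forall>p\<in>camera_image A. peval f p = 0"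
  show "f \<in> multiview_ideal A"
    unfolding multiview_ideal_def
  proof (intro CollectI ballI)
    fix p assume p: "p \<in> multiprojective_closure (camera_image A)"
    have "peval (hcomp fst u f) p = 0" for u
    proof -
      have "peval (hcomp fst u f) q = 0" if "q \<in> camera_image A" for q
        using van camera_image_scale[OF that] by (intro hcomp_vanishes) blast
      moreover have "multihomogeneous fst (hcomp fst u f)"
        using hcomp_in_gp unfolding multihomogeneous_def by blast
      ultimately show ?thesis using p unfolding multiprojective_closure_def by blast
    qed
    then show "peval f p = 0"
      by (subst sum_hcomp[of f fst]) (simp add: peval_sum)
  qed
qed

lemma multiview_ideal_homogeneous:
  "homogeneous_ideal fst (multiview_ideal A :: ('n::finite, 'k::alg_closed_field) xyz_poly set)"
  unfolding homogeneous_ideal_def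
proof (intro conjI ballI allI)
  show "is_ideal (multiview_ideal A)"
    by (simp add: is_ideal_def multiview_ideal_iff peval_add peval_mult)
  fix f u assume f: "f \<in> multiview_ideal A"
  have "peval (hcomp fst u f) q = 0" if "q \<in> camera_image A" for q
    using f camera_image_scale[OF that] unfolding multiview_ideal_iff
    by (intro hcomp_vanishes) blast
  then have "hcomp fst u f \<in> multiview_ideal A" unfolding multiview_ideal_iff by blast
  then show "\<exists>g\<in>multiview_ideal A. \<forall>m. lookup g m = (if multideg fst m = u then lookup f m else 0)"
    using lookup_hcomp by blast
qed

text \<open>A form of \<open>generic_cameras\<close> that speaks of linear maps only;
  \<open>generic_cameras_iff\<close> shows that they agree for at least three views.\<close>

definition generic :: "('n::finite, 'k::field) cameras \<Rightarrow> bool" where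
  "generic A \<longleftrightarrow> (\<forall>i. surj ((*v) (A i))) \<and>
     (\<forall>i j X. i \<noteq> j \<longrightarrow> A i *v X = 0 \<longrightarrow> A j *v X = 0 \<longrightarrow> X = 0)"

lemma exists_common_nonkernel:
  fixes A :: "('n::finite, 'k::alg_closed_field) cameras"
  assumes "\<And>i. surj ((*v) (A i))"
  shows "\<exists>Y. \<forall>i. A i *v Y \<noteq> 0"
proof -
  \<comment> \<open>Points of the twisted cubic: a nonzero linear form restricts to a nonzero
    polynomial of degree at most 3 in \<open>t\<close>, so every camera excludes finitely many
    \<open>t\<close>.\<close>
  define Y :: "'k \<Rightarrow> 'k ^ 4" where "Y t = (\<chi> j. if j = 1 then 1 else if j = 2 then t else if j = 3 then t^2 else t^3)" for t
  have fin: "finite {t. A i *v Y t = 0}" for i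
  proof -
    obtain Z where "A i *v Z = axis 1 1" using assms[of i] by (metis surjD)
    then have "(A i *v Z) $ 1 \<noteq> 0" by (simp add: axis_def)
    then have "(\<Sum>j\<in>UNIV. A i $ 1 $ j * Z $ j) \<noteq> 0" by (simp add: matrix_vector_mult_def)
    then obtain j where "A i $ 1 $ j * Z $ j \<noteq> 0" by (meson sum.neutral)
    then have j: "A i $ 1 $ j \<noteq> 0" by simp
    define p where "p = [:A i $ 1 $ 1, A i $ 1 $ 2, A i $ 1 $ 3, A i $ 1 $ 4:]"
    have "p \<noteq> 0" using j exhaust_4[of j] by (auto simp: p_def)
    moreover have "(A i *v Y t) $ 1 = poly p t" for t
      by (simp add: p_def matrix_vector_mult_def sum_4 Y_def algebra_simps power2_eq_square power3_eq_cube)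
    then have "{t. A i *v Y t = 0} \<subseteq> {t. poly p t = 0}" by (metis (mono_tags, lifting) mem_Collect_eq subsetI zero_index)
    ultimately show ?thesis using poly_roots_finite finite_subset by blast
  qed
  then have "finite (\<Union>i. {t. A i *v Y t = 0})" by simp
  then obtain t where "t \<notin> (\<Union>i. {t. A i *v Y t = 0})"
    using infinite_UNIV_alg_closed ex_new_if_finite by blast
  then show ?thesis by blast
qed

text \<open>The camera image leaves out the \<open>X\<close> that lie in some kernel. Moving
  \<open>X\<close> in a direction outside all kernels meets the kernels for finitely many parameters
  only, and a polynomial function that is zero off a finite set is zero.\<close>

lemma multiview_ideal_graded:
  fixes f :: "('n::finite, 'k::alg_closed_field) xyz_poly"
  assumes "\<And>i. surj ((*v) (A i))" "f \<in> graded_part fst u"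
  shows "f \<in> multiview_ideal A \<longleftrightarrow> (\<forall>X. peval f (cam_point A X) = 0)"
proof
  assume f: "f \<in> multiview_ideal A"
  have *: "peval f (cam_point A X) = 0" if "\<forall>i. A i *v X \<noteq> 0" for X
  proof -
    have "cam_point A X \<in> camera_image A"
      unfolding camera_image_def
      by (rule CollectI, rule exI[of _ X], rule exI[of _ "\<lambda>_. 1"]) (use that in \<open>simp add: cam_point_def\<close>)
    then show ?thesis using f unfolding multiview_ideal_iff by blast
  qed
  obtain Y where Y: "\<forall>i. A i *v Y \<noteq> 0" using exists_common_nonkernel[of A] assms(1) by blast
  show "\<forall>X. peval f (cam_point A X) = 0"
  proof
    fix X
    define E where "E = (\<Union>i. {t. A i *v (X + t *s Y) = 0})"
    have finE: "finite E"
      unfolding E_def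
    proof (rule finite_UN_I)
      fix i
      show "finite {t. A i *v (X + t *s Y) = 0}"
      proof (cases "{t. A i *v (X + t *s Y) = 0} = {}")
        case False
        then obtain t0 where t0: "A i *v (X + t0 *s Y) = 0" by blast
        have "t = t0" if "A i *v (X + t *s Y) = 0" for t
        proof -
          have "A i *v (X + t *s Y) - A i *v (X + t0 *s Y) = (t - t0) *s (A i *v Y)"
            by (simp add: vec.add vec.scale vector_sub_rdistrib)
          then show ?thesis using that t0 Y by simp
        qed
        then have "{t. A i *v (X + t *s Y) = 0} \<subseteq> {t0}" by blast
        then show ?thesis by (rule finite_subset) simp
      qed simp
    qed simp
    have "peval f (cam_point A (X + 0 *s Y)) = 0"
    proof (rule polyfun_eq_0[where E = E and g = "\<lambda>t. peval f (cam_point A (X + t *s Y))"])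
      show "polyfun (\<lambda>t. peval f (cam_point A (X + t *s Y)))"
        by (rule polyfun_peval_const) (auto simp: cam_point_alt)
      show "peval f (cam_point A (X + t *s Y)) = 0" if "t \<notin> E" for t
        using that * by (auto simp: E_def)
    qed (rule finE)
    then show "peval f (cam_point A X) = 0" by simp
  qed
next
  assume van: "\<forall>X. peval f (cam_point A X) = 0"
  show "f \<in> multiview_ideal A"
    unfolding multiview_ideal_iff
  proof
    fix p assume "p \<in> camera_image A"
    then obtain x t where "\<forall>i r. p (i, r) = t i * (A i *v x) $ r"
      unfolding camera_image_def by blast
    then have "p = (\<lambda>v. t (fst v) * cam_point A x v)" by (auto simp: cam_point_def)
    then show "peval f p = 0" using van by (simp add: peval_torus[OF assms(2)])
  qed
qed

section \<open>Forms on projective space\<close>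

lemma sum_fun_apply: "sum f A x = (\<Sum>a\<in>A. f a x)"
  by (induction A rule: infinite_finite_induct) auto

text \<open>Forms are taken as functions on 4-space, so that products of arbitrary linear forms need
  no change of variables. Over an infinite field nothing is lost.\<close>

definition forms :: "nat \<Rightarrow> ('k::field ^ 4 \<Rightarrow> 'k) set" where
  "forms d = (\<lambda>g X. peval g (($) X)) ` graded_part (\<lambda>_. ()) (\<lambda>_. d)"

lemma fs_image_subspace:
  fixes pt :: "'x \<Rightarrow> 'v \<Rightarrow> 'k::field"
  assumes "pm.subspace V"
  shows "fs.subspace ((\<lambda>g X. peval g (pt X)) ` V)"
proof (rule fs.subspaceI)
  show "0 \<in> (\<lambda>g X. peval g (pt X)) ` V"
    using pm.subspace_0[OF assms] by (intro image_eqI[of _ _ 0]) (auto simp: fun_eq_iff)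
next
  fix f g assume "f \<in> (\<lambda>g X. peval g (pt X)) ` V" "g \<in> (\<lambda>g X. peval g (pt X)) ` V"
  then obtain a b where "a \<in> V" "b \<in> V" "f = (\<lambda>X. peval a (pt X))" "g = (\<lambda>X. peval b (pt X))" by blast
  then show "f + g \<in> (\<lambda>g X. peval g (pt X)) ` V"
    using pm.subspace_add[OF assms, of a b] by (intro image_eqI[of _ _ "a + b"]) (auto simp: fun_eq_iff peval_add)
next
  fix c f assume "f \<in> (\<lambda>g X. peval g (pt X)) ` V"
  then obtain a where "a \<in> V" "f = (\<lambda>X. peval a (pt X))" by blast
  then show "(\<lambda>x. c * f x) \<in> (\<lambda>g X. peval g (pt X)) ` V"
    using pm.subspace_scale[OF assms, of a c] by (intro image_eqI[of _ _ "scale c a"]) (auto simp: fun_eq_iff)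
qed

lemma forms_subspace: "fs.subspace (forms d)"
  unfolding forms_def by (rule fs_image_subspace) (rule gp_subspace)

lemma formsI: "g \<in> graded_part (\<lambda>_. ()) (\<lambda>_. d) \<Longrightarrow> (\<And>X. f X = peval g (($) X)) \<Longrightarrow> f \<in> forms d"
  unfolding forms_def by (rule image_eqI[of _ _ g]) auto

lemma forms_mult:
  assumes "f \<in> forms d" "g \<in> forms e" shows "f * g \<in> forms (d + e)"
proof -
  obtain a b where ab: "a \<in> graded_part (\<lambda>_. ()) (\<lambda>_. d)" "b \<in> graded_part (\<lambda>_. ()) (\<lambda>_. e)"
    "f = (\<lambda>X. peval a (($) X))" "g = (\<lambda>X. peval b (($) X))"
    using assms unfolding forms_def by blast
  show ?thesis
    by (rule formsI[of "a * b"]) (use gp_mult[OF ab(1,2)] ab(3,4) in \<open>auto simp: plus_fun_def peval_mult\<close>)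
qed

lemma forms_1: "1 \<in> forms 0"
  by (rule formsI[of 1]) (use gp_1' in auto)

lemma forms_power: "f \<in> forms d \<Longrightarrow> f ^ n \<in> forms (n * d)"
  by (induction n) (auto intro: forms_1 forms_mult)

lemma forms_prod: "(\<And>i. i \<in> S \<Longrightarrow> f i \<in> forms (d i)) \<Longrightarrow> prod f S \<in> forms (sum d S)"
  by (induction S rule: infinite_finite_induct) (auto intro: forms_1 forms_mult)

lemma forms_linear: "(\<lambda>X. \<Sum>j\<in>UNIV. c j * X $ j) \<in> forms 1"
proof (rule formsI)
  have "Var j \<in> graded_part (\<lambda>_::4. ()) (\<lambda>_. 1)" for j :: 4
    using gp_Var[of j "\<lambda>_. ()"] by (simp add: unit_deg_def[abs_def])
  then show "(\<Sum>j\<in>UNIV. scale (c j) (Var j)) \<in> graded_part (\<lambda>_. ()) (\<lambda>_. 1)"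
    using gp_subspace by (intro pm.subspace_sum pm.subspace_scale) auto
qed (simp add: peval_sum)

lemma multideg_unit: "multideg (\<lambda>_::4. ()) m = (\<lambda>_. \<Sum>j\<in>UNIV. lookup m j)"
  by (simp add: fun_eq_iff multideg_superset[of UNIV])

lemma finite_card_monom_4:
  "finite {m :: 4 monom. multideg (\<lambda>_. ()) m = (\<lambda>_. d)}"
  "card {m :: 4 monom. multideg (\<lambda>_. ()) m = (\<lambda>_. d)} = (d + 3) choose 3"
proof -
  have bij: "bij_betw lookup {m :: 4 monom. multideg (\<lambda>_. ()) m = (\<lambda>_. d)} {q :: 4 \<Rightarrow> nat. sum q UNIV = d}"
  proof (rule bij_betw_imageI)
    show "inj_on lookup {m :: 4 monom. multideg (\<lambda>_. ()) m = (\<lambda>_. d)}"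
      using bij_is_inj[OF bij_lookup_finite] inj_on_subset by blast
    show "lookup ` {m :: 4 monom. multideg (\<lambda>_. ()) m = (\<lambda>_. d)} = {q. sum q UNIV = d}"
    proof (intro equalityI subsetI)
      fix q :: "4 \<Rightarrow> nat" assume "q \<in> {q. sum q UNIV = d}"
      moreover obtain m where "q = lookup m" using bij_lookup_finite by (metis bij_pointE)
      ultimately show "q \<in> lookup ` {m :: 4 monom. multideg (\<lambda>_. ()) m = (\<lambda>_. d)}"
        by (intro image_eqI[of _ _ m]) (auto simp: multideg_unit)
    qed (auto simp: multideg_unit fun_eq_iff)
  qed
  show "card {m :: 4 monom. multideg (\<lambda>_. ()) m = (\<lambda>_. d)} = (d + 3) choose 3"
    using bij_betw_same_card[OF bij] by (simp add: card_exponents_4)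
  then show "finite {m :: 4 monom. multideg (\<lambda>_. ()) m = (\<lambda>_. d)}"
    by (intro card_ge_0_finite) (simp add: zero_less_binomial)
qed

lemma forms_basis:
  fixes d :: nat
  defines "M \<equiv> {m :: 4 monom. multideg (\<lambda>_. ()) m = (\<lambda>_. d)}"
  defines "b \<equiv> (\<lambda>m (X :: 'k::alg_closed_field ^ 4). meval m (($) X))"
  shows "fs.indep_mod {0} M b" "fs.spans_mod {0} M b (forms d)" "b ` M \<subseteq> forms d"
proof -
  have fin: "finite M" unfolding M_def by (rule finite_card_monom_4)
  show "fs.indep_mod {0} M b"
  proof (rule fs.indep_modI)
    fix c m assume 0: "(\<Sum>j\<in>M. (\<lambda>x. c j * b j x)) \<in> {0}" and m: "m \<in> M"
    have "(\<Sum>m\<in>M. scale (c m) (Mon m)) = (0 :: (4, 'k) mpoly)"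
    proof (rule peval_eq_0_imp)
      fix p :: "4 \<Rightarrow> 'k"
      have "peval (\<Sum>m\<in>M. scale (c m) (Mon m)) p = (\<Sum>j\<in>M. (\<lambda>x. c j * b j x)) (\<chi> j. p j)"
        by (simp add: peval_sum b_def sum_fun_apply vec_lambda_inverse)
      then show "peval (\<Sum>m\<in>M. scale (c m) (Mon m)) p = 0" using 0 by simp
    qed
    then show "c m = 0" using pm.indep_modD[OF indep_Mon[OF fin], of c m] m by auto
  qed
  show "fs.spans_mod {0} M b (forms d)"
    unfolding fs.spans_mod_def
  proof
    fix p :: "'k ^ 4 \<Rightarrow> 'k" assume "p \<in> forms d"
    then obtain g where g: "g \<in> graded_part (\<lambda>_. ()) (\<lambda>_. d)" "p = (\<lambda>X. peval g (($) X))"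
      unfolding forms_def by blast
    have "p X = (\<Sum>m\<in>M. lookup g m * b m X)" for X
      using g fin by (simp add: b_def peval_superset[of M] M_def graded_part_def subset_iff)
    then have "p - (\<Sum>m\<in>M. (\<lambda>x. lookup g m * b m x)) = 0"
      by (simp add: fun_eq_iff sum_fun_apply)
    then show "\<exists>c. p - (\<Sum>m\<in>M. (\<lambda>x. c m * b m x)) \<in> {0}" by blast
  qed
  show "b ` M \<subseteq> forms d"
  proof
    fix f assume "f \<in> b ` M"
    then obtain m where m: "m \<in> M" "f = b m" by blast
    then have "(Mon m :: (4, 'k) mpoly) \<in> graded_part (\<lambda>_. ()) (\<lambda>_. d)"
      using gp_Mon[of m "\<lambda>_. ()"] by (simp add: M_def)
    then show "f \<in> forms d" using m by (intro formsI) (auto simp: b_def)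
  qed
qed

lemma forms_0: "f \<in> forms 0 \<Longrightarrow> \<exists>c. f = (\<lambda>X. c * 1)"
proof -
  assume "f \<in> forms 0"
  then obtain g where g: "g \<in> graded_part (\<lambda>_::4. ()) (\<lambda>_. 0)" "f = (\<lambda>X. peval g (($) X))"
    unfolding forms_def by blast
  have "m = 0" if "m \<in> keys g" for m
    using that g(1) by (intro poly_mapping_eqI) (simp add: graded_part_def multideg_unit fun_eq_iff)
  then have "keys g \<subseteq> {0}" by blast
  then have "peval g p = lookup g 0" for p by (subst peval_superset[of "{0}"]) auto
  then show ?thesis using g(2) by auto
qed

lemma forms_Suc_induct:
  fixes Q :: "('k::field ^ 4 \<Rightarrow> 'k) set"
  assumes Q: "fs.subspace Q" and step: "\<And>j g. g \<in> forms d \<Longrightarrow> (\<lambda>X. X $ j) * g \<in> Q"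
  shows "forms (Suc d) \<subseteq> Q"
proof
  fix f :: "'k ^ 4 \<Rightarrow> 'k" assume "f \<in> forms (Suc d)"
  then obtain g where g: "g \<in> graded_part (\<lambda>_::4. ()) (\<lambda>_. Suc d)" "f = (\<lambda>X. peval g (($) X))"
    unfolding forms_def by blast
  have "(\<lambda>X. meval m (($) X)) \<in> Q" if m: "m \<in> keys g" for m
  proof -
    have sum: "(\<Sum>j\<in>UNIV. lookup m j) = Suc d"
      using m g(1) by (auto simp: graded_part_def multideg_unit fun_eq_iff)
    then obtain j where j: "lookup m j \<noteq> 0" by (metis sum.neutral nat.distinct(1))
    define m' where "m' = m - Poly_Mapping.single j 1"
    have m': "m = Poly_Mapping.single j 1 + m'"
      using j by (intro poly_mapping_eqI) (auto simp: m'_def lookup_add lookup_minus lookup_single when_def)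
    have "(\<Sum>i\<in>UNIV. lookup m i) = 1 + (\<Sum>i\<in>UNIV. lookup m' i)"
      by (subst m') (simp add: lookup_add sum.distrib lookup_single when_def)
    then have "(Mon m' :: (4, 'k) mpoly) \<in> graded_part (\<lambda>_. ()) (\<lambda>_. d)"
      using gp_Mon[of m' "\<lambda>_. ()"] sum by (simp add: multideg_unit)
    then have "(\<lambda>X. meval m' (($) X)) \<in> (forms d :: ('k ^ 4 \<Rightarrow> 'k) set)" by (intro formsI) auto
    from step[OF this, of j] show ?thesis
      by (subst m') (simp add: meval_add times_fun_def)
  qed
  then have "(\<Sum>m\<in>keys g. (\<lambda>X. lookup g m * meval m (($) X))) \<in> Q"
    using Q by (intro fs.subspace_sum fs.subspace_scale) auto
  also have "(\<Sum>m\<in>keys g. (\<lambda>X. lookup g m * meval m (($) X))) = f"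
    using g(2) by (simp add: fun_eq_iff sum_fun_apply peval_superset[of "keys g"])
  finally show "f \<in> Q" .
qed

lemma fs_subspace_mult_vimage: "fs.subspace Q \<Longrightarrow> fs.subspace {g. h * g \<in> Q}" for h :: "'a \<Rightarrow> 'k::field"
proof (rule fs.subspaceI)
  assume Q: "fs.subspace Q"
  show "0 \<in> {g. h * g \<in> Q}" using fs.subspace_0[OF Q] by simp
  fix f assume f: "f \<in> {g. h * g \<in> Q}"
  show "f + g \<in> {g. h * g \<in> Q}" if "g \<in> {g. h * g \<in> Q}" for g
    using f that fs.subspace_add[OF Q] by (simp add: distrib_left)
  show "(\<lambda>x. c * f x) \<in> {g. h * g \<in> Q}" for c
    using f fs.subspace_scale[OF Q, of "h * f" c] by (simp add: times_fun_def mult_ac)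
qed

text \<open>For any basis \<open>l\<close>, \<open>m0\<close>, \<open>m1\<close>, \<open>m2\<close>
  of the linear forms, forms are spanned by multiples of \<open>l\<close> and monomials in the other
  three. The induction replaces \<open>Q\<close> by the subspace of all \<open>g\<close> whose
  products with \<open>m0\<close>, \<open>m1\<close> and \<open>m2\<close> lie in
  \<open>Q\<close>.\<close>

lemma forms_basis_induct:
  fixes Q :: "('k::field ^ 4 \<Rightarrow> 'k) set" and l m0 m1 m2 :: "'k ^ 4 \<Rightarrow> 'k"
  assumes "fs.subspace Q" and lin: "l \<in> forms 1" "m0 \<in> forms 1" "m1 \<in> forms 1" "m2 \<in> forms 1"
    and coord: "\<And>j. \<exists>a b c e. \<forall>X. X $ j = a * l X + b * m0 X + c * m1 X + e * m2 X"
    and "\<And>d' g. Suc d' = d \<Longrightarrow> g \<in> forms d' \<Longrightarrow> l * g \<in> Q"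
    and "\<And>a b c. a + b + c = d \<Longrightarrow> m0 ^ a * m1 ^ b * m2 ^ c \<in> Q"
  shows "forms d \<subseteq> Q"
  using assms(1,7,8)
proof (induction d arbitrary: Q)
  case 0
  have "1 \<in> Q" using "0.prems"(3)[of 0 0 0] by (simp add: one_fun_def)
  show ?case
  proof
    fix f :: "'k ^ 4 \<Rightarrow> 'k" assume "f \<in> forms 0"
    then obtain c where "f = (\<lambda>X. c * 1)" using forms_0 by blast
    then show "f \<in> Q" using fs.subspace_scale[OF 0(1) \<open>1 \<in> Q\<close>, of c] by (simp add: one_fun_def)
  qed
next
  case (Suc d)
  define Q' where "Q' = {g. m0 * g \<in> Q} \<inter> {g. m1 * g \<in> Q} \<inter> {g. m2 * g \<in> Q}"
  have "forms d \<subseteq> Q'"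
  proof (rule Suc.IH)
    show "fs.subspace Q'"
      unfolding Q'_def using Suc.prems(1) by (intro fs.subspace_inter fs_subspace_mult_vimage)
  next
    fix d' and g :: "'k ^ 4 \<Rightarrow> 'k" assume "Suc d' = d" "g \<in> forms d'"
    then have "m * g \<in> forms d" if "m \<in> forms 1" for m using forms_mult[OF that, of g d'] by simp
    then have "m * (l * g) \<in> Q" if "m \<in> forms 1" for m
      using that Suc.prems(2)[of d "m * g"] by (simp only: mult.left_commute[of m l g])
    then show "l * g \<in> Q'" using lin unfolding Q'_def by blast
  next
    fix a b c assume abc: "a + b + c = d"
    have "m0 ^ Suc a * m1 ^ b * m2 ^ c \<in> Q" "m0 ^ a * m1 ^ Suc b * m2 ^ c \<in> Q" "m0 ^ a * m1 ^ b * m2 ^ Suc c \<in> Q"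
      using abc by (intro Suc.prems(3); simp)+
    then show "m0 ^ a * m1 ^ b * m2 ^ c \<in> Q'" unfolding Q'_def by (simp add: mult_ac)
  qed
  show ?case
  proof (rule forms_Suc_induct[OF Suc.prems(1)])
    fix j and g :: "'k ^ 4 \<Rightarrow> 'k" assume g: "g \<in> forms d"
    obtain a b c e where co: "\<And>X :: 'k ^ 4. X $ j = a * l X + b * m0 X + c * m1 X + e * m2 X"
      using coord by blast
    have "(\<lambda>X. X $ j) * g = (\<lambda>X. a * (l * g) X) + (\<lambda>X. b * (m0 * g) X) + (\<lambda>X. c * (m1 * g) X) + (\<lambda>X. e * (m2 * g) X)"
      by (simp add: fun_eq_iff co distrib_right mult.assoc)
    also have "\<dots> \<in> Q"
    proof -
      have "l * g \<in> Q" "m0 * g \<in> Q" "m1 * g \<in> Q" "m2 * g \<in> Q"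
        using g \<open>forms d \<subseteq> Q'\<close> Suc.prems(2)[of d g] by (auto simp only: Q'_def)
      then show ?thesis by (intro fs.subspace_add fs.subspace_scale Suc.prems(1))
    qed
    finally show "(\<lambda>X. X $ j) * g \<in> Q" .
  qed
qed

section \<open>The Hilbert function of a multiview ideal\<close>

lemma power_fun_apply: "(f ^ k) x = f x ^ k" for f :: "'a \<Rightarrow> 'b::comm_ring_1"
  by (induction k) auto

lemma prod_fun_apply: "prod f S x = (\<Prod>i\<in>S. f i x)" for f :: "'i \<Rightarrow> 'a \<Rightarrow> 'b::comm_ring_1"
  by (induction S rule: infinite_finite_induct) auto

lemma coord_eq_sum_axis: "X = (\<Sum>j\<in>UNIV. X $ j *s axis j 1)" for X :: "'k::field ^ 'm"
  by (simp add: vec_eq_iff axis_def if_distrib[of "\<lambda>x. _ * x"] cong: if_cong)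

lemma surj_camera_kernel:
  fixes M :: "'k::field ^ 4 ^ 3"
  assumes "surj ((*v) M)"
  shows "\<exists>P. P \<noteq> 0 \<and> M *v P = 0 \<and> (\<forall>X. M *v X = 0 \<longrightarrow> (\<exists>c. X = c *s P))"
proof -
  obtain c where c: "\<exists>j\<in>UNIV. c j \<noteq> 0" "\<forall>r\<in>UNIV. (\<Sum>j\<in>UNIV. c j * M $ r $ j) = 0"
    using homogeneous_system_solution[of "UNIV :: 3 set" "UNIV :: 4 set" "\<lambda>j r. M $ r $ j"] by auto
  define P where "P = (\<chi> j. c j)"
  have P: "P \<noteq> 0" "M *v P = 0"
    using c by (auto simp: P_def vec_eq_iff matrix_vector_mult_def mult.commute)
  have "\<exists>x. M *v x = axis r 1" for r using assms by (metis surjD)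
  then obtain b where b: "\<And>r :: 3. M *v b r = axis r 1" by metis
  have "\<exists>c. X = c *s P" if X: "M *v X = 0" for X
  proof -
    \<comment> \<open>Five vectors in 4-space: \<open>X\<close>, \<open>P\<close> and preimages of
      the three unit vectors. In a relation among them, applying \<open>M\<close> kills the
      coefficients of the preimages and leaves a relation between \<open>X\<close> and
      \<open>P\<close>.\<close>
    define w :: "3 option option \<Rightarrow> 'k ^ 4" where
      "w = (\<lambda>j. case j of None \<Rightarrow> X | Some None \<Rightarrow> P | Some (Some r) \<Rightarrow> b r)"
    have univ: "(UNIV :: 3 option option set) = insert None (insert (Some None) ((\<lambda>r. Some (Some r)) ` UNIV))"
      by (auto simp: image_iff)
    have fin: "finite (UNIV :: 3 option option set)" by simp
    have "card (UNIV :: 3 option option set) = 5" by (simp add: card_option)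
    then obtain e where e: "\<exists>j\<in>UNIV. e j \<noteq> 0" "\<forall>t\<in>UNIV. (\<Sum>j\<in>UNIV. e j * w j $ t) = 0"
      using homogeneous_system_solution[of "UNIV :: 4 set" "UNIV :: 3 option option set" "\<lambda>j t. w j $ t"]
      by auto
    have split: "(\<Sum>j\<in>UNIV. f j) = f None + (f (Some None) + (\<Sum>r\<in>UNIV. f (Some (Some r))))"
      for f :: "3 option option \<Rightarrow> 'k ^ 4"
      by (subst univ) (simp add: sum.reindex inj_on_def image_iff)
    have "(\<Sum>j\<in>UNIV. e j *s w j) = 0" using e(2) by (simp add: vec_eq_iff)
    then have rel: "e None *s X + (e (Some None) *s P + (\<Sum>r\<in>UNIV. e (Some (Some r)) *s b r)) = 0"
      unfolding split by (simp add: w_def)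
    then have "M *v (e None *s X + (e (Some None) *s P + (\<Sum>r\<in>UNIV. e (Some (Some r)) *s b r))) = 0"
      by simp
    then have "(\<Sum>r\<in>UNIV. e (Some (Some r)) *s axis r 1) = (0 :: 'k ^ 3)"
      by (simp add: vec.add vec.scale vec.sum X P b)
    then have z: "e (Some (Some r)) = 0" for r
      by (simp add: vec_eq_iff axis_def if_distrib[of "\<lambda>x. _ * x"] cong: if_cong)
    then have rel': "e None *s X = - e (Some None) *s P" using rel by (simp add: eq_neg_iff_add_eq_0)
    have "e None \<noteq> 0"
    proof
      assume "e None = 0"
      then have "e (Some None) = 0" using rel' P by simp
      then have "e j = 0" for j using z \<open>e None = 0\<close> by (cases j) (auto split: option.splits, metis option.exhaust)
      with e(1) show False by blast
    qed
    then have "X = (inverse (e None) * - e (Some None)) *s P"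
      using arg_cong[OF rel', of "\<lambda>v. inverse (e None) *s v"] by (simp add: vector_smult_assoc)
    then show ?thesis by blast
  qed
  with P show ?thesis by blast
qed

text \<open>A point and a chosen lift of its image differ by a multiple of the centre, where the
  linear form vanishes; so its values depend only on the image.\<close>

lemma functional_through_camera:
  fixes M :: "'k::field ^ 4 ^ 3" and \<phi> :: "'k ^ 4 \<Rightarrow> 'k"
  assumes "surj ((*v) M)" and ker: "\<And>X. M *v X = 0 \<Longrightarrow> \<exists>c. X = c *s P"
    and \<phi>: "\<And>X. \<phi> X = (\<Sum>j\<in>UNIV. c j * X $ j)" and "\<phi> P = 0"
  shows "\<exists>y. \<forall>X. \<phi> X = (\<Sum>r\<in>UNIV. y r * (M *v X) $ r)"
proof -
  have lin: "\<phi> (X + Y) = \<phi> X + \<phi> Y" "\<phi> (a *s X) = a * \<phi> X" for X Y a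
    by (simp_all add: \<phi> distrib_left sum.distrib sum_distrib_left mult_ac)
  have lin_diff: "\<phi> (X - Y) = \<phi> X - \<phi> Y" for X Y
    using lin(1)[of "X - Y" Y] by simp
  have lin_sum: "\<phi> (\<Sum>r\<in>S. g r) = (\<Sum>r\<in>S. \<phi> (g r))" if "finite S" for S :: "3 set" and g
    using that by (induction S rule: finite_induct) (use lin(2)[of 0 0] in \<open>auto simp: lin\<close>)
  have "\<exists>x. M *v x = axis r 1" for r using assms(1) by (metis surjD)
  then obtain b where b: "\<And>r :: 3. M *v b r = axis r 1" by metis
  have eq: "\<phi> X = (\<Sum>r\<in>UNIV. \<phi> (b r) * (M *v X) $ r)" for X
  proof -
    define Y where "Y = (\<Sum>r\<in>UNIV. (M *v X) $ r *s b r)"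
    have "M *v Y = M *v X"
      unfolding Y_def by (simp add: vec.sum vec.scale b coord_eq_sum_axis[symmetric])
    then have "M *v (X - Y) = 0" by (simp add: vec.diff)
    then obtain a where "X - Y = a *s P" using ker by blast
    then have "\<phi> X = \<phi> Y" using lin(2)[of a P] \<open>\<phi> P = 0\<close> lin_diff[of X Y] by simp
    then show ?thesis by (simp add: Y_def lin_sum lin mult.commute)
  qed
  show ?thesis by (rule exI[of _ "\<lambda>r. \<phi> (b r)"], rule allI, rule eq)
qed

section \<open>Pulling multihomogeneous polynomials back to 4-space\<close>

definition restr :: "('n::finite, 'k::field) cameras \<Rightarrow> ('n, 'k) xyz_poly \<Rightarrow> 'k ^ 4 \<Rightarrow> 'k" where
  "restr A f = (\<lambda>X. peval f (cam_point A X))"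

text \<open>For surjective cameras the kernel of \<open>restr A\<close> in degree \<open>u\<close>
  is the part of the multiview ideal of that degree, so the dimension of this space is the value of
  the Hilbert function.\<close>

definition restr_image :: "('n::finite, 'k::field) cameras \<Rightarrow> ('n \<Rightarrow> nat) \<Rightarrow> ('k ^ 4 \<Rightarrow> 'k) set" where
  "restr_image A u = restr A ` graded_part fst u"

lemma restr_add: "restr A (f + g) = restr A f + restr A g"
  by (simp add: restr_def fun_eq_iff peval_add)

lemma restr_mult: "restr A (f * g) = restr A f * restr A g"
  by (simp add: restr_def fun_eq_iff peval_mult)

lemma restr_image_subspace: "fs.subspace (restr_image A u)"
  unfolding restr_image_def restr_def by (rule fs_image_subspace) (rule gp_subspace)

lemma restr_image_mult:
  assumes "f \<in> restr_image A u" "g \<in> restr_image A v"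
  shows "f * g \<in> restr_image A (u + v)"
proof -
  obtain a b where "a \<in> graded_part fst u" "b \<in> graded_part fst v" "f = restr A a" "g = restr A b"
    using assms unfolding restr_image_def by blast
  then show ?thesis
    unfolding restr_image_def by (intro image_eqI[of _ _ "a * b"]) (auto simp: restr_mult intro: gp_mult)
qed

lemma restr_image_1: "1 \<in> restr_image A 0"
  unfolding restr_image_def
  by (rule image_eqI[of _ _ 1]) (simp_all add: gp_1 restr_def fun_eq_iff)

lemma restr_image_power: "f \<in> restr_image A u \<Longrightarrow> f ^ n \<in> restr_image A (\<lambda>i. n * u i)"
proof (induction n)
  case 0
  then show ?case using restr_image_1[of A] by (simp add: zero_fun_def one_fun_def)
next
  case (Suc n)
  have "u + (\<lambda>i. n * u i) = (\<lambda>i. Suc n * u i)" by (simp add: fun_eq_iff)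
  with Suc restr_image_mult[of f A u "f ^ n" "\<lambda>i. n * u i"] show ?case
    by (simp only: power_Suc)
qed

lemma restr_image_linear:
  "(\<lambda>X. \<Sum>r\<in>UNIV. y r * (A i *v X) $ r) \<in> restr_image A (unit_deg i)"
  unfolding restr_image_def
proof (rule image_eqI)
  show "(\<Sum>r\<in>UNIV. scale (y r) (Var (i, r))) \<in> graded_part fst (unit_deg i)"
    using gp_Var[of "(i, _)" fst] gp_subspace by (intro pm.subspace_sum pm.subspace_scale) auto
qed (simp add: restr_def fun_eq_iff peval_sum cam_point_def)

lemma restr_image_coord: "(\<lambda>X. (A i *v X) $ r) \<in> restr_image A (unit_deg i)"
  using restr_image_linear[of "\<lambda>s. if s = r then 1 else 0" A i]
  by (simp add: if_distrib[of "\<lambda>x. x * _"] cong: if_cong)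

lemma forms_camera_coord: "(\<lambda>X. (M *v X) $ r) \<in> forms 1"
  using forms_linear[of "\<lambda>j. M $ r $ j"] by (simp add: matrix_vector_mult_def)

lemma sum_multideg: "(\<Sum>i\<in>UNIV. multideg fst m i) = (\<Sum>v\<in>UNIV. lookup m v)" for m :: "('n::finite \<times> 3) monom"
proof -
  have "(\<Sum>v\<in>UNIV. lookup m v) = (\<Sum>i\<in>UNIV. \<Sum>v | v \<in> UNIV \<and> fst v = i. lookup m v)"
    by (rule sum.group[symmetric]) auto
  then show ?thesis by (simp add: multideg_superset[of UNIV])
qed

lemma restr_image_subset_forms: "restr_image A u \<subseteq> forms (\<Sum>i\<in>UNIV. u i)"
proof
  fix h assume "h \<in> restr_image A u"
  then obtain f where f: "f \<in> graded_part fst u" "h = restr A f" unfolding restr_image_def by blast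
  have "(\<lambda>X. meval m (cam_point A X)) \<in> forms (\<Sum>i\<in>UNIV. u i)" if "m \<in> keys f" for m
  proof -
    have "(\<Prod>v\<in>UNIV. (\<lambda>X. (A (fst v) *v X) $ snd v) ^ lookup m v) \<in> forms (\<Sum>v\<in>UNIV. lookup m v * 1)"
      by (intro forms_prod forms_power forms_camera_coord)
    moreover have "(\<Sum>v\<in>UNIV. lookup m v) = (\<Sum>i\<in>UNIV. u i)"
      using that f(1) sum_multideg[of m] by (simp add: graded_part_def)
    moreover have "(\<Prod>v\<in>UNIV. (\<lambda>X. (A (fst v) *v X) $ snd v) ^ lookup m v) = (\<lambda>X. meval m (cam_point A X))"
      by (simp add: fun_eq_iff prod_fun_apply power_fun_apply meval_UNIV cam_point_def)
    ultimately show ?thesis by simp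
  qed
  then have "(\<Sum>m\<in>keys f. (\<lambda>X. lookup f m * meval m (cam_point A X))) \<in> forms (\<Sum>i\<in>UNIV. u i)"
    by (intro fs.subspace_sum[OF forms_subspace] fs.subspace_scale[OF forms_subspace]) auto
  also have "(\<Sum>m\<in>keys f. (\<lambda>X. lookup f m * meval m (cam_point A X))) = h"
    using f(2) by (simp add: restr_def fun_eq_iff sum_fun_apply peval_superset[of "keys f"])
  finally show "h \<in> forms (\<Sum>i\<in>UNIV. u i)" .
qed

context field_vector_space
begin

text \<open>Allows a spanning property to be checked on generators of a space.\<close>

lemma subspace_spanned_mod:
  assumes "subspace U"
  shows "subspace {p. \<exists>c. p - (\<Sum>j\<in>J. scale (c j) (v j)) \<in> U}"
proof (rule subspaceI)
  show "0 \<in> {p. \<exists>c. p - (\<Sum>j\<in>J. scale (c j) (v j)) \<in> U}"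
    using subspace_0[OF assms] by (intro CollectI exI[of _ "\<lambda>_. 0"]) simp
next
  fix x y assume "x \<in> {p. \<exists>c. p - (\<Sum>j\<in>J. scale (c j) (v j)) \<in> U}" "y \<in> {p. \<exists>c. p - (\<Sum>j\<in>J. scale (c j) (v j)) \<in> U}"
  then obtain c d where "x - (\<Sum>j\<in>J. scale (c j) (v j)) \<in> U" "y - (\<Sum>j\<in>J. scale (d j) (v j)) \<in> U" by blast
  from subspace_add[OF assms this] show "x + y \<in> {p. \<exists>c. p - (\<Sum>j\<in>J. scale (c j) (v j)) \<in> U}"
    by (intro CollectI exI[of _ "\<lambda>j. c j + d j"]) (simp add: scale_left_distrib sum.distrib algebra_simps)
next
  fix a x assume "x \<in> {p. \<exists>c. p - (\<Sum>j\<in>J. scale (c j) (v j)) \<in> U}"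
  then obtain c where "x - (\<Sum>j\<in>J. scale (c j) (v j)) \<in> U" by blast
  from subspace_scale[OF assms this, of a] show "scale a x \<in> {p. \<exists>c. p - (\<Sum>j\<in>J. scale (c j) (v j)) \<in> U}"
    by (intro CollectI exI[of _ "\<lambda>j. a * c j"]) (simp add: scale_right_diff_distrib scale_sum_right)
qed

lemma spans_mod_image:
  assumes "finite J" "spans_mod U J v V"
  shows "spans_mod U (v ` J) id V"
  unfolding spans_mod_def
proof
  fix p assume "p \<in> V"
  then obtain c where c: "p - (\<Sum>j\<in>J. scale (c j) (v j)) \<in> U" using assms(2) by (elim spans_modE)
  have "(\<Sum>j\<in>J. scale (c j) (v j)) = (\<Sum>x\<in>v ` J. scale (\<Sum>j | j \<in> J \<and> v j = x. c j) (id x))"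
    unfolding scale_sum_left by (subst sum.image_gen[OF assms(1), of _ v]) (auto intro!: sum.cong)
  with c show "\<exists>c. p - (\<Sum>j\<in>v ` J. scale (c j) (id j)) \<in> U" by auto
qed

end

section \<open>Upper bound for the codimension of the restrictions in the forms\<close>

definition linform :: "('k::field ^ 4 \<Rightarrow> 'k) \<Rightarrow> bool" where
  "linform \<phi> \<longleftrightarrow> (\<exists>c. \<forall>X. \<phi> X = (\<Sum>j\<in>UNIV. c j * X $ j))"

lemma linform_coord: "linform (\<lambda>X. X $ r)"
  unfolding linform_def
  by (rule exI[of _ "\<lambda>j. if j = r then 1 else 0"]) (simp add: if_distrib[of "\<lambda>x. x * _"] cong: if_cong)

lemma linform_camera: "linform (\<lambda>X. (M *v X) $ r)"
  unfolding linform_def by (rule exI[of _ "\<lambda>j. M $ r $ j"]) (simp add: matrix_vector_mult_def)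

lemma linform_add: assumes "linform f" "linform g" shows "linform (\<lambda>X. f X + g X)"
proof -
  obtain c d where "\<And>X. f X = (\<Sum>j\<in>UNIV. c j * X $ j)" "\<And>X. g X = (\<Sum>j\<in>UNIV. d j * X $ j)"
    using assms unfolding linform_def by blast
  then show ?thesis unfolding linform_def
    by (intro exI[of _ "\<lambda>j. c j + d j"]) (simp add: distrib_right sum.distrib)
qed

lemma linform_scale: assumes "linform f" shows "linform (\<lambda>X. a * f X)"
proof -
  obtain c where "\<And>X. f X = (\<Sum>j\<in>UNIV. c j * X $ j)"
    using assms unfolding linform_def by blast
  then show ?thesis unfolding linform_def
    by (intro exI[of _ "\<lambda>j. a * c j"]) (simp add: sum_distrib_left mult.assoc)
qed

lemma linform_diff: "linform f \<Longrightarrow> linform g \<Longrightarrow> linform (\<lambda>X. f X - g X)"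
  using linform_add[of f "\<lambda>X. -1 * g X"] linform_scale[of g "-1"] by simp

lemma linform_forms:
  assumes "linform f" shows "f \<in> forms 1"
proof -
  obtain c where "\<And>X. f X = (\<Sum>j\<in>UNIV. c j * X $ j)"
    using assms unfolding linform_def by blast
  then have "f = (\<lambda>X. \<Sum>j\<in>UNIV. c j * X $ j)" by (rule ext)
  then show ?thesis using forms_linear[of c] by simp
qed

lemma linform_linear:
  assumes "linform f" shows "f (X + Y) = f X + f Y" "f (a *s X) = a * f X"
  using assms unfolding linform_def
  by (auto simp: distrib_left sum.distrib sum_distrib_left mult_ac)

text \<open>The condition on \<open>t\<close> says that, in the image plane of camera
  \<open>j\<close>, the line with coefficients 1, \<open>t\<close>, \<open>t\<^sup>2\<close> misses
  the images of all other centres. Each pair excludes the roots of a nonzero polynomial of degree at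
  most 2, so such \<open>t\<close> exist.\<close>

locale camera_centers =
  fixes A :: "('n::finite, 'k::alg_closed_field) cameras" and P :: "'n \<Rightarrow> 'k ^ 4" and t :: 'k
  assumes surj: "\<And>i. surj ((*v) (A i))"
    and P_nonzero: "\<And>i. P i \<noteq> 0"
    and P_kernel: "\<And>i. A i *v P i = 0"
    and kernel: "\<And>i X. A i *v X = 0 \<Longrightarrow> \<exists>c. X = c *s P i"
    and t: "\<And>i j. i \<noteq> j \<Longrightarrow> (A j *v P i) $ 1 + t * (A j *v P i) $ 2 + t\<^sup>2 * (A j *v P i) $ 3 \<noteq> 0"
begin

text \<open>Preimage of that line: a plane through the centre of camera \<open>j\<close> and through
  no other centre.\<close>

definition plane :: "'n \<Rightarrow> 'k ^ 4 \<Rightarrow> 'k" where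
  "plane j X = (A j *v X) $ 1 + t * (A j *v X) $ 2 + t\<^sup>2 * (A j *v X) $ 3"

text \<open>A linear form with value 1 at \<open>P j\<close>: some nonvanishing coordinate of
  \<open>P j\<close>, divided by its value there.\<close>

definition off :: "'n \<Rightarrow> 'k ^ 4 \<Rightarrow> 'k" where
  "off j X = inverse (P j $ (SOME r. P j $ r \<noteq> 0)) * X $ (SOME r. P j $ r \<noteq> 0)"

lemma linform_plane: "linform (plane j)"
  unfolding plane_def[abs_def] by (intro linform_add linform_scale linform_camera)

lemma linform_off: "linform (off j)"
  unfolding off_def[abs_def] by (intro linform_scale linform_coord)

lemma off_P: "off j (P j) = 1"
proof -
  have "\<exists>r. P j $ r \<noteq> 0" using P_nonzero[of j] by (auto simp: vec_eq_iff)
  then have "P j $ (SOME r. P j $ r \<noteq> 0) \<noteq> 0" by (rule someI_ex)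
  then show ?thesis by (simp add: off_def)
qed

lemma plane_P: "plane j (P j) = 0" "i \<noteq> j \<Longrightarrow> plane j (P i) \<noteq> 0"
  using t by (auto simp: plane_def P_kernel)

lemma plane_image: "plane j \<in> restr_image A (unit_deg j)"
proof -
  have eq: "plane j = (\<lambda>X. \<Sum>r\<in>UNIV. (if r = 1 then 1 else if r = 2 then t else t\<^sup>2) * (A j *v X) $ r)"
    by (simp add: fun_eq_iff plane_def sum_3)
  show ?thesis unfolding eq by (rule restr_image_linear)
qed

text \<open>After subtracting its value at \<open>P j\<close> times \<open>off j\<close>, a
  coordinate factors through camera \<open>j\<close>. The coefficient of the first image coordinate
  in \<open>plane j\<close> is 1, so \<open>plane j\<close> can take its place.\<close>

lemma coord_basis:
  "\<exists>a b c e. \<forall>X. X $ r = a * plane j X + b * off j X + c * (A j *v X) $ 2 + e * (A j *v X) $ 3"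
proof -
  have "linform (\<lambda>X. X $ r - P j $ r * off j X)"
    by (intro linform_diff linform_scale linform_coord linform_off)
  then obtain c where "\<And>X. X $ r - P j $ r * off j X = (\<Sum>k\<in>UNIV. c k * X $ k)"
    unfolding linform_def by blast
  from functional_through_camera[where M = "A j" and P = "P j", OF surj kernel this] obtain y where
    y: "\<And>X. X $ r - P j $ r * off j X = (\<Sum>s\<in>UNIV. y s * (A j *v X) $ s)"
    using off_P by auto
  have "X $ r = y 1 * plane j X + P j $ r * off j X +
      (y 2 - y 1 * t) * (A j *v X) $ 2 + (y 3 - y 1 * t\<^sup>2) * (A j *v X) $ 3" for X
  proof -
    have "X $ r = (X $ r - P j $ r * off j X) + P j $ r * off j X" by simp
    then show ?thesis unfolding y sum_3 by (simp add: plane_def algebra_simps)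
  qed
  then show ?thesis by blast
qed

text \<open>Since \<open>plane j\<close> is nonzero at \<open>P i\<close>, a multiple of it corrects
  any linear form to one that vanishes at \<open>P i\<close> and thus factors through camera
  \<open>i\<close>.\<close>

lemma coord_mod_plane:
  assumes "i \<noteq> j"
  shows "\<exists>y c. \<forall>X. X $ r = (\<Sum>s\<in>UNIV. y s * (A i *v X) $ s) + c * plane j X"
proof -
  let ?c = "P i $ r / plane j (P i)"
  have "linform (\<lambda>X. X $ r - ?c * plane j X)"
    by (intro linform_diff linform_scale linform_coord linform_plane)
  then obtain c where "\<And>X. X $ r - ?c * plane j X = (\<Sum>k\<in>UNIV. c k * X $ k)"
    unfolding linform_def by blast
  from functional_through_camera[where M = "A i" and P = "P i", OF surj kernel this] obtain y where
    y: "\<And>X. X $ r - ?c * plane j X = (\<Sum>s\<in>UNIV. y s * (A i *v X) $ s)"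
    using plane_P(2)[OF assms] by auto
  have eq: "X $ r = (\<Sum>s\<in>UNIV. y s * (A i *v X) $ s) + ?c * plane j X" for X
    unfolding y[symmetric] by simp
  show ?thesis by (rule exI[of _ y], rule exI[of _ ?c], rule allI, rule eq)
qed

definition mod_plane :: "('n \<Rightarrow> nat) \<Rightarrow> 'n \<Rightarrow> nat \<Rightarrow> ('k ^ 4 \<Rightarrow> 'k) set" where
  "mod_plane u j d = {f. \<exists>w g. w \<in> restr_image A u \<and> g \<in> forms d \<and> f = w + plane j * g}"

lemma mod_planeI: "w \<in> restr_image A u \<Longrightarrow> g \<in> forms d \<Longrightarrow> w + plane j * g \<in> mod_plane u j d"
  unfolding mod_plane_def by blast

lemma mod_planeI1:
  assumes "w \<in> restr_image A u" shows "w \<in> mod_plane u j d"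
proof -
  have "w + plane j * 0 \<in> mod_plane u j d"
    by (intro mod_planeI assms fs.subspace_0[OF forms_subspace])
  then show ?thesis by simp
qed

lemma mod_planeI2:
  assumes "g \<in> forms d" shows "plane j * g \<in> mod_plane u j d"
proof -
  have "0 + plane j * g \<in> mod_plane u j d"
    by (intro mod_planeI assms fs.subspace_0[OF restr_image_subspace])
  then show ?thesis by simp
qed

lemma mod_plane_subspace: "fs.subspace (mod_plane u j d)"
proof (rule fs.subspaceI)
  show "0 \<in> mod_plane u j d" by (rule mod_planeI1) (rule fs.subspace_0[OF restr_image_subspace])
next
  fix x y assume "x \<in> mod_plane u j d" "y \<in> mod_plane u j d"
  then obtain w g w' g' where *: "w \<in> restr_image A u" "g \<in> forms d" "x = w + plane j * g"
    "w' \<in> restr_image A u" "g' \<in> forms d" "y = w' + plane j * g'" unfolding mod_plane_def by blast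
  have "(w + w') + plane j * (g + g') \<in> mod_plane u j d"
    using * by (intro mod_planeI fs.subspace_add[OF restr_image_subspace] fs.subspace_add[OF forms_subspace])
  then show "x + y \<in> mod_plane u j d" using * by (simp add: algebra_simps)
next
  fix c x assume "x \<in> mod_plane u j d"
  then obtain w g where *: "w \<in> restr_image A u" "g \<in> forms d" "x = w + plane j * g"
    unfolding mod_plane_def by blast
  have "(\<lambda>X. c * w X) + plane j * (\<lambda>X. c * g X) \<in> mod_plane u j d"
    using * by (intro mod_planeI fs.subspace_scale[OF restr_image_subspace] fs.subspace_scale[OF forms_subspace])
  also have "(\<lambda>X. c * w X) + plane j * (\<lambda>X. c * g X) = (\<lambda>X. c * x X)"
    using * by (simp add: fun_eq_iff algebra_simps)
  finally show "(\<lambda>X. c * x X) \<in> mod_plane u j d" .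
qed

text \<open>Modulo the plane, every linear form vanishes at the centre of any other camera, so
  missing factors can be supplied from the cameras other than \<open>j\<close>.\<close>

lemma mult_in_mod_plane:
  assumes "sum u UNIV = Suc d" "sum u UNIV = sum v UNIV + k" "\<And>i. v i \<le> u i" "v j = u j"
    "p \<in> restr_image A v" "g \<in> forms k"
  shows "p * g \<in> mod_plane u j d"
  using assms(2-)
proof (induction k arbitrary: v p g)
  case 0
  have "v i = u i" for i
  proof (rule ccontr)
    assume "v i \<noteq> u i"
    then have "sum v UNIV < sum u UNIV"
      using "0.prems"(2) by (intro sum_strict_mono_ex1) (auto intro!: exI[of _ i] simp: le_neq_implies_less)
    then show False using "0.prems"(1) by simp
  qed
  then have "v = u" by auto
  obtain c where "g = (\<lambda>X. c * 1)" using forms_0[OF "0.prems"(5)] by blast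
  then have "p * g = (\<lambda>X. c * p X)" by (simp add: fun_eq_iff)
  then show ?case
    using "0.prems"(4) \<open>v = u\<close> fs.subspace_scale[OF restr_image_subspace, of p A u c]
    by (simp add: mod_planeI1)
next
  case (Suc k)
  have "\<exists>i. v i < u i"
  proof (rule ccontr)
    assume "\<not> ?thesis"
    then have "v i = u i" for i using Suc.prems(2)[of i] by (meson antisym_conv2)
    then show False using Suc.prems(1) by simp
  qed
  then obtain i where i: "v i < u i" by blast
  then have "i \<noteq> j" using Suc.prems(3) by auto
  have "forms (Suc k) \<subseteq> {g. p * g \<in> mod_plane u j d}"
  proof (rule forms_Suc_induct)
    show "fs.subspace {g. p * g \<in> mod_plane u j d}"
      by (rule fs_subspace_mult_vimage) (rule mod_plane_subspace)
    fix r and g :: "'k ^ 4 \<Rightarrow> 'k" assume g: "g \<in> forms k"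
    obtain y c where yc: "\<And>X. X $ r = (\<Sum>s\<in>UNIV. y s * (A i *v X) $ s) + c * plane j X"
      using coord_mod_plane[OF \<open>i \<noteq> j\<close>] by blast
    define l where "l = (\<lambda>X. \<Sum>s\<in>UNIV. y s * (A i *v X) $ s)"
    have "(p * l) * g \<in> mod_plane u j d"
    proof (rule Suc.IH[of "v + unit_deg i"])
      show "sum u UNIV = sum (v + unit_deg i) UNIV + k"
        using Suc.prems(1) by (simp add: sum.distrib unit_deg_def)
      show "(v + unit_deg i) i' \<le> u i'" for i'
        using Suc.prems(2)[of i'] i by (auto simp: unit_deg_def)
      show "(v + unit_deg i) j = u j" using \<open>i \<noteq> j\<close> Suc.prems(3) by (simp add: unit_deg_def)
      show "p * l \<in> restr_image A (v + unit_deg i)"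
        unfolding l_def by (intro restr_image_mult Suc.prems(4) restr_image_linear)
    qed (rule g)
    moreover have "plane j * (\<lambda>X. c * (p * g) X) \<in> mod_plane u j d"
    proof (rule mod_planeI2)
      have "p * g \<in> forms (sum v UNIV + k)"
        using Suc.prems(4) restr_image_subset_forms g by (intro forms_mult) auto
      moreover have "sum v UNIV + k = d" using Suc.prems(1) assms(1) by simp
      ultimately have "p * g \<in> forms d" by simp
      then show "(\<lambda>X. c * (p * g) X) \<in> forms d" by (rule fs.subspace_scale[OF forms_subspace])
    qed
    ultimately have "(p * l) * g + plane j * (\<lambda>X. c * (p * g) X) \<in> mod_plane u j d"
      by (rule fs.subspace_add[OF mod_plane_subspace])
    also have "(p * l) * g + plane j * (\<lambda>X. c * (p * g) X) = p * ((\<lambda>X. X $ r) * g)"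
      unfolding fun_eq_iff plus_fun_apply times_fun_apply yc l_def by (simp add: algebra_simps)
    finally show "(\<lambda>X. X $ r) * g \<in> {g. p * g \<in> mod_plane u j d}" unfolding mem_Collect_eq .
  qed
  then show ?case using Suc.prems(5) by blast
qed

text \<open>Multiples of \<open>plane j\<close> reduce to the previous degree. Of the other
  monomials, those with at least \<open>u j + 1\<close> factors among the image coordinates of view
  \<open>j\<close> are covered by \<open>mult_in_mod_plane\<close>; the rest, with
  \<open>b + c \<le> u j\<close>, are counted by the binomial.\<close>

lemma forms_spanned_step:
  assumes B: "finite B" "fs.spans_mod (restr_image A u) B id (forms (sum u UNIV))"
  shows "\<exists>B'. finite B' \<and> card B' \<le> card B + ((u j + 2) choose 2) \<and>
    fs.spans_mod (restr_image A (u + unit_deg j)) B' id (forms (Suc (sum u UNIV)))"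
proof -
  define d where "d = sum u UNIV"
  define u' where "u' = u + unit_deg j"
  have sum_u': "sum u' UNIV = Suc d" by (simp add: u'_def d_def sum.distrib unit_deg_def)
  have u'j: "u' j = Suc (u j)" by (simp add: u'_def unit_deg_def)
  define m1 m2 where "m1 = (\<lambda>X. (A j *v X) $ 2)" and "m2 = (\<lambda>X. (A j *v X) $ 3)"
  define T where "T = {q :: 3 \<Rightarrow> nat. sum q UNIV = u j}"
  \<comment> \<open>\<open>q 3\<close> is a slack exponent: \<open>T\<close> stands for the pairs
    with \<open>q 1 + q 2 \<le> u j\<close>, and \<open>off j\<close> fills up the degree.\<close>
  define fam where "fam q = off j ^ (Suc d - q 1 - q 2) * m1 ^ q 1 * m2 ^ q 2" for q :: "3 \<Rightarrow> nat"
  have cardT: "card T = (u j + 2) choose 2" unfolding T_def by (rule card_exponents_3)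
  then have finT: "finite T" by (intro card_ge_0_finite) (simp add: zero_less_binomial)
  let ?Q = "{f. \<exists>c. f - (\<Sum>q\<in>T. (\<lambda>X. c q * fam q X)) \<in> mod_plane u' j d}"
  have sub: "fs.subspace ?Q" by (rule fs.subspace_spanned_mod) (rule mod_plane_subspace)
  have subQ: "f \<in> ?Q" if "f \<in> mod_plane u' j d" for f
    using that by (intro CollectI exI[of _ "\<lambda>_. 0"]) (simp add: zero_fun_def[symmetric])
  have "forms (Suc d) \<subseteq> ?Q"
  proof (rule forms_basis_induct[where l = "plane j" and ?m0.0 = "off j" and ?m1.0 = m1 and ?m2.0 = m2])
    show "fs.subspace ?Q" by (rule sub)
    show "plane j \<in> forms 1" "off j \<in> forms 1" "m1 \<in> forms 1" "m2 \<in> forms 1"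
      unfolding m1_def m2_def by (intro linform_forms linform_plane linform_off linform_camera)+
    show "\<exists>a b c e. \<forall>X. X $ r = a * plane j X + b * off j X + c * m1 X + e * m2 X" for r
      unfolding m1_def m2_def by (rule coord_basis)
    show "plane j * g \<in> ?Q" if "Suc d' = Suc d" "g \<in> forms d'" for d' g
      using that by (intro subQ mod_planeI2) simp
    fix a b c assume abc: "a + b + c = Suc d"
    show "off j ^ a * m1 ^ b * m2 ^ c \<in> ?Q"
    proof (cases "b + c \<le> u j")
      case True
      define q :: "3 \<Rightarrow> nat" where "q = (\<lambda>r. if r = 1 then b else if r = 2 then c else u j - b - c)"
      have "q \<in> T" using True by (simp add: T_def q_def sum_3)
      moreover have "fam q = off j ^ a * m1 ^ b * m2 ^ c"
        using abc by (simp add: fam_def q_def flip: abc)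
      ultimately show ?thesis
        using fs.sum_scale_indicator[OF finT, of q fam] fs.subspace_0[OF mod_plane_subspace]
        by (intro CollectI exI[of _ "\<lambda>j. if j = q then 1 else 0"]) simp
    next
      case False
      \<comment> \<open>Exactly \<open>u' j\<close> of the factors \<open>m1\<close>,
        \<open>m2\<close> are used as coordinates of view \<open>j\<close>; the others join the
        arbitrary form that is distributed over the remaining views.\<close>
      define b' c' where "b' = min b (u' j)" and "c' = u' j - b'"
      have bc: "b' \<le> b" "c' \<le> c" "b' + c' = u' j" using False u'j by (auto simp: b'_def c'_def)
      have img: "m1 \<in> restr_image A (unit_deg j)" "m2 \<in> restr_image A (unit_deg j)"
        unfolding m1_def m2_def by (rule restr_image_coord)+
      define v where "v = (\<lambda>i. b' * unit_deg j i) + (\<lambda>i. c' * unit_deg j i)"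
      have v: "v i = (if i = j then u' j else 0)" for i
        using bc by (simp add: v_def unit_deg_def)
      have "(m1 ^ b' * m2 ^ c') * (off j ^ a * m1 ^ (b - b') * m2 ^ (c - c')) \<in> mod_plane u' j d"
      proof (rule mult_in_mod_plane[where v = v and k = "a + (b - b') + (c - c')"])
        show "sum u' UNIV = Suc d" by (rule sum_u')
        show "sum u' UNIV = sum v UNIV + (a + (b - b') + (c - c'))"
          using abc bc by (simp add: sum_u' v)
        show "m1 ^ b' * m2 ^ c' \<in> restr_image A v"
          unfolding v_def by (intro restr_image_mult restr_image_power img)
        have "off j ^ a * m1 ^ (b - b') * m2 ^ (c - c') \<in> forms (a * 1 + (b - b') * 1 + (c - c') * 1)"
          unfolding m1_def m2_def
          by (intro forms_mult forms_power linform_forms linform_off linform_camera)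
        then show "off j ^ a * m1 ^ (b - b') * m2 ^ (c - c') \<in> forms (a + (b - b') + (c - c'))" by simp
      qed (auto simp: v)
      also have "(m1 ^ b' * m2 ^ c') * (off j ^ a * m1 ^ (b - b') * m2 ^ (c - c')) =
          off j ^ a * (m1 ^ b' * m1 ^ (b - b')) * (m2 ^ c' * m2 ^ (c - c'))"
        by (simp only: mult_ac)
      also have "\<dots> = off j ^ a * m1 ^ b * m2 ^ c"
        unfolding power_add[symmetric] using bc by simp
      finally show ?thesis by (rule subQ)
    qed
  qed
  then have 1: "fs.spans_mod (mod_plane u' j d) T fam (forms (Suc d))"
    unfolding fs.spans_mod_def by blast
  have 2: "fs.spans_mod (restr_image A u') B (\<lambda>b. plane j * b) (mod_plane u' j d)"
    unfolding fs.spans_mod_def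
  proof
    fix f assume "f \<in> mod_plane u' j d"
    then obtain w g where f: "w \<in> restr_image A u'" "g \<in> forms d" "f = w + plane j * g"
      unfolding mod_plane_def by blast
    obtain c where c: "g - (\<Sum>b\<in>B. (\<lambda>X. c b * id b X)) \<in> restr_image A u"
      using fs.spans_modE[OF B(2)] f(2) unfolding d_def by blast
    have "w + (g - (\<Sum>b\<in>B. (\<lambda>X. c b * id b X))) * plane j \<in> restr_image A u'"
      unfolding u'_def using f(1) c
      by (intro fs.subspace_add[OF restr_image_subspace] restr_image_mult plane_image) (auto simp: u'_def)
    also have "w + (g - (\<Sum>b\<in>B. (\<lambda>X. c b * id b X))) * plane j = f - (\<Sum>b\<in>B. (\<lambda>X. c b * (plane j * b) X))"
      unfolding f(3) by (simp add: fun_eq_iff sum_fun_apply algebra_simps sum_distrib_left)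
    finally show "\<exists>c. f - (\<Sum>b\<in>B. (\<lambda>X. c b * (plane j * b) X)) \<in> restr_image A u'" by blast
  qed
  have "fs.spans_mod (restr_image A u') (T <+> B) (case_sum fam (\<lambda>b. plane j * b)) (forms (Suc d))"
    by (rule fs.spans_mod_Plus[OF finT B(1) 1 2])
  then have "fs.spans_mod (restr_image A u') (case_sum fam (\<lambda>b. plane j * b) ` (T <+> B)) id (forms (Suc d))"
    using finT B(1) by (intro fs.spans_mod_image) auto
  moreover have "card (case_sum fam (\<lambda>b. plane j * b) ` (T <+> B)) \<le> card B + ((u j + 2) choose 2)"
    using card_image_le[of "T <+> B" "case_sum fam (\<lambda>b. plane j * b)"] finT B(1) cardT
    by (simp add: card_Plus)
  ultimately show ?thesis
    using finT B(1) unfolding u'_def d_def by (intro exI conjI) auto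
qed

text \<open>The increments of \<open>forms_spanned_step\<close> add up by Pascal's rule to
  \<open>(u i + 2) choose 3\<close>, the number of conditions for vanishing to order
  \<open>u i\<close> at a point of 3-space.\<close>

lemma forms_spanned:
  "\<exists>B. finite B \<and> card B \<le> (\<Sum>i\<in>UNIV. (u i + 2) choose 3) \<and>
    fs.spans_mod (restr_image A u) B id (forms (sum u UNIV))"
proof (induction "sum u UNIV" arbitrary: u)
  case 0
  then have "u = 0" by (simp add: fun_eq_iff)
  have sp: "fs.spans_mod (restr_image A u) {} id (forms (sum u UNIV))"
    unfolding fs.spans_mod_def
  proof
    fix p :: "'k ^ 4 \<Rightarrow> 'k" assume "p \<in> forms (sum u UNIV)"
    then obtain c where p: "p = (\<lambda>X. c * 1)" using forms_0 0 by metis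
    have "(\<lambda>X. c * 1 X) \<in> restr_image A u"
      unfolding \<open>u = 0\<close> by (intro fs.subspace_scale[OF restr_image_subspace] restr_image_1)
    then show "\<exists>c. p - (\<Sum>j\<in>{}. (\<lambda>x. c j * id j x)) \<in> restr_image A u" using p by simp
  qed
  show ?case
    by (rule exI[of _ "{}"], intro conjI finite.emptyI sp) simp
next
  case (Suc d)
  then obtain j where j: "u j \<noteq> 0" by (metis sum.neutral nat.distinct(1))
  define u0 where "u0 = u(j := u j - 1)"
  have u: "u = u0 + unit_deg j" using j by (auto simp: u0_def unit_deg_def fun_eq_iff)
  have "sum u UNIV = Suc (sum u0 UNIV)" by (subst u) (simp add: sum.distrib unit_deg_def)
  then have d: "d = sum u0 UNIV" using Suc(2) by simp
  from Suc(1)[OF this] obtain B where B: "finite B" "card B \<le> (\<Sum>i\<in>UNIV. (u0 i + 2) choose 3)"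
    "fs.spans_mod (restr_image A u0) B id (forms (sum u0 UNIV))" by blast
  from forms_spanned_step[OF B(1,3), of j] obtain B' where B': "finite B'"
    "card B' \<le> card B + ((u0 j + 2) choose 2)"
    "fs.spans_mod (restr_image A u) B' id (forms (sum u UNIV))"
    using Suc(2) d unfolding u[symmetric] by auto
  have "(\<Sum>i\<in>UNIV. (u i + 2) choose 3) = (\<Sum>i\<in>UNIV. ((u0 i + 2) choose 3) + (if i = j then (u0 j + 2) choose 2 else 0))"
    by (rule sum.cong) (auto simp: u unit_deg_def numeral_3_eq_3 numeral_2_eq_2)
  then have "(\<Sum>i\<in>UNIV. (u i + 2) choose 3) = (\<Sum>i\<in>UNIV. (u0 i + 2) choose 3) + ((u0 j + 2) choose 2)"
    by (simp add: sum.distrib)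
  then show ?case using B B' by (intro exI[of _ B']) auto
qed

end

text \<open>The order is tested on lines through \<open>P\<close> and not by derivatives, so that it
  is meaningful in every characteristic.\<close>

definition vanishes_to :: "nat \<Rightarrow> 'k::field ^ 4 \<Rightarrow> ('k ^ 4 \<Rightarrow> 'k) \<Rightarrow> bool" where
  "vanishes_to m P f \<longleftrightarrow> (\<forall>v. \<exists>q. \<forall>s. f (P + s *s v) = s ^ m * poly q s)"

lemma vanishes_to_subspace: "fs.subspace {f. vanishes_to m P f}"
proof (rule fs.subspaceI)
  show "0 \<in> {f. vanishes_to m P f}" by (auto simp: vanishes_to_def intro!: exI[of _ 0])
next
  fix f g assume fg: "f \<in> {f. vanishes_to m P f}" "g \<in> {f. vanishes_to m P f}"
  have "\<exists>q. \<forall>s. (f + g) (P + s *s v) = s ^ m * poly q s" for v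
  proof -
    obtain q q' where "\<And>s. f (P + s *s v) = s ^ m * poly q s" "\<And>s. g (P + s *s v) = s ^ m * poly q' s"
      using fg unfolding vanishes_to_def by blast
    then show ?thesis by (intro exI[of _ "q + q'"]) (simp add: distrib_left)
  qed
  then show "f + g \<in> {f. vanishes_to m P f}" by (simp add: vanishes_to_def)
next
  fix c f assume f: "f \<in> {f. vanishes_to m P f}"
  have "\<exists>q. \<forall>s. c * f (P + s *s v) = s ^ m * poly q s" for v
  proof -
    obtain q where "\<And>s. f (P + s *s v) = s ^ m * poly q s"
      using f unfolding vanishes_to_def by blast
    then show ?thesis by (intro exI[of _ "smult c q"]) simp
  qed
  then show "(\<lambda>x. c * f x) \<in> {f. vanishes_to m P f}" by (simp add: vanishes_to_def)
qed

text \<open>As \<open>H\<close> has nonzero constant term, the power of the variable must divide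
  \<open>G\<close>, whose degree is too small.\<close>

lemma coeffs_zero_of_monom_dvd:
  fixes H G Q :: "'k::idom poly"
  assumes "H * G = monom 1 u * Q" "coeff H 0 \<noteq> 0" "\<And>k. k \<ge> u \<Longrightarrow> coeff G k = 0"
  shows "G = 0"
proof -
  have "coeff G k = 0" for k
  proof (induction k rule: less_induct)
    case (less k)
    show ?case
    proof (cases "k < u")
      case True
      have "coeff (H * G) k = coeff H 0 * coeff G k + (\<Sum>i\<in>{..k} - {0}. coeff H i * coeff G (k - i))"
        unfolding coeff_mult by (subst sum.remove[of _ 0]) auto
      also have "(\<Sum>i\<in>{..k} - {0}. coeff H i * coeff G (k - i)) = 0"
        using less by (intro sum.neutral) auto
      finally have "coeff H 0 * coeff G k = 0"
        using True unfolding assms(1) by (simp add: coeff_monom_mult)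
      then show ?thesis using assms(2) by simp
    qed (use assms(3) in auto)
  qed
  then show ?thesis by (simp add: poly_eq_iff)
qed

lemma poly_fun_inject:
  fixes p q :: "'k::alg_closed_field poly"
  assumes "\<And>s. poly p s = poly q s" shows "p = q"
proof -
  have "p - q = 0"
    by (rule infinite_zeros_imp_poly_zero) (simp add: assms infinite_UNIV_alg_closed)
  then show ?thesis by simp
qed

section \<open>Lower bound for the codimension: orders of vanishing at the centres\<close>

context camera_centers
begin

text \<open>On a line through \<open>P i\<close> the image under camera \<open>i\<close> is
  \<open>s\<close> times a constant vector, so each of the \<open>u i\<close> factors from view
  \<open>i\<close> contributes a factor \<open>s\<close>.\<close>

lemma restr_image_vanishes:
  assumes "f \<in> restr_image A u"
  shows "vanishes_to (u i) (P i) f"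
  unfolding vanishes_to_def
proof
  fix v
  obtain g where g: "g \<in> graded_part fst u" "f = restr A g" using assms unfolding restr_image_def by blast
  define p where "p s w = (if fst w = i then (A i *v v) $ snd w else cam_point A (P i + s *s v) w)" for s w
  have "polyfun (\<lambda>s. peval g (p s))"
  proof (rule polyfun_peval_const)
    show "polyfun (\<lambda>s. p s w)" for w
      by (cases "fst w = i") (auto simp: p_def cam_point_alt)
  qed
  then obtain q where q: "\<And>s. peval g (p s) = poly q s" unfolding polyfun_def by blast
  have "f (P i + s *s v) = s ^ u i * poly q s" for s
  proof -
    have eq: "cam_point A (P i + s *s v) = (\<lambda>w. (if fst w = i then s else 1) * p s w)"
      by (auto simp: p_def cam_point_def vec.add vec.scale P_kernel)
    have "peval g (cam_point A (P i + s *s v)) = (\<Prod>k\<in>UNIV. (if k = i then s else 1) ^ u k) * poly q s"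
      unfolding eq q[symmetric] by (rule peval_torus[OF g(1), of "\<lambda>k. if k = i then s else 1" "p s"])
    also have "(\<Prod>k\<in>UNIV. (if k = i then s else 1) ^ u k) = (\<Prod>k\<in>UNIV. if k = i then s ^ u i else 1)"
      by (rule prod.cong) auto
    finally show ?thesis by (simp add: g(2) restr_def)
  qed
  then show "\<exists>q. \<forall>s. f (P i + s *s v) = s ^ u i * poly q s" by blast
qed

text \<open>The planes make the form vanish to order \<open>u k\<close> at every other centre
  \<open>P k\<close>. Near \<open>P i\<close> the rest is a local monomial of order
  \<open>q 1 + q 2 + q 3\<close>; the successor in the exponent of \<open>off i\<close> keeps this
  order below \<open>u i\<close> while the factors other than the planes have total degree
  \<open>u i\<close>.\<close>

definition dual_form :: "('n \<Rightarrow> nat) \<Rightarrow> 'n \<times> (4 \<Rightarrow> nat) \<Rightarrow> 'k ^ 4 \<Rightarrow> 'k" where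
  "dual_form u = (\<lambda>(i, q) X. (\<Prod>k\<in>UNIV - {i}. plane k X ^ u k) * off i X ^ Suc (q 4) *
     (A i *v X) $ 1 ^ q 1 * (A i *v X) $ 2 ^ q 2 * (A i *v X) $ 3 ^ q 3)"

definition dual_index :: "('n \<Rightarrow> nat) \<Rightarrow> ('n \<times> (4 \<Rightarrow> nat)) set" where
  "dual_index u = (SIGMA i:UNIV. {q. Suc (sum q UNIV) = u i})"

lemma card_dual_index_fibre: "card {q :: 4 \<Rightarrow> nat. Suc (sum q UNIV) = k} = (k + 2) choose 3"
  "finite {q :: 4 \<Rightarrow> nat. Suc (sum q UNIV) = k}"
proof -
  have "card {q :: 4 \<Rightarrow> nat. Suc (sum q UNIV) = k} = (k + 2) choose 3 \<and>
      finite {q :: 4 \<Rightarrow> nat. Suc (sum q UNIV) = k}"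
  proof (cases k)
    case (Suc s)
    then have "{q :: 4 \<Rightarrow> nat. Suc (sum q UNIV) = k} = {q. sum q UNIV = s}" by auto
    then show ?thesis
      using Suc card_exponents_4[of s] by (auto intro!: card_ge_0_finite simp: numeral_3_eq_3)
  qed simp
  then show "card {q :: 4 \<Rightarrow> nat. Suc (sum q UNIV) = k} = (k + 2) choose 3"
    "finite {q :: 4 \<Rightarrow> nat. Suc (sum q UNIV) = k}" by auto
qed

lemma finite_dual_index: "finite (dual_index u)"
  unfolding dual_index_def by (intro finite_SigmaI card_dual_index_fibre) simp

lemma card_dual_index: "card (dual_index u) = (\<Sum>i\<in>UNIV. (u i + 2) choose 3)"
  unfolding dual_index_def by (simp add: card_SigmaI card_dual_index_fibre)

lemma dual_form_in_forms:
  assumes "iq \<in> dual_index u" shows "dual_form u iq \<in> forms (sum u UNIV)"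
proof -
  obtain i q where iq: "iq = (i, q)" "Suc (sum q UNIV) = u i" using assms unfolding dual_index_def by auto
  define m where "m r = (\<lambda>X. (A i *v X) $ r)" for r
  have "(\<Prod>k\<in>UNIV - {i}. plane k ^ u k) * off i ^ Suc (q 4) * m 1 ^ q 1 * m 2 ^ q 2 * m 3 ^ q 3
      \<in> forms ((\<Sum>k\<in>UNIV - {i}. u k * 1) + Suc (q 4) * 1 + q 1 * 1 + q 2 * 1 + q 3 * 1)"
    unfolding m_def
    by (intro forms_mult forms_prod forms_power linform_forms linform_plane linform_off linform_camera)
  moreover have "(\<Sum>k\<in>UNIV - {i}. u k * 1) + Suc (q 4) * 1 + q 1 * 1 + q 2 * 1 + q 3 * 1 = sum u UNIV"
    using iq(2) by (simp add: sum_4 sum.remove[of UNIV i u])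
  moreover have "(\<Prod>k\<in>UNIV - {i}. plane k ^ u k) * off i ^ Suc (q 4) * m 1 ^ q 1 * m 2 ^ q 2 * m 3 ^ q 3
      = dual_form u iq"
    by (simp add: fun_eq_iff dual_form_def iq m_def prod_fun_apply power_fun_apply del: power_Suc)
  ultimately show ?thesis by simp
qed

text \<open>Expanding a relation around the centre \<open>P i\<close> isolates the forms attached to \<open>i\<close>:
  those attached to other centres vanish there to the full order \<open>u i\<close>.\<close>

lemma dual_form_independent:
  "fs.indep_mod {f. \<forall>i. vanishes_to (u i) (P i) f} (dual_index u) (dual_form u)"
proof (rule fs.indep_modI)
  fix c iq
  assume van: "(\<Sum>j\<in>dual_index u. (\<lambda>x. c j * dual_form u j x)) \<in> {f. \<forall>i. vanishes_to (u i) (P i) f}"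
    and iq: "iq \<in> dual_index u"
  obtain i q where iq': "iq = (i, q)" "Suc (sum q UNIV) = u i" using iq unfolding dual_index_def by auto
  define F where "F = {q :: 4 \<Rightarrow> nat. Suc (sum q UNIV) = u i}"
  have finF: "finite F" unfolding F_def by (rule card_dual_index_fibre)
  define e :: "(4 \<Rightarrow> nat) \<Rightarrow> 3 \<Rightarrow> nat" where
    "e q = (\<lambda>r. if r = 1 then q 1 else if r = 2 then q 2 else q 3)" for q
  have key: "(\<Sum>q\<in>F. c (i, q) * (\<Prod>r\<in>UNIV. y r ^ e q r)) = 0" for y
  proof -
    obtain X where X: "A i *v X = (\<chi> r. y r)" using surj[of i] by (metis surjD)
    \<comment> \<open>Lifting the image point \<open>y\<close> with \<open>off i v = 0\<close> keeps
      \<open>off i\<close> equal to 1 along the line, so that it drops out of the expansion.\<close>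
    define v where "v = X - off i X *s P i"
    have Av: "A i *v v = (\<chi> r. y r)" by (simp add: v_def vec.diff vec.scale P_kernel X)
    have "off i v = 0"
      using linform_linear(1)[OF linform_off, of i v "off i X *s P i"]
      by (simp add: v_def linform_linear(2)[OF linform_off] off_P)
    then have off: "off i (P i + s *s v) = 1" for s
      by (simp add: linform_linear[OF linform_off] off_P)
    have AP: "A i *v (P i + s *s v) = s *s (\<chi> r. y r)" for s
      by (simp add: vec.add vec.scale P_kernel Av)
    have "polyfun (\<lambda>s. \<Prod>k\<in>UNIV - {i}. plane k (P i + s *s v) ^ u k)"
      by (intro polyfun_prod polyfun_power) (auto simp: linform_linear[OF linform_plane])
    then obtain H where H: "\<And>s. (\<Prod>k\<in>UNIV - {i}. plane k (P i + s *s v) ^ u k) = poly H s"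
      unfolding polyfun_def by blast
    have "poly H 0 \<noteq> 0"
      unfolding H[symmetric] using plane_P(2) by (simp add: prod_zero_iff)
    \<comment> \<open>On the line the forms attached to \<open>i\<close> add up to
      \<open>H * G\<close>: \<open>H\<close> comes from the planes and is nonzero at the centre, and
      \<open>G\<close> has degree less than \<open>u i\<close>.\<close>
    define G where "G = (\<Sum>q\<in>F. monom (c (i, q) * (\<Prod>r\<in>UNIV. y r ^ e q r)) (q 1 + q 2 + q 3))"
    have own: "dual_form u (i, q) (P i + s *s v) = poly H s * ((\<Prod>r\<in>UNIV. y r ^ e q r) * s ^ (q 1 + q 2 + q 3))" for q s
    proof -
      have "(\<Prod>r\<in>UNIV. y r ^ e q r) = y 1 ^ q 1 * (y 2 ^ q 2 * y 3 ^ q 3)"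
        unfolding UNIV_3 by (simp add: e_def)
      then show ?thesis
        unfolding dual_form_def by (simp add: H off AP power_mult_distrib power_add mult_ac)
    qed
    have other: "\<exists>Q. \<forall>s. dual_form u kq (P i + s *s v) = s ^ u i * poly Q s" if ki: "fst kq \<noteq> i" for kq
    proof -
      obtain k q where kq: "kq = (k, q)" "k \<noteq> i" using ki by (cases kq) auto
      define R where "R s = plane i v ^ u i * (\<Prod>k'\<in>UNIV - {k} - {i}. plane k' (P i + s *s v) ^ u k') *
         off k (P i + s *s v) ^ Suc (q 4) * (A k *v (P i + s *s v)) $ 1 ^ q 1 * (A k *v (P i + s *s v)) $ 2 ^ q 2 *
         (A k *v (P i + s *s v)) $ 3 ^ q 3" for s
      have "polyfun R"
        unfolding R_def[abs_def]
        by (intro polyfun_mult polyfun_prod polyfun_power)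
          (auto simp: linform_linear[OF linform_plane] linform_linear[OF linform_off] vec.add vec.scale simp del: power_Suc)
      then obtain Q where Q: "\<And>s. R s = poly Q s" unfolding polyfun_def by blast
      have "dual_form u kq (P i + s *s v) = s ^ u i * R s" for s
      proof -
        have "(\<Prod>k'\<in>UNIV - {k}. plane k' (P i + s *s v) ^ u k') =
            plane i (P i + s *s v) ^ u i * (\<Prod>k'\<in>UNIV - {k} - {i}. plane k' (P i + s *s v) ^ u k')"
          using kq(2) by (intro prod.remove) auto
        moreover have "plane i (P i + s *s v) = s * plane i v"
          by (simp add: linform_linear[OF linform_plane] plane_P)
        ultimately show ?thesis
          unfolding dual_form_def kq R_def by (simp add: power_mult_distrib mult_ac del: power_Suc)
      qed
      then show ?thesis unfolding Q by blast
    qed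
    then obtain Q where Q: "\<And>kq s. fst kq \<noteq> i \<Longrightarrow> dual_form u kq (P i + s *s v) = s ^ u i * poly (Q kq) s"
      by metis
    have "\<exists>q. \<forall>s. (\<Sum>j\<in>dual_index u. c j * dual_form u j (P i + s *s v)) = s ^ u i * poly q s"
      using van by (simp add: vanishes_to_def sum_fun_apply)
    then obtain Q0 where Q0: "\<And>s. (\<Sum>j\<in>dual_index u. c j * dual_form u j (P i + s *s v)) = s ^ u i * poly Q0 s"
      by blast
    define Oth where "Oth = {kq \<in> dual_index u. fst kq \<noteq> i}"
    have split: "dual_index u = Pair i ` F \<union> Oth" "Pair i ` F \<inter> Oth = {}" "finite Oth"
      using finite_dual_index[of u] by (auto simp: Oth_def F_def dual_index_def)
    have "poly (H * G) s = poly (monom 1 (u i) * (Q0 - (\<Sum>kq\<in>Oth. smult (c kq) (Q kq)))) s" for s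
    proof -
      have "(\<Sum>j\<in>dual_index u. c j * dual_form u j (P i + s *s v)) =
          (\<Sum>q\<in>F. c (i, q) * dual_form u (i, q) (P i + s *s v)) + (\<Sum>kq\<in>Oth. c kq * dual_form u kq (P i + s *s v))"
        unfolding split(1) using finF split(2,3) by (simp add: sum.union_disjoint sum.reindex inj_on_def)
      moreover have "(\<Sum>kq\<in>Oth. c kq * dual_form u kq (P i + s *s v)) = s ^ u i * (\<Sum>kq\<in>Oth. c kq * poly (Q kq) s)"
        unfolding sum_distrib_left by (rule sum.cong) (auto simp: Oth_def Q)
      moreover have "(\<Sum>q\<in>F. c (i, q) * dual_form u (i, q) (P i + s *s v)) = poly H s * poly G s"
        unfolding G_def own poly_sum poly_monom sum_distrib_left by (simp add: mult_ac)
      ultimately show ?thesis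
        unfolding Q0 by (simp add: poly_sum poly_monom algebra_simps)
    qed
    then have HG: "H * G = monom 1 (u i) * (Q0 - (\<Sum>kq\<in>Oth. smult (c kq) (Q kq)))" by (rule poly_fun_inject)
    have "G = 0"
    proof (rule coeffs_zero_of_monom_dvd[OF HG])
      show "coeff H 0 \<noteq> 0" using \<open>poly H 0 \<noteq> 0\<close> by (simp add: poly_0_coeff_0)
      fix k assume k: "u i \<le> k"
      show "coeff G k = 0"
        unfolding G_def coeff_sum
        using k by (intro sum.neutral) (auto simp: F_def sum_4)
    qed
    then have "poly G 1 = 0" by simp
    then show ?thesis by (simp add: G_def poly_sum poly_monom)
  qed
  have inj: "inj_on e F"
  proof
    fix a b assume ab: "a \<in> F" "b \<in> F" "e a = e b"
    have "a 1 = b 1" "a 2 = b 2" "a 3 = b 3"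
      using fun_cong[OF ab(3), of 1] fun_cong[OF ab(3), of 2] fun_cong[OF ab(3), of 3] by (auto simp: e_def)
    moreover from this ab have "a 4 = b 4" by (auto simp: F_def sum_4)
    ultimately have "a x = b x" for x using exhaust_4[of x] by auto
    then show "a = b" by (rule ext)
  qed
  have "(\<lambda>m. c (i, the_inv_into F e m)) (e q) = 0"
  proof (rule monomial_functions_independent[where V = "UNIV :: 3 set" and M = "e ` F"])
    fix y
    show "(\<Sum>m\<in>e ` F. c (i, the_inv_into F e m) * (\<Prod>r\<in>UNIV. y r ^ m r)) = 0"
      using key[of y] by (simp add: sum.reindex[OF inj] the_inv_into_f_f[OF inj])
  qed (use finF iq' in \<open>auto simp: F_def\<close>)
  moreover have "q \<in> F" using iq' by (simp add: F_def)
  ultimately show "c iq = 0" using iq' the_inv_into_f_f[OF inj] by simp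
qed

text \<open>\<open>forms_spanned\<close> bounds the codimension of the restrictions from above, and
  the dual forms bound it from below by the same number.\<close>

lemma restr_image_basis:
  "\<exists>B. finite B \<and> B \<subseteq> restr_image A u \<and> fs.indep_mod {0} B id \<and> fs.spans_mod {0} B id (restr_image A u) \<and>
    int (card B) = mv_hilbert_function u"
proof -
  define d where "d = sum u UNIV"
  define N where "N = (\<Sum>i\<in>UNIV. (u i + 2) choose 3)"
  define M :: "4 monom set" where "M = {m. multideg (\<lambda>_. ()) m = (\<lambda>_. d)}"
  define b where "b = (\<lambda>m (X :: 'k ^ 4). meval m (($) X))"
  have M: "finite M" "card M = (d + 3) choose 3" unfolding M_def by (rule finite_card_monom_4)+
  have bM: "fs.indep_mod {0} M b" "fs.spans_mod {0} M b (forms d)" "b ` M \<subseteq> forms d"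
    unfolding M_def b_def by (rule forms_basis)+
  have sub: "restr_image A u \<subseteq> forms d" unfolding d_def by (rule restr_image_subset_forms)
  obtain B where B: "finite B" "B \<subseteq> restr_image A u" "fs.indep_mod {0} B id" "fs.spans_mod {0} B id (restr_image A u)"
    using fs.exists_basis_mod[OF fs.subspace_single_0 restr_image_subspace M(1) fs.spans_mod_subset[OF bM(2) sub]]
    by blast
  obtain C where C: "finite C" "card C \<le> N" "fs.spans_mod (restr_image A u) C id (forms d)"
    using forms_spanned[of u] unfolding d_def N_def by blast
  have "fs.spans_mod {0} (C <+> B) (case_sum id id) (forms d)"
    by (rule fs.spans_mod_Plus[OF C(1) B(1) C(3) B(4)])
  then have "card M \<le> card (C <+> B)"
    using M C B bM by (intro fs.steinitz_mod[OF fs.subspace_single_0 _ _ bM(1)]) auto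
  then have le: "card M \<le> N + card B" using C B by (simp add: card_Plus)
  let ?Z = "{f. \<forall>i. vanishes_to (u i) (P i) f}"
  have Z: "fs.subspace ?Z"
  proof -
    have eq: "?Z = (\<Inter>i. {f. vanishes_to (u i) (P i) f})" by auto
    show ?thesis unfolding eq by (rule fs.subspace_Inter) (use vanishes_to_subspace in fast)
  qed
  have "fs.indep_mod {0} (dual_index u <+> B) (case_sum (dual_form u) id)"
    using B restr_image_vanishes fs.subspace_0[OF Z]
    by (intro fs.indep_mod_Plus[OF finite_dual_index B(1) dual_form_independent B(3) _ Z]) auto
  then have "card (dual_index u <+> B) \<le> card M"
    using B M sub dual_form_in_forms finite_dual_index
    by (intro fs.steinitz_mod[OF fs.subspace_single_0 _ _ _ bM(2)]) (auto simp: d_def)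
  then have "N + card B \<le> card M"
    using B finite_dual_index by (simp add: card_Plus card_dual_index N_def)
  with le M have "int (card B) = int ((d + 3) choose 3) - int N" by linarith
  then show ?thesis using B unfolding mv_hilbert_function_def d_def N_def by (intro exI[of _ B]) simp
qed

end

section \<open>From restrictions to the Hilbert function of the multiview ideal\<close>

lemma generic_camera_centers:
  fixes A :: "('n::finite, 'k::alg_closed_field) cameras"
  assumes "generic A"
  shows "\<exists>P t. camera_centers A P t"
proof -
  have surj: "surj ((*v) (A i))" for i using assms unfolding generic_def by blast
  have "\<forall>i. \<exists>P. P \<noteq> 0 \<and> A i *v P = 0 \<and> (\<forall>X. A i *v X = 0 \<longrightarrow> (\<exists>c. X = c *s P))"
    using surj_camera_kernel[OF surj] by blast
  then obtain P where P: "\<And>i. P i \<noteq> 0" "\<And>i. A i *v P i = 0" "\<And>i X. A i *v X = 0 \<Longrightarrow> \<exists>c. X = c *s P i"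
    by metis
  have nz: "A j *v P i \<noteq> 0" if "i \<noteq> j" for i j
    using assms that P unfolding generic_def by blast
  define p where "p = (\<lambda>(i, j). [:(A j *v P i) $ 1, (A j *v P i) $ 2, (A j *v P i) $ 3:])"
  have "finite {t. poly (p ij) t = 0}" if "fst ij \<noteq> snd ij" for ij
  proof (rule poly_roots_finite)
    obtain i j where ij: "ij = (i, j)" by (cases ij)
    have "A j *v P i \<noteq> 0" using nz that ij by simp
    then show "p ij \<noteq> 0"
      unfolding vec_eq_iff forall_3 by (auto simp: p_def ij)
  qed
  then have "finite (\<Union>ij\<in>{ij. fst ij \<noteq> snd ij}. {t. poly (p ij) t = 0})" by auto
  then obtain t where t: "t \<notin> (\<Union>ij\<in>{ij. fst ij \<noteq> snd ij}. {t. poly (p ij) t = 0})"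
    using infinite_UNIV_alg_closed ex_new_if_finite by blast
  have "(A j *v P i) $ 1 + t * (A j *v P i) $ 2 + t\<^sup>2 * (A j *v P i) $ 3 \<noteq> 0" if "i \<noteq> j" for i j
  proof -
    have "poly (p (i, j)) t \<noteq> 0" using t that by auto
    then show ?thesis by (simp add: p_def algebra_simps power2_eq_square)
  qed
  then have "camera_centers A P t" using surj P by unfold_locales
  then show ?thesis by blast
qed

lemma multiview_ideal_hilbert_function:
  fixes A :: "('n::finite, 'k::alg_closed_field) cameras"
  assumes "generic A"
  shows "has_hilbert_function fst (multiview_ideal A) mv_hilbert_function"
  unfolding has_hilbert_function_def
proof
  fix u
  have surj: "surj ((*v) (A i))" for i using assms unfolding generic_def by blast
  have ideal: "is_ideal (multiview_ideal A)"
    using multiview_ideal_homogeneous[of A] unfolding homogeneous_ideal_def by blast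
  obtain P t where "camera_centers A P t" using generic_camera_centers[OF assms] by blast
  then obtain B where B: "finite B" "B \<subseteq> restr_image A u" "fs.indep_mod {0} B id"
    "fs.spans_mod {0} B id (restr_image A u)" "int (card B) = mv_hilbert_function u"
    using camera_centers.restr_image_basis[of A P t u] by blast
  have "\<forall>b\<in>B. \<exists>f. f \<in> graded_part fst u \<and> restr A f = b"
    using B(2) unfolding restr_image_def by auto
  then obtain g where g: "\<And>b. b \<in> B \<Longrightarrow> g b \<in> graded_part fst u" "\<And>b. b \<in> B \<Longrightarrow> restr A (g b) = b" by metis
  have mem: "f \<in> multiview_ideal A \<longleftrightarrow> restr A f = 0" if "f \<in> graded_part fst u" for f
    using multiview_ideal_graded[OF surj that] by (simp add: restr_def fun_eq_iff)
  have sum: "restr A (\<Sum>b\<in>B. scale (c b) (g b)) = (\<Sum>b\<in>B. (\<lambda>X. c b * id b X))" for c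
  proof -
    have "restr A (\<Sum>b\<in>B. scale (c b) (g b)) X = (\<Sum>b\<in>B. c b * restr A (g b) X)" for X
      by (simp add: restr_def peval_sum)
    then show ?thesis using g(2) by (simp add: fun_eq_iff sum_fun_apply)
  qed
  have gp: "(\<Sum>b\<in>B. scale (c b) (g b)) \<in> graded_part fst u" for c
    using g(1) gp_subspace by (intro pm.subspace_sum pm.subspace_scale) auto
  have ind: "pm.indep_mod (multiview_ideal A) B g"
    using fs.indep_modD[OF B(3)] mem[OF gp] sum by (intro pm.indep_modI) auto
  have span: "pm.spans_mod (multiview_ideal A) B g (graded_part fst u)"
    unfolding pm.spans_mod_def
  proof
    fix f :: "('n, 'k) xyz_poly" assume f: "f \<in> graded_part fst u"
    then obtain c where c: "restr A f - (\<Sum>b\<in>B. (\<lambda>X. c b * id b X)) \<in> {0}"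
      using fs.spans_modE[OF B(4), of "restr A f"] unfolding restr_image_def by auto
    have "f - (\<Sum>b\<in>B. scale (c b) (g b)) \<in> graded_part fst u"
      using f gp by (intro pm.subspace_diff[OF gp_subspace])
    moreover have "restr A (f - (\<Sum>b\<in>B. scale (c b) (g b))) = restr A f - restr A (\<Sum>b\<in>B. scale (c b) (g b))"
      by (simp add: restr_def fun_eq_iff peval_diff)
    ultimately show "\<exists>c. f - (\<Sum>b\<in>B. scale (c b) (g b)) \<in> multiview_ideal A"
      using c mem sum by (intro exI[of _ c]) simp
  qed
  have inj: "inj_on g B" by (rule inj_on_inverseI[of _ "restr A"]) (rule g(2))
  have "quotient_basis (graded_part fst u) (multiview_ideal A) (g ` B)"
    unfolding quotient_basis_iff[OF ideal_subspace[OF ideal] gp_subspace]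
  proof (intro conjI)
    show "pm.indep_mod (multiview_ideal A) (g ` B) id"
    proof (rule pm.indep_modI)
      fix c j assume "(\<Sum>j\<in>g ` B. scale (c j) (id j)) \<in> multiview_ideal A" "j \<in> g ` B"
      then show "c j = 0"
        using pm.indep_modD[OF ind, of "c \<circ> g"] by (auto simp: sum.reindex[OF inj])
    qed
    show "pm.spans_mod (multiview_ideal A) (g ` B) id (graded_part fst u)"
      by (rule pm.spans_mod_image[OF B(1) span])
  qed (use B g in auto)
  then show "\<exists>B. quotient_basis (graded_part fst u) (multiview_ideal A) B \<and> int (card B) = mv_hilbert_function u"
    using B(5) card_image[OF inj] by auto
qed

lemma multiview_ideal_hilbert_point:
  "generic A \<Longrightarrow> multiview_ideal A \<in> (hilbert_points :: ('n::finite, 'k::alg_closed_field) xyz_poly set set)"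
  using multiview_ideal_hilbert_function multiview_ideal_homogeneous unfolding hilbert_points_def by blast

section \<open>One-parameter families of cameras\<close>

lemma polyfun_uminus [intro!]: "polyfun f \<Longrightarrow> polyfun (\<lambda>t. - f t)"
  using polyfun_diff[OF polyfun_const[of 0]] by simp

text \<open>Gaussian elimination over polynomials in the parameter \<open>t\<close>, without determinants: functions
  that are independent at \<open>t = 0\<close> are dualised by suitable evaluation points.\<close>

lemma elimination:
  fixes v :: "'j \<Rightarrow> 'k::field \<Rightarrow> 'x \<Rightarrow> 'k"
  assumes "finite J" "\<And>a x. polyfun (\<lambda>t. v a t x)"
    "\<And>c. (\<And>x. (\<Sum>a\<in>J. c a * v a 0 x) = 0) \<Longrightarrow> \<forall>a\<in>J. c a = 0"
  shows "\<exists>\<omega> T \<delta>. (\<forall>a b. polyfun (T a b)) \<and> polyfun \<delta> \<and> \<delta> 0 \<noteq> 0 \<and>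
    (\<forall>t. \<forall>a\<in>J. \<forall>b\<in>J. (\<Sum>c\<in>J. T a c t * v c t (\<omega> b)) = (if a = b then \<delta> t else 0))"
  using assms(1,3)
proof (induction J rule: finite_induct)
  case empty
  show ?case
    by (rule exI, rule exI[of _ "\<lambda>_ _ _. 0"], rule exI[of _ "\<lambda>_. 1"]) simp
next
  case (insert j J)
  have "\<forall>a\<in>J. c a = 0" if c: "\<And>x. (\<Sum>a\<in>J. c a * v a 0 x) = 0" for c
  proof -
    have "(\<Sum>a\<in>insert j J. (if a = j then 0 else c a) * v a 0 x) = (\<Sum>a\<in>J. c a * v a 0 x)" for x
      using insert.hyps by (auto intro: sum.cong)
    with c have "(\<Sum>a\<in>insert j J. (if a = j then 0 else c a) * v a 0 x) = 0" for x by simp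
    from insert.prems[OF this] show ?thesis using insert.hyps by (auto split: if_splits)
  qed
  from insert.IH[OF this] obtain \<omega> T \<delta> where T: "\<And>a b. polyfun (T a b)" and \<delta>: "polyfun \<delta>" "\<delta> 0 \<noteq> 0"
    and dual: "\<And>t a b. a \<in> J \<Longrightarrow> b \<in> J \<Longrightarrow> (\<Sum>c\<in>J. T a c t * v c t (\<omega> b)) = (if a = b then \<delta> t else 0)"
    by blast
  define g where "g a t x = (\<Sum>c\<in>J. T a c t * v c t x)" for a t x
  define S where "S c t = (if c = j then \<delta> t else - (\<Sum>i\<in>J. v j t (\<omega> i) * T i c t))" for c t
  define f where "f t x = \<delta> t * v j t x - (\<Sum>i\<in>J. v j t (\<omega> i) * g i t x)" for t x
  have f: "f t x = (\<Sum>c\<in>insert j J. S c t * v c t x)" for t x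
  proof -
    have "(\<Sum>c\<in>J. S c t * v c t x) = (\<Sum>c\<in>J. - (\<Sum>i\<in>J. v j t (\<omega> i) * T i c t * v c t x))"
      using insert.hyps by (intro sum.cong) (auto simp: S_def sum_distrib_right)
    also have "\<dots> = - (\<Sum>i\<in>J. v j t (\<omega> i) * g i t x)"
      unfolding sum_negf g_def sum_distrib_left by (subst sum.swap) (simp add: mult.assoc)
    finally show ?thesis using insert.hyps by (simp add: f_def S_def)
  qed
  obtain x where x: "f 0 x \<noteq> 0"
    using insert.prems[of "\<lambda>c. S c 0"] \<delta>(2) unfolding f[symmetric] by (auto simp: S_def)
  define \<omega>' where "\<omega>' = (\<lambda>b. if b = j then x else \<omega> b)"
  \<comment> \<open>The new function \<open>f\<close> vanishes at the old points and not at
    \<open>x\<close> for \<open>t = 0\<close>. Subtracting suitable multiples of it makes the old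
    functions vanish at \<open>x\<close>; scaling by \<open>f t x\<close> and
    \<open>\<delta> t\<close> avoids division and makes all diagonal values equal.\<close>
  define T' where "T' a c t = (if a = j then \<delta> t * S c t
    else f t x * (if c = j then 0 else T a c t) - g a t x * S c t)" for a c t
  have g: "polyfun (\<lambda>t. g a t x)" for a x unfolding g_def by (intro polyfun_sum polyfun_mult T assms(2))
  have S: "polyfun (\<lambda>t. S c t)" for c
    by (cases "c = j") (use \<delta> T assms(2) in \<open>auto simp: S_def \<close>)
  have fpoly: "polyfun (\<lambda>t. f t x)" for x unfolding f_def
    by (intro polyfun_diff polyfun_sum polyfun_mult \<delta>(1) g assms(2))
  have T': "polyfun (T' a c)" for a c
    unfolding T'_def[abs_def] using \<delta> S fpoly g T by (cases "a = j"; cases "c = j") auto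
  have expand: "(\<Sum>c\<in>insert j J. T' a c t * v c t y) =
      (if a = j then \<delta> t * f t y else f t x * g a t y - g a t x * f t y)" for a t y
  proof (cases "a = j")
    case True
    then show ?thesis by (simp add: T'_def f sum_distrib_left mult.assoc)
  next
    case False
    have A: "(\<Sum>c\<in>insert j J. (if c = j then 0 else T a c t) * v c t y) = g a t y"
      unfolding g_def using insert.hyps by (auto intro: sum.cong)
    have B: "(\<Sum>c\<in>insert j J. T' a c t * v c t y) =
        (\<Sum>c\<in>insert j J. f t x * ((if c = j then 0 else T a c t) * v c t y)) -
        (\<Sum>c\<in>insert j J. g a t x * (S c t * v c t y))"
      unfolding sum_subtractf[symmetric] using False by (intro sum.cong) (auto simp: T'_def algebra_simps)
    show ?thesis
      unfolding B sum_distrib_left[symmetric] A f[symmetric] using False by simp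
  qed
  have fJ: "f t (\<omega> b) = 0" if "b \<in> J" for t b
  proof -
    have "(\<Sum>i\<in>J. v j t (\<omega> i) * g i t (\<omega> b)) = (\<Sum>i\<in>J. if i = b then v j t (\<omega> i) * \<delta> t else 0)"
      using that by (intro sum.cong) (auto simp: g_def dual)
    then show ?thesis using that insert.hyps by (simp add: f_def)
  qed
  have "(\<Sum>c\<in>insert j J. T' a c t * v c t (\<omega>' b)) = (if a = b then \<delta> t * f t x else 0)"
    if "a \<in> insert j J" "b \<in> insert j J" for t a b
  proof (cases "b = j")
    case True
    then show ?thesis unfolding expand by (simp add: \<omega>'_def)
  next
    case False
    then have "b \<in> J" using that by simp
    then show ?thesis
      unfolding expand using False that fJ dual[of a b t] by (auto simp: \<omega>'_def g_def)
  qed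
  moreover have "polyfun (\<lambda>t. \<delta> t * f t x)" by (rule polyfun_mult[OF \<delta>(1) fpoly])
  moreover have "\<delta> 0 * f 0 x \<noteq> 0" using \<delta> x by simp
  ultimately show ?case using T'
    by (intro exI[of _ \<omega>'] exI[of _ T'] exI[of _ "\<lambda>t. \<delta> t * f t x"]) simp
qed

text \<open>A matrix with a left inverse up to a nonzero factor has independent rows. If
  \<open>c a0\<close> were nonzero in a relation of rows, a vector killed by all rows except
  \<open>a0\<close> would be killed by that row too, hence by \<open>T\<close> times the
  matrix.\<close>

lemma dual_points_independent:
  fixes M :: "'j \<Rightarrow> 'j \<Rightarrow> 'k::field"
  assumes J: "finite J" and dual: "\<And>a b. a \<in> J \<Longrightarrow> b \<in> J \<Longrightarrow> (\<Sum>c\<in>J. T a c * M c b) = (if a = b then \<delta> else 0)"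
    and "\<delta> \<noteq> 0" and c: "\<And>b. b \<in> J \<Longrightarrow> (\<Sum>a\<in>J. c a * M a b) = 0" and "a0 \<in> J"
  shows "c a0 = 0"
proof (rule ccontr)
  assume ca: "c a0 \<noteq> 0"
  have "card (J - {a0}) < card J" using J \<open>a0 \<in> J\<close> by (intro psubset_card_mono) auto
  then obtain x where x: "\<exists>b\<in>J. x b \<noteq> 0" "\<forall>a\<in>J - {a0}. (\<Sum>b\<in>J. x b * M a b) = 0"
    using homogeneous_system_solution[of "J - {a0}" J "\<lambda>b a. M a b"] J by auto
  have "(\<Sum>a\<in>J. c a * (\<Sum>b\<in>J. x b * M a b)) = (\<Sum>b\<in>J. x b * (\<Sum>a\<in>J. c a * M a b))"
    unfolding sum_distrib_left by (subst sum.swap) (simp add: mult_ac)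
  also have "\<dots> = 0" using c by simp
  also have "(\<Sum>a\<in>J. c a * (\<Sum>b\<in>J. x b * M a b)) = c a0 * (\<Sum>b\<in>J. x b * M a0 b)"
    by (subst sum.remove[OF J \<open>a0 \<in> J\<close>]) (simp add: x(2))
  finally have "(\<Sum>b\<in>J. x b * M a b) = 0" if "a \<in> J" for a using x(2) ca that by (cases "a = a0") auto
  then have "(\<Sum>c\<in>J. T a c * (\<Sum>b\<in>J. x b * M c b)) = 0" for a by simp
  moreover have "(\<Sum>c\<in>J. T a c * (\<Sum>b\<in>J. x b * M c b)) = (\<Sum>b\<in>J. x b * (\<Sum>c\<in>J. T a c * M c b))" for a
    unfolding sum_distrib_left by (subst sum.swap) (simp add: mult_ac)
  moreover have "(\<Sum>b\<in>J. x b * (\<Sum>c\<in>J. T a c * M c b)) = x a * \<delta>" if "a \<in> J" for a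
  proof -
    have "(\<Sum>b\<in>J. x b * (\<Sum>c\<in>J. T a c * M c b)) = (\<Sum>b\<in>J. if b = a then x b * \<delta> else 0)"
      using that dual by (intro sum.cong) auto
    then show ?thesis using J that by simp
  qed
  ultimately show False using x(1) \<open>\<delta> \<noteq> 0\<close> by force
qed

context field_vector_space
begin

lemma indep_card_spans_mod:
  assumes U: "subspace U" and fin: "finite J" "finite T" and ind: "indep_mod U J v" and sub: "v ` J \<subseteq> V"
    and span: "spans_mod U T w V" and card: "card T \<le> card J"
  shows "spans_mod U J v V"
  unfolding spans_mod_def
proof
  fix p assume p: "p \<in> V"
  show "\<exists>c. p - (\<Sum>j\<in>J. scale (c j) (v j)) \<in> U"
  proof (rule ccontr)
    assume none: "\<not> ?thesis"
    define J' where "J' = insert None (Some ` J)"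
    define v' where "v' j = (case j of None \<Rightarrow> p | Some j \<Rightarrow> v j)" for j
    have sum: "(\<Sum>j\<in>J'. scale (c j) (v' j)) = scale (c None) p + (\<Sum>j\<in>J. scale (c (Some j)) (v j))" for c
      using fin(1) by (simp add: J'_def v'_def sum.reindex)
    have "indep_mod U J' v'"
    proof (rule indep_modI)
      fix c j assume c: "(\<Sum>j\<in>J'. scale (c j) (v' j)) \<in> U" and j: "j \<in> J'"
      have "c None = 0"
      proof (rule ccontr)
        assume nz: "c None \<noteq> 0"
        have "scale (inverse (c None)) (scale (c None) p + (\<Sum>j\<in>J. scale (c (Some j)) (v j))) \<in> U"
          using c unfolding sum by (rule subspace_scale[OF U])
        also have "scale (inverse (c None)) (scale (c None) p + (\<Sum>j\<in>J. scale (c (Some j)) (v j))) =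
            p - (\<Sum>j\<in>J. scale (- inverse (c None) * c (Some j)) (v j))"
          using nz by (simp add: scale_right_distrib scale_sum_right sum_negf)
        finally show False using none by (elim notE) (rule exI[of _ "\<lambda>j. - inverse (c None) * c (Some j)"])
      qed
      moreover from this have "c (Some j) = 0" if "j \<in> J" for j
        using c ind that indep_modD[of U J v "\<lambda>j. c (Some j)"] unfolding sum by simp
      ultimately show "c j = 0" using j by (auto simp: J'_def)
    qed
    then have "card J' \<le> card T"
      using fin sub p by (intro steinitz_mod[OF U _ _ _ span]) (auto simp: J'_def v'_def)
    moreover have "card J' = Suc (card J)" using fin by (simp add: J'_def card_image)
    ultimately show False using card by simp
  qed
qed

lemma indep_mod_list:
  assumes "distinct xs" "independent (set xs)"
  shows "indep_mod {0} {..<length xs} ((!) xs)"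
proof (rule indep_modI)
  fix c i assume c: "(\<Sum>i<length xs. scale (c i) (xs ! i)) \<in> {0}" and i: "i \<in> {..<length xs}"
  have inj: "inj_on ((!) xs) {..<length xs}" using assms(1) by (auto simp: inj_on_def nth_eq_iff_index_eq)
  have set: "set xs = (!) xs ` {..<length xs}" by (auto simp: set_conv_nth)
  define c' where "c' x = c (the_inv_into {..<length xs} ((!) xs) x)" for x
  have "(\<Sum>x\<in>set xs. scale (c' x) x) = (\<Sum>i<length xs. scale (c i) (xs ! i))"
    unfolding set sum.reindex[OF inj] c'_def comp_def
    by (intro sum.cong refl) (simp add: the_inv_into_f_f[OF inj])
  then have "(\<Sum>x\<in>set xs. scale (c' x) x) = 0" using c by simp
  then have "c' (xs ! i) = 0"
    using assms(2) i unfolding independent_explicit_finite_subsets by (metis List.finite_set lessThan_iff nth_mem order_refl)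
  then show "c i = 0" using i by (simp add: c'_def the_inv_into_f_f[OF inj])
qed

lemma spans_mod_list:
  assumes "distinct xs" "span (set xs) = V"
  shows "spans_mod {0} {..<length xs} ((!) xs) V"
  unfolding spans_mod_def
proof
  fix p assume "p \<in> V"
  then obtain c where c: "p = (\<Sum>x\<in>set xs. scale (c x) x)"
    using assms(2) span_finite[of "set xs"] by auto
  have inj: "inj_on ((!) xs) {..<length xs}" using assms(1) by (auto simp: inj_on_def nth_eq_iff_index_eq)
  have set: "set xs = (!) xs ` {..<length xs}" by (auto simp: set_conv_nth)
  have "p = (\<Sum>i<length xs. scale (c (xs ! i)) (xs ! i))"
    unfolding c set sum.reindex[OF inj] by simp
  then show "\<exists>c. p - (\<Sum>j<length xs. scale (c j) (xs ! j)) \<in> {0}" by (intro exI[of _ "\<lambda>i. c (xs ! i)"]) simp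
qed

lemma basis_list:
  assumes ind: "indep_mod {0} {..<length xs} ((!) xs)"
    and span: "spans_mod {0} {..<length xs} ((!) xs) V" and sub: "set xs \<subseteq> V" "subspace V"
  shows "distinct xs \<and> independent (set xs) \<and> span (set xs) = V"
proof -
  have inj: "inj_on ((!) xs) {..<length xs}"
    by (rule indep_mod_inj_on[OF subspace_single_0 _ ind]) simp
  then have dist: "distinct xs" by (auto simp: distinct_conv_nth inj_on_def)
  have set: "set xs = (!) xs ` {..<length xs}" by (auto simp: set_conv_nth)
  have "independent (set xs)"
    unfolding dependent_finite[OF List.finite_set]
  proof
    assume "\<exists>u. (\<exists>v\<in>set xs. u v \<noteq> 0) \<and> (\<Sum>v\<in>set xs. scale (u v) v) = 0"
    then obtain c where c: "\<exists>v\<in>set xs. c v \<noteq> 0" "(\<Sum>x\<in>set xs. scale (c x) x) = 0" by blast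
    have "(\<Sum>i<length xs. scale (c (xs ! i)) (xs ! i)) \<in> {0}"
      using c(2) unfolding set sum.reindex[OF inj] by simp
    then have "c (xs ! i) = 0" if "i < length xs" for i
      using indep_modD[OF ind, of "\<lambda>i. c (xs ! i)"] that by simp
    with c(1) show False by (auto simp: in_set_conv_nth)
  qed
  moreover have "span (set xs) = V"
  proof
    show "span (set xs) \<subseteq> V" using sub by (rule span_minimal)
    show "V \<subseteq> span (set xs)"
    proof
      fix p assume "p \<in> V"
      then obtain c where "p - (\<Sum>j<length xs. scale (c j) (xs ! j)) \<in> {0}" using span by (elim spans_modE)
      then have eq: "p = (\<Sum>j<length xs. scale (c j) (xs ! j))" by simp
      show "p \<in> span (set xs)" unfolding eq by (intro span_sum span_scale span_base nth_mem) simp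
    qed
  qed
  ultimately show ?thesis using dist by blast
qed

end

section \<open>Lines in the space of cameras\<close>

definition camera_line :: "('n, 'k::field) cameras \<Rightarrow> ('n, 'k) cameras \<Rightarrow> 'k \<Rightarrow> ('n, 'k) cameras" where
  "camera_line A B t i = (\<chi> r j. A i $ r $ j + t * (B i $ r $ j - A i $ r $ j))"

lemma camera_line_0: "camera_line A B 0 = A"
  by (simp add: camera_line_def fun_eq_iff vec_eq_iff)

lemma polyfun_camera_line: "polyfun (\<lambda>t. camera_line A B t i $ r $ j)"
  by (auto simp: camera_line_def)

lemma polyfun_cam_point_line: "polyfun (\<lambda>t. cam_point (camera_line A B t) X v)"
  unfolding cam_point_alt by (intro polyfun_sum polyfun_mult polyfun_camera_line polyfun_const)

lemma polyfun_det:
  fixes M :: "'k::field \<Rightarrow> 'k ^ 'm ^ 'm"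
  assumes "\<And>i j. polyfun (\<lambda>t. M t $ i $ j)"
  shows "polyfun (\<lambda>t. det (M t))"
  unfolding det_def using assms by (intro polyfun_sum polyfun_mult polyfun_prod polyfun_const)

text \<open>A one-sided inverse at \<open>t = 0\<close> turns each rank condition into the
  nonvanishing of a determinant that is polynomial in \<open>t\<close>. For two cameras it is a left
  inverse of the stacked 6 by 4 matrix.\<close>

lemma generic_camera_line:
  fixes A B :: "('n::finite, 'k::field) cameras"
  assumes "generic A"
  shows "finite {t. \<not> generic (camera_line A B t)}"
proof -
  have "finite {t. \<not> surj ((*v) (camera_line A B t i))}" for i
  proof -
    have "surj ((*v) (A i))" using assms by (simp add: generic_def)
    then obtain R where R: "A i ** R = mat 1" using matrix_right_invertible_surjective[of "A i"] by blast
    define g where "g t = det (camera_line A B t i ** R)" for t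
    have "polyfun g"
      unfolding g_def[abs_def] matrix_matrix_mult_def
      by (intro polyfun_det) (auto intro!: polyfun_sum polyfun_mult polyfun_camera_line)
    moreover have "g 0 \<noteq> 0" by (simp add: g_def camera_line_0 R)
    ultimately have "finite {t. g t = 0}" by (rule polyfun_finite_zeros)
    moreover have "surj ((*v) (camera_line A B t i))" if "g t \<noteq> 0" for t
    proof -
      have "invertible (camera_line A B t i ** R)" using that by (simp add: g_def invertible_det_nz)
      then obtain S where "(camera_line A B t i ** R) ** S = mat 1" unfolding invertible_def by blast
      then have "camera_line A B t i ** (R ** S) = mat 1" by (simp add: matrix_mul_assoc)
      then show ?thesis using matrix_right_invertible_surjective by blast
    qed
    ultimately show ?thesis by (elim rev_finite_subset) auto
  qed
  moreover have "finite {t. \<not> (\<forall>X. camera_line A B t i *v X = 0 \<longrightarrow> camera_line A B t j *v X = 0 \<longrightarrow> X = 0)}"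
    if ij: "i \<noteq> j" for i j
  proof -
    define M :: "'k \<Rightarrow> 'k ^ 4 ^ (3 + 3)" where
      "M t = (\<chi> s. case s of Inl r \<Rightarrow> camera_line A B t i $ r | Inr r \<Rightarrow> camera_line A B t j $ r)" for t
    have M0: "M t *v X = 0 \<longleftrightarrow> camera_line A B t i *v X = 0 \<and> camera_line A B t j *v X = 0" for t X
    proof
      assume eq: "M t *v X = 0"
      have "(M t *v X) $ Inl r = (camera_line A B t i *v X) $ r" "(M t *v X) $ Inr r = (camera_line A B t j *v X) $ r" for r
        by (simp_all add: M_def matrix_vector_mult_def)
      then show "camera_line A B t i *v X = 0 \<and> camera_line A B t j *v X = 0"
        unfolding eq by (metis vec_eq_iff zero_index)
    next
      assume "camera_line A B t i *v X = 0 \<and> camera_line A B t j *v X = 0"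
      then have "(\<Sum>l\<in>UNIV. M t $ s $ l * X $ l) = 0" for s
        unfolding vec_eq_iff matrix_vector_mult_def by (cases s) (auto simp: M_def)
      then show "M t *v X = 0" by (simp add: vec_eq_iff matrix_vector_mult_def)
    qed
    have "inj ((*v) (M 0))"
      unfolding vec.inj_iff_eq_0 M0 camera_line_0 using assms ij unfolding generic_def by blast
    then obtain L where L: "L ** M 0 = mat 1" using matrix_left_invertible_injective[of "M 0"] by blast
    define g where "g t = det (L ** M t)" for t
    have Mp: "polyfun (\<lambda>t. M t $ s $ l)" for s l by (cases s) (auto simp: M_def intro: polyfun_camera_line)
    have "polyfun g"
      unfolding g_def[abs_def] matrix_matrix_mult_def
      by (intro polyfun_det) (auto intro!: polyfun_sum polyfun_mult Mp)
    moreover have "g 0 \<noteq> 0" by (simp add: g_def L)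
    ultimately have "finite {t. g t = 0}" by (rule polyfun_finite_zeros)
    moreover have "X = 0" if "g t \<noteq> 0" "camera_line A B t i *v X = 0" "camera_line A B t j *v X = 0" for t X
    proof -
      have "invertible (L ** M t)" using that(1) by (simp add: g_def invertible_det_nz)
      then obtain S where "S ** (L ** M t) = mat 1" unfolding invertible_def by blast
      then have "X = S *v (L *v (M t *v X))" by (simp add: matrix_vector_mul_assoc matrix_mul_assoc)
      also have "M t *v X = 0" using that M0 by blast
      finally show ?thesis by simp
    qed
    ultimately show ?thesis by (elim rev_finite_subset) auto
  qed
  ultimately have "finite ((\<Union>i. {t. \<not> surj ((*v) (camera_line A B t i))}) \<union>
      (\<Union>i. \<Union>j\<in>- {i}. {t. \<not> (\<forall>X. camera_line A B t i *v X = 0 \<longrightarrow> camera_line A B t j *v X = 0 \<longrightarrow> X = 0)}))"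
    by (intro finite_UnI finite_UN_I) auto
  then show ?thesis
    by (rule rev_finite_subset) (unfold generic_def, blast)
qed

lemma multiview_ideal_generic_iff:
  fixes A :: "('n::finite, 'k::alg_closed_field) cameras"
  assumes "generic A" "f \<in> graded_part fst u"
  shows "f \<in> multiview_ideal A \<longleftrightarrow> (\<forall>X. peval f (cam_point A X) = 0)"
  by (rule multiview_ideal_graded[OF _ assms(2)]) (use assms(1) in \<open>simp add: generic_def\<close>)

text \<open>The values at the points \<open>\<omega>\<close> determine the coefficients with respect
  to a basis \<open>Q\<close> of the quotient, for all but finitely many \<open>t\<close>. Each
  \<open>fs ! a\<close> is corrected by the combination of \<open>Q\<close> with the same values.
  Since the Hilbert function is constant, \<open>Q\<close> remains a basis of the quotient, and so
  the corrected elements lie in the ideal.\<close>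

lemma kernel_family:
  fixes A B :: "('n::finite, 'k::alg_closed_field) cameras"
  assumes gen: "generic A" and fs: "distinct fs" "pm.independent (set fs)"
    "pm.span (set fs) = multiview_ideal A \<inter> graded_part fst u"
  shows "\<exists>gs E. finite E \<and> (\<forall>a<length fs. gs a 0 = fs ! a) \<and> (\<forall>a m. polyfun (\<lambda>t. lookup (gs a t) m)) \<and>
    (\<forall>t. t \<notin> E \<longrightarrow> generic (camera_line A B t) \<longrightarrow>
      distinct (map (\<lambda>a. gs a t) [0..<length fs]) \<and>
      pm.independent (set (map (\<lambda>a. gs a t) [0..<length fs])) \<and>
      pm.span (set (map (\<lambda>a. gs a t) [0..<length fs])) =
        multiview_ideal (camera_line A B t) \<inter> graded_part fst u)"
proof -
  define L where "L = camera_line A B"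
  have L0: "L 0 = A" by (simp add: L_def camera_line_0)
  have ideal: "is_ideal (multiview_ideal A')" for A' :: "('n, 'k) cameras"
    using multiview_ideal_homogeneous[of A'] unfolding homogeneous_ideal_def by blast
  note idsub = ideal_subspace[OF ideal]
  note memJ = multiview_ideal_generic_iff[where u = u]
  let ?s = "length fs"
  have fsJ: "fs ! a \<in> multiview_ideal A \<inter> graded_part fst u" if "a < ?s" for a
    using fs(3) that pm.span_base[of "fs ! a" "set fs"] by (simp add: nth_mem)
  obtain Q where Q: "finite Q" "Q \<subseteq> graded_part fst u" "pm.indep_mod (multiview_ideal A) Q id"
    "pm.spans_mod (multiview_ideal A) Q id (graded_part fst u)" "int (card Q) = mv_hilbert_function u"
    using has_hilbert_functionE[OF ideal multiview_ideal_hilbert_function[OF gen]] by metis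
  have sumQ: "(\<Sum>b\<in>Q. scale (c b) b) \<in> graded_part fst u" for c
    using Q(2) gp_subspace by (intro pm.subspace_sum pm.subspace_scale) auto
  define v where "v b t X = peval b (cam_point (L t) X)" for b t X
  have v: "polyfun (\<lambda>t. v b t X)" for b X
    unfolding v_def L_def by (intro polyfun_peval_const polyfun_cam_point_line)
  have v_sum: "peval (\<Sum>b\<in>Q. scale (c b) b) (cam_point (L t) X) = (\<Sum>b\<in>Q. c b * v b t X)" for c t X
    by (simp add: peval_sum v_def)
  have ind0: "\<forall>b\<in>Q. c b = 0" if "\<And>X. (\<Sum>b\<in>Q. c b * v b 0 X) = 0" for c
  proof -
    have "(\<Sum>b\<in>Q. scale (c b) (id b)) \<in> multiview_ideal A"
      using that memJ[OF gen sumQ[of c]] v_sum[of c 0] by (simp add: L0)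
    then show ?thesis using pm.indep_modD[OF Q(3)] by blast
  qed
  from elimination[where v = v, OF Q(1) v ind0] obtain \<omega> T \<delta> where T: "\<And>a b. polyfun (T a b)"
    and \<delta>: "polyfun \<delta>" "\<delta> 0 \<noteq> 0"
    and dual: "\<And>t a b. a \<in> Q \<Longrightarrow> b \<in> Q \<Longrightarrow> (\<Sum>c\<in>Q. T a c t * v c t (\<omega> b)) = (if a = b then \<delta> t else 0)"
    by blast
  define pe where "pe a b t = v (fs ! a) t (\<omega> b)" for a b t
  \<comment> \<open>The factor \<open>\<delta> t\<close> replaces a division and keeps the
    coefficients polynomial in \<open>t\<close>; dividing by the constant \<open>\<delta> 0\<close>
    makes the family start at \<open>fs ! a\<close>.\<close>
  define gs where "gs a t = scale (1 / \<delta> 0) (scale (\<delta> t) (fs ! a) -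
    (\<Sum>b\<in>Q. scale (pe a b t) (\<Sum>c\<in>Q. scale (T b c t) c)))" for a t
  have gs0: "gs a 0 = fs ! a" if "a < ?s" for a
  proof -
    have "\<forall>X. peval (fs ! a) (cam_point A X) = 0"
      using fsJ[OF that] memJ[OF gen, of "fs ! a"] by blast
    then have "pe a b 0 = 0" for b by (simp add: pe_def v_def L0)
    then show ?thesis using \<delta>(2) by (simp add: gs_def)
  qed
  have gs_poly: "polyfun (\<lambda>t. lookup (gs a t) m)" for a m
    unfolding gs_def lookup_scale lookup_minus lookup_sum
    by (intro polyfun_mult polyfun_diff polyfun_sum polyfun_const \<delta>(1) T) (auto simp: pe_def v)
  have gs_gp: "gs a t \<in> graded_part fst u" if "a < ?s" for a t
    unfolding gs_def using fsJ[OF that] sumQ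
    by (intro sumQ pm.subspace_scale[OF gp_subspace] pm.subspace_diff[OF gp_subspace]
        pm.subspace_sum[OF gp_subspace]) auto
  have gs_van: "peval (gs a t) (cam_point (L t) (\<omega> b)) = 0" if "b \<in> Q" for a b t
  proof -
    have "peval (\<Sum>b\<in>Q. scale (pe a b t) (\<Sum>c\<in>Q. scale (T b c t) c)) (cam_point (L t) (\<omega> b)) =
        (\<Sum>b'\<in>Q. pe a b' t * (\<Sum>c\<in>Q. T b' c t * v c t (\<omega> b)))"
      by (simp add: peval_sum v_def)
    also have "\<dots> = (\<Sum>b'\<in>Q. if b' = b then pe a b' t * \<delta> t else 0)"
      using that dual by (intro sum.cong) auto
    also have "\<dots> = \<delta> t * pe a b t" using that Q(1) by simp
    finally show ?thesis by (simp add: gs_def peval_diff pe_def v_def)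
  qed
  have ind1: "\<forall>a\<in>{..<?s}. c a = 0" if "\<And>m. (\<Sum>a<?s. c a * lookup (gs a 0) m) = 0" for c
  proof -
    have "(\<Sum>a<?s. scale (c a) (fs ! a)) = 0"
      using that gs0 by (intro poly_mapping_eqI) (simp add: lookup_sum lookup_scale)
    then show ?thesis using pm.indep_modD[OF pm.indep_mod_list[OF fs(1,2)]] by blast
  qed
  \<comment> \<open>The same elimination with coefficients in place of values: the family
    \<open>gs\<close> stays independent off a finite set.\<close>
  from elimination[where v = "\<lambda>a t m. lookup (gs a t) m", OF finite_lessThan gs_poly ind1] obtain \<mu> T' \<delta>' where \<delta>': "polyfun \<delta>'" "\<delta>' 0 \<noteq> 0"
    and dual': "\<And>t a b. a \<in> {..<?s} \<Longrightarrow> b \<in> {..<?s} \<Longrightarrow>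
      (\<Sum>c<?s. T' a c t * lookup (gs c t) (\<mu> b)) = (if a = b then \<delta>' t else 0)"
    by blast
  define E where "E = {t. \<delta> t = 0} \<union> {t. \<delta>' t = 0}"
  have finE: "finite E" using \<delta> \<delta>' polyfun_finite_zeros unfolding E_def by blast
  define D where "D = card {m :: ('n \<times> 3) monom. multideg fst m = u}"
  have D_le: "D \<le> card Q + ?s"
  proof -
    have "pm.spans_mod (multiview_ideal A \<inter> graded_part fst u) Q id (graded_part fst u)"
      unfolding pm.spans_mod_def
    proof
      fix p :: "('n, 'k) xyz_poly" assume p: "p \<in> graded_part fst u"
      then obtain c where "p - (\<Sum>j\<in>Q. scale (c j) (id j)) \<in> multiview_ideal A"
        using Q(4) by (elim pm.spans_modE)
      moreover have "p - (\<Sum>j\<in>Q. scale (c j) (id j)) \<in> graded_part fst u"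
        using p sumQ[of c] by (simp add: pm.subspace_diff[OF gp_subspace])
      ultimately show "\<exists>c. p - (\<Sum>j\<in>Q. scale (c j) (id j)) \<in> multiview_ideal A \<inter> graded_part fst u" by blast
    qed
    from pm.spans_mod_Plus[OF Q(1) finite_lessThan this pm.spans_mod_list[OF fs(1,3)]]
    have span: "pm.spans_mod {0} (Q <+> {..<?s}) (case_sum id ((!) fs)) (graded_part fst u)" .
    have "D \<le> card (Q <+> {..<?s})"
      unfolding D_def using Q(1) finite_multideg
      by (intro pm.steinitz_mod[OF pm.subspace_single_0 _ _ indep_Mon span]) (auto simp: gp_Mon intro: gp_Mon)
    then show ?thesis using Q(1) by (simp add: card_Plus)
  qed
  have main: "distinct xs \<and> pm.independent (set xs) \<and> pm.span (set xs) = multiview_ideal (L t) \<inter> graded_part fst u"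
    if t: "t \<notin> E" and gent: "generic (L t)" and xs: "xs = map (\<lambda>a. gs a t) [0..<?s]" for t xs
  proof -
    have dt: "\<delta> t \<noteq> 0" "\<delta>' t \<noteq> 0" using t by (auto simp: E_def)
    have indQ: "pm.indep_mod (multiview_ideal (L t)) Q id"
    proof (rule pm.indep_modI)
      fix c b assume c: "(\<Sum>j\<in>Q. scale (c j) (id j)) \<in> multiview_ideal (L t)" and b: "b \<in> Q"
      have "(\<Sum>b\<in>Q. c b * v b t X) = 0" for X
        using c memJ[OF gent sumQ[of c]] v_sum[of c t X] by simp
      then show "c b = 0"
        using dual_points_independent[OF Q(1), where T = "\<lambda>a c. T a c t" and M = "\<lambda>c b. v c t (\<omega> b)", OF dual dt(1) _ b] by blast
    qed
    obtain Q' where Q': "finite Q'" "pm.spans_mod (multiview_ideal (L t)) Q' id (graded_part fst u)"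
      "int (card Q') = mv_hilbert_function u"
      using has_hilbert_functionE[OF ideal multiview_ideal_hilbert_function[OF gent]] by metis
    have spanQ: "pm.spans_mod (multiview_ideal (L t)) Q id (graded_part fst u)"
      using Q Q' by (intro pm.indep_card_spans_mod[OF idsub Q(1) Q'(1) indQ _ Q'(2)]) auto
    have gsJ: "gs a t \<in> multiview_ideal (L t)" if a: "a < ?s" for a
    proof -
      obtain c where c: "gs a t - (\<Sum>j\<in>Q. scale (c j) (id j)) \<in> multiview_ideal (L t)"
        using pm.spans_modE[OF spanQ gs_gp[OF a]] by blast
      have "gs a t - (\<Sum>j\<in>Q. scale (c j) j) \<in> graded_part fst u"
        using gs_gp[OF a] sumQ by (intro pm.subspace_diff[OF gp_subspace])
      then have "peval (gs a t - (\<Sum>j\<in>Q. scale (c j) j)) (cam_point (L t) X) = 0" for X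
        using c memJ[OF gent] by simp
      then have "(\<Sum>j\<in>Q. c j * v j t (\<omega> b)) = 0" if "b \<in> Q" for b
        using gs_van[OF that, of a t] by (simp add: peval_diff v_sum)
      then have "c b = 0" if "b \<in> Q" for b
        using that dual_points_independent[OF Q(1), where T = "\<lambda>a c. T a c t" and M = "\<lambda>c b. v c t (\<omega> b)", OF dual dt(1)] by blast
      then show ?thesis using c by simp
    qed
    have nth: "xs ! a = gs a t" if "a < ?s" for a using that xs by simp
    have len: "length xs = ?s" using xs by simp
    have ind: "pm.indep_mod {0} {..<length xs} ((!) xs)"
    proof (rule pm.indep_modI)
      fix c a assume c: "(\<Sum>j<length xs. scale (c j) (xs ! j)) \<in> {0}" and a: "a \<in> {..<length xs}"
      have "(\<Sum>j<?s. c j * lookup (gs j t) m) = 0" for m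
      proof -
        have "(\<Sum>j<?s. c j * lookup (gs j t) m) = lookup (\<Sum>j<length xs. scale (c j) (xs ! j)) m"
          unfolding lookup_sum lookup_scale len by (intro sum.cong) (auto simp: nth)
        then show ?thesis using c by simp
      qed
      then show "c a = 0"
        using a dual_points_independent[OF finite_lessThan, where T = "\<lambda>a c. T' a c t" and M = "\<lambda>c b. lookup (gs c t) (\<mu> b)", OF dual' dt(2), of c a]
        unfolding len by blast
    qed
    let ?V = "multiview_ideal (L t) \<inter> graded_part fst u"
    have subV: "pm.subspace ?V" by (intro pm.subspace_inter idsub gp_subspace)
    have setV: "set xs \<subseteq> ?V" using gsJ gs_gp xs by auto
    have fin: "finite {m :: ('n \<times> 3) monom. multideg fst m = u}" by (rule finite_multideg)
    obtain V where V: "finite V" "V \<subseteq> ?V" "pm.indep_mod {0} V id" "pm.spans_mod {0} V id ?V"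
      using pm.exists_basis_mod[OF pm.subspace_single_0 subV fin pm.spans_mod_subset[OF gp_spans_Mon[OF fin], of ?V]] by auto
    have "pm.indep_mod {0} (Q <+> V) (case_sum id id)"
      using V pm.subspace_0[OF idsub[of "L t"]] by (intro pm.indep_mod_Plus[OF Q(1) V(1) indQ V(3) _ idsub]) auto
    then have "card (Q <+> V) \<le> D"
      unfolding D_def using Q V
      by (intro pm.steinitz_mod[OF pm.subspace_single_0 _ fin _ gp_spans_Mon[OF fin], where v = "case_sum id id"]) auto
    then have "card V \<le> ?s" using D_le Q V by (simp add: card_Plus)
    then have "pm.spans_mod {0} {..<length xs} ((!) xs) ?V"
      using V setV len by (intro pm.indep_card_spans_mod[OF pm.subspace_single_0 _ V(1) ind _ V(4)]) auto
    from pm.basis_list[OF ind this setV subV] show ?thesis .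
  qed
  show ?thesis
    by (rule exI[of _ gs], rule exI[of _ E]) (use finE gs0 gs_poly main in \<open>auto simp: L_def\<close>)
qed

text \<open>The Pluecker coordinates of the ideals on the line can be chosen polynomial in
  \<open>t\<close>, so \<open>F\<close> becomes a polynomial function of \<open>t\<close> that is
  nonzero at 0.\<close>

lemma hilbert_basic_open_line:
  fixes A B :: "('n::finite, 'k::alg_closed_field) cameras"
  assumes gen: "generic A" and mem: "multiview_ideal A \<in> hilbert_basic_open F"
  shows "finite {t. \<not> (generic (camera_line A B t) \<and> multiview_ideal (camera_line A B t) \<in> hilbert_basic_open F)}"
proof -
  obtain P0 where P0: "pluecker_vector (multiview_ideal A) P0" "peval F P0 \<noteq> 0"
    using mem unfolding hilbert_basic_open_def by blast
  obtain fs where fs: "\<And>u. distinct (fs u) \<and> pm.independent (set (fs u)) \<and>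
     pm.span (set (fs u)) = multiview_ideal A \<inter> graded_part fst u \<and>
     (\<forall>ms. P0 (u, ms) = (if length ms = length (fs u) \<and> (\<forall>m\<in>set ms. multideg fst m = u) then minor (fs u) ms else 0))"
    using P0(1) unfolding pluecker_vector_def by metis
  have "\<forall>u. \<exists>gs E. finite E \<and> (\<forall>a<length (fs u). gs a 0 = fs u ! a) \<and> (\<forall>a m. polyfun (\<lambda>t. lookup (gs a t) m)) \<and>
    (\<forall>t. t \<notin> E \<longrightarrow> generic (camera_line A B t) \<longrightarrow>
      distinct (map (\<lambda>a. gs a t) [0..<length (fs u)]) \<and>
      pm.independent (set (map (\<lambda>a. gs a t) [0..<length (fs u)])) \<and>
      pm.span (set (map (\<lambda>a. gs a t) [0..<length (fs u)])) =
        multiview_ideal (camera_line A B t) \<inter> graded_part fst u)"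
    using kernel_family[OF gen] fs by blast
  then obtain gs E where finE: "\<And>u. finite (E u)" and gs0: "\<And>u a. a < length (fs u) \<Longrightarrow> gs u a 0 = fs u ! a"
    and gs_poly: "\<And>u a m. polyfun (\<lambda>t. lookup (gs u a t) m)"
    and gsE: "\<And>u t. t \<notin> E u \<Longrightarrow> generic (camera_line A B t) \<Longrightarrow>
      distinct (map (\<lambda>a. gs u a t) [0..<length (fs u)]) \<and>
      pm.independent (set (map (\<lambda>a. gs u a t) [0..<length (fs u)])) \<and>
      pm.span (set (map (\<lambda>a. gs u a t) [0..<length (fs u)])) =
        multiview_ideal (camera_line A B t) \<inter> graded_part fst u"
    by metis
  define xs where "xs u t = map (\<lambda>a. gs u a t) [0..<length (fs u)]" for u t
  have len: "length (xs u t) = length (fs u)" for u t by (simp add: xs_def)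
  have xs0: "xs u 0 = fs u" for u by (rule nth_equalityI) (simp_all add: xs_def gs0)
  define PP where "PP t = (\<lambda>(u, ms). if length ms = length (fs u) \<and> (\<forall>m\<in>set ms. multideg fst m = u)
    then minor (xs u t) ms else 0)" for t
  have PP0: "PP 0 = P0" using fs by (auto simp: PP_def xs0 fun_eq_iff)
  have minor_poly: "polyfun (\<lambda>t. minor (xs u t) ms)" for u ms
  proof -
    have "minor (xs u t) ms = (\<Sum>\<pi> | \<pi> permutes {..<length (fs u)}.
        of_int (sign \<pi>) * (\<Prod>i<length (fs u). lookup (gs u i t) (ms ! \<pi> i)))" for t
      unfolding minor_def len by (intro sum.cong prod.cong arg_cong2[where f = times] refl) (simp add: xs_def)
    then show ?thesis
      using gs_poly by (simp only:) (intro polyfun_sum polyfun_mult polyfun_prod polyfun_const)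
  qed
  have PP_poly: "polyfun (\<lambda>t. PP t w)" for w
  proof (cases w)
    case (Pair u ms)
    define b where "b \<longleftrightarrow> length ms = length (fs u) \<and> (\<forall>m\<in>set ms. multideg fst m = u)"
    have "PP t w = (if b then minor (xs u t) ms else 0)" for t by (simp add: PP_def Pair b_def)
    then show ?thesis by (cases b) (simp_all add: minor_poly)
  qed
  have g_poly: "polyfun (\<lambda>t. peval F (PP t))" by (intro polyfun_peval_const PP_poly)
  define U where "U = fst ` (\<Union>m\<in>keys F. keys m)"
  have finU: "finite U" by (simp add: U_def)
  let ?bad = "{t. \<not> generic (camera_line A B t)} \<union> {t. peval F (PP t) = 0} \<union> (\<Union>u\<in>U. E u)"
  have "multiview_ideal (camera_line A B t) \<in> hilbert_basic_open F" if "t \<notin> ?bad" for t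
  proof -
    let ?J = "multiview_ideal (camera_line A B t)"
    have gent: "generic (camera_line A B t)" using that by blast
    have point: "?J \<in> hilbert_points" by (rule multiview_ideal_hilbert_point[OF gent])
    then obtain Q where Q: "pluecker_vector ?J Q"
      using pluecker_vector_exists[of ?J] unfolding hilbert_points_def homogeneous_ideal_def by blast
    \<comment> \<open>Every degree excludes its own finite set of parameters, so polynomial families
      are used only in the finitely many degrees \<open>U\<close> occurring in \<open>F\<close>;
      elsewhere any Pluecker vector serves.\<close>
    define R where "R = (\<lambda>(u, ms). if u \<in> U then PP t (u, ms) else Q (u, ms))"
    have "pluecker_vector ?J R"
      unfolding pluecker_vector_def
    proof
      fix u
      show "\<exists>fs. distinct fs \<and> pm.independent (set fs) \<and> pm.span (set fs) = ?J \<inter> graded_part fst u \<and>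
         (\<forall>ms. R (u, ms) = (if length ms = length fs \<and> (\<forall>m\<in>set ms. multideg fst m = u) then minor fs ms else 0))"
      proof (cases "u \<in> U")
        case True
        then have "t \<notin> E u" using that by blast
        from gsE[OF this gent] show ?thesis
          unfolding xs_def[symmetric] using True
          by (intro exI[of _ "xs u t"]) (auto simp: R_def PP_def len)
      next
        case False
        then show ?thesis using Q unfolding pluecker_vector_def R_def by simp
      qed
    qed
    moreover have "peval F R = peval F (PP t)"
      unfolding peval_def
    proof (intro sum.cong prod.cong refl arg_cong2[where f = times] arg_cong2[where f = power])
      fix m w assume "m \<in> keys F" "w \<in> keys m"
      then have "fst w \<in> U" unfolding U_def by blast
      then show "R w = PP t w" by (cases w) (simp add: R_def)
    qed
    ultimately show ?thesis using point that unfolding hilbert_basic_open_def by auto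
  qed
  then have "{t. \<not> (generic (camera_line A B t) \<and> multiview_ideal (camera_line A B t) \<in> hilbert_basic_open F)} \<subseteq> ?bad"
    by blast
  moreover have "finite {t. peval F (PP t) = 0}"
    by (rule polyfun_finite_zeros[OF g_poly, of 0]) (simp add: PP0 P0)
  ultimately show ?thesis
    using finU finE generic_camera_line[OF gen] finite_subset by (metis (no_types, lifting) finite_UN finite_UnI)
qed

lemma open_line:
  fixes A B :: "('n::finite, 'k::alg_closed_field) cameras"
  assumes "openin hilbert_scheme U" "generic A" "multiview_ideal A \<in> U"
  shows "finite {t. \<not> (generic (camera_line A B t) \<and> multiview_ideal (camera_line A B t) \<in> U)}"
proof -
  have "generate_topology_on {hilbert_basic_open F | F. multihomogeneous fst F} U"
    using assms(1) unfolding hilbert_scheme_def openin_topology_generated_by_iff .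
  then show ?thesis using assms(3)
  proof (induction rule: generate_topology_on.induct)
    case (Int a b)
    then have "finite ({t. \<not> (generic (camera_line A B t) \<and> multiview_ideal (camera_line A B t) \<in> a)} \<union>
       {t. \<not> (generic (camera_line A B t) \<and> multiview_ideal (camera_line A B t) \<in> b)})" by simp
    then show ?case by (rule rev_finite_subset) blast
  next
    case (UN K)
    then obtain k where "k \<in> K" "multiview_ideal A \<in> k" by blast
    then have "finite {t. \<not> (generic (camera_line A B t) \<and> multiview_ideal (camera_line A B t) \<in> k)}"
      using UN.IH by blast
    then show ?case by (rule rev_finite_subset) (use \<open>k \<in> K\<close> in blast)
  next
    case (Basis s)
    then show ?case using hilbert_basic_open_line[OF assms(2)] by blast
  qed simp
qed

lemma camera_line_swap: "camera_line A B t = camera_line B A (1 - t)"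
  by (simp add: camera_line_def fun_eq_iff vec_eq_iff algebra_simps)

text \<open>Both conditions exclude finitely many points of the line through \<open>A\<close> and
  \<open>B\<close>; one is read from \<open>A\<close> and the other from \<open>B\<close>, hence the
  parameter \<open>1 - t\<close>.\<close>

lemma opens_meet:
  fixes A B :: "('n::finite, 'k::alg_closed_field) cameras"
  assumes "openin hilbert_scheme U" "generic A" "multiview_ideal A \<in> U"
    "openin hilbert_scheme V" "generic B" "multiview_ideal B \<in> V"
  shows "\<exists>C. generic C \<and> multiview_ideal C \<in> U \<and> multiview_ideal C \<in> V"
proof -
  let ?X = "{t. \<not> (generic (camera_line A B t) \<and> multiview_ideal (camera_line A B t) \<in> U)}"
  let ?Y = "{t. \<not> (generic (camera_line B A t) \<and> multiview_ideal (camera_line B A t) \<in> V)}"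
  have "finite (?X \<union> (\<lambda>t. 1 - t) ` ?Y)"
    using open_line[OF assms(1-3)] open_line[OF assms(4-6)] by simp
  then obtain t where t: "t \<notin> ?X \<union> (\<lambda>t. 1 - t) ` ?Y"
    using infinite_UNIV_alg_closed ex_new_if_finite by blast
  have "1 - t \<notin> ?Y"
  proof
    assume "1 - t \<in> ?Y"
    then have "1 - (1 - t) \<in> (\<lambda>t. 1 - t) ` ?Y" by (rule imageI)
    then show False using t by simp
  qed
  then have "multiview_ideal (camera_line A B t) \<in> V" unfolding camera_line_swap[of A B t] by blast
  with t show ?thesis by blast
qed

lemma irreducible_camera_space:
  assumes "\<exists>A :: ('n::finite, 'k::alg_closed_field) cameras. generic A"
    and gamma: "gamma ` gamma_domain = {multiview_ideal A | A :: ('n, 'k) cameras. generic A}"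
  shows "irreducible_in hilbert_scheme (camera_space :: ('n, 'k) xyz_poly set set)"
proof -
  let ?S = "{multiview_ideal A | A :: ('n, 'k) cameras. generic A}"
  have cs: "camera_space = hilbert_scheme closure_of ?S" unfolding camera_space_def gamma ..
  have sub: "?S \<subseteq> topspace hilbert_scheme"
    unfolding topspace_hilbert_scheme using multiview_ideal_hilbert_point by blast
  show ?thesis
    unfolding irreducible_in_def
  proof (intro conjI allI impI)
    show "(camera_space :: ('n, 'k) xyz_poly set set) \<subseteq> topspace hilbert_scheme" unfolding cs by (rule closure_of_subset_topspace)
    show "(camera_space :: ('n, 'k) xyz_poly set set) \<noteq> {}"
      using closure_of_subset[OF sub] assms(1) unfolding cs by blast
    fix C D :: "('n, 'k) xyz_poly set set"
    assume CD: "closedin hilbert_scheme C \<and> closedin hilbert_scheme D \<and> camera_space \<subseteq> C \<union> D"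
    have cover: "?S \<subseteq> C \<union> D" using CD closure_of_subset[OF sub] unfolding cs by blast
    have "?S \<subseteq> C \<or> ?S \<subseteq> D"
    proof (rule ccontr)
      assume "\<not> ?thesis"
      then obtain A B where AB: "generic A" "multiview_ideal A \<notin> C" "generic B" "multiview_ideal B \<notin> D" by blast
      have "\<exists>E. generic E \<and> multiview_ideal E \<in> topspace hilbert_scheme - C \<and> multiview_ideal E \<in> topspace hilbert_scheme - D"
        using AB CD sub by (intro opens_meet[of _ A _ B]) auto
      then show False using cover by blast
    qed
    then show "camera_space \<subseteq> C \<or> camera_space \<subseteq> D"
      using CD unfolding cs by (meson closure_of_minimal)
  qed
qed

section \<open>Linear algebra of three bilinear forms\<close>

definition lin :: "('k::field ^ 'm \<Rightarrow> 'k) \<Rightarrow> bool" where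
  "lin f \<longleftrightarrow> (\<forall>x y. f (x + y) = f x + f y) \<and> (\<forall>c x. f (c *s x) = c * f x)"

definition bilin :: "('k::field ^ 'm \<Rightarrow> 'k ^ 'm \<Rightarrow> 'k) \<Rightarrow> bool" where
  "bilin f \<longleftrightarrow> (\<forall>x. lin (f x)) \<and> (\<forall>y. lin (\<lambda>x. f x y))"

lemma linD:
  assumes "lin f"
  shows "f (x + y) = f x + f y" "f (c *s x) = c * f x" "f 0 = 0" "f (x - y) = f x - f y" "f (- x) = - f x"
proof -
  show add: "f (x + y) = f x + f y" for x y using assms by (simp add: lin_def)
  show sc: "f (c *s x) = c * f x" for c x using assms by (simp add: lin_def)
  show "f 0 = 0" using sc[of 0 0] by simp
  show "f (x - y) = f x - f y" using add[of "x - y" y] by simp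
  show "f (- x) = - f x" using sc[of "-1" x] by (simp add: vector_sneg_minus1[symmetric])
qed

lemma bilinD: "bilin f \<Longrightarrow> lin (f x)" "bilin f \<Longrightarrow> lin (\<lambda>x. f x y)"
  by (auto simp: bilin_def)

lemma lin_sum: "lin f \<Longrightarrow> f (sum g S) = (\<Sum>i\<in>S. f (g i))"
  by (induction S rule: infinite_finite_induct) (auto simp: linD)

lemma lin_expand: "lin f \<Longrightarrow> f x = (\<Sum>j\<in>UNIV. x $ j * f (axis j 1))"
  by (subst coord_eq_sum_axis[of x]) (simp add: lin_sum linD)

lemma two_forms_kernel:
  fixes f g :: "'k::field ^ 3 \<Rightarrow> 'k"
  assumes "lin f" "lin g"
  shows "\<exists>e. e \<noteq> 0 \<and> f e = 0 \<and> g e = 0"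
proof -
  obtain c where c: "\<exists>j\<in>UNIV. c j \<noteq> 0"
    "\<forall>t\<in>UNIV. (\<Sum>j\<in>UNIV. c j * (if t then f (axis j 1) else g (axis j 1))) = 0"
    using homogeneous_system_solution[of "UNIV :: bool set" "UNIV :: 3 set"
        "\<lambda>j t. if t then f (axis j 1) else g (axis j 1)"] by auto
  have "f (\<chi> j. c j) = 0" "g (\<chi> j. c j) = 0"
    using c(2)[rule_format, of True] c(2)[rule_format, of False]
    by (simp_all add: lin_expand[OF assms(1), of "\<chi> j. c j"] lin_expand[OF assms(2), of "\<chi> j. c j"])
  moreover have "(\<chi> j. c j) \<noteq> 0" using c(1) by (auto simp: vec_eq_iff)
  ultimately show ?thesis by blast
qed

lemma kernel_not_line:
  fixes l :: "'k::field ^ 3 \<Rightarrow> 'k"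
  assumes "lin l"
  shows "\<exists>h1 h2. h1 \<noteq> 0 \<and> l h1 = 0 \<and> l h2 = 0 \<and> (\<forall>c. h2 \<noteq> c *s h1)"
proof -
  obtain h1 where h1: "h1 \<noteq> 0" "l h1 = 0" using two_forms_kernel[OF assms assms] by blast
  then obtain r where r: "h1 $ r \<noteq> 0" by (auto simp: vec_eq_iff)
  have "lin (\<lambda>x :: 'k ^ 3. x $ r)" by (simp add: lin_def)
  then obtain h2 where h2: "h2 \<noteq> 0" "l h2 = 0" "h2 $ r = 0" using two_forms_kernel[OF assms] by blast
  have "h2 \<noteq> c *s h1" for c using h2 r by auto
  then show ?thesis using h1 h2 by blast
qed

text \<open>Serves to move a degenerate point into general position along a line while the nonzero
  \<open>t\<close> can still be cancelled.\<close>

lemma exists_small_parameter: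
  fixes f g :: "'k::alg_closed_field \<Rightarrow> 'k"
  assumes "polyfun f" "f 0 \<noteq> 0" "polyfun g" "g 0 \<noteq> 0"
  shows "\<exists>t. t \<noteq> 0 \<and> f t \<noteq> 0 \<and> g t \<noteq> 0"
proof -
  have fin: "finite ({t. f t = 0} \<union> {t. g t = 0} \<union> {0})"
    using polyfun_finite_zeros[OF assms(1,2)] polyfun_finite_zeros[OF assms(3,4)] by simp
  obtain t where "t \<notin> {t. f t = 0} \<union> {t. g t = 0} \<union> {0}"
    using ex_new_if_finite[OF infinite_UNIV_alg_closed fin] by blast
  then show ?thesis by blast
qed

text \<open>For fixed \<open>p\<close> the relation equates two tensors of rank one, whence
  \<open>a\<close> and \<open>b\<close> are multiples of \<open>L\<close> and \<open>N\<close> with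
  factors \<open>s\<close> and \<open>- s\<close> depending on \<open>p\<close>. If the factor
  differed between \<open>p\<close> and \<open>p0\<close>, the relation at \<open>p + p0\<close>
  would make \<open>N\<close> and \<open>L\<close> at \<open>p\<close> the same multiple of their
  values at \<open>p0\<close>, giving a common kernel vector. Points where \<open>N\<close> or
  \<open>L\<close> vanishes are reached by perturbing \<open>p0\<close>.\<close>

lemma proportional_on_subspace:
  fixes a b N L :: "'k::alg_closed_field ^ 3 \<Rightarrow> 'k ^ 3 \<Rightarrow> 'k"
  assumes bil: "bilin a" "bilin b" "bilin N" "bilin L" and l: "lin l"
    and rel: "\<And>x y p. l p = 0 \<Longrightarrow> a y p * N x p + b x p * L y p = 0"
    and kN: "\<And>z z'. z \<noteq> 0 \<Longrightarrow> (\<forall>x. N x z = 0) \<Longrightarrow> (\<forall>x. N x z' = 0) \<Longrightarrow> \<exists>c. z' = c *s z"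
    and kL: "\<And>z z'. z \<noteq> 0 \<Longrightarrow> (\<forall>x. L x z = 0) \<Longrightarrow> (\<forall>x. L x z' = 0) \<Longrightarrow> \<exists>c. z' = c *s z"
    and cNLz: "\<And>z. (\<forall>x. N x z = 0) \<Longrightarrow> (\<forall>y. L y z = 0) \<Longrightarrow> z = 0"
  shows "\<exists>s. \<forall>p. l p = 0 \<longrightarrow> (\<forall>y. a y p = s * L y p) \<and> (\<forall>x. b x p = - s * N x p)"
proof -
  note lins = linD[OF bilinD(1)[OF bil(1)]] linD[OF bilinD(1)[OF bil(2)]]
    linD[OF bilinD(1)[OF bil(3)]] linD[OF bilinD(1)[OF bil(4)]]
  obtain h1 h2 where h: "h1 \<noteq> 0" "l h1 = 0" "l h2 = 0" "\<And>c. h2 \<noteq> c *s h1"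
    using kernel_not_line[OF l] by blast
  obtain p1 where p1: "l p1 = 0" "\<exists>x. N x p1 \<noteq> 0" using kN[of h1 h2] h by blast
  obtain p2 where p2: "l p2 = 0" "\<exists>y. L y p2 \<noteq> 0" using kL[of h1 h2] h by blast
  have "\<exists>p0. l p0 = 0 \<and> (\<exists>x. N x p0 \<noteq> 0) \<and> (\<exists>y. L y p0 \<noteq> 0)"
  proof (cases "(\<exists>y. L y p1 \<noteq> 0) \<or> (\<exists>x. N x p2 \<noteq> 0)")
    case True
    then show ?thesis using p1 p2 by blast
  next
    case False
    then have "N x (p1 + p2) = N x p1" "L y (p1 + p2) = L y p2" for x y by (auto simp: lins)
    moreover have "l (p1 + p2) = 0" using p1 p2 by (simp add: linD[OF l])
    ultimately show ?thesis using p1 p2 by metis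
  qed
  then obtain p0 x0 y0 where p0: "l p0 = 0" "N x0 p0 \<noteq> 0" "L y0 p0 \<noteq> 0" by blast
  have good: "\<exists>s. (\<forall>y. a y p = s * L y p) \<and> (\<forall>x. b x p = - s * N x p)"
    if p: "l p = 0" "N x1 p \<noteq> 0" "L y1 p \<noteq> 0" for p x1 y1
  proof -
    define s where "s = - b x1 p / N x1 p"
    have ay: "a y p = s * L y p" for y
    proof -
      have "a y p * N x1 p = - b x1 p * L y p" using rel[OF p(1), of y x1] by (simp add: eq_neg_iff_add_eq_0)
      then show ?thesis using p(2) by (simp add: s_def field_simps)
    qed
    have "b x p = - s * N x p" for x
    proof -
      have "(b x p + s * N x p) * L y1 p = 0"
        using rel[OF p(1), of y1 x] by (simp add: ay algebra_simps)
      then show ?thesis using p(3) by (simp add: eq_neg_iff_add_eq_0)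
    qed
    with ay show ?thesis by blast
  qed
  obtain s where s: "\<And>y. a y p0 = s * L y p0" "\<And>x. b x p0 = - s * N x p0"
    using good[OF p0] by blast
  have good': "(\<forall>y. a y p = s * L y p) \<and> (\<forall>x. b x p = - s * N x p)"
    if p: "l p = 0" "N x0 p \<noteq> 0" "L y0 p \<noteq> 0" for p
  proof -
    obtain s' where s': "\<And>y. a y p = s' * L y p" "\<And>x. b x p = - s' * N x p"
      using good[OF p] by blast
    have "s' = s"
    proof (rule ccontr)
      assume ne: "s' \<noteq> s"
      have eq: "L y p * N x p0 = L y p0 * N x p" for x y
      proof -
        have "l (p + p0) = 0" using p p0 by (simp add: linD[OF l])
        from rel[OF this, of y x] have "(s' - s) * (L y p * N x p0 - L y p0 * N x p) = 0"
          by (simp add: lins s s' algebra_simps)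
        then show ?thesis using ne by simp
      qed
      define \<kappa> where "\<kappa> = N x0 p / N x0 p0"
      have Lk: "L y p = \<kappa> * L y p0" for y using eq[of y x0] p0(2) by (simp add: \<kappa>_def field_simps)
      have Nk: "N x p = \<kappa> * N x p0" for x
      proof -
        have "L y0 p0 * N x p = L y0 p0 * (\<kappa> * N x p0)"
          using eq[of y0 x] unfolding Lk by (simp only: mult_ac)
        then show ?thesis using mult_left_cancel[OF p0(3)] by blast
      qed
      have "p - \<kappa> *s p0 = 0" by (rule cNLz) (simp_all add: lins Lk Nk)
      then have "p = \<kappa> *s p0" by simp
      then have "s' * L y0 p = s * L y0 p" using s'(1)[of y0] s(1)[of y0] by (auto simp: lins)
      then show False using ne p(3) by simp
    qed
    then show ?thesis using s' by blast
  qed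
  have "(\<forall>y. a y p = s * L y p) \<and> (\<forall>x. b x p = - s * N x p)" if p: "l p = 0" for p
  proof -
    have "polyfun (\<lambda>t. N x0 (p0 + t *s p))" "polyfun (\<lambda>t. L y0 (p0 + t *s p))"
      by (auto simp: lins)
    from exists_small_parameter[OF this(1) _ this(2)] p0
    obtain t where t: "t \<noteq> 0" "N x0 (p0 + t *s p) \<noteq> 0" "L y0 (p0 + t *s p) \<noteq> 0" by auto
    have "l (p0 + t *s p) = 0" using p p0 by (simp add: linD[OF l])
    from good'[OF this t(2,3)] have
      1: "\<And>y. a y (p0 + t *s p) = s * L y (p0 + t *s p)" "\<And>x. b x (p0 + t *s p) = - s * N x (p0 + t *s p)"
      by auto
    have "t * (a y p - s * L y p) = 0" for y using 1(1)[of y] s(1)[of y] by (simp add: lins algebra_simps)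
    moreover have "t * (b x p + s * N x p) = 0" for x using 1(2)[of x] s(2)[of x] by (simp add: lins algebra_simps)
    ultimately show ?thesis using t(1) by (auto simp: eq_neg_iff_add_eq_0)
  qed
  then show ?thesis by blast
qed

text \<open>The relation expresses that \<open>l(z) T\<close> lies in the ideal of the three bilinear forms. On the line
  \<open>l = 0\<close> it writes \<open>M\<close> as an element of the ideal of \<open>N(\<sqdot>,z)\<close> and \<open>L(\<sqdot>,z)\<close>, so that \<open>M\<close> has rank 2.\<close>

lemma epipoles_of_relation:
  fixes M N L a b q :: "'k::alg_closed_field ^ 3 \<Rightarrow> 'k ^ 3 \<Rightarrow> 'k" and l :: "'k ^ 3 \<Rightarrow> 'k" and T :: "'k ^ 3 \<Rightarrow> 'k ^ 3 \<Rightarrow> 'k ^ 3 \<Rightarrow> 'k"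
  assumes bil: "bilin M" "bilin N" "bilin L" "bilin a" "bilin b" "bilin q" and l: "lin l"
    and T: "\<And>x y. lin (T x y)"
    and rel: "\<And>x y z. l z * T x y z + q z z * M x y + a y z * N x z + b x z * L y z = 0"
    and kM1: "\<And>x x'. x \<noteq> 0 \<Longrightarrow> (\<forall>y. M x y = 0) \<Longrightarrow> (\<forall>y. M x' y = 0) \<Longrightarrow> \<exists>c. x' = c *s x"
    and kM2: "\<And>y y'. y \<noteq> 0 \<Longrightarrow> (\<forall>x. M x y = 0) \<Longrightarrow> (\<forall>x. M x y' = 0) \<Longrightarrow> \<exists>c. y' = c *s y"
    and kN: "\<And>z z'. z \<noteq> 0 \<Longrightarrow> (\<forall>x. N x z = 0) \<Longrightarrow> (\<forall>x. N x z' = 0) \<Longrightarrow> \<exists>c. z' = c *s z"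
    and kL: "\<And>z z'. z \<noteq> 0 \<Longrightarrow> (\<forall>x. L x z = 0) \<Longrightarrow> (\<forall>x. L x z' = 0) \<Longrightarrow> \<exists>c. z' = c *s z"
    and cMNx: "\<And>x. (\<forall>y. M x y = 0) \<Longrightarrow> (\<forall>z. N x z = 0) \<Longrightarrow> x = 0"
    and cMLy: "\<And>y. (\<forall>x. M x y = 0) \<Longrightarrow> (\<forall>z. L y z = 0) \<Longrightarrow> y = 0"
    and cNLz: "\<And>z. (\<forall>x. N x z = 0) \<Longrightarrow> (\<forall>y. L y z = 0) \<Longrightarrow> z = 0"
    and nontrivial: "\<And>s. (\<forall>z. l z = 0) \<Longrightarrow> (\<forall>z. q z z = 0) \<Longrightarrow> (\<forall>y z. a y z = s * L y z) \<Longrightarrow>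
       (\<forall>x z. b x z = - s * N x z) \<Longrightarrow> False"
    and T_notin: "\<And>c0 a1 b1 :: 'k ^ 3 \<Rightarrow> 'k. lin c0 \<Longrightarrow> lin a1 \<Longrightarrow> lin b1 \<Longrightarrow>
       (\<forall>x y z. T x y z = c0 z * M x y + a1 y * N x z + b1 x * L y z) \<Longrightarrow> False"
  shows "\<exists>e e'. e \<noteq> 0 \<and> e' \<noteq> 0 \<and> (\<forall>y. M e y = 0) \<and> (\<forall>x. M x e' = 0) \<and> (\<forall>z. N e z = 0 \<longleftrightarrow> L e' z = 0)"
proof (cases "\<exists>p. l p = 0 \<and> q p p \<noteq> 0")
  case True
  then obtain p0 where p0: "l p0 = 0" "q p0 p0 \<noteq> 0" by blast
  \<comment> \<open>Two linear conditions on 3-space have a nonzero solution \<open>e\<close>; it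
    kills both products in the relation, and \<open>q p p\<close> can be cancelled.\<close>
  have left: "\<exists>e. e \<noteq> 0 \<and> (\<forall>y. M e y = 0) \<and> N e p = 0" if "l p = 0" "q p p \<noteq> 0" for p
  proof -
    obtain e where e: "e \<noteq> 0" "N e p = 0" "b e p = 0"
      using two_forms_kernel[OF bilinD(2)[OF bil(2)] bilinD(2)[OF bil(5)]] by blast
    have "M e y = 0" for y using rel[of p e y] that e by simp
    with e show ?thesis by blast
  qed
  have right: "\<exists>e. e \<noteq> 0 \<and> (\<forall>x. M x e = 0) \<and> L e p = 0" if "l p = 0" "q p p \<noteq> 0" for p
  proof -
    obtain e where e: "e \<noteq> 0" "L e p = 0" "a e p = 0"
      using two_forms_kernel[OF bilinD(2)[OF bil(3)] bilinD(2)[OF bil(4)]] by blast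
    have "M x e = 0" for x using rel[of p x e] that e by simp
    with e show ?thesis by blast
  qed
  obtain e where e: "e \<noteq> 0" "\<forall>y. M e y = 0" using left[OF p0] by blast
  obtain e' where e': "e' \<noteq> 0" "\<forall>x. M x e' = 0" using right[OF p0] by blast
  have generic0: "N e p = 0 \<and> L e' p = 0" if p: "l p = 0" "q p p \<noteq> 0" for p
  proof -
    obtain f where f: "f \<noteq> 0" "\<forall>y. M f y = 0" "N f p = 0" using left[OF p] by blast
    obtain f' where f': "f' \<noteq> 0" "\<forall>x. M x f' = 0" "L f' p = 0" using right[OF p] by blast
    obtain c c' where "e = c *s f" "e' = c' *s f'" using kM1[OF f(1,2) e(2)] kM2[OF f'(1,2) e'(2)] by blast
    then show ?thesis using f f' by (simp add: linD[OF bilinD(2)[OF bil(2)]] linD[OF bilinD(2)[OF bil(3)]])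
  qed
  have van: "N e p = 0 \<and> L e' p = 0" if p: "l p = 0" for p
  proof -
    have "polyfun (\<lambda>t. q (p0 + t *s p) (p0 + t *s p))"
      by (auto simp: linD[OF bilinD(1)[OF bil(6)]] linD[OF bilinD(2)[OF bil(6)]])
    then obtain t where t: "t \<noteq> 0" "q (p0 + t *s p) (p0 + t *s p) \<noteq> 0"
      using exists_small_parameter[of "\<lambda>t. q (p0 + t *s p) (p0 + t *s p)" "\<lambda>_. 1"] p0(2) by auto
    have "l (p0 + t *s p) = 0" using p p0 by (simp add: linD[OF l])
    from generic0[OF this t(2)] generic0[OF p0] show ?thesis
      using t(1) by (simp add: linD[OF bilinD(1)[OF bil(2)]] linD[OF bilinD(1)[OF bil(3)]])
  qed
  \<comment> \<open>\<open>N e\<close> and \<open>L e'\<close> vanish wherever \<open>l\<close> does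
    and are nonzero, so both are nonzero multiples of \<open>l\<close> and have the same
    zeros.\<close>
  obtain v where v: "l v \<noteq> 0" using van cMNx[OF e(2)] e(1) by blast
  have "N e z = 0 \<longleftrightarrow> l z = 0" "L e' z = 0 \<longleftrightarrow> l z = 0" for z
  proof -
    have eq: "N e z = l z / l v * N e v" "L e' z = l z / l v * L e' v" for z
    proof -
      have "l (z - (l z / l v) *s v) = 0" using v by (simp add: linD[OF l])
      from van[OF this] show "N e z = l z / l v * N e v" "L e' z = l z / l v * L e' v"
        by (simp_all add: linD[OF bilinD(1)[OF bil(2)]] linD[OF bilinD(1)[OF bil(3)]])
    qed
    have "N e v \<noteq> 0"
    proof
      assume "N e v = 0"
      have "N e z = 0" for z using eq(1)[of z] unfolding \<open>N e v = 0\<close> by simp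
      then have "\<forall>z. N e z = 0" by blast
      then show False using cMNx[OF e(2)] e(1) by blast
    qed
    moreover have "L e' v \<noteq> 0"
    proof
      assume "L e' v = 0"
      have "L e' z = 0" for z using eq(2)[of z] unfolding \<open>L e' v = 0\<close> by simp
      then have "\<forall>z. L e' z = 0" by blast
      then show False using cMLy[OF e'(2)] e'(1) by blast
    qed
    ultimately show "N e z = 0 \<longleftrightarrow> l z = 0" "L e' z = 0 \<longleftrightarrow> l z = 0" using eq[of z] v by auto
  qed
  then show ?thesis using e e' by (intro exI[of _ e] exI[of _ e']) simp
next
  case False
  then have q0: "l p = 0 \<Longrightarrow> q p p = 0" for p by blast
  have "a y p * N x p + b x p * L y p = 0" if "l p = 0" for x y p
    using rel[of p x y] q0[OF that] that by simp
  then obtain s where s: "\<And>p y. l p = 0 \<Longrightarrow> a y p = s * L y p" "\<And>p x. l p = 0 \<Longrightarrow> b x p = - s * N x p"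
    using proportional_on_subspace[OF bil(4,5,2,3) l _ kN kL cNLz] by blast
  show ?thesis
  proof (cases "\<forall>z. l z = 0")
    \<comment> \<open>The relation would be the trivial one between \<open>N\<close> and
      \<open>L\<close>, scaled by \<open>s\<close>.\<close>
    case True
    have False
      by (rule nontrivial[of s]) (use True q0 s in simp_all)
    then show ?thesis ..
  next
    \<comment> \<open>Modulo the trivial relation between \<open>N\<close> and \<open>L\<close>, all
      coefficients are divisible by \<open>l\<close>. Cancelling \<open>l\<close> expresses
      \<open>T\<close> through the three bilinear forms, which is excluded.\<close>
    case nz: False
    then obtain v0 where "l v0 \<noteq> 0" by blast
    then obtain v where v: "l v = 1" using that linD(2)[OF l, of "1 / l v0" v0] by (metis nonzero_divide_eq_eq)
    define pr where "pr z = z - l z *s v" for z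
    have lpr: "l (pr z) = 0" for z by (simp add: pr_def linD[OF l] v)
    have dec: "z = pr z + l z *s v" for z by (simp add: pr_def)
    define c0 where "c0 z = l z * q v v + q v (pr z) + q (pr z) v" for z
    define a1 where "a1 y = a y v - s * L y v" for y
    define b1 where "b1 x = b x v + s * N x v" for x
    have qz: "q z z = l z * c0 z" for z
    proof -
      have "q z z = q (pr z + l z *s v) (pr z + l z *s v)" using dec[of z] by simp
      also have "\<dots> = l z * c0 z + q (pr z) (pr z)"
        by (simp add: c0_def linD(1,2)[OF bilinD(1)[OF bil(6)]] linD(1,2)[OF bilinD(2)[OF bil(6)]] algebra_simps)
      finally show ?thesis using q0[OF lpr[of z]] by simp
    qed
    have az: "a y z = s * L y z + l z * a1 y" for y z
    proof -
      have "a y z = a y (pr z) + l z * a y v" "L y z = L y (pr z) + l z * L y v"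
        using linD(1,2)[OF bilinD(1)[OF bil(4)]] linD(1,2)[OF bilinD(1)[OF bil(3)]] dec[of z] by metis+
      then show ?thesis using s(1)[OF lpr[of z], of y] by (simp add: a1_def algebra_simps)
    qed
    have bz: "b x z = - s * N x z + l z * b1 x" for x z
    proof -
      have "b x z = b x (pr z) + l z * b x v" "N x z = N x (pr z) + l z * N x v"
        using linD(1,2)[OF bilinD(1)[OF bil(5)]] linD(1,2)[OF bilinD(1)[OF bil(2)]] dec[of z] by metis+
      then show ?thesis using s(2)[OF lpr[of z], of x] by (simp add: b1_def algebra_simps)
    qed
    have lin_pr: "pr (z + z') = pr z + pr z'" "pr (c *s z) = c *s pr z" for z z' c
      by (simp_all add: pr_def linD[OF l] vec_eq_iff algebra_simps)
    have lin_c0: "lin c0"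
      unfolding lin_def c0_def
      by (simp add: lin_pr linD(1,2)[OF l] linD(1,2)[OF bilinD(1)[OF bil(6)]] linD(1,2)[OF bilinD(2)[OF bil(6)]] algebra_simps)
    have lin_a1: "lin a1" unfolding lin_def a1_def
      by (simp add: linD(1,2)[OF bilinD(2)[OF bil(4)]] linD(1,2)[OF bilinD(2)[OF bil(3)]] algebra_simps)
    have lin_b1: "lin b1" unfolding lin_def b1_def
      by (simp add: linD(1,2)[OF bilinD(2)[OF bil(5)]] linD(1,2)[OF bilinD(2)[OF bil(2)]] algebra_simps)
    define g where "g x y z = T x y z + c0 z * M x y + a1 y * N x z + b1 x * L y z" for x y z
    have lg: "l z * g x y z = 0" for x y z
      using rel[of z x y] unfolding qz az bz g_def by (simp add: algebra_simps)
    have ling: "lin (g x y)" for x y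
      unfolding lin_def g_def
      by (simp add: linD(1,2)[OF T] linD(1,2)[OF lin_c0] linD(1,2)[OF bilinD(1)[OF bil(2)]] linD(1,2)[OF bilinD(1)[OF bil(3)]] algebra_simps)
    have "g x y z = 0" for x y z
    proof (cases "l z = 0")
      case True
      then have "l (z + v) \<noteq> 0" by (simp add: linD[OF l] v)
      then have "g x y (z + v) = 0" "g x y v = 0" using lg[of "z + v"] lg[of v] v by auto
      then show ?thesis by (simp add: linD[OF ling])
    qed (use lg in auto)
    then have eqT: "T x y z = (- c0 z) * M x y + (- a1 y) * N x z + (- b1 x) * L y z" for x y z
      by (simp add: g_def add_eq_0_iff2 algebra_simps)
    have neg: "lin (\<lambda>z. - f z)" if "lin f" for f :: "'k ^ 3 \<Rightarrow> 'k"
      using that by (simp add: lin_def)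
    have False
      by (rule T_notin[OF neg[OF lin_c0] neg[OF lin_a1] neg[OF lin_b1]]) (intro allI eqT)
    then show ?thesis ..
  qed
qed

section \<open>Bilinear forms in a point of the Hilbert scheme\<close>

lemma multideg_UNIV: "multideg \<delta> m i = (\<Sum>v | \<delta> v = i. lookup m v)" for m :: "'v::finite monom"
  using multideg_superset[of UNIV m \<delta> i] by simp

lemma lookup_le_multideg: "lookup m v \<le> multideg fst m (fst v)" for m :: "('n::finite \<times> 3) monom"
  unfolding multideg_UNIV by (rule member_le_sum) auto

lemma peval_cong_blocks:
  fixes f :: "('n::finite, 'k::field) xyz_poly"
  assumes "f \<in> graded_part fst u" "\<And>i r. u i \<noteq> 0 \<Longrightarrow> p (i, r) = p' (i, r)"
  shows "peval f p = peval f p'"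
proof -
  have "meval m p = meval m p'" if m: "m \<in> keys f" for m
    unfolding meval_def
  proof (rule prod.cong[OF refl])
    fix v assume v: "v \<in> keys m"
    have "u (fst v) \<noteq> 0"
      using lookup_le_multideg[of m v] m v assms(1) by (auto simp: graded_part_def in_keys_iff)
    then show "p v ^ lookup m v = p' v ^ lookup m v" using assms(2)[of "fst v" "snd v"] by simp
  qed
  then show ?thesis by (simp add: peval_superset[of "keys f"])
qed

lemma monom_split_variable:
  fixes m :: "('n::finite \<times> 3) monom"
  assumes "multideg fst m i \<noteq> 0"
  shows "\<exists>r m'. m = Poly_Mapping.single (i, r) 1 + m' \<and> multideg fst m = unit_deg i + multideg fst m'"
proof -
  have "\<exists>v. fst v = i \<and> lookup m v \<noteq> 0"
    using assms unfolding multideg_UNIV by (metis (mono_tags, lifting) mem_Collect_eq sum.neutral)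
  then obtain r where r: "lookup m (i, r) \<noteq> 0" by auto
  define m' where "m' = m - Poly_Mapping.single (i, r) 1"
  have m: "m = Poly_Mapping.single (i, r) 1 + m'"
    using r by (intro poly_mapping_eqI) (auto simp: m'_def lookup_add lookup_minus lookup_single when_def)
  then have "multideg fst m = unit_deg i + multideg fst m'"
    by (metis fst_conv multideg_add multideg_single)
  with m show ?thesis by blast
qed

definition set_block :: "('n \<times> 3 \<Rightarrow> 'k) \<Rightarrow> 'n \<Rightarrow> 'k ^ 3 \<Rightarrow> 'n \<times> 3 \<Rightarrow> 'k" where
  "set_block p i x v = (if fst v = i then x $ snd v else p v)"

text \<open>With \<open>u i = 1\<close>, each monomial has exactly one variable from block
  \<open>i\<close>.\<close>

lemma lin_set_block:
  fixes f :: "('n::finite, 'k::field) xyz_poly"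
  assumes "f \<in> graded_part fst u" "u i = 1"
  shows "lin (\<lambda>x. peval f (set_block p i x))"
proof -
  have "\<exists>c r. \<forall>x. meval m (set_block p i x) = c * x $ r" if m: "m \<in> keys f" for m
  proof -
    have mu: "multideg fst m = u" using m assms(1) by (simp add: graded_part_def)
    then obtain r m' where m': "m = Poly_Mapping.single (i, r) 1 + m'" "u = unit_deg i + multideg fst m'"
      using monom_split_variable[of m i] assms(2) by auto
    have "multideg fst m' i = 0" using fun_cong[OF m'(2), of i] assms(2) by (simp add: unit_deg_def)
    then have "lookup m' v = 0" if "fst v = i" for v using lookup_le_multideg[of m' v] that by simp
    then have "meval m' (set_block p i x) = meval m' p" for x
      unfolding meval_def by (intro prod.cong refl) (auto simp: set_block_def in_keys_iff)
    then have "meval m (set_block p i x) = meval m' p * x $ r" for x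
      unfolding m'(1) meval_add meval_single by (simp add: set_block_def)
    then show ?thesis by blast
  qed
  then obtain c r where cr: "\<And>m x. m \<in> keys f \<Longrightarrow> meval m (set_block p i x) = c m * x $ r m" by metis
  have "peval f (set_block p i x) = (\<Sum>m\<in>keys f. lookup f m * (c m * x $ r m))" for x
    by (simp add: peval_superset[of "keys f"] cr)
  then show ?thesis
    unfolding lin_def by (simp add: distrib_left sum.distrib sum_distrib_left mult_ac)
qed

definition coef2 :: "('n::finite, 'k::field) xyz_poly \<Rightarrow> 'n \<Rightarrow> 'n \<Rightarrow> 3 \<Rightarrow> 3 \<Rightarrow> 'k" where
  "coef2 f i j r s = lookup f (Poly_Mapping.single (i, r) 1 + Poly_Mapping.single (j, s) 1)"

definition form2 :: "('n::finite, 'k::field) xyz_poly \<Rightarrow> 'n \<Rightarrow> 'n \<Rightarrow> 'k ^ 3 \<Rightarrow> 'k ^ 3 \<Rightarrow> 'k" where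
  "form2 f i j x y = (\<Sum>r\<in>UNIV. \<Sum>s\<in>UNIV. coef2 f i j r s * x $ r * y $ s)"

lemma coef2_commute: "coef2 f i j r s = coef2 f j i s r"
  by (simp add: coef2_def add.commute)

lemma form2_commute: "form2 f i j x y = form2 f j i y x"
  unfolding form2_def by (subst sum.swap) (simp add: coef2_commute[of f i j] mult_ac)

lemma bilin_form2: "bilin (form2 f i j)"
  by (simp add: bilin_def lin_def form2_def distrib_left distrib_right sum.distrib sum_distrib_left mult_ac)

lemma form2_axis: "form2 f i j (axis r 1) (axis s 1) = coef2 f i j r s"
  by (simp add: form2_def axis_def if_distrib[of "\<lambda>x. _ * x"] if_distrib[of "\<lambda>x. x * _"] cong: if_cong)

lemma peval_form2:
  fixes f :: "('n::finite, 'k::field) xyz_poly"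
  assumes f: "f \<in> graded_part fst (unit_deg i + unit_deg j)" and "i \<noteq> j"
  shows "peval f p = form2 f i j (\<chi> r. p (i, r)) (\<chi> r. p (j, r))"
proof -
  define m2 :: "3 \<times> 3 \<Rightarrow> ('n \<times> 3) monom" where "m2 = (\<lambda>rs. Poly_Mapping.single (i, fst rs) 1 + Poly_Mapping.single (j, snd rs) (1::nat))"
  have inj: "inj m2"
  proof
    fix a b assume "m2 a = m2 b"
    then have eq: "lookup (m2 a) v = lookup (m2 b) v" for v by simp
    have "fst a = fst b"
      using eq[of "(i, fst a)"] \<open>i \<noteq> j\<close> by (simp add: m2_def lookup_add lookup_single when_def split: if_splits)
    moreover have "snd a = snd b"
      using eq[of "(j, snd a)"] \<open>i \<noteq> j\<close> by (simp add: m2_def lookup_add lookup_single when_def split: if_splits)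
    ultimately show "a = b" by (simp add: prod_eq_iff)
  qed
  have "keys f \<subseteq> range m2"
  proof
    fix m assume "m \<in> keys f"
    then have md: "multideg fst m = unit_deg i + unit_deg j" using f by (simp add: graded_part_def)
    then obtain r m' where r: "m = Poly_Mapping.single (i, r) 1 + m'" "multideg fst m' = unit_deg j"
      using monom_split_variable[of m i] by (auto simp: unit_deg_def)
    then obtain s m'' where s: "m' = Poly_Mapping.single (j, s) 1 + m''" "unit_deg j = unit_deg j + multideg fst m''"
      using monom_split_variable[of m' j] by (auto simp: unit_deg_def)
    have "multideg fst m'' = 0" using s(2) by simp
    then have "m'' = 0"
      using lookup_le_multideg[of m''] by (intro poly_mapping_eqI) (metis le_zero_eq lookup_zero zero_fun_apply)
    then show "m \<in> range m2" using r s by (intro image_eqI[of _ _ "(r, s)"]) (simp_all add: m2_def)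
  qed
  then have "peval f p = (\<Sum>m\<in>range m2. lookup f m * meval m p)" by (intro peval_superset) auto
  also have "\<dots> = (\<Sum>rs\<in>UNIV. lookup f (m2 rs) * meval (m2 rs) p)" by (subst sum.reindex[OF inj]) simp
  also have "\<dots> = (\<Sum>rs\<in>UNIV \<times> UNIV. coef2 f i j (fst rs) (snd rs) * p (i, fst rs) * p (j, snd rs))"
    by (simp add: m2_def coef2_def meval_add mult.assoc)
  finally show ?thesis by (simp add: form2_def sum.cartesian_product split_def)
qed

definition det3 :: "(3 \<Rightarrow> 'k::field) \<Rightarrow> (3 \<Rightarrow> 'k) \<Rightarrow> (3 \<Rightarrow> 'k) \<Rightarrow> 'k" where
  "det3 u v w = u 1 * (v 2 * w 3 - v 3 * w 2) - u 2 * (v 1 * w 3 - v 3 * w 1) + u 3 * (v 1 * w 2 - v 2 * w 1)"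

lemma det3_kernel:
  fixes x :: "'k::field ^ 3"
  assumes "det3 u v w \<noteq> 0" "(\<Sum>r\<in>UNIV. u r * x $ r) = 0" "(\<Sum>r\<in>UNIV. v r * x $ r) = 0" "(\<Sum>r\<in>UNIV. w r * x $ r) = 0"
  shows "x = 0"
proof -
  have e: "u 1 * x $ 1 + u 2 * x $ 2 + u 3 * x $ 3 = 0" "v 1 * x $ 1 + v 2 * x $ 2 + v 3 * x $ 3 = 0"
    "w 1 * x $ 1 + w 2 * x $ 2 + w 3 * x $ 3 = 0"
    using assms(2-) by (simp_all add: sum_3)
  have "det3 u v w * x $ 1 = 0" "det3 u v w * x $ 2 = 0" "det3 u v w * x $ 3 = 0"
    using e unfolding det3_def by algebra+
  then show ?thesis using assms(1) by (simp add: vec_eq_iff forall_3)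
qed

section \<open>Dimensions of ideals in degrees supported on three views\<close>

lemma hilbert_basis_length:
  fixes I :: "('n::finite, 'k::field) xyz_poly set"
  assumes I: "is_ideal I" "has_hilbert_function fst I h"
    and fs: "pm.indep_mod {0} K w" "pm.spans_mod {0} K w (I \<inter> graded_part fst u)" "w ` K \<subseteq> I \<inter> graded_part fst u" "finite K"
  shows "int (card {m :: ('n \<times> 3) monom. multideg fst m = u}) = h u + int (card K)"
proof -
  let ?M = "{m :: ('n \<times> 3) monom. multideg fst m = u}"
  obtain Q where Q: "finite Q" "Q \<subseteq> graded_part fst u" "pm.indep_mod I Q id"
    "pm.spans_mod I Q id (graded_part fst u)" "int (card Q) = h u"
    using has_hilbert_functionE[OF I] by metis
  have sumQ: "(\<Sum>b\<in>Q. scale (c b) b) \<in> graded_part fst u" for c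
    using Q(2) gp_subspace by (intro pm.subspace_sum pm.subspace_scale) auto
  have "pm.spans_mod (I \<inter> graded_part fst u) Q id (graded_part fst u)"
    unfolding pm.spans_mod_def
  proof
    fix p :: "('n, 'k) xyz_poly" assume p: "p \<in> graded_part fst u"
    then obtain c where "p - (\<Sum>j\<in>Q. scale (c j) (id j)) \<in> I"
      using Q(4) by (elim pm.spans_modE)
    moreover have "p - (\<Sum>j\<in>Q. scale (c j) (id j)) \<in> graded_part fst u"
      using p sumQ[of c] by (simp add: pm.subspace_diff[OF gp_subspace])
    ultimately show "\<exists>c. p - (\<Sum>j\<in>Q. scale (c j) (id j)) \<in> I \<inter> graded_part fst u" by blast
  qed
  from pm.spans_mod_Plus[OF Q(1) fs(4) this fs(2)]
  have span: "pm.spans_mod {0} (Q <+> K) (case_sum id w) (graded_part fst u)" .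
  have "card ?M \<le> card (Q <+> K)"
    using Q(1) fs(4) finite_multideg
    by (intro pm.steinitz_mod[OF pm.subspace_single_0 _ _ indep_Mon span]) (auto intro: gp_Mon)
  moreover have "pm.indep_mod {0} (Q <+> K) (case_sum id w)"
    using fs pm.subspace_0[OF ideal_subspace[OF I(1)]]
    by (intro pm.indep_mod_Plus[OF Q(1) fs(4) Q(3) fs(1) _ ideal_subspace[OF I(1)]]) auto
  then have "card (Q <+> K) \<le> card ?M"
    using Q fs
    by (intro pm.steinitz_mod[OF pm.subspace_single_0 _ finite_multideg _ gp_spans_Mon[OF finite_multideg],
          where v = "case_sum id w"]) auto
  ultimately show ?thesis using Q fs(4) by (simp add: card_Plus)
qed

definition deg3 :: "'n \<Rightarrow> 'n \<Rightarrow> 'n \<Rightarrow> nat \<Rightarrow> nat \<Rightarrow> nat \<Rightarrow> 'n \<Rightarrow> nat" where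
  "deg3 i j k a b c l = (if l = i then a else if l = j then b else if l = k then c else 0)"

lemma sum_deg3:
  fixes g :: "nat \<Rightarrow> 'a::comm_monoid_add"
  assumes "distinct [i, j, k :: 'n::finite]" "g 0 = 0"
  shows "(\<Sum>l\<in>UNIV. g (deg3 i j k a b c l)) = g a + g b + g c"
proof -
  have "(\<Sum>l\<in>UNIV. g (deg3 i j k a b c l)) = (\<Sum>l\<in>{i, j, k}. g (deg3 i j k a b c l))"
    by (rule sum.mono_neutral_right) (auto simp: deg3_def assms(2))
  then show ?thesis using assms(1) by (auto simp: deg3_def add.assoc)
qed

lemma prod_deg3:
  fixes g :: "nat \<Rightarrow> 'a::comm_monoid_mult"
  assumes "distinct [i, j, k :: 'n::finite]" "g 0 = 1"
  shows "(\<Prod>l\<in>UNIV. g (deg3 i j k a b c l)) = g a * g b * g c"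
proof -
  have "(\<Prod>l\<in>UNIV. g (deg3 i j k a b c l)) = (\<Prod>l\<in>{i, j, k}. g (deg3 i j k a b c l))"
    by (rule prod.mono_neutral_right) (auto simp: deg3_def assms(2))
  then show ?thesis using assms(1) by (auto simp: deg3_def mult.assoc)
qed

lemma hilbert_deg3:
  assumes "distinct [i, j, k :: 'n::finite]"
  shows "mv_hilbert_function (deg3 i j k a b c) =
    int ((a + b + c + 3) choose 3) - int ((a + 2) choose 3) - int ((b + 2) choose 3) - int ((c + 2) choose 3)"
  using sum_deg3[OF assms, of "\<lambda>u. u" a b c] sum_deg3[OF assms, of "\<lambda>u. int ((u + 2) choose 3)" a b c]
  by (simp add: mv_hilbert_function_def numeral_3_eq_3)

lemma card_deg3:
  assumes "distinct [i, j, k :: 'n::finite]"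
  shows "card {m :: ('n \<times> 3) monom. multideg fst m = deg3 i j k a b c} =
    ((a + 2) choose 2) * ((b + 2) choose 2) * ((c + 2) choose 2)"
  unfolding card_multideg using prod_deg3[OF assms, of "\<lambda>u. (u + 2) choose 2" a b c]
  by (simp add: numeral_2_eq_2)

lemma Mon_image: "Mon ` {m. multideg \<delta> m = u} \<subseteq> graded_part \<delta> u"
  by (auto simp: graded_part_def Mon_def)

definition point3 :: "'n \<Rightarrow> 'n \<Rightarrow> 'n \<Rightarrow> 'k::zero ^ 3 \<Rightarrow> 'k ^ 3 \<Rightarrow> 'k ^ 3 \<Rightarrow> 'n \<times> 3 \<Rightarrow> 'k" where
  "point3 i j k x y z v = (if fst v = i then x $ snd v else if fst v = j then y $ snd v
     else if fst v = k then z $ snd v else 0)"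

text \<open>The determinant condition forces the left kernels of \<open>F i j\<close> and \<open>F i k\<close> to meet trivially. It is
  open, because up to a nonzero factor the coefficients of \<open>F i j\<close> are Pluecker coordinates.\<close>

locale nondegenerate_point =
  fixes I :: "('n::finite, 'k::alg_closed_field) xyz_poly set" and F :: "'n \<Rightarrow> 'n \<Rightarrow> ('n, 'k) xyz_poly"
  assumes ideal: "is_ideal I" and hilbert: "has_hilbert_function fst I mv_hilbert_function"
    and F_ideal: "\<And>i j. i \<noteq> j \<Longrightarrow> F i j \<in> I"
    and F_deg: "\<And>i j. i \<noteq> j \<Longrightarrow> F i j \<in> graded_part fst (unit_deg i + unit_deg j)"
    and F_sym: "\<And>i j. F i j = F j i"
    and det: "\<And>i j k. distinct [i, j, k] \<Longrightarrow>
      det3 (\<lambda>r. coef2 (F i j) i j r 2) (\<lambda>r. coef2 (F i j) i j r 3) (\<lambda>r. coef2 (F i k) i k r 3) \<noteq> 0"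
begin

definition B :: "'n \<Rightarrow> 'n \<Rightarrow> 'k ^ 3 \<Rightarrow> 'k ^ 3 \<Rightarrow> 'k" where
  "B i j = form2 (F i j) i j"

lemma B_commute: "B i j x y = B j i y x"
  unfolding B_def by (subst form2_commute) (simp add: F_sym)

lemma bilin_B: "bilin (B i j)"
  unfolding B_def by (rule bilin_form2)

lemmas B_lin1 = linD[OF bilinD(2)[OF bilin_B]]
lemmas B_lin2 = linD[OF bilinD(1)[OF bilin_B]]

lemma peval_F: "i \<noteq> j \<Longrightarrow> peval (F i j) p = B i j (\<chi> r. p (i, r)) (\<chi> r. p (j, r))"
  unfolding B_def by (rule peval_form2[OF F_deg])

lemma B_axis: "B i j x (axis s 1) = (\<Sum>r\<in>UNIV. coef2 (F i j) i j r s * x $ r)"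
  by (simp add: B_def form2_def axis_def if_distrib[of "\<lambda>x. _ * x"] cong: if_cong)

lemma B_columns:
  assumes "distinct [i, j, k]" "B i j x (axis 2 1) = 0" "B i j x (axis 3 1) = 0" "B i k x (axis 3 1) = 0"
  shows "x = 0"
  by (rule det3_kernel[OF det[OF assms(1)]]) (use assms(2-) in \<open>simp_all add: B_axis\<close>)

lemma B_no_common_kernel:
  assumes "distinct [i, j, k]" "\<forall>y. B i j x y = 0" "\<forall>z. B i k x z = 0"
  shows "x = 0"
  using B_columns[OF assms(1), of x] assms(2,3) by simp

lemma B_kernel_line:
  assumes "distinct [i, j, k]" "x \<noteq> 0" "\<forall>y. B i j x y = 0" "\<forall>y. B i j x' y = 0"
  shows "\<exists>c. x' = c *s x"
proof -
  let ?w = "\<lambda>x. B i k x (axis 3 1)"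
  have "?w x \<noteq> 0" using B_columns[OF assms(1), of x] assms(2,3) by auto
  then have "x' - (?w x' / ?w x) *s x = 0"
    using assms(3,4) by (intro B_columns[OF assms(1)]) (simp_all add: B_lin1)
  then show ?thesis by (metis eq_iff_diff_eq_0)
qed

text \<open>There are 27 monomials and the Hilbert function is 17, so the ideal has dimension 10 in
  this degree. Multiples of the bilinear forms span at most 3 + 3 + 3 dimensions.\<close>

lemma trilinear_exists:
  assumes dist: "distinct [i, j, k]"
  shows "\<exists>T. T \<in> I \<and> T \<in> graded_part fst (deg3 i j k 1 1 1) \<and>
    \<not> (\<exists>c0 a1 b1. lin c0 \<and> lin a1 \<and> lin b1 \<and>
      (\<forall>x y z. peval T (point3 i j k x y z) = c0 z * B i j x y + a1 y * B i k x z + b1 x * B j k y z))"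
proof (rule ccontr)
  assume none: "\<not> ?thesis"
  let ?u = "deg3 i j k 1 1 1"
  have ne: "i \<noteq> j" "i \<noteq> k" "j \<noteq> k" using dist by auto
  define w where "w = case_sum (\<lambda>r. Var (k, r) * F i j) (case_sum (\<lambda>r. Var (j, r) * F i k) (\<lambda>r. Var (i, r) * F j k))"
  define K where "K = (UNIV :: 3 set) <+> ((UNIV :: 3 set) <+> (UNIV :: 3 set))"
  have finK: "finite K" by (simp add: K_def)
  have gp: "f * F a b \<in> graded_part fst ?u"
    if "f \<in> graded_part fst (unit_deg c)" "a \<noteq> b" "unit_deg c + (unit_deg a + unit_deg b) = ?u" for f a b c
    using gp_mult[OF that(1) F_deg[OF that(2)]] that(3) by simp
  have udeg: "unit_deg k + (unit_deg i + unit_deg j) = ?u" "unit_deg j + (unit_deg i + unit_deg k) = ?u"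
    "unit_deg i + (unit_deg j + unit_deg k) = ?u"
    using ne by (auto simp: fun_eq_iff unit_deg_def deg3_def)
  have span: "pm.spans_mod {0} K w (I \<inter> graded_part fst ?u)"
    unfolding pm.spans_mod_def
  proof
    fix T assume T: "T \<in> I \<inter> graded_part fst ?u"
    then obtain c0 a1 b1 where lins: "lin c0" "lin a1" "lin b1"
      and eq: "\<And>x y z. peval T (point3 i j k x y z) = c0 z * B i j x y + a1 y * B i k x z + b1 x * B j k y z"
      using none by blast
    define S where "S = (\<Sum>r\<in>UNIV. scale (c0 (axis r 1)) (Var (k, r) * F i j)) +
      ((\<Sum>r\<in>UNIV. scale (a1 (axis r 1)) (Var (j, r) * F i k)) + (\<Sum>r\<in>UNIV. scale (b1 (axis r 1)) (Var (i, r) * F j k)))"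
    have "T = S"
    proof (rule peval_inject)
      fix p :: "'n \<times> 3 \<Rightarrow> 'k"
      define bl where "bl l = (\<chi> r. p (l, r))" for l
      have lc: "(\<Sum>r\<in>UNIV. f (axis r 1) * (p (l, r) * b)) = f (bl l) * b" if "lin f" for f l b
        unfolding lin_expand[OF that, of "bl l"] by (simp add: sum_distrib_right sum_distrib_left bl_def mult_ac)
      have "peval T p = peval T (point3 i j k (bl i) (bl j) (bl k))"
        by (rule peval_cong_blocks[of _ ?u]) (use T in \<open>auto simp: point3_def deg3_def bl_def split: if_splits\<close>)
      also have "\<dots> = c0 (bl k) * B i j (bl i) (bl j) + a1 (bl j) * B i k (bl i) (bl k) + b1 (bl i) * B j k (bl j) (bl k)"
        by (rule eq)
      also have "\<dots> = peval S p"
        using ne by (simp add: S_def peval_add peval_sum peval_mult peval_F lc lins flip: bl_def)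
      finally show "peval T p = peval S p" .
    qed
    then have "T - (\<Sum>x\<in>K. scale ((case_sum (\<lambda>r. c0 (axis r 1)) (case_sum (\<lambda>r. a1 (axis r 1)) (\<lambda>r. b1 (axis r 1)))) x) (w x)) = 0"
      by (simp add: K_def w_def S_def sum.Plus del: UNIV_Plus_UNIV)
    then show "\<exists>c. T - (\<Sum>j\<in>K. scale (c j) (w j)) \<in> {0}" by blast
  qed
  obtain Q where Q: "finite Q" "Q \<subseteq> graded_part fst ?u" "pm.spans_mod I Q id (graded_part fst ?u)" "int (card Q) = mv_hilbert_function ?u"
    using has_hilbert_functionE[OF ideal hilbert] by metis
  have "pm.spans_mod (I \<inter> graded_part fst ?u) Q id (graded_part fst ?u)"
    unfolding pm.spans_mod_def
  proof
    fix p :: "('n, 'k) xyz_poly" assume p: "p \<in> graded_part fst ?u"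
    then obtain c where c: "p - (\<Sum>j\<in>Q. scale (c j) (id j)) \<in> I"
      using Q(3) by (elim pm.spans_modE)
    have "(\<Sum>j\<in>Q. scale (c j) (id j)) \<in> graded_part fst ?u"
      using Q(2) gp_subspace by (intro pm.subspace_sum pm.subspace_scale) auto
    then have "p - (\<Sum>j\<in>Q. scale (c j) (id j)) \<in> graded_part fst ?u"
      using p by (intro pm.subspace_diff[OF gp_subspace])
    with c show "\<exists>c. p - (\<Sum>j\<in>Q. scale (c j) (id j)) \<in> I \<inter> graded_part fst ?u" by blast
  qed
  then have span': "pm.spans_mod {0} (Q <+> K) (case_sum id w) (graded_part fst ?u)"
    by (rule pm.spans_mod_Plus[OF Q(1) finK _ span])
  have "card {m :: ('n \<times> 3) monom. multideg fst m = ?u} \<le> card (Q <+> K)"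
    by (rule pm.steinitz_mod[OF pm.subspace_single_0 _ _ indep_Mon[OF finite_multideg] span' Mon_image])
      (use Q(1) finK finite_multideg in auto)
  moreover have "card K = 9" by (simp add: K_def card_Plus)
  moreover have "card Q = 17" using Q(4) unfolding hilbert_deg3[OF dist] by (simp add: eval_nat_numeral)
  moreover have "card {m :: ('n \<times> 3) monom. multideg fst m = ?u} = 27"
    unfolding card_deg3[OF dist] by (simp add: eval_nat_numeral)
  ultimately show False using Q(1) by (simp add: card_Plus K_def)
qed

text \<open>In degree e_i + e_j + 2 e_k there are 54 monomials and the Hilbert function is 29. The 3
  + 6 + 8 + 9 = 26 products considered here lie in a space of dimension 25 and are therefore
  dependent.\<close>

lemma epipoles:
  assumes dist: "distinct [i, j, k]"
  shows "\<exists>e e'. e \<noteq> 0 \<and> e' \<noteq> 0 \<and> (\<forall>y. B i j e y = 0) \<and> (\<forall>x. B i j x e' = 0) \<and>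
    (\<forall>z. B i k e z = 0 \<longleftrightarrow> B j k e' z = 0)"
proof -
  have ne: "i \<noteq> j" "i \<noteq> k" "j \<noteq> k" using dist by auto
  let ?u = "deg3 i j k 1 1 2"
  obtain T where T: "T \<in> I" "T \<in> graded_part fst (deg3 i j k 1 1 1)" and T_notin:
    "\<not> (\<exists>c0 a1 b1. lin c0 \<and> lin a1 \<and> lin b1 \<and>
      (\<forall>x y z. peval T (point3 i j k x y z) = c0 z * B i j x y + a1 y * B i k x z + b1 x * B j k y z))"
    using trilinear_exists[OF dist] by blast
  have "\<exists>r s. coef2 (F j k) j k r s \<noteq> 0"
  proof (rule ccontr)
    assume "\<not> ?thesis"
    then show False using det[of j k i] ne by (simp add: det3_def)
  qed
  then obtain r0 s0 where rs0: "coef2 (F j k) j k r0 s0 \<noteq> 0" by blast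
  define S2 :: "(3 \<times> 3) set" where "S2 = {(1,1),(1,2),(1,3),(2,2),(2,3),(3,3)}"
  \<comment> \<open>The trivial relation between \<open>F i k\<close> and \<open>F j k\<close> has
    the coefficients of \<open>F j k\<close> in this place. Omitting one pair where they do not
    vanish excludes it, so the dependence found is a different one.\<close>
  define S3 :: "(3 \<times> 3) set" where "S3 = UNIV - {(r0, s0)}"
  define J where "J = (UNIV :: 3 set) <+> (S2 <+> (S3 <+> (UNIV :: (3 \<times> 3) set)))"
  define w where "w = case_sum (\<lambda>r. Var (k, r) * T) (case_sum (\<lambda>(r, s). Var (k, r) * Var (k, s) * F i j)
    (case_sum (\<lambda>(r, s). Var (j, r) * Var (k, s) * F i k) (\<lambda>(r, s). Var (i, r) * Var (k, s) * F j k)))"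
  have udeg: "unit_deg k + deg3 i j k 1 1 1 = ?u" "unit_deg k + unit_deg k + (unit_deg i + unit_deg j) = ?u"
    "unit_deg j + unit_deg k + (unit_deg i + unit_deg k) = ?u" "unit_deg i + unit_deg k + (unit_deg j + unit_deg k) = ?u"
    using ne by (auto simp: fun_eq_iff unit_deg_def deg3_def)
  have V: "Var (l, r) \<in> graded_part fst (unit_deg l)" for l :: 'n and r :: 3
    using gp_Var[of "(l, r)" fst] by simp
  have "w x \<in> graded_part fst ?u" for x
  proof -
    have "Var (k, r) * T \<in> graded_part fst ?u" for r by (rule gp_mult[OF V[of k r] T(2), unfolded udeg])
    moreover have "Var (k, r) * Var (k, s) * F i j \<in> graded_part fst ?u" for r s
      by (rule gp_mult[OF gp_mult[OF V[of k r] V[of k s]] F_deg[OF ne(1)], unfolded udeg])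
    moreover have "Var (j, r) * Var (k, s) * F i k \<in> graded_part fst ?u" for r s
      by (rule gp_mult[OF gp_mult[OF V[of j r] V[of k s]] F_deg[OF ne(2)], unfolded udeg])
    moreover have "Var (i, r) * Var (k, s) * F j k \<in> graded_part fst ?u" for r s
      by (rule gp_mult[OF gp_mult[OF V[of i r] V[of k s]] F_deg[OF ne(3)], unfolded udeg])
    ultimately show ?thesis by (auto simp: w_def split: sum.splits)
  qed
  moreover have "w x \<in> I" for x
    using T(1) F_ideal ne ideal_mult(1)[OF ideal] by (auto simp: w_def split: sum.splits)
  ultimately have wJ: "w ` J \<subseteq> I \<inter> graded_part fst ?u" by blast
  have "card S2 = 6" by (simp add: S2_def)
  moreover have "card S3 = 8" by (simp add: S3_def card_Diff_singleton)
  ultimately have cardJ: "card J = 26" by (simp add: J_def card_Plus)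
  have "int (card {m :: ('n \<times> 3) monom. multideg fst m = ?u}) = 54"
    unfolding card_deg3[OF dist] by (simp add: eval_nat_numeral)
  moreover have "mv_hilbert_function ?u = 29"
    unfolding hilbert_deg3[OF dist] by (simp add: eval_nat_numeral)
  ultimately obtain c where c: "\<exists>x\<in>J. c x \<noteq> 0" "(\<Sum>x\<in>J. scale (c x) (w x)) = 0"
    using hilbert_relation[OF ideal hilbert _ wJ finite_multideg] cardJ by (auto simp: J_def)
  define c1 c2 c3 c4 where "c1 r = c (Inl r)" and "c2 rs = c (Inr (Inl rs))"
    and "c3 rs = (if rs = (r0, s0) then 0 else c (Inr (Inr (Inl rs))))" and "c4 rs = c (Inr (Inr (Inr rs)))" for r :: 3 and rs :: "3 \<times> 3"
  define l where "l z = (\<Sum>r\<in>UNIV. c1 r * z $ r)" for z :: "'k ^ 3"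
  define q where "q z z' = (\<Sum>rs\<in>S2. c2 rs * (z $ fst rs * z' $ snd rs))" for z z' :: "'k ^ 3"
  define a where "a y z = (\<Sum>rs\<in>UNIV. c3 rs * (y $ fst rs * z $ snd rs))" for y z :: "'k ^ 3"
  define b where "b x z = (\<Sum>rs\<in>UNIV. c4 rs * (x $ fst rs * z $ snd rs))" for x z :: "'k ^ 3"
  have bil: "bilin (\<lambda>x z. \<Sum>rs\<in>R. d rs * (x $ fst rs * z $ snd rs))" for R :: "(3 \<times> 3) set" and d :: "3 \<times> 3 \<Rightarrow> 'k"
    by (simp add: bilin_def lin_def distrib_left distrib_right sum.distrib sum_distrib_left mult_ac)
  have bil_axis: "(\<Sum>rs\<in>UNIV. d rs * (axis r 1 $ fst rs * axis s 1 $ snd rs)) = d (r, s)" for d :: "3 \<times> 3 \<Rightarrow> 'k" and r s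
  proof -
    have "(\<Sum>rs\<in>UNIV. d rs * ((axis r 1 :: 'k ^ 3) $ fst rs * (axis s 1 :: 'k ^ 3) $ snd rs)) = (\<Sum>rs\<in>UNIV. if rs = (r, s) then d rs else 0)"
      by (intro sum.cong) (auto simp: axis_def)
    then show ?thesis by simp
  qed
  have rel: "l z * peval T (point3 i j k x y z) + q z z * B i j x y + a y z * B i k x z + b x z * B j k y z = 0" for x y z
  proof -
    let ?p = "point3 i j k x y z"
    have p: "(\<chi> r. ?p (i, r)) = x" "(\<chi> r. ?p (j, r)) = y" "(\<chi> r. ?p (k, r)) = z"
      "?p (i, r) = x $ r" "?p (j, r) = y $ r" "?p (k, r) = z $ r" for r
      using ne by (simp_all add: point3_def vec_eq_iff)
    have a: "a y z = (\<Sum>rs\<in>S3. c (Inr (Inr (Inl rs))) * (y $ fst rs * z $ snd rs))"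
      unfolding a_def S3_def by (intro sum.mono_neutral_cong_right) (auto simp: c3_def)
    have "0 = (\<Sum>x\<in>J. c x * peval (w x) ?p)"
      using arg_cong[OF c(2), of "\<lambda>f. peval f ?p"] by (simp add: peval_sum)
    also have "\<dots> = l z * peval T ?p + (q z z * B i j x y + (a y z * B i k x z + b x z * B j k y z))"
      unfolding J_def a
      by (simp add: sum.Plus S2_def[THEN arg_cong[of _ _ finite]] w_def peval_mult peval_F ne p split_def l_def q_def b_def
          c1_def c2_def c4_def sum_distrib_left sum_distrib_right mult_ac)
    finally show ?thesis by (simp add: add.assoc)
  qed
  show ?thesis
  proof (rule epipoles_of_relation[where T = "\<lambda>x y z. peval T (point3 i j k x y z)" and N = "B i k" and l = l and q = q and a = a and b = b])
    show "bilin a" "bilin b" "bilin q" unfolding a_def[abs_def] b_def[abs_def] q_def[abs_def] by (rule bil)+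
    show "lin l" by (simp add: lin_def l_def distrib_left sum.distrib sum_distrib_left mult_ac)
    show "lin (\<lambda>z. peval T (point3 i j k x y z))" for x y
    proof -
      have eq: "(\<lambda>z. peval T (point3 i j k x y z)) = (\<lambda>z. peval T (set_block (point3 i j k x y 0) k z))"
        by (rule ext, rule arg_cong[where f = "peval T"]) (use ne in \<open>auto simp: point3_def set_block_def\<close>)
      show ?thesis unfolding eq by (rule lin_set_block[OF T(2)]) (use ne in \<open>simp add: deg3_def\<close>)
    qed
    show "\<exists>c. x' = c *s x" if "x \<noteq> 0" "\<forall>y. B i j x y = 0" "\<forall>y. B i j x' y = 0" for x x'
      using B_kernel_line[OF dist that] .
    show "\<exists>c. y' = c *s y" if "y \<noteq> 0" "\<forall>x. B i j x y = 0" "\<forall>x. B i j x y' = 0" for y y'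
      using B_kernel_line[of j i k y y'] that ne unfolding B_commute[of i j] by auto
    show "\<exists>c. y' = c *s y" if "y \<noteq> 0" "\<forall>x. B i k x y = 0" "\<forall>x. B i k x y' = 0" for y y'
      using B_kernel_line[of k i j y y'] that ne unfolding B_commute[of i k] by auto
    show "\<exists>c. y' = c *s y" if "y \<noteq> 0" "\<forall>x. B j k x y = 0" "\<forall>x. B j k x y' = 0" for y y'
      using B_kernel_line[of k j i y y'] that ne unfolding B_commute[of j k] by auto
    show "x = 0" if "\<forall>y. B i j x y = 0" "\<forall>z. B i k x z = 0" for x
      using B_no_common_kernel[OF dist that] .
    show "y = 0" if "\<forall>x. B i j x y = 0" "\<forall>z. B j k y z = 0" for y
      using B_no_common_kernel[of j i k y] that ne unfolding B_commute[of i j] by auto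
    show "z = 0" if "\<forall>x. B i k x z = 0" "\<forall>y. B j k y z = 0" for z
      using B_no_common_kernel[of k i j z] that ne unfolding B_commute[of i k] B_commute[of j k] by auto
  next
    fix s assume l0: "\<forall>z. l z = 0" and q0: "\<forall>z. q z z = 0" and a0: "\<forall>y z. a y z = s * B j k y z"
      and b0: "\<forall>x z. b x z = - s * B i k x z"
    have c1: "c1 r = 0" for r
      using l0[rule_format, of "axis r 1"] by (simp add: l_def axis_def if_distrib[of "\<lambda>x. _ * x"] cong: if_cong)
    have "c3 (r0, s0) = s * coef2 (F j k) j k r0 s0"
      using a0[rule_format, of "axis r0 1" "axis s0 1"] unfolding a_def bil_axis B_def form2_axis .
    then have s: "s = 0" using rs0 by (simp add: c3_def)
    have c3: "c3 rs = 0" for rs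
      using a0[rule_format, of "axis (fst rs) 1" "axis (snd rs) 1"] s unfolding a_def bil_axis by simp
    have c4: "c4 rs = 0" for rs
      using b0[rule_format, of "axis (fst rs) 1" "axis (snd rs) 1"] s unfolding b_def bil_axis by simp
    have qe: "q z z = c2 (1,1) * (z $ 1 * z $ 1) + (c2 (1,2) * (z $ 1 * z $ 2) + (c2 (1,3) * (z $ 1 * z $ 3) +
        (c2 (2,2) * (z $ 2 * z $ 2) + (c2 (2,3) * (z $ 2 * z $ 3) + c2 (3,3) * (z $ 3 * z $ 3)))))" for z
      by (simp add: q_def S2_def)
    have d: "c2 (1,1) = 0" "c2 (2,2) = 0" "c2 (3,3) = 0"
      using q0[rule_format, of "axis 1 1"] q0[rule_format, of "axis 2 1"] q0[rule_format, of "axis 3 1"]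
      unfolding qe by (simp_all add: axis_def)
    moreover have "c2 (1,2) = 0" "c2 (1,3) = 0" "c2 (2,3) = 0"
      using q0[rule_format, of "axis 1 1 + axis 2 1"] q0[rule_format, of "axis 1 1 + axis 3 1"]
        q0[rule_format, of "axis 2 1 + axis 3 1"] d
      unfolding qe by (simp_all add: axis_def)
    ultimately have c2: "c2 rs = 0" if "rs \<in> S2" for rs using that by (auto simp: S2_def)
    have "c (Inr (Inr (Inl rs))) = 0" if "rs \<in> S3" for rs
      using c3[of rs] that by (auto simp: c3_def S3_def)
    then have "c x = 0" if "x \<in> J" for x
      using that c1 c2 c4 unfolding J_def c1_def c2_def c4_def by auto
    then show False using c(1) by blast
  next
    fix c0 a1 b1 :: "'k ^ 3 \<Rightarrow> 'k"
    assume "lin c0" "lin a1" "lin b1"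
      "\<forall>x y z. peval T (point3 i j k x y z) = c0 z * B i j x y + a1 y * B i k x z + b1 x * B j k y z"
    then show False using T_notin by blast
  qed (use bilin_B rel in blast)+
qed

end

section \<open>Reconstruction of the cameras\<close>

definition cross :: "'k::field ^ 3 \<Rightarrow> 'k ^ 3 \<Rightarrow> 'k ^ 3" where
  "cross u v = (\<chi> r. if r = 1 then u $ 2 * v $ 3 - u $ 3 * v $ 2
     else if r = 2 then u $ 3 * v $ 1 - u $ 1 * v $ 3 else u $ 1 * v $ 2 - u $ 2 * v $ 1)"

definition dot :: "'k::field ^ 3 \<Rightarrow> 'k ^ 3 \<Rightarrow> 'k" where
  "dot u v = u $ 1 * v $ 1 + u $ 2 * v $ 2 + u $ 3 * v $ 3"

lemma cross_components [simp]:
  "cross u v $ 1 = u $ 2 * v $ 3 - u $ 3 * v $ 2" "cross u v $ 2 = u $ 3 * v $ 1 - u $ 1 * v $ 3"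
  "cross u v $ 3 = u $ 1 * v $ 2 - u $ 2 * v $ 1"
  by (simp_all add: cross_def)

text \<open>Cramer's rule for \<open>cross a b\<close> in terms of \<open>u\<close>,
  \<open>v\<close>, \<open>w\<close>; the coordinates are the determinants of Lagrange's
  identity.\<close>

lemma cross_expand:
  "dot (cross u v) w *s cross a b = (dot a u * dot b v - dot a v * dot b u) *s w +
     (dot a v * dot b w - dot a w * dot b v) *s u + (dot a w * dot b u - dot a u * dot b w) *s v"
  unfolding vec_eq_iff forall_3 by (simp add: dot_def) algebra

lemma cross_zero_imp:
  assumes "cross u v = 0" "u \<noteq> 0" shows "\<exists>c. v = c *s u"
proof -
  have e: "u $ 2 * v $ 3 = u $ 3 * v $ 2" "u $ 3 * v $ 1 = u $ 1 * v $ 3" "u $ 1 * v $ 2 = u $ 2 * v $ 1"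
    using assms(1) unfolding vec_eq_iff forall_3 by simp_all
  consider "u $ 1 \<noteq> 0" | "u $ 2 \<noteq> 0" | "u $ 3 \<noteq> 0" using assms(2) unfolding vec_eq_iff forall_3 by auto
  then show ?thesis
  proof cases
    case 1
    then have "v = (v $ 1 / u $ 1) *s u" using e unfolding vec_eq_iff forall_3 by (simp add: field_simps)
    then show ?thesis by blast
  next
    case 2
    then have "v = (v $ 2 / u $ 2) *s u" using e unfolding vec_eq_iff forall_3 by (simp add: field_simps)
    then show ?thesis by blast
  next
    case 3
    then have "v = (v $ 3 / u $ 3) *s u" using e unfolding vec_eq_iff forall_3 by (simp add: field_simps)
    then show ?thesis by blast
  qed
qed

lemma basis_expand:
  assumes "dot (cross u v) w \<noteq> 0"
  shows "\<exists>a b c. x = a *s u + b *s v + c *s w"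
proof -
  let ?D = "dot (cross u v) w"
  have "?D *s x = dot (cross v w) x *s u + dot (cross w u) x *s v + dot (cross u v) x *s w"
    unfolding vec_eq_iff forall_3 by (simp add: dot_def) algebra
  then have "x = inverse ?D *s (dot (cross v w) x *s u + dot (cross w u) x *s v + dot (cross u v) x *s w)"
    using assms by (metis left_inverse vector_smult_assoc vector_smult_lid)
  then have "x = (inverse ?D * dot (cross v w) x) *s u + (inverse ?D * dot (cross w u) x) *s v +
      (inverse ?D * dot (cross u v) x) *s w"
    by (simp only: vec.scale_right_distrib vector_smult_assoc)
  then show ?thesis by blast
qed

lemma lin_basis_zero:
  assumes "lin f" "dot (cross u v) w \<noteq> 0" "f u = 0" "f v = 0" "f w = 0"
  shows "f x = 0"
  using basis_expand[OF assms(2), of x] by (auto simp: linD[OF assms(1)] assms(3-))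

lemma exists_third_basis_vector:
  assumes "u \<noteq> 0" "\<And>c. v \<noteq> c *s u"
  shows "\<exists>w. dot (cross u v) w \<noteq> 0"
proof (rule ccontr)
  assume "\<not> ?thesis"
  then have "dot (cross u v) (axis r 1) = 0" for r by blast
  from this[of 1] this[of 2] this[of 3] have "cross u v = 0"
    unfolding vec_eq_iff forall_3 by (simp add: dot_def axis_def)
  then show False using cross_zero_imp assms by blast
qed

lemma proportional_same_kernel:
  assumes "lin f" "lin g" "\<And>z. f z = 0 \<longleftrightarrow> g z = 0"
  shows "\<exists>s. \<forall>z. g z = s * f z"
proof (cases "\<exists>z. f z \<noteq> 0")
  case True
  then obtain z0 where z0: "f z0 \<noteq> 0" by blast
  have "g z = g z0 / f z0 * f z" for z
  proof -
    have "f (z - (f z / f z0) *s z0) = 0" using z0 by (simp add: linD[OF assms(1)])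
    then have "g (z - (f z / f z0) *s z0) = 0" using assms(3) by blast
    then show ?thesis by (simp add: linD[OF assms(2)])
  qed
  then show ?thesis by blast
next
  case False
  then show ?thesis using assms(3) by auto
qed

lemma proportional_common_zeros:
  fixes f g :: "'k::field ^ 3 \<Rightarrow> 'k"
  assumes "lin f" "lin g" "u \<noteq> 0" "\<And>c. v \<noteq> c *s u" "f u = 0" "f v = 0" "g u = 0" "g v = 0" "f x0 \<noteq> 0"
  shows "\<exists>s. \<forall>z. g z = s * f z"
proof -
  obtain w where w: "dot (cross u v) w \<noteq> 0" using exists_third_basis_vector[OF assms(3,4)] by blast
  have "f w \<noteq> 0" using lin_basis_zero[OF assms(1) w assms(5,6)] assms(9) by blast
  define c where "c = g w / f w"
  have "lin (\<lambda>z. g z - c * f z)"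
    using assms(1,2) by (simp add: lin_def algebra_simps)
  then have "g z - c * f z = 0" for z
    by (rule lin_basis_zero[OF _ w]) (use assms(5-8) \<open>f w \<noteq> 0\<close> in \<open>simp_all add: c_def\<close>)
  then have "\<forall>z. g z = c * f z" by simp
  then show ?thesis ..
qed

lemma matrix_of_linear:
  fixes g :: "'k::field ^ 4 \<Rightarrow> 'k ^ 3"
  assumes "\<And>r. lin (\<lambda>X. g X $ r)"
  shows "\<exists>M. \<forall>X. M *v X = g X"
proof (intro exI allI)
  fix X
  show "(\<chi> r j. g (axis j 1) $ r) *v X = g X"
    unfolding vec_eq_iff by (simp add: matrix_vector_mult_def lin_expand[OF assms, of X] mult.commute)
qed

context nondegenerate_point
begin

text \<open>The vectors supplied by \<open>epipoles\<close> depend on the third view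
  \<open>k\<close>. Since the kernels are lines, they are multiples of vectors chosen once for each
  ordered pair.\<close>

lemma exists_epipoles:
  assumes card: "CARD('n) \<ge> 3"
  shows "\<exists>e. (\<forall>i j. i \<noteq> j \<longrightarrow> e i j \<noteq> 0 \<and> (\<forall>y. B i j (e i j) y = 0)) \<and>
    (\<forall>i j k. distinct [i, j, k] \<longrightarrow> (\<forall>z. B i k (e i j) z = 0 \<longleftrightarrow> B j k (e j i) z = 0))"
proof -
  have third: "\<exists>k. distinct [i, j, k]" if "i \<noteq> j" for i j :: 'n
  proof (rule ccontr)
    assume "\<not> ?thesis"
    then have "UNIV \<subseteq> {i, j}" using that by auto
    then have "CARD('n) \<le> card {i, j}" by (intro card_mono) auto
    also have "\<dots> \<le> 2" by (simp add: card_insert_if)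
    finally show False using card by simp
  qed
  have "\<forall>ij. \<exists>e. fst ij \<noteq> snd ij \<longrightarrow> e \<noteq> 0 \<and> (\<forall>y. B (fst ij) (snd ij) e y = 0)"
    using third epipoles by (metis prod.collapse)
  then obtain e0 where "\<And>ij. fst ij \<noteq> snd ij \<Longrightarrow> e0 ij \<noteq> 0 \<and> (\<forall>y. B (fst ij) (snd ij) (e0 ij) y = 0)" by metis
  then have e: "e0 (i, j) \<noteq> 0" "\<forall>y. B i j (e0 (i, j)) y = 0" if "i \<noteq> j" for i j using that by auto
  have ep: "B i k (e0 (i, j)) z = 0 \<longleftrightarrow> B j k (e0 (j, i)) z = 0" if dist: "distinct [i, j, k]" for i j k z
  proof -
    have ne: "i \<noteq> j" "j \<noteq> i" "distinct [j, i, k]" using dist by auto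
    obtain f f' where f: "f \<noteq> 0" "f' \<noteq> 0" "\<forall>y. B i j f y = 0" "\<forall>x. B i j x f' = 0" "\<forall>z. B i k f z = 0 \<longleftrightarrow> B j k f' z = 0"
      using epipoles[OF dist] by blast
    have f': "\<forall>x. B j i f' x = 0" using f(4) by (simp add: B_commute[of i j])
    obtain c c' where c: "f = c *s e0 (i, j)" "f' = c' *s e0 (j, i)"
      using B_kernel_line[OF dist e[OF ne(1)] f(3)] B_kernel_line[OF ne(3) e[OF ne(2)] f'] by blast
    then have "c \<noteq> 0" "c' \<noteq> 0" using f(1,2) by auto
    then show ?thesis using f(5)[rule_format, of z] by (simp add: c B_lin1)
  qed
  show ?thesis
    by (rule exI[of _ "\<lambda>i j. e0 (i, j)"], intro conjI allI impI) (use e in blast, use e in blast, rule ep)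
qed

text \<open>Since \<open>e'\<close> spans the missing direction of view \<open>j\<close>, the form
  can be written with only the two linear forms \<open>f 1\<close> and \<open>f 2\<close> on view
  \<open>i\<close>. The form \<open>f 3\<close>, taken from a third view, completes them to
  coordinates.\<close>

lemma first_two_cameras:
  assumes dist: "distinct [i, j, k]" and e': "e' \<noteq> 0" "\<forall>x. B i j x e' = 0"
  shows "\<exists>(M1 :: 'k ^ 4 ^ 3) (M2 :: 'k ^ 4 ^ 3). surj ((*v) M1) \<and> surj ((*v) M2) \<and>
    (\<forall>X. M1 *v X = 0 \<longrightarrow> M2 *v X = 0 \<longrightarrow> X = 0) \<and> (\<forall>X. B i j (M1 *v X) (M2 *v X) = 0)"
proof -
  define f where "f s x = (if s = 1 then B i j x (axis 2 1) else if s = 2 then B i j x (axis 3 1) else B i k x (axis 3 1))" for s :: 3 and x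
  define R :: "'k ^ 3 ^ 3" where "R = (\<chi> s r. f s (axis r 1))"
  have lf: "lin (f s)" for s
    by (cases "s = 1"; cases "s = 2") (simp_all add: f_def[abs_def] bilinD(2)[OF bilin_B])
  have R: "(R *v x) $ s = f s x" for x s
    by (simp add: R_def matrix_vector_mult_def lin_expand[OF lf, of s x] mult.commute)
  have "inj ((*v) R)"
    unfolding vec.inj_iff_eq_0
  proof (intro allI impI)
    fix x assume "R *v x = 0"
    then have "f s x = 0" for s using R[of x s] by simp
    from this[of 1] this[of 2] this[of 3] show "x = 0" by (intro B_columns[OF dist]) (simp_all add: f_def)
  qed
  then obtain L where L: "L ** R = mat 1" using matrix_left_invertible_injective[of R] by blast
  then have RL: "R ** L = mat 1" by (simp add: matrix_left_right_inverse)
  have Rinv: "R *v (L *v y) = y" "L *v (R *v x) = x" for x y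
    by (simp_all add: matrix_vector_mul_assoc L RL)
  define emb where "emb X = (\<chi> s :: 3. if s = 1 then X $ 1 else if s = 2 then X $ 2 else X $ 3)" for X :: "'k ^ 4"
  have "lin (\<lambda>X. (L *v emb X) $ r)" for r
    by (simp add: lin_def matrix_vector_mult_def sum_3 emb_def algebra_simps)
  then obtain M1 where M1: "\<And>X. M1 *v X = L *v emb X" using matrix_of_linear[of "\<lambda>X. L *v emb X"] by blast
  have fM1: "f 1 (M1 *v X) = X $ 1" "f 2 (M1 *v X) = X $ 2" "f 3 (M1 *v X) = X $ 3" for X
    unfolding R[symmetric] M1 Rinv by (simp_all add: emb_def)
  have Bx: "B i j x y = y $ 1 * B i j x (axis 1 1) + y $ 2 * f 1 x + y $ 3 * f 2 x" for x y
    by (simp add: lin_expand[OF bilinD(1)[OF bilin_B], of i j x y] sum_3 f_def)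
  have "e' $ 1 \<noteq> 0"
  proof
    assume 0: "e' $ 1 = 0"
    have "y $ 2 = 0" "y $ 3 = 0" if "\<And>x. y $ 2 * f 1 x + y $ 3 * f 2 x = 0" for y :: "'k ^ 3"
      using that[of "M1 *v axis 1 1"] that[of "M1 *v axis 2 1"] by (simp_all add: fM1 axis_def)
    moreover have "e' $ 2 * f 1 x + e' $ 3 * f 2 x = 0" for x using e'(2) Bx[of x e'] 0 by simp
    ultimately have "e' = 0" using 0 unfolding vec_eq_iff forall_3 by simp
    with e'(1) show False by simp
  qed
  define b1 b2 where "b1 = - e' $ 2 / e' $ 1" and "b2 = - e' $ 3 / e' $ 1"
  have ax: "B i j x (axis 1 1) = b1 * f 1 x + b2 * f 2 x" for x
  proof -
    have "e' $ 1 * B i j x (axis 1 1) = - e' $ 2 * f 1 x - e' $ 3 * f 2 x"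
      using e'(2) Bx[of x e'] by (simp add: algebra_simps eq_neg_iff_add_eq_0)
    then show ?thesis using \<open>e' $ 1 \<noteq> 0\<close> by (simp add: b1_def b2_def field_simps)
  qed
  have Bx': "B i j x y = (y $ 2 + b1 * y $ 1) * f 1 x + (y $ 3 + b2 * y $ 1) * f 2 x" for x y
    unfolding Bx[of x y] ax by (simp add: algebra_simps)
  \<comment> \<open>With \<open>f 1 = X $ 1\<close> and \<open>f 2 = X $ 2\<close> on view
    \<open>i\<close>, this choice makes the two factors in \<open>Bx'\<close> equal to
    \<open>X $ 2\<close> and \<open>- X $ 1\<close>, so the terms cancel; \<open>X $ 4\<close> is
    the free coordinate along \<open>e'\<close>.\<close>
  define g where "g X = (\<chi> s :: 3. if s = 1 then X $ 4 else if s = 2 then X $ 2 - b1 * X $ 4 else - X $ 1 - b2 * X $ 4)" for X :: "'k ^ 4"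
  have "lin (\<lambda>X. g X $ r)" for r
    by (simp add: lin_def g_def algebra_simps)
  then obtain M2 where M2: "\<And>X. M2 *v X = g X" using matrix_of_linear[of g] by blast
  have "surj ((*v) M1)"
  proof (rule surjI)
    fix y :: "'k ^ 3"
    show "M1 *v (\<chi> l. if l = 1 then (R *v y) $ 1 else if l = 2 then (R *v y) $ 2 else if l = 3 then (R *v y) $ 3 else 0) = y"
    proof -
      have "emb (\<chi> l. if l = 1 then (R *v y) $ 1 else if l = 2 then (R *v y) $ 2 else if l = 3 then (R *v y) $ 3 else 0) = R *v y"
        unfolding vec_eq_iff forall_3 by (simp add: emb_def)
      then show ?thesis by (simp add: M1 Rinv)
    qed
  qed
  moreover have "surj ((*v) M2)"
  proof (rule surjI)
    fix y :: "'k ^ 3"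
    show "M2 *v (\<chi> l. if l = 1 then - y $ 3 - b2 * y $ 1 else if l = 2 then y $ 2 + b1 * y $ 1 else if l = 3 then 0 else y $ 1) = y"
      unfolding M2 vec_eq_iff forall_3 by (simp add: g_def)
  qed
  moreover have "X = 0" if "M1 *v X = 0" "M2 *v X = 0" for X
  proof -
    have "X $ 1 = 0" "X $ 2 = 0" "X $ 3 = 0" using fM1[of X] by (simp_all add: that linD[OF lf])
    moreover have "X $ 4 = 0" using that(2) unfolding M2 vec_eq_iff forall_3 by (simp add: g_def)
    ultimately show ?thesis unfolding vec_eq_iff forall_4 by simp
  qed
  moreover have "B i j (M1 *v X) (M2 *v X) = 0" for X
    unfolding Bx' fM1 M2 by (simp add: g_def algebra_simps)
  ultimately show ?thesis by blast
qed

end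

context nondegenerate_point
begin

definition cross_form :: "'n \<Rightarrow> 'n \<Rightarrow> 'n \<Rightarrow> 'k ^ 3 \<Rightarrow> 'k ^ 3 \<Rightarrow> 'k ^ 3" where
  "cross_form i j k x y = cross (\<chi> r. B i k x (axis r 1)) (\<chi> r. B j k y (axis r 1))"

text \<open>The epipolar lines of \<open>x\<close> and \<open>y\<close> in the image of a further camera meet in a point that, along
  the variety of \<open>F i j\<close>, is a linear form times the image under that camera.\<close>

lemma third_camera:
  fixes M1 M2 :: "'k ^ 4 ^ 3"
  assumes dist: "distinct [i, j, k]"
    and e0: "\<And>i j. i \<noteq> j \<Longrightarrow> e i j \<noteq> 0" and eB: "\<And>i j y. i \<noteq> j \<Longrightarrow> B i j (e i j) y = 0"
    and ee: "\<And>i j k z. distinct [i, j, k] \<Longrightarrow> B i k (e i j) z = 0 \<longleftrightarrow> B j k (e j i) z = 0"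
    and M: "surj ((*v) M1)" "surj ((*v) M2)" "\<And>X. M1 *v X = 0 \<Longrightarrow> M2 *v X = 0 \<Longrightarrow> X = 0"
    and BM: "\<And>X. B i j (M1 *v X) (M2 *v X) = 0"
  shows "\<exists>(M3 :: 'k ^ 4 ^ 3) m. surj ((*v) M3) \<and> (\<forall>X. M1 *v X = 0 \<longrightarrow> M3 *v X = 0 \<longrightarrow> X = 0) \<and>
    (\<forall>X. M2 *v X = 0 \<longrightarrow> M3 *v X = 0 \<longrightarrow> X = 0) \<and> (\<forall>X. B i k (M1 *v X) (M3 *v X) = 0) \<and>
    lin m \<and> (\<exists>X. m X \<noteq> 0) \<and> (\<forall>X. cross_form i j k (M1 *v X) (M2 *v X) = m X *s (M3 *v X))"
proof -
  have ne: "i \<noteq> j" "i \<noteq> k" "j \<noteq> k" "j \<noteq> i" "k \<noteq> i" "k \<noteq> j" using dist by auto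
  have eB': "B j i y (e i j) = 0" if "i \<noteq> j" for i j y using eB[OF that] by (simp add: B_commute[of j i])
  define u v where "u = e k i" and "v = e k j"
  have u: "u \<noteq> 0" "\<And>x. B i k x u = 0" and v: "v \<noteq> 0" "\<And>y. B j k y v = 0"
    using e0 eB' ne by (auto simp: u_def v_def)
  have vu: "v \<noteq> c *s u" for c
  proof
    assume "v = c *s u"
    then have "B i k x v = 0" for x using u by (simp add: B_lin2)
    then have "v = 0"
      using v(2) ne by (intro B_no_common_kernel[of k i j v]) (auto simp: B_commute[of k])
    with v(1) show False by simp
  qed
  obtain w where w: "dot (cross u v) w \<noteq> 0" using exists_third_basis_vector[OF u(1) vu] by blast
  define D where "D = dot (cross u v) w"
  define l1 l2 where "l1 x = B i k x v" and "l2 y = B j k y u" for x y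
  have lin_l: "lin l1" "lin l2" unfolding l1_def[abs_def] l2_def[abs_def] by (rule bilinD(2)[OF bilin_B])+
  \<comment> \<open>Polarising \<open>BM\<close>: the pulled back form is alternating.\<close>
  have alt: "B i j (M1 *v X) (M2 *v Y) = - B i j (M1 *v Y) (M2 *v X)" for X Y
    using BM[of "X + Y"] BM[of X] BM[of Y] by (simp add: vec.add B_lin1 B_lin2 eq_neg_iff_add_eq_0 add.commute)
  have l1_e: "l1 (e i j) = 0" "l1 (e i k) = 0"
    using ee[OF dist, of v] v(2) eB ne by (auto simp: l1_def)
  have "\<exists>x. l1 x \<noteq> 0"
  proof (rule ccontr)
    assume "\<not> ?thesis"
    then have "v = 0"
      using v(2) ne by (intro B_no_common_kernel[of k i j v]) (auto simp: B_commute[of k] l1_def)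
    with v(1) show False by simp
  qed
  then obtain x1 where x1: "l1 x1 \<noteq> 0" by blast
  have "\<exists>y. l2 y \<noteq> 0"
  proof (rule ccontr)
    assume "\<not> ?thesis"
    then have "u = 0"
      using u(2) ne by (intro B_no_common_kernel[of k i j u]) (auto simp: B_commute[of k] l2_def)
    with u(1) show False by simp
  qed
  then obtain y1 where y1: "l2 y1 \<noteq> 0" by blast
  obtain E where E: "e i k = M1 *v E" using M(1) by (metis surjD)
  have e_indep: "e i k \<noteq> c *s e i j" for c
  proof
    assume c: "e i k = c *s e i j"
    have "B i j (e i k) y = 0" for y unfolding c using eB[OF ne(1)] by (simp add: B_lin1)
    then have "e i k = 0"
      using eB[OF ne(2)] by (intro B_no_common_kernel[OF dist]) auto
    then show False using e0 ne by blast
  qed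
  \<comment> \<open>Both linear forms vanish at the two independent epipoles of view
    \<open>i\<close>, so they are proportional. This links \<open>l2\<close> on view
    \<open>j\<close> to \<open>l1\<close> on view \<open>i\<close>.\<close>
  have "\<exists>s. \<forall>x. B i j x (M2 *v E) = s * l1 x"
  proof (rule proportional_common_zeros[where u = "e i j" and v = "e i k" and f = l1 and ?x0.0 = x1])
    show "B i j (e i k) (M2 *v E) = 0" unfolding E by (rule BM)
    show "B i j (e i j) (M2 *v E) = 0" using eB ne by blast
  qed (use lin_l l1_e x1 e0 ne e_indep bilinD(2)[OF bilin_B] in auto)
  then obtain s1 where s1: "\<And>x. B i j x (M2 *v E) = s1 * l1 x" by blast
  have "B i j (e i k) y = 0 \<longleftrightarrow> l2 y = 0" for y
    using ee[of i k j y] ne by (simp add: l2_def u_def B_commute[of j k])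
  then obtain s2 where s2: "\<And>y. l2 y = s2 * B i j (e i k) y"
    using proportional_same_kernel[OF bilinD(1)[OF bilin_B] lin_l(2)] by metis
  define s where "s = - s2 * s1"
  have l2M: "l2 (M2 *v X) = s * l1 (M1 *v X)" for X
    unfolding s2 E alt[of E X] s1 s_def by simp
  have "s \<noteq> 0"
  proof
    assume "s = 0"
    obtain X where "y1 = M2 *v X" using M(2) by (metis surjD)
    then show False using l2M[of X] y1 \<open>s = 0\<close> by simp
  qed
  define al be where "al X = B i k (M1 *v X) w" and "be X = B j k (M2 *v X) w" for X
  \<comment> \<open>These are the coordinates of the cross product from \<open>cross_expand\<close>,
    with \<open>l2\<close> replaced by \<open>s * l1\<close> and the common factor \<open>l1\<close>
    removed.\<close>
  define g where "g X = (- s * l1 (M1 *v X)) *s w + be X *s u + (s * al X) *s v" for X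
  have lin_M: "lin (\<lambda>X. h (M' *v X))" if "lin h" for h :: "'k ^ 3 \<Rightarrow> 'k" and M' :: "'k ^ 4 ^ 3"
    using that by (simp add: lin_def vec.add vec.scale)
  have lin_ab: "lin al" "lin be" "lin (\<lambda>X. l1 (M1 *v X))"
    unfolding al_def[abs_def] be_def[abs_def] by (intro lin_M bilinD(2)[OF bilin_B] lin_l)+
  have "lin (\<lambda>X. g X $ r)" for r
    using lin_ab by (simp add: lin_def g_def algebra_simps)
  then obtain M3 where M3: "\<And>X. M3 *v X = g X" using matrix_of_linear[of g] by blast
  have dotB: "dot (\<chi> r. B a b x (axis r 1)) z = B a b x z" for a b x z
    unfolding lin_expand[OF bilinD(1)[OF bilin_B], of a b x z] by (simp add: dot_def sum_3 mult.commute)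
  have cf: "cross_form i j k (M1 *v X) (M2 *v X) = (l1 (M1 *v X) / D) *s (M3 *v X)" for X
  proof -
    have "D *s cross_form i j k (M1 *v X) (M2 *v X) = l1 (M1 *v X) *s g X"
      unfolding cross_form_def D_def cross_expand dotB
      by (simp add: u v g_def al_def be_def l2M[unfolded l2_def] l1_def[symmetric] vec_eq_iff algebra_simps)
    then have "inverse D *s (D *s cross_form i j k (M1 *v X) (M2 *v X)) = inverse D *s (l1 (M1 *v X) *s g X)" by simp
    then show ?thesis using w by (simp add: vector_smult_assoc M3 D_def[symmetric] divide_inverse mult.commute)
  qed
  have be_nz: "be X \<noteq> 0" "l1 (M1 *v X) = 0" "al X = 0" if X: "M1 *v X = 0" "X \<noteq> 0" for X
  proof -
    show "l1 (M1 *v X) = 0" "al X = 0" using X by (simp_all add: al_def linD[OF lin_l(1)] B_lin1)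
    show "be X \<noteq> 0"
    proof
      assume be0: "be X = 0"
      have "B i j x (M2 *v X) = 0" for x
      proof -
        obtain Y where "x = M1 *v Y" using M(1) by (metis surjD)
        then show ?thesis using alt[of Y X] X by (simp add: B_lin1)
      qed
      then have "\<forall>y. B j i (M2 *v X) y = 0" by (simp add: B_commute[of j i])
      then obtain c where c: "M2 *v X = c *s e j i"
        using B_kernel_line[of j i k "e j i" "M2 *v X"] e0[OF ne(4)] eB[OF ne(4)] ne by auto
      have "lin (B j k (M2 *v X))" by (rule bilinD(1)[OF bilin_B])
      moreover have "B j k (M2 *v X) u = 0" using ee[OF dist, of u] u(2) by (simp add: c B_lin1)
      moreover have "B j k (M2 *v X) v = 0" by (rule v(2))
      moreover have "B j k (M2 *v X) w = 0" using be0 by (simp add: be_def)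
      ultimately have "B j k (M2 *v X) z = 0" for z using lin_basis_zero[OF _ w] by blast
      moreover have "B j i (M2 *v X) z = 0" for z using eB ne by (simp add: c B_lin1)
      ultimately have "M2 *v X = 0" using ne by (intro B_no_common_kernel[of j i k]) auto
      then show False using M(3) X by blast
    qed
  qed
  have al_nz: "al X \<noteq> 0" "l1 (M1 *v X) = 0" "be X = 0" if X: "M2 *v X = 0" "X \<noteq> 0" for X
  proof -
    show "l1 (M1 *v X) = 0" using l2M[of X] X \<open>s \<noteq> 0\<close> by (simp add: linD[OF lin_l(2)])
    show "be X = 0" using X by (simp add: be_def B_lin1)
    show "al X \<noteq> 0"
    proof
      assume al0: "al X = 0"
      have "B i j (M1 *v X) y = 0" for y
      proof -
        obtain Y where "y = M2 *v Y" using M(2) by (metis surjD)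
        then show ?thesis using alt[of X Y] X by (simp add: B_lin2)
      qed
      then obtain c where c: "M1 *v X = c *s e i j"
        using B_kernel_line[OF dist, of "e i j" "M1 *v X"] e0 eB ne by auto
      have "lin (B i k (M1 *v X))" by (rule bilinD(1)[OF bilin_B])
      moreover have "B i k (M1 *v X) u = 0" by (rule u(2))
      moreover have "B i k (M1 *v X) v = 0" using l1_e by (simp add: c B_lin1 l1_def)
      moreover have "B i k (M1 *v X) w = 0" using al0 by (simp add: al_def)
      ultimately have "B i k (M1 *v X) z = 0" for z using lin_basis_zero[OF _ w] by blast
      moreover have "B i j (M1 *v X) z = 0" for z using eB ne by (simp add: c B_lin1)
      ultimately have "M1 *v X = 0" by (intro B_no_common_kernel[OF dist]) auto
      then show False using M(3) X by blast
    qed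
  qed
  obtain X1 where X1: "X1 \<noteq> 0" "M1 *v X1 = 0" using surj_camera_kernel[OF M(1)] by blast
  obtain X2 where X2: "X2 \<noteq> 0" "M2 *v X2 = 0" using surj_camera_kernel[OF M(2)] by blast
  obtain X0 where X0: "x1 = M1 *v X0" using M(1) by (metis surjD)
  note n1 = be_nz[OF X1(2,1)] and n2 = al_nz[OF X2(2,1)]
  have "surj ((*v) M3)"
  proof (rule surjI[of _ "\<lambda>y. SOME X. M3 *v X = y"], rule someI_ex)
    fix y
    obtain a b c where y: "y = a *s u + b *s v + c *s w" using basis_expand[OF w] by blast
    define c0 where "c0 = c / (- s * l1 x1)"
    \<comment> \<open>\<open>X0\<close> adjusts the coordinate along \<open>w\<close>; the centre
      \<open>X1\<close> of the first camera changes only \<open>be\<close> and the centre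
      \<open>X2\<close> of the second only \<open>al\<close>, which adjusts the other two.\<close>
    define X where "X = ((a - c0 * be X0) / be X1) *s X1 + ((b - s * (c0 * al X0)) / (s * al X2)) *s X2 + c0 *s X0"
    have "l1 (M1 *v X) = c0 * l1 x1"
      unfolding X_def linD(1,2)[OF lin_ab(3)] n1 n2 X0 by simp
    moreover have "be X = a"
      unfolding X_def linD(1,2)[OF lin_ab(2)] n2 using n1 by simp
    moreover have "s * al X = b"
      unfolding X_def linD(1,2)[OF lin_ab(1)] n1 using n2 \<open>s \<noteq> 0\<close> by (simp add: field_simps)
    ultimately have "M3 *v X = y"
      using x1 \<open>s \<noteq> 0\<close> unfolding M3 g_def y c0_def by (simp add: algebra_simps)
    then show "\<exists>X. M3 *v X = y" ..
  qed
  moreover have "X = 0" if "M1 *v X = 0" "M3 *v X = 0" for X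
  proof (rule ccontr)
    assume "X \<noteq> 0"
    from be_nz[OF that(1) this] that(2) show False unfolding M3 g_def using u(1) by simp
  qed
  moreover have "X = 0" if "M2 *v X = 0" "M3 *v X = 0" for X
  proof (rule ccontr)
    assume "X \<noteq> 0"
    from al_nz[OF that(1) this] that(2) show False unfolding M3 g_def using v(1) \<open>s \<noteq> 0\<close> by simp
  qed
  moreover have "B i k (M1 *v X) (M3 *v X) = 0" for X
    unfolding M3 g_def by (simp add: B_lin2 u(2) l1_def[symmetric] al_def[symmetric])
  moreover have "lin (\<lambda>X. l1 (M1 *v X) / D)" using lin_ab(3) by (simp add: lin_def add_divide_distrib)
  moreover have "l1 (M1 *v X0) / D \<noteq> 0" using x1 w X0 by (simp add: D_def)
  ultimately show ?thesis
    using cf by (intro exI[of _ M3] exI[of _ "\<lambda>X. l1 (M1 *v X) / D"]) blast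
qed

lemma reconstruction:
  assumes card: "CARD('n) \<ge> 3" and "i \<noteq> j"
  shows "\<exists>A m. generic A \<and> (\<forall>X. B i j (A i *v X) (A j *v X) = 0) \<and>
    (\<forall>k. k \<notin> {i, j} \<longrightarrow> lin (m k) \<and> (\<exists>X. m k X \<noteq> 0) \<and>
      (\<forall>X. cross_form i j k (A i *v X) (A j *v X) = m k X *s (A k *v X)))"
proof -
  from exists_epipoles[OF card] obtain e where e: "(\<forall>i j. i \<noteq> j \<longrightarrow> e i j \<noteq> 0 \<and> (\<forall>y. B i j (e i j) y = 0)) \<and>
    (\<forall>i j k. distinct [i, j, k] \<longrightarrow> (\<forall>z. B i k (e i j) z = 0 \<longleftrightarrow> B j k (e j i) z = 0))" by (rule exE)
  have e0: "e i j \<noteq> 0" and eB: "B i j (e i j) y = 0" if "i \<noteq> j" for i j y using e that by simp_all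
  have ee: "B i k (e i j) z = 0 \<longleftrightarrow> B j k (e j i) z = 0" if "distinct [i, j, k]" for i j k z
    using conjunct2[OF e] that by blast
  have "\<exists>k. k \<notin> {i, j}"
  proof (rule ccontr)
    assume "\<not> ?thesis"
    then have "CARD('n) \<le> card {i, j}" by (intro card_mono) auto
    then show False using card card_insert_le_m1[of 2 "{j}" i] by (simp add: card_insert_if split: if_splits)
  qed
  then obtain k0 where "k0 \<notin> {i, j}" by blast
  then have "distinct [i, j, k0]" using \<open>i \<noteq> j\<close> by auto
  then obtain M1 M2 :: "'k ^ 4 ^ 3" where M: "surj ((*v) M1)" "surj ((*v) M2)"
    "\<And>X. M1 *v X = 0 \<Longrightarrow> M2 *v X = 0 \<Longrightarrow> X = 0" "\<And>X. B i j (M1 *v X) (M2 *v X) = 0"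
    using first_two_cameras[of i j k0 "e j i"] e0 eB \<open>i \<noteq> j\<close> by (metis B_commute)
  define good where "good k M3 m \<longleftrightarrow> surj ((*v) M3) \<and> (\<forall>X. M1 *v X = 0 \<longrightarrow> M3 *v X = 0 \<longrightarrow> X = 0) \<and>
    (\<forall>X. M2 *v X = 0 \<longrightarrow> M3 *v X = 0 \<longrightarrow> X = 0) \<and> (\<forall>X. B i k (M1 *v X) (M3 *v X) = 0) \<and>
    lin m \<and> (\<exists>X. m X \<noteq> 0) \<and> (\<forall>X. cross_form i j k (M1 *v X) (M2 *v X) = m X *s (M3 *v X))"
    for k and M3 :: "'k ^ 4 ^ 3" and m
  have "\<exists>M3 m. good k M3 m" if "k \<notin> {i, j}" for k
    unfolding good_def using that \<open>i \<noteq> j\<close> by (intro third_camera[OF _ e0 eB ee M]) auto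
  then obtain C m where C: "\<And>k. k \<notin> {i, j} \<Longrightarrow> good k (C k) (m k)" by metis
  define A where "A k = (if k = i then M1 else if k = j then M2 else C k)" for k
  have Ai: "A i = M1" "A j = M2" "k \<notin> {i, j} \<Longrightarrow> A k = C k" for k using \<open>i \<noteq> j\<close> by (auto simp: A_def)
  \<comment> \<open>A common centre of two further cameras would have an image in view
    \<open>i\<close> that lies in the left kernels of two bilinear forms, and these meet
    trivially.\<close>
  have far: "X = 0" if k: "k \<notin> {i, j}" "k' \<notin> {i, j}" "k \<noteq> k'" and X: "C k *v X = 0" "C k' *v X = 0" for k k' X
  proof -
    have "B i h (M1 *v X) y = 0" if h: "h \<notin> {i, j}" "C h *v X = 0" for h y
    proof -
      have gh: "\<And>X. B i h (M1 *v X) (C h *v X) = 0" "surj ((*v) (C h))" using C[OF h(1)] by (auto simp: good_def)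
      obtain Y where Y: "y = C h *v Y" using gh(2) by (metis surjD)
      have "B i h (M1 *v (X + Y)) (C h *v (X + Y)) = 0" by (rule gh)
      then show ?thesis using gh(1)[of Y] h(2) by (simp add: vec.add B_lin1 B_lin2 Y)
    qed
    then have "M1 *v X = 0"
      using k X by (intro B_no_common_kernel[of i k k']) auto
    then show ?thesis using C[OF k(1)] X(1) by (auto simp: good_def)
  qed
  have "generic A"
    unfolding generic_def
  proof (intro conjI allI impI)
    show "surj ((*v) (A k))" for k using M(1,2) C[of k] by (auto simp: A_def good_def)
    fix k k' X assume "k \<noteq> k'" "A k *v X = 0" "A k' *v X = 0"
    then show "X = 0"
      using M(3) C[of k] C[of k'] far[of k k' X] unfolding good_def A_def by (auto split: if_splits)
  qed
  moreover have "\<forall>k. k \<notin> {i, j} \<longrightarrow> lin (m k) \<and> (\<exists>X. m k X \<noteq> 0) \<and>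
      (\<forall>X. cross_form i j k (A i *v X) (A j *v X) = m k X *s (A k *v X))"
    using C unfolding good_def by (simp add: Ai)
  ultimately show ?thesis using M(4) unfolding Ai[symmetric] by blast
qed

end

section \<open>Ideals near a multiview ideal are multiview ideals\<close>

text \<open>Polynomial along every line: this is enough to conclude that a product of functions that
  are not identically zero is not identically zero.\<close>

definition line_poly :: "('k::field ^ 4 \<Rightarrow> 'k) \<Rightarrow> bool" where
  "line_poly h \<longleftrightarrow> (\<forall>X Y. polyfun (\<lambda>t. h (X + t *s Y)))"

lemma line_poly_common_nonzero:
  fixes g h :: "'k::alg_closed_field ^ 4 \<Rightarrow> 'k"
  assumes "line_poly g" "line_poly h" "g X \<noteq> 0" "h Y \<noteq> 0"
  shows "\<exists>Z. g Z \<noteq> 0 \<and> h Z \<noteq> 0"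
proof -
  let ?l = "\<lambda>t. X + t *s (Y - X)"
  have pf: "polyfun (\<lambda>t. g (?l t))" "polyfun (\<lambda>t. h (?l t))"
    using assms(1,2) unfolding line_poly_def by blast+
  have nz: "g (?l 0) \<noteq> 0" "h (?l 1) \<noteq> 0" using assms(3,4) by simp_all
  have fin: "finite ({t. g (?l t) = 0} \<union> {t. h (?l t) = 0})"
    using polyfun_finite_zeros[OF pf(1) nz(1)] polyfun_finite_zeros[OF pf(2) nz(2)] by (rule finite_UnI)
  obtain t where "t \<notin> {t. g (?l t) = 0} \<union> {t. h (?l t) = 0}"
    using ex_new_if_finite[OF infinite_UNIV_alg_closed fin] by blast
  then show ?thesis by blast
qed

lemma line_poly_mult: "line_poly g \<Longrightarrow> line_poly h \<Longrightarrow> line_poly (\<lambda>X. g X * h X)"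
  by (auto simp: line_poly_def)

lemma line_poly_power: "line_poly g \<Longrightarrow> line_poly (\<lambda>X. g X ^ n)"
  by (auto simp: line_poly_def)

lemma line_poly_lin: "lin g \<Longrightarrow> line_poly g"
  by (auto simp: line_poly_def linD)

lemma line_poly_restr: "line_poly (restr A f)"
  unfolding line_poly_def restr_def
  by (intro allI polyfun_peval_const) (auto simp: cam_point_alt)

lemma line_poly_prod_nonzero:
  fixes g :: "'i \<Rightarrow> 'k::alg_closed_field ^ 4 \<Rightarrow> 'k"
  assumes "finite S" "\<And>i. i \<in> S \<Longrightarrow> line_poly (g i)" "\<And>i. i \<in> S \<Longrightarrow> \<exists>X. g i X \<noteq> 0"
  shows "line_poly (\<lambda>X. \<Prod>i\<in>S. g i X) \<and> (\<exists>X. (\<Prod>i\<in>S. g i X) \<noteq> 0)"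
  using assms
proof (induction S rule: finite_induct)
  case empty
  then show ?case by (simp add: line_poly_def)
next
  case (insert i S)
  have IH: "line_poly (\<lambda>X. \<Prod>i\<in>S. g i X)" "\<exists>Y. (\<Prod>i\<in>S. g i Y) \<noteq> 0"
    using insert.IH insert.prems by blast+
  have gi: "line_poly (g i)" "\<exists>X. g i X \<noteq> 0" using insert.prems by blast+
  obtain X Y where XY: "g i X \<noteq> 0" "(\<Prod>i\<in>S. g i Y) \<noteq> 0" using gi(2) IH(2) by blast
  show ?case
    using line_poly_common_nonzero[OF gi(1) IH(1) XY] line_poly_mult[OF gi(1) IH(1)]
    by (simp only: prod.insert[OF insert.hyps] mult_eq_0_iff) blast
qed

text \<open>On the line joining a point where \<open>f\<close> is nonzero to one where
  \<open>g\<close> is nonzero, both are nonzero at all but finitely many points.\<close>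

lemma mpoly_mult_eq_0:
  fixes f g :: "('v::finite, 'k::alg_closed_field) mpoly"
  assumes "f * g = 0" "f \<noteq> 0"
  shows "g = 0"
proof (rule ccontr)
  assume "g \<noteq> 0"
  obtain p q where pq: "peval f p \<noteq> 0" "peval g q \<noteq> 0"
    using peval_eq_0_imp \<open>g \<noteq> 0\<close> assms(2) by metis
  let ?l = "\<lambda>t v. p v + t * (q v - p v)"
  have pf: "polyfun (\<lambda>t. peval h (?l t))" for h :: "('v, 'k) mpoly"
    by (rule polyfun_peval_const) auto
  have "finite {t. peval f (?l t) = 0}" "finite {t. peval g (?l t) = 0}"
    using pq by (auto intro: polyfun_finite_zeros[OF pf, of _ 0] polyfun_finite_zeros[OF pf, of _ 1])
  then have fin: "finite ({t. peval f (?l t) = 0} \<union> {t. peval g (?l t) = 0})" by simp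
  obtain t where t: "t \<notin> {t. peval f (?l t) = 0} \<union> {t. peval g (?l t) = 0}"
    using ex_new_if_finite[OF infinite_UNIV_alg_closed fin] by blast
  have "peval (f * g) (?l t) = 0" unfolding assms(1) by simp
  then show False using t by (simp add: peval_mult)
qed

lemma monom_split:
  fixes m :: "('n::finite \<times> 3) monom"
  assumes "multideg fst m = u + u'"
  shows "\<exists>a b. m = a + b \<and> multideg fst a = u \<and> multideg fst b = u'"
  using assms
proof (induction "sum u UNIV" arbitrary: u m)
  case 0
  then have "u = 0" by (simp add: fun_eq_iff)
  then show ?case using 0 by (intro exI[of _ 0] exI[of _ m]) simp
next
  case (Suc d)
  then obtain i where i: "u i \<noteq> 0" by (metis sum.neutral nat.distinct(1))
  then obtain r m' where m': "m = Poly_Mapping.single (i, r) 1 + m'" "multideg fst m = unit_deg i + multideg fst m'"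
    using monom_split_variable[of m i] Suc(3) by auto
  define u0 where "u0 = u(i := u i - 1)"
  have u: "u = unit_deg i + u0" using i by (auto simp: u0_def unit_deg_def fun_eq_iff)
  have "sum u UNIV = Suc (sum u0 UNIV)" by (subst u) (simp add: sum.distrib unit_deg_def)
  then have d: "d = sum u0 UNIV" using Suc(2) by simp
  have "multideg fst m' = u0 + u'"
    using m'(2) unfolding Suc(3) u by (simp add: add.assoc)
  from Suc(1)[OF d this] obtain a b where ab: "m' = a + b" "multideg fst a = u0" "multideg fst b = u'" by blast
  have "multideg fst (Poly_Mapping.single (i, r) 1 + a) = u"
    unfolding multideg_add multideg_single ab(2) u by simp
  then show ?case using ab m'(1)
    by (intro exI[of _ "Poly_Mapping.single (i, r) 1 + a"] exI[of _ b]) (simp add: add.assoc)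
qed

section \<open>Numerical identities for the Hilbert function\<close>

lemma two_choose: "2 * ((n + 2) choose 2) = (n + 1) * (n + 2)"
  by (induction n) (simp_all add: numeral_2_eq_2 algebra_simps)

lemma six_choose: "6 * ((n + 2) choose 3) = n * (n + 1) * (n + 2)"
proof (induction n)
  case (Suc n)
  have "6 * ((n + 2) choose 2) = 3 * ((n + 1) * (n + 2))"
    using two_choose[of n] by linarith
  moreover have "(Suc n + 2) choose 3 = ((n + 2) choose 2) + ((n + 2) choose 3)"
    by (simp add: numeral_3_eq_3 numeral_2_eq_2)
  ultimately show ?case using Suc by (simp add: algebra_simps)
qed (simp add: numeral_3_eq_3)

lemma hilbert_diagonal:
  assumes "distinct [i, j, k :: 'n::finite]"
  shows "mv_hilbert_function (deg3 i j k w w 0) = (int w + 1) ^ 3"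
proof -
  have "6 * int ((w + w + 0 + 3) choose 3) = (2 * int w + 1) * (2 * int w + 2) * (2 * int w + 3)"
  proof -
    have e: "w + w + 0 + 3 = (2 * w + 1) + 2" by simp
    have "6 * int (((2 * w + 1) + 2) choose 3) = int ((2 * w + 1) * ((2 * w + 1) + 1) * ((2 * w + 1) + 2))"
      unfolding six_choose[symmetric] by simp
    then show ?thesis unfolding e by (simp add: algebra_simps)
  qed
  moreover have "6 * int ((w + 2) choose 3) = int w * (int w + 1) * (int w + 2)"
    using arg_cong[OF six_choose[of w], of int]
    by (simp only: of_nat_mult of_nat_add of_nat_1 of_nat_numeral)
  moreover have "((0 + 2) choose 3) = (0::nat)" by simp
  ultimately have "6 * mv_hilbert_function (deg3 i j k w w 0) = 6 * (int w + 1) ^ 3"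
    unfolding hilbert_deg3[OF assms] by (simp add: algebra_simps power3_eq_cube)
  then show ?thesis by simp
qed

text \<open>The squares of consecutive triangular numbers differ by a cube. With
  \<open>hilbert_diagonal\<close> this says that the ideal has, in such a degree, the dimension of
  the multiples of one bilinear form.\<close>

lemma card_diagonal:
  assumes "distinct [i, j, k :: 'n::finite]"
  shows "int (card {m :: ('n \<times> 3) monom. multideg fst m = deg3 i j k (Suc w) (Suc w) 0}) =
    (int w + 2) ^ 3 + int (card {m :: ('n \<times> 3) monom. multideg fst m = deg3 i j k w w 0})"
proof -
  have c: "2 * int ((w + 2) choose 2) = (int w + 1) * (int w + 2)" for w
    using arg_cong[OF two_choose[of w], of int]
    by (simp only: of_nat_mult of_nat_add of_nat_1 of_nat_numeral)
  have "4 * int (((Suc w + 2) choose 2) * ((Suc w + 2) choose 2)) =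
      (2 * int ((Suc w + 2) choose 2)) * (2 * int ((Suc w + 2) choose 2))" by simp
  moreover have "4 * int (((w + 2) choose 2) * ((w + 2) choose 2)) =
      (2 * int ((w + 2) choose 2)) * (2 * int ((w + 2) choose 2))" by simp
  ultimately have "4 * int (((Suc w + 2) choose 2) * ((Suc w + 2) choose 2)) =
      4 * ((int w + 2) ^ 3 + int (((w + 2) choose 2) * ((w + 2) choose 2)))"
    unfolding c by (simp add: algebra_simps power3_eq_cube)
  then show ?thesis unfolding card_deg3[OF assms] by (simp add: numeral_2_eq_2)
qed

text \<open>Raising one degree by 1 adds \<open>(sum x UNIV + 3) choose 2\<close> and subtracts the
  smaller \<open>(x k + 2) choose 2\<close>.\<close>

lemma mv_hilbert_mono: "mv_hilbert_function v \<le> mv_hilbert_function (u + v)"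
proof (induction "sum u UNIV" arbitrary: u)
  case 0
  then have "u = 0" by (simp add: fun_eq_iff)
  then show ?case by simp
next
  case (Suc d)
  then obtain k where k: "u k \<noteq> 0" by (metis sum.neutral nat.distinct(1))
  define u0 where "u0 = u(k := u k - 1)"
  have u: "u = u0 + unit_deg k" using k by (auto simp: u0_def unit_deg_def fun_eq_iff)
  have "sum u UNIV = Suc (sum u0 UNIV)" by (subst u) (simp add: sum.distrib unit_deg_def)
  then have d: "d = sum u0 UNIV" using Suc(2) by simp
  define x where "x = u0 + v"
  have ux: "u + v = x + unit_deg k" by (simp add: u x_def add_ac)
  have "(\<Sum>l\<in>UNIV. int (((x + unit_deg k) l + 2) choose 3)) =
      (\<Sum>l\<in>UNIV. int ((x l + 2) choose 3) + (if l = k then int ((x k + 2) choose 2) else 0))"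
    by (rule sum.cong) (auto simp: unit_deg_def numeral_3_eq_3 numeral_2_eq_2)
  then have s: "(\<Sum>l\<in>UNIV. int (((x + unit_deg k) l + 2) choose 3)) =
      (\<Sum>l\<in>UNIV. int ((x l + 2) choose 3)) + int ((x k + 2) choose 2)"
    by (simp add: sum.distrib)
  have "(\<Sum>l\<in>UNIV. (x + unit_deg k) l) = Suc (sum x UNIV)" by (simp add: sum.distrib unit_deg_def)
  moreover have "(Suc (sum x UNIV) + 3) choose 3 = ((sum x UNIV + 3) choose 2) + ((sum x UNIV + 3) choose 3)"
    by (simp add: numeral_3_eq_3 numeral_2_eq_2)
  moreover have "(x k + 2) choose 2 \<le> (sum x UNIV + 3) choose 2"
  proof (rule binomial_right_mono)
    have "x k \<le> sum x UNIV" by (rule member_le_sum) auto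
    then show "x k + 2 \<le> sum x UNIV + 3" by simp
  qed
  ultimately have "mv_hilbert_function x \<le> mv_hilbert_function (u + v)"
    unfolding ux mv_hilbert_function_def s by simp
  with Suc(1)[OF d] show ?case unfolding x_def by simp
qed

section \<open>Expressing all views through two of them\<close>

context nondegenerate_point
begin

text \<open>Replaces the point in a third view by the intersection of the epipolar lines of the points in
  the views \<open>i\<close> and \<open>j\<close>.\<close>

definition meet :: "'n \<Rightarrow> 'n \<Rightarrow> 'n \<times> 3 \<Rightarrow> ('n, 'k) xyz_poly" where
  "meet i j v = (if fst v \<in> {i, j} then Var v else
     (let a = (\<lambda>r. \<Sum>s\<in>UNIV. scale (coef2 (F i (fst v)) i (fst v) s r) (Var (i, s)));
          b = (\<lambda>r. \<Sum>s\<in>UNIV. scale (coef2 (F j (fst v)) j (fst v) s r) (Var (j, s)))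
      in if snd v = 1 then a 2 * b 3 - a 3 * b 2 else if snd v = 2 then a 3 * b 1 - a 1 * b 3
         else a 1 * b 2 - a 2 * b 1))"

text \<open>With \<open>F i k = a . z\<close> and \<open>F j k = b . z\<close> this is the triple
  product identity: the components of z x (a x b) are combinations of these two forms.\<close>

lemma meet_swap:
  assumes ij: "i \<noteq> j" and v: "fst v = fst v'"
  shows "Var v * meet i j v' - Var v' * meet i j v \<in> I"
proof (cases "fst v \<in> {i, j}")
  case True
  then show ?thesis using v is_ideal_def[of I] ideal by (simp add: meet_def mult.commute)
next
  case False
  define k where "k = fst v"
  have k: "k \<noteq> i" "k \<noteq> j" "i \<noteq> k" "j \<noteq> k" using False by (auto simp: k_def)
  obtain r s where vr: "v = (k, r)" "v' = (k, s)" using v by (cases v; cases v') (auto simp: k_def)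
  define a where "a r = (\<Sum>s\<in>UNIV. scale (coef2 (F i k) i k s r) (Var (i, s)))" for r
  define b where "b r = (\<Sum>s\<in>UNIV. scale (coef2 (F j k) j k s r) (Var (j, s)))" for r
  define q where "q r = meet i j (k, r)" for r
  have q: "q 1 = a 2 * b 3 - a 3 * b 2" "q 2 = a 3 * b 1 - a 1 * b 3" "q 3 = a 1 * b 2 - a 2 * b 1"
    using k by (simp_all add: q_def meet_def Let_def a_def b_def)
  have Fexp: "F i k = a 1 * Var (k, 1) + a 2 * Var (k, 2) + a 3 * Var (k, 3)"
    "F j k = b 1 * Var (k, 1) + b 2 * Var (k, 2) + b 3 * Var (k, 3)"
    by (rule peval_inject; simp add: peval_F k B_def form2_def peval_add peval_mult peval_sum a_def b_def sum_3 algebra_simps)+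
  have "Var (k, 2) * q 3 - Var (k, 3) * q 2 = a 1 * F j k - b 1 * F i k"
    "Var (k, 3) * q 1 - Var (k, 1) * q 3 = a 2 * F j k - b 2 * F i k"
    "Var (k, 1) * q 2 - Var (k, 2) * q 1 = a 3 * F j k - b 3 * F i k"
    unfolding Fexp q by (simp_all add: algebra_simps)
  moreover have "f * F j k - g * F i k \<in> I" for f g
    using F_ideal[OF k(3)] F_ideal[OF k(4)] ideal_mult(1)[OF ideal] pm.subspace_diff[OF ideal_subspace[OF ideal]] by blast
  ultimately have pos: "Var (k, 2) * q 3 - Var (k, 3) * q 2 \<in> I" "Var (k, 3) * q 1 - Var (k, 1) * q 3 \<in> I"
    "Var (k, 1) * q 2 - Var (k, 2) * q 1 \<in> I" by simp_all
  have neg: "g - f \<in> I" if "f - g \<in> I" for f g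
    using pm.subspace_neg[OF ideal_subspace[OF ideal] that] by simp
  have "0 \<in> I" by (rule pm.subspace_0[OF ideal_subspace[OF ideal]])
  then show ?thesis
    unfolding vr q_def[symmetric] using exhaust_3[of r] exhaust_3[of s] pos neg[OF pos(1)] neg[OF pos(2)] neg[OF pos(3)] by auto
qed

definition meet_monom :: "'n \<Rightarrow> 'n \<Rightarrow> ('n \<times> 3) monom \<Rightarrow> ('n, 'k) xyz_poly" where
  "meet_monom i j m = (\<Prod>v\<in>UNIV. meet i j v ^ lookup m v)"

lemma meet_monom_add: "meet_monom i j (m + m') = meet_monom i j m * meet_monom i j m'"
  by (simp add: meet_monom_def lookup_add power_add prod.distrib)

lemma meet_monom_single: "meet_monom i j (Poly_Mapping.single v 1) = meet i j v"
proof -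
  have "meet_monom i j (Poly_Mapping.single v 1) = (\<Prod>w\<in>UNIV. if w = v then meet i j v else 1)"
    unfolding meet_monom_def by (rule prod.cong) (auto simp: lookup_single when_def)
  then show ?thesis by simp
qed

text \<open>Modulo \<open>I\<close>, a monomial and its substitute stand in a ratio that depends
  only on the degree. Variables of the same view are exchanged one at a time.\<close>

lemma meet_monom_swap:
  assumes "i \<noteq> j" "multideg fst m = u" "multideg fst m' = u"
  shows "Mon m * meet_monom i j m' - Mon m' * meet_monom i j m \<in> I"
  using assms(2,3)
proof (induction "sum u UNIV" arbitrary: u m m')
  case 0
  then have "u = 0" by (simp add: fun_eq_iff)
  have "a = 0" if "multideg fst a = u" for a :: "('n \<times> 3) monom"
    using lookup_le_multideg[of a] that \<open>u = 0\<close> by (intro poly_mapping_eqI) (metis le_zero_eq lookup_zero zero_fun_apply)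
  then have "m = 0" "m' = 0" using 0 by blast+
  then show ?case using pm.subspace_0[OF ideal_subspace[OF ideal]] by simp
next
  case (Suc d)
  then obtain k where k: "u k \<noteq> 0" by (metis sum.neutral nat.distinct(1))
  obtain r a where a: "m = Poly_Mapping.single (k, r) 1 + a" "multideg fst m = unit_deg k + multideg fst a"
    using monom_split_variable[of m k] Suc(3) k by auto
  obtain s b where b: "m' = Poly_Mapping.single (k, s) 1 + b" "multideg fst m' = unit_deg k + multideg fst b"
    using monom_split_variable[of m' k] Suc(4) k by auto
  have ab: "multideg fst b = multideg fst a"
    using a(2) b(2) Suc(3,4) by simp
  have "sum u UNIV = Suc (sum (multideg fst a) UNIV)"
    unfolding Suc(3)[symmetric] a(2) by (simp add: sum.distrib unit_deg_def)
  then have d: "d = sum (multideg fst a) UNIV" using Suc(2) by simp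
  have IH: "Mon a * meet_monom i j b - Mon b * meet_monom i j a \<in> I" by (rule Suc(1)[OF d refl ab])
  have sw: "Var (k, r) * meet i j (k, s) - Var (k, s) * meet i j (k, r) \<in> I"
    by (rule meet_swap[OF assms(1)]) simp
  have "Mon m * meet_monom i j m' - Mon m' * meet_monom i j m =
      (Var (k, r) * meet i j (k, s)) * (Mon a * meet_monom i j b - Mon b * meet_monom i j a) +
      (Var (k, r) * meet i j (k, s) - Var (k, s) * meet i j (k, r)) * (Mon b * meet_monom i j a)"
    unfolding a(1) b(1) Mon_add meet_monom_add meet_monom_single Var_def[symmetric] by (simp add: algebra_simps)
  also have "\<dots> \<in> I"
    using IH sw ideal_mult[OF ideal] ideal_add[OF ideal] by blast
  finally show ?case .
qed

definition substitute :: "'n \<Rightarrow> 'n \<Rightarrow> ('n, 'k) xyz_poly \<Rightarrow> ('n, 'k) xyz_poly" where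
  "substitute i j f = (\<Sum>m\<in>keys f. scale (lookup f m) (meet_monom i j m))"

text \<open>By swapping in each term, \<open>Mon z * substitute i j f\<close> is congruent to
  \<open>f * meet_monom i j z\<close>, a multiple of \<open>f\<close>.\<close>

lemma Mon_mult_substitute:
  assumes "i \<noteq> j" "f \<in> I" "f \<in> graded_part fst u" "multideg fst z = u"
  shows "Mon z * substitute i j f \<in> I"
proof -
  have "(\<Sum>m\<in>keys f. scale (lookup f m) (Mon z * meet_monom i j m - Mon m * meet_monom i j z)) \<in> I"
    using assms meet_monom_swap[OF assms(1)]
    by (intro pm.subspace_sum[OF ideal_subspace[OF ideal]] pm.subspace_scale[OF ideal_subspace[OF ideal]])
      (auto simp: graded_part_def)
  moreover have "f * meet_monom i j z \<in> I" by (rule ideal_mult(2)[OF ideal assms(2)])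
  moreover have "(\<Sum>m\<in>keys f. scale (lookup f m) (Mon m * meet_monom i j z)) = f * meet_monom i j z"
    by (subst (3) mpoly_eq_sum_Mon[of f]) (simp add: sum_distrib_right scale_def mult.assoc)
  moreover have "(\<Sum>m\<in>keys f. scale (lookup f m) (Mon z * meet_monom i j m)) = Mon z * substitute i j f"
    by (simp add: substitute_def sum_distrib_left scale_def mult_ac)
  ultimately show ?thesis
    using ideal_add[OF ideal] by (fastforce simp: pm.scale_right_diff_distrib sum_subtractf)
qed

lemma peval_substitute: "peval (substitute i j f) p = peval f (\<lambda>v. peval (meet i j v) p)"
  by (simp add: substitute_def peval_sum meet_monom_def peval_prod peval_power peval_superset[of "keys f"] meval_UNIV)

lemma peval_meet:
  assumes "fst v \<notin> {i, j}"
  shows "peval (meet i j v) p = cross_form i j (fst v) (\<chi> r. p (i, r)) (\<chi> r. p (j, r)) $ snd v"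
  using assms exhaust_3[of "snd v"]
  by (auto simp: meet_def Let_def cross_form_def peval_diff peval_mult peval_sum B_axis)

lemma meet_deg:
  assumes "i \<noteq> j"
  shows "meet i j v \<in> graded_part fst (if fst v \<in> {i, j} then unit_deg (fst v) else unit_deg i + unit_deg j)"
proof (cases "fst v \<in> {i, j}")
  case True
  then show ?thesis by (simp add: meet_def gp_Var)
next
  case False
  have V: "Var (l, r) \<in> graded_part fst (unit_deg l)" for l :: 'n and r :: 3
    using gp_Var[of "(l, r)" fst] by simp
  have "(\<Sum>s\<in>UNIV. scale (c s) (Var (l, s))) \<in> graded_part fst (unit_deg l)" for l :: 'n and c :: "3 \<Rightarrow> 'k"
    using V gp_subspace by (intro pm.subspace_sum pm.subspace_scale) auto
  then show ?thesis using False
    unfolding meet_def Let_def by (auto intro!: pm.subspace_diff[OF gp_subspace] gp_mult)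
qed

lemma substitute_deg:
  assumes dist: "distinct [i, j, k]" and f: "f \<in> graded_part fst u"
  shows "\<exists>a b. substitute i j f \<in> graded_part fst (deg3 i j k a b 0)"
proof -
  have ij: "i \<noteq> j" using dist by auto
  define dv where "dv l = (if l \<in> {i, j} then unit_deg l else unit_deg i + unit_deg j)" for l
  define D where "D = (\<lambda>l. \<Sum>h\<in>UNIV. u h * dv h l)"
  have "meet_monom i j m \<in> graded_part fst D" if "m \<in> keys f" for m
  proof -
    have "meet_monom i j m \<in> graded_part fst (\<Sum>v\<in>UNIV. (\<lambda>l. lookup m v * dv (fst v) l))"
      unfolding meet_monom_def dv_def by (intro gp_prod gp_power meet_deg ij)
    also have "(\<Sum>v\<in>UNIV. (\<lambda>l. lookup m v * dv (fst v) l)) = D"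
    proof
      fix l
      have "(\<Sum>v\<in>UNIV. lookup m v * dv (fst v) l) = (\<Sum>h\<in>UNIV. \<Sum>v | v \<in> UNIV \<and> fst v = h. lookup m v * dv (fst v) l)"
        by (rule sum.group[symmetric]) auto
      also have "\<dots> = (\<Sum>h\<in>UNIV. multideg fst m h * dv h l)"
        unfolding multideg_UNIV sum_distrib_right by (intro sum.cong) auto
      finally show "(\<Sum>v\<in>UNIV. (\<lambda>l. lookup m v * dv (fst v) l)) l = D l"
        using that f by (simp add: D_def sum_fun_apply graded_part_def)
    qed
    finally show ?thesis .
  qed
  then have "substitute i j f \<in> graded_part fst D"
    unfolding substitute_def
    by (intro pm.subspace_sum[OF gp_subspace] pm.subspace_scale[OF gp_subspace]) auto
  moreover have "D = deg3 i j k (D i) (D j) 0"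
    using ij by (auto simp: fun_eq_iff deg3_def D_def dv_def unit_deg_def)
  ultimately show ?thesis by metis
qed

end

lemma deg3_add:
  "deg3 i j k a b c + deg3 i j k a' b' c' = deg3 i j k (a + a') (b + b') (c + c')"
  by (simp add: deg3_def fun_eq_iff)

lemma unit_deg_pair: "i \<noteq> j \<Longrightarrow> unit_deg i + unit_deg j = deg3 i j k 1 1 0"
  by (auto simp: deg3_def unit_deg_def fun_eq_iff)

lemma restr_0: "restr A 0 = 0"
  by (simp add: restr_def fun_eq_iff peval_def)

lemma restr_scale: "restr A (scale c f) X = c * restr A f X"
  by (simp add: restr_def peval_scale)

lemma restr_diff: "restr A (f - g) = restr A f - restr A g"
  by (simp add: restr_def fun_eq_iff peval_diff)

lemma restr_eq_0_iff:
  fixes A :: "('n::finite, 'k::alg_closed_field) cameras"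
  assumes "generic A" "f \<in> graded_part fst u"
  shows "restr A f = 0 \<longleftrightarrow> f \<in> multiview_ideal A"
  unfolding multiview_ideal_generic_iff[OF assms] by (simp add: restr_def fun_eq_iff)

lemma multiview_ideal_props:
  fixes A :: "('n::finite, 'k::alg_closed_field) cameras"
  assumes "generic A"
  shows "is_ideal (multiview_ideal A)" "has_hilbert_function fst (multiview_ideal A) mv_hilbert_function"
    "homogeneous_ideal fst (multiview_ideal A)"
  using multiview_ideal_hilbert_point[OF assms] unfolding hilbert_points_def homogeneous_ideal_def by blast+

lemma exists_distinct_triple:
  assumes "CARD('n::finite) \<ge> 3"
  shows "\<exists>i j k :: 'n. distinct [i, j, k]"
proof -
  obtain S :: "'n set" where "card S = 3" using assms obtain_subset_with_card_n by metis
  then show ?thesis by (auto simp: card_3_iff)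
qed

text \<open>With x = w + 1 the right side is at most 3 N e x^2, which forces x to be at most 3 N
  e.\<close>

lemma cube_growth_contradiction:
  fixes N e :: nat
  assumes "\<And>w. e \<le> w \<Longrightarrow> 0 < w \<Longrightarrow> (int w + 1) ^ 3 \<le> int N * ((int w + 1) ^ 3 - (int w - int e + 1) ^ 3)"
  shows False
proof -
  define x where "x = int (3 * N * e + e + 1) + 1"
  have "0 \<le> int N * int e" by simp
  moreover have "x = 3 * (int N * int e) + int e + 2" by (simp add: x_def)
  ultimately have x: "int e \<le> x" "3 * int N * int e < x" "0 < x" unfolding mult.assoc by linarith+
  have "x ^ 3 \<le> int N * (x ^ 3 - (x - int e) ^ 3)"
    using assms[of "3 * N * e + e + 1"] by (simp add: x_def algebra_simps)
  also have "x ^ 3 - (x - int e) ^ 3 = int e * (x\<^sup>2 + x * (x - int e) + (x - int e)\<^sup>2)"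
    by (simp add: power3_eq_cube power2_eq_square algebra_simps)
  also have "\<dots> \<le> int e * (3 * x\<^sup>2)"
  proof (rule mult_left_mono)
    have "(x - int e)\<^sup>2 \<le> x\<^sup>2" using x by (intro power_mono) auto
    moreover have "x * (x - int e) \<le> x\<^sup>2" using x unfolding power2_eq_square by (intro mult_left_mono) auto
    ultimately show "x\<^sup>2 + x * (x - int e) + (x - int e)\<^sup>2 \<le> 3 * x\<^sup>2" by simp
  qed simp
  finally have "x ^ 3 \<le> int N * (int e * (3 * x\<^sup>2))" by (simp add: mult_left_mono)
  then have "x * x\<^sup>2 \<le> (3 * int N * int e) * x\<^sup>2" by (simp add: power3_eq_cube power2_eq_square mult_ac)
  moreover have "0 < x\<^sup>2" using x(3) by simp
  ultimately have "x \<le> 3 * int N * int e" by (rule mult_right_le_imp_le)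
  with x(2) show False by simp
qed

section \<open>Vanishing on the reconstructed cameras\<close>

context nondegenerate_point
begin

lemma F_nonzero: "distinct [i, j, k] \<Longrightarrow> F i j \<noteq> 0"
  using det[of i j k] by (auto simp: det3_def coef2_def)

lemma restr_F:
  assumes "i \<noteq> j" "\<forall>X. B i j (A i *v X) (A j *v X) = 0"
  shows "restr A (F i j) = 0"
proof
  fix X
  have "(\<chi> r. cam_point A X (l, r)) = A l *v X" for l by (simp add: cam_point_def vec_eq_iff)
  then show "restr A (F i j) X = 0 X" using assms by (simp add: restr_def peval_F)
qed

text \<open>By a dimension count, the multiples of \<open>F i j\<close> are all forms in two views that vanish on the
  image of the two cameras.\<close>

lemma two_view_ideal:
  assumes dist: "distinct [i, j, k]" and gen: "generic A" and van: "restr A (F i j) = 0"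
    and g: "g \<in> graded_part fst (deg3 i j k (Suc w) (Suc w) 0)" "restr A g = 0"
  shows "g \<in> I"
proof -
  have ij: "i \<noteq> j" using dist by simp
  let ?u = "deg3 i j k (Suc w) (Suc w) 0" and ?uw = "deg3 i j k w w 0"
  let ?V = "multiview_ideal A \<inter> graded_part fst ?u"
  define K where "K = {m :: ('n \<times> 3) monom. multideg fst m = ?uw}"
  define wf where "wf m = F i j * (Mon m :: ('n, 'k) xyz_poly)" for m
  have finK: "finite K" unfolding K_def by (rule finite_multideg)
  have u: "?u = (unit_deg i + unit_deg j) + ?uw"
    using ij by (auto simp: deg3_def unit_deg_def fun_eq_iff)
  have deg: "wf m \<in> graded_part fst ?u" if "m \<in> K" for m
  proof -
    have "multideg fst m = ?uw" using that unfolding K_def by blast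
    then have "Mon m \<in> graded_part fst ?uw" using gp_Mon[of m fst] by metis
    then show ?thesis unfolding wf_def u by (rule gp_mult[OF F_deg[OF ij]])
  qed
  have sub: "wf ` K \<subseteq> ?V"
  proof (intro image_subsetI IntI)
    fix m assume m: "m \<in> K"
    show "wf m \<in> graded_part fst ?u" by (rule deg[OF m])
    have "restr A (wf m) = 0" unfolding wf_def restr_mult van by (rule mult_zero_left)
    then show "wf m \<in> multiview_ideal A" using restr_eq_0_iff[OF gen deg[OF m]] by blast
  qed
  have ind: "pm.indep_mod {0} K wf"
  proof (rule pm.indep_modI)
    fix c m assume s: "(\<Sum>m\<in>K. scale (c m) (wf m)) \<in> {0}" and m: "m \<in> K"
    have "(\<Sum>m\<in>K. scale (c m) (wf m)) = F i j * (\<Sum>m\<in>K. scale (c m) (Mon m))"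
      by (simp add: sum_distrib_left wf_def scale_def mult_ac)
    then have "(\<Sum>m\<in>K. scale (c m) (Mon m)) \<in> ({0} :: ('n, 'k) xyz_poly set)"
      using s mpoly_mult_eq_0[OF _ F_nonzero[OF dist]] by simp
    then show "c m = 0" by (rule pm.indep_modD[OF indep_Mon[OF finK] _ m])
  qed
  have subV: "pm.subspace ?V"
    by (rule pm.subspace_inter[OF ideal_subspace[OF multiview_ideal_props(1)[OF gen]] gp_subspace])
  have "pm.spans_mod {0} {m :: ('n \<times> 3) monom. multideg fst m = ?u} Mon ?V"
    by (rule pm.spans_mod_subset[OF gp_spans_Mon[OF finite_multideg]]) simp
  from pm.exists_basis_mod[OF pm.subspace_single_0 subV finite_multideg this]
  obtain Bs where Bs: "finite Bs" "Bs \<subseteq> ?V" "pm.indep_mod {0} Bs id" "pm.spans_mod {0} Bs id ?V" by blast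
  have "int (card {m :: ('n \<times> 3) monom. multideg fst m = ?u}) = mv_hilbert_function ?u + int (card Bs)"
    by (rule hilbert_basis_length[OF multiview_ideal_props(1,2)[OF gen] Bs(3,4) _ Bs(1)]) (use Bs(2) in simp)
  then have "card Bs = card K"
    using card_diagonal[OF dist, of w] hilbert_diagonal[OF dist, of "Suc w"] by (simp add: K_def algebra_simps)
  then have le: "card Bs \<le> card K" by simp
  have "pm.spans_mod {0} K wf ?V"
    by (rule pm.indep_card_spans_mod[OF pm.subspace_single_0 finK Bs(1) ind sub Bs(4) le])
  moreover have "g \<in> ?V" using g restr_eq_0_iff[OF gen g(1)] by blast
  ultimately obtain c where c: "g - (\<Sum>m\<in>K. scale (c m) (wf m)) \<in> {0}" by (rule pm.spans_modE)
  have "wf m \<in> I" for m unfolding wf_def by (rule ideal_mult(2)[OF ideal F_ideal[OF ij]])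
  then have "(\<Sum>m\<in>K. scale (c m) (wf m)) \<in> I"
    by (intro pm.subspace_sum[OF ideal_subspace[OF ideal]] pm.subspace_scale[OF ideal_subspace[OF ideal]])
  then show ?thesis using c by simp
qed

text \<open>
  If \<open>\<phi>\<close> did not vanish on the image of the two cameras, the residues modulo \<open>I\<close> in degree
  \<open>u + w (e\<^sub>i + e\<^sub>j)\<close> would be spanned by the products of the monomials of degree \<open>u\<close> with the
  residues of degree \<open>w (e\<^sub>i + e\<^sub>j)\<close> modulo \<open>F i j\<close> and \<open>\<phi>\<close>. The number of these grows
  quadratically in \<open>w\<close>, while the Hilbert function grows cubically.
\<close>

lemma conductor_vanishes:
  assumes dist: "distinct [i, j, k]" and gen: "generic A" and van: "restr A (F i j) = 0"
    and phi: "\<phi> \<in> graded_part fst (deg3 i j k e e 0)"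
    and cond: "\<And>z. multideg fst z = u \<Longrightarrow> Mon z * \<phi> \<in> I"
  shows "restr A \<phi> = 0"
proof (rule ccontr)
  assume nz: "restr A \<phi> \<noteq> 0"
  let ?J = "multiview_ideal A"
  note J = multiview_ideal_props(1,2)[OF gen]
  define Z where "Z = {m :: ('n \<times> 3) monom. multideg fst m = u}"
  have finZ: "finite Z" unfolding Z_def by (rule finite_multideg)
  have "(int w + 1) ^ 3 \<le> int (card Z) * ((int w + 1) ^ 3 - (int w - int e + 1) ^ 3)" if ew: "e \<le> w" and w: "0 < w" for w
  proof -
    obtain w0 where Suc: "w = Suc w0" using w by (cases w) auto
    let ?v = "deg3 i j k w w 0" and ?v' = "deg3 i j k (w - e) (w - e) 0"
    \<comment> \<open>On the cameras, members of \<open>U\<close> agree with multiples of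
      \<open>\<phi>\<close>. By \<open>two_view_ideal\<close> they differ from these by elements of
      \<open>I\<close>, so monomials of degree \<open>u\<close> multiply \<open>U\<close> into
      \<open>I\<close>.\<close>
    define U where "U = {g \<in> graded_part fst ?v. \<exists>h\<in>graded_part fst ?v'. restr A g = restr A (\<phi> * h)}"
    have v: "?v = deg3 i j k e e 0 + ?v'" using ew by (simp add: deg3_add)
    have phih: "\<phi> * h \<in> graded_part fst ?v" if "h \<in> graded_part fst ?v'" for h
      unfolding v by (rule gp_mult[OF phi that])
    have UI: "Mon z * g \<in> I" if g: "g \<in> U" and z: "z \<in> Z" for g z
    proof -
      obtain h where h: "h \<in> graded_part fst ?v'" "restr A g = restr A (\<phi> * h)" using g by (auto simp: U_def)
      have "g - \<phi> * h \<in> graded_part fst (deg3 i j k (Suc w0) (Suc w0) 0)"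
        unfolding Suc[symmetric]
        by (rule pm.subspace_diff[OF gp_subspace _ phih[OF h(1)]]) (use g in \<open>simp add: U_def\<close>)
      moreover have "restr A (g - \<phi> * h) = 0" unfolding restr_diff h(2) by simp
      ultimately have "g - \<phi> * h \<in> I" by (rule two_view_ideal[OF dist gen van])
      then have "Mon z * (g - \<phi> * h) + (Mon z * \<phi>) * h \<in> I"
        using cond z ideal_mult[OF ideal] ideal_add[OF ideal] unfolding Z_def by blast
      then show ?thesis by (simp add: algebra_simps)
    qed
    have subU: "pm.subspace U"
      unfolding pm.subspace_def
    proof (intro conjI ballI allI)
      show "0 \<in> U" unfolding U_def
        using pm.subspace_0[OF gp_subspace] by (auto intro!: bexI[of _ 0])
    next
      fix f g assume "f \<in> U" "g \<in> U"
      then obtain h h' where h: "h \<in> graded_part fst ?v'" "restr A f = restr A (\<phi> * h)" "f \<in> graded_part fst ?v"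
        "h' \<in> graded_part fst ?v'" "restr A g = restr A (\<phi> * h')" "g \<in> graded_part fst ?v"
        by (auto simp: U_def)
      have "restr A (f + g) = restr A (\<phi> * (h + h'))"
        unfolding distrib_left restr_add h(2,5) ..
      then show "f + g \<in> U" unfolding U_def
        using h pm.subspace_add[OF gp_subspace] by blast
    next
      fix c f assume "f \<in> U"
      then obtain h where h: "h \<in> graded_part fst ?v'" "restr A f = restr A (\<phi> * h)" "f \<in> graded_part fst ?v"
        by (auto simp: U_def)
      have e: "\<phi> * scale c h = scale c (\<phi> * h)" by (simp add: scale_def mult_ac)
      have "restr A (scale c f) = restr A (\<phi> * scale c h)"
        unfolding e by (rule ext) (simp only: restr_scale h(2))
      then show "scale c f \<in> U" unfolding U_def
        using h pm.subspace_scale[OF gp_subspace] by blast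
    qed
    have "pm.spans_mod U {m :: ('n \<times> 3) monom. multideg fst m = ?v} Mon (graded_part fst ?v)"
      unfolding pm.spans_mod_def
    proof
      fix p :: "('n, 'k) xyz_poly" assume "p \<in> graded_part fst ?v"
      from pm.spans_modE[OF gp_spans_Mon[OF finite_multideg] this]
      obtain c where "p - (\<Sum>m | multideg fst m = ?v. scale (c m) (Mon m)) \<in> {0}" by blast
      then have "p - (\<Sum>m | multideg fst m = ?v. scale (c m) (Mon m)) \<in> U"
        using pm.subspace_0[OF subU] by simp
      then show "\<exists>c. p - (\<Sum>m | multideg fst m = ?v. scale (c m) (Mon m)) \<in> U" by (rule exI[of _ c])
    qed
    from pm.exists_basis_mod[OF subU gp_subspace finite_multideg this]
    obtain T where T: "finite T" "T \<subseteq> graded_part fst ?v" "pm.indep_mod U T id" "pm.spans_mod U T id (graded_part fst ?v)"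
      by blast
    obtain H where H: "finite H" "H \<subseteq> graded_part fst ?v'" "pm.indep_mod ?J H id" "int (card H) = mv_hilbert_function ?v'"
      using has_hilbert_functionE[OF J] by metis
    have indH: "pm.indep_mod ?J H (\<lambda>h. \<phi> * h)"
    proof (rule pm.indep_modI)
      fix c h assume s: "(\<Sum>h\<in>H. scale (c h) (\<phi> * h)) \<in> ?J" and h: "h \<in> H"
      let ?S = "\<Sum>h\<in>H. scale (c h) (id h)"
      have S: "?S \<in> graded_part fst ?v'"
        using H(2) by (intro pm.subspace_sum[OF gp_subspace] pm.subspace_scale[OF gp_subspace]) auto
      have "(\<Sum>h\<in>H. scale (c h) (\<phi> * h)) = \<phi> * ?S"
        by (simp add: sum_distrib_left scale_def mult_ac)
      then have z: "restr A (\<phi> * ?S) = 0"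
        using s restr_eq_0_iff[OF gen phih[OF S]] by simp
      have "restr A ?S = 0"
      proof (rule ccontr)
        assume "restr A ?S \<noteq> 0"
        then obtain X Y where "restr A \<phi> X \<noteq> 0" "restr A ?S Y \<noteq> 0" using nz by (auto simp: fun_eq_iff)
        from line_poly_common_nonzero[OF line_poly_restr line_poly_restr this]
        obtain Q where "restr A \<phi> Q \<noteq> 0" "restr A ?S Q \<noteq> 0" by blast
        moreover have "restr A \<phi> Q * restr A ?S Q = 0"
          using fun_cong[OF z, of Q] by (simp only: restr_mult times_fun_def zero_fun_apply)
        ultimately show False by simp
      qed
      then have "?S \<in> ?J" using restr_eq_0_iff[OF gen S] by blast
      then show "c h = 0" by (rule pm.indep_modD[OF H(3) _ h])
    qed
    have JU: "?J \<inter> graded_part fst ?v \<subseteq> U"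
    proof
      fix g assume g: "g \<in> ?J \<inter> graded_part fst ?v"
      then have "restr A g = restr A (\<phi> * 0)" using restr_eq_0_iff[OF gen, of g ?v] restr_0 by simp
      then show "g \<in> U" unfolding U_def using g pm.subspace_0[OF gp_subspace] by blast
    qed
    have ind2: "pm.indep_mod (?J \<inter> graded_part fst ?v) (T <+> H) (case_sum id (\<lambda>h. \<phi> * h))"
    proof (rule pm.indep_mod_Plus[OF T(1) H(1) T(3) _ _ subU JU])
      show "pm.indep_mod (?J \<inter> graded_part fst ?v) H (\<lambda>h. \<phi> * h)"
        using indH unfolding pm.indep_mod_def by blast
      show "(\<lambda>h. \<phi> * h) ` H \<subseteq> U"
        using H(2) phih unfolding U_def by blast
    qed
    have inV: "case_sum id (\<lambda>h. \<phi> * h) ` (T <+> H) \<subseteq> graded_part fst ?v"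
      using T(2) H(2) phih by auto
    have "pm.indep_mod ?J (T <+> H) (case_sum id (\<lambda>h. \<phi> * h))"
    proof (rule pm.indep_modI)
      fix c x assume s: "(\<Sum>x\<in>T <+> H. scale (c x) (case_sum id (\<lambda>h. \<phi> * h) x)) \<in> ?J" and x: "x \<in> T <+> H"
      have "(\<Sum>x\<in>T <+> H. scale (c x) (case_sum id (\<lambda>h. \<phi> * h) x)) \<in> graded_part fst ?v"
        using inV by (intro pm.subspace_sum[OF gp_subspace] pm.subspace_scale[OF gp_subspace]) blast
      with s have "(\<Sum>x\<in>T <+> H. scale (c x) (case_sum id (\<lambda>h. \<phi> * h) x)) \<in> ?J \<inter> graded_part fst ?v" by blast
      then show "c x = 0" by (rule pm.indep_modD[OF ind2 _ x])
    qed
    \<comment> \<open>The products \<open>\<phi> * h\<close> remain independent modulo the multiview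
      ideal because \<open>\<phi>\<close> is not zero on the cameras. They occupy a cube inside
      \<open>U\<close>, and only a difference of cubes is left for \<open>T\<close>.\<close>
    from hilbert_ge[OF J _ this inV]
    have "int (card (T <+> H)) \<le> mv_hilbert_function ?v" using T(1) H(1) by simp
    then have cardT: "int (card T) \<le> (int w + 1) ^ 3 - (int w - int e + 1) ^ 3"
      using T(1) H(1,4) ew by (simp add: card_Plus hilbert_diagonal[OF dist] of_nat_diff del: UNIV_Plus_UNIV)
    have "pm.spans_mod I (Z \<times> T) (\<lambda>(z, t). Mon z * t) (graded_part fst (u + ?v))"
      unfolding pm.spans_mod_def
    proof
      fix p :: "('n, 'k) xyz_poly" assume p: "p \<in> graded_part fst (u + ?v)"
      let ?W = "{p. \<exists>c. p - (\<Sum>x\<in>Z \<times> T. scale (c x) ((\<lambda>(z, t). Mon z * t) x)) \<in> I}"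
      have subW: "pm.subspace ?W" by (rule pm.subspace_spanned_mod[OF ideal_subspace[OF ideal]])
      have "Mon m \<in> ?W" if m: "m \<in> keys p" for m
      proof -
        have "multideg fst m = u + ?v" using p m by (simp add: graded_part_def)
        then obtain z b where zb: "m = z + b" "multideg fst z = u" "multideg fst b = ?v"
          using monom_split by blast
        have z: "z \<in> Z" using zb(2) by (simp add: Z_def)
        have "Mon b \<in> graded_part fst ?v" using gp_Mon[of b fst] unfolding zb(3) .
        from pm.spans_modE[OF T(4) this] obtain c where c: "Mon b - (\<Sum>t\<in>T. scale (c t) (id t)) \<in> U" by blast
        define c' where "c' x = (if fst x = z then c (snd x) else 0)" for x :: "('n \<times> 3) monom \<times> ('n, 'k) xyz_poly"
        have "(\<Sum>x\<in>Z \<times> T. scale (c' x) ((\<lambda>(z, t). Mon z * t) x)) =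
            (\<Sum>z'\<in>Z. \<Sum>t\<in>T. scale (c' (z', t)) (Mon z' * t))"
          unfolding sum.cartesian_product by (rule sum.cong) auto
        also have "\<dots> = (\<Sum>z'\<in>Z. if z' = z then \<Sum>t\<in>T. scale (c t) (Mon z * t) else 0)"
          by (rule sum.cong) (auto simp: c'_def)
        also have "\<dots> = (\<Sum>t\<in>T. scale (c t) (Mon z * t))" using z finZ by simp
        also have "\<dots> = Mon z * (\<Sum>t\<in>T. scale (c t) (id t))"
          by (simp add: sum_distrib_left scale_def mult_ac)
        finally have "Mon m - (\<Sum>x\<in>Z \<times> T. scale (c' x) ((\<lambda>(z, t). Mon z * t) x)) =
            Mon z * (Mon b - (\<Sum>t\<in>T. scale (c t) (id t)))"
          by (simp add: zb(1) Mon_add algebra_simps)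
        also have "\<dots> \<in> I" by (rule UI[OF c z])
        finally show ?thesis by blast
      qed
      then have "(\<Sum>m\<in>keys p. scale (lookup p m) (Mon m)) \<in> ?W"
        by (intro pm.subspace_sum[OF subW] pm.subspace_scale[OF subW])
      then have "p \<in> ?W" unfolding mpoly_eq_sum_Mon[of p, symmetric] .
      then show "\<exists>c. p - (\<Sum>x\<in>Z \<times> T. scale (c x) ((\<lambda>(z, t). Mon z * t) x)) \<in> I" by blast
    qed
    from hilbert_le[OF ideal hilbert _ this]
    have "mv_hilbert_function (u + ?v) \<le> int (card Z) * int (card T)"
      using finZ T(1) by (simp add: card_cartesian_product)
    moreover have "mv_hilbert_function ?v \<le> mv_hilbert_function (u + ?v)" by (rule mv_hilbert_mono)
    moreover have "int (card Z) * int (card T) \<le> int (card Z) * ((int w + 1) ^ 3 - (int w - int e + 1) ^ 3)"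
      using cardT by (rule mult_left_mono) simp
    ultimately show ?thesis unfolding hilbert_diagonal[OF dist] by simp
  qed
  then show False by (rule cube_growth_contradiction)
qed

text \<open>On the cameras the substitution multiplies each view \<open>l\<close> by the nonzero
  form \<open>m l\<close>, so \<open>substitute i j f\<close> restricts to \<open>f\<close> times a
  product of such forms and is nonzero whenever \<open>f\<close> is.\<close>

lemma vanishes_on_reconstruction:
  assumes dist: "distinct [i, j, k]" and gen: "generic A"
    and AB: "\<forall>X. B i j (A i *v X) (A j *v X) = 0"
    and m: "\<And>l. l \<notin> {i, j} \<Longrightarrow> lin (m l)" "\<And>l. l \<notin> {i, j} \<Longrightarrow> \<exists>X. m l X \<noteq> 0"
      "\<And>l X. l \<notin> {i, j} \<Longrightarrow> cross_form i j l (A i *v X) (A j *v X) = m l X *s (A l *v X)"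
    and f: "f \<in> I" "f \<in> graded_part fst u"
  shows "restr A f = 0"
proof (rule ccontr)
  assume nz: "restr A f \<noteq> 0"
  have ij: "i \<noteq> j" using dist by simp
  have van: "restr A (F i j) = 0" by (rule restr_F[OF ij AB])
  obtain a b where phi0: "substitute i j f \<in> graded_part fst (deg3 i j k a b 0)"
    using substitute_deg[OF dist f(2)] by blast
  define mm where "mm l = (if l \<in> {i, j} then (\<lambda>X. 1) else m l)" for l
  have mm: "line_poly (mm l)" "\<exists>X. mm l X \<noteq> 0" for l
    using m(1,2)[of l] line_poly_lin by (auto simp: mm_def line_poly_def)
  have restr_sub: "restr A (substitute i j f) X = (\<Prod>l\<in>UNIV. mm l X ^ u l) * restr A f X" for X
  proof -
    have cp: "(\<chi> r. cam_point A X (l, r)) = A l *v X" for l by (simp add: cam_point_def vec_eq_iff)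
    have "peval (meet i j v) (cam_point A X) = mm (fst v) X * cam_point A X v" for v
    proof (cases "fst v \<in> {i, j}")
      case True
      then show ?thesis by (simp add: meet_def mm_def peval_Var)
    next
      case False
      then show ?thesis using m(3)[OF False, of X] by (simp add: peval_meet cp mm_def cam_point_def)
    qed
    then have "restr A (substitute i j f) X = peval f (\<lambda>v. mm (fst v) X * cam_point A X v)"
      by (simp add: restr_def peval_substitute)
    also have "\<dots> = (\<Prod>l\<in>UNIV. mm l X ^ u l) * restr A f X"
      unfolding restr_def by (rule peval_torus[OF f(2)])
    finally show ?thesis .
  qed
  have coord: "\<exists>r X. restr A (Var (l, r)) X \<noteq> 0" for l
  proof (rule ccontr)
    assume "\<not> ?thesis"
    then have "(A l *v X) $ r = 0" for r X by (simp add: restr_def peval_Var cam_point_def)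
    then have "A l *v X = 0" for X by (simp add: vec_eq_iff)
    moreover obtain X where "A l *v X = axis 1 1" using gen unfolding generic_def by (metis surjD)
    ultimately show False by (metis axis_eq_0_iff zero_neq_one)
  qed
  obtain r s X Y where rs: "restr A (Var (i, r)) X \<noteq> 0" "restr A (Var (j, s)) Y \<noteq> 0" using coord by metis
  \<comment> \<open>\<open>conductor_vanishes\<close> wants equal degrees in both views; powers of a
    coordinate from each view, with the degrees exchanged, achieve \<open>a + b\<close>
    twice.\<close>
  define \<phi> where "\<phi> = substitute i j f * (Var (i, r) ^ b * Var (j, s) ^ a)"
  have "Var (i, r) ^ b \<in> graded_part fst (deg3 i j k b 0 0)"
  proof -
    have "Var (i, r) ^ b \<in> graded_part fst (\<lambda>l. b * unit_deg i l)"
      using gp_power[OF gp_Var[of "(i, r)" fst], of b] by simp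
    moreover have "(\<lambda>l. b * unit_deg i l) = deg3 i j k b 0 0" by (auto simp: fun_eq_iff deg3_def unit_deg_def)
    ultimately show ?thesis by simp
  qed
  moreover have "Var (j, s) ^ a \<in> graded_part fst (deg3 i j k 0 a 0)"
  proof -
    have "Var (j, s) ^ a \<in> graded_part fst (\<lambda>l. a * unit_deg j l)"
      using gp_power[OF gp_Var[of "(j, s)" fst], of a] by simp
    moreover have "(\<lambda>l. a * unit_deg j l) = deg3 i j k 0 a 0" using ij by (auto simp: fun_eq_iff deg3_def unit_deg_def)
    ultimately show ?thesis by simp
  qed
  ultimately have "\<phi> \<in> graded_part fst (deg3 i j k a b 0 + (deg3 i j k b 0 0 + deg3 i j k 0 a 0))"
    unfolding \<phi>_def using phi0 by (intro gp_mult)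
  then have phi: "\<phi> \<in> graded_part fst (deg3 i j k (a + b) (a + b) 0)"
    by (simp add: deg3_add add.commute)
  have "Mon z * \<phi> \<in> I" if "multideg fst z = u" for z
    unfolding \<phi>_def mult.assoc[symmetric] by (intro ideal_mult(2)[OF ideal] Mon_mult_substitute[OF ij f that])
  then have "restr A \<phi> = 0" by (rule conductor_vanishes[OF dist gen van phi])
  obtain X' where X': "restr A f X' \<noteq> 0" using nz by (auto simp: fun_eq_iff)
  define G where "G n = (if n = 0 then restr A f else if n = 1 then (\<lambda>X. \<Prod>l\<in>UNIV. mm l X ^ u l)
    else if n = 2 then (\<lambda>X. restr A (Var (i, r)) X ^ b) else (\<lambda>X. restr A (Var (j, s)) X ^ a))" for n :: nat
  have pw: "\<exists>X. g X ^ n \<noteq> 0" if "\<exists>X. g X \<noteq> 0" for g :: "'k ^ 4 \<Rightarrow> 'k" and n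
    using that by auto
  have mmu: "line_poly (\<lambda>X. \<Prod>l\<in>UNIV. mm l X ^ u l) \<and> (\<exists>X. (\<Prod>l\<in>UNIV. mm l X ^ u l) \<noteq> 0)"
    by (rule line_poly_prod_nonzero) (intro finite_class.finite_UNIV line_poly_power mm pw)+
  have "line_poly (\<lambda>X. \<Prod>n\<in>{0, 1, 2, 3}. G n X) \<and> (\<exists>X. (\<Prod>n\<in>{0, 1, 2, 3}. G n X) \<noteq> 0)"
  proof (rule line_poly_prod_nonzero)
    fix n :: nat
    show "line_poly (G n)"
      unfolding G_def using mmu by (simp add: line_poly_restr line_poly_power)
    show "\<exists>X. G n X \<noteq> 0"
      unfolding G_def using mmu X' pw[of "restr A (Var (i, r))"] pw[of "restr A (Var (j, s))"] rs by auto
  qed simp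
  then obtain Q where "(\<Prod>n\<in>{0, 1, 2, 3}. G n Q) \<noteq> 0" by blast
  then have "restr A f Q * ((\<Prod>l\<in>UNIV. mm l Q ^ u l) * (restr A (Var (i, r)) Q ^ b * restr A (Var (j, s)) Q ^ a)) \<noteq> 0"
    by (simp add: G_def)
  moreover have "restr A \<phi> Q = ((\<Prod>l\<in>UNIV. mm l Q ^ u l) * restr A f Q) * (restr A (Var (i, r)) Q ^ b * restr A (Var (j, s)) Q ^ a)"
    unfolding restr_sub[symmetric] \<phi>_def by (simp add: restr_def peval_mult peval_power)
  ultimately have "restr A \<phi> Q \<noteq> 0" by (simp only: mult_ac simp_thms)
  then show False by (simp add: \<open>restr A \<phi> = 0\<close>)
qed

theorem eq_multiview_ideal:
  assumes card: "CARD('n) \<ge> 3" and hom: "homogeneous_ideal fst I"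
  shows "\<exists>A. generic A \<and> I = multiview_ideal A"
proof -
  obtain i j k :: 'n where dist: "distinct [i, j, k]" using exists_distinct_triple[OF card] by blast
  then have ij: "i \<noteq> j" by simp
  obtain A m where A: "generic A" "\<forall>X. B i j (A i *v X) (A j *v X) = 0" and
    m: "\<forall>k. k \<notin> {i, j} \<longrightarrow> lin (m k) \<and> (\<exists>X. m k X \<noteq> 0) \<and>
      (\<forall>X. cross_form i j k (A i *v X) (A j *v X) = m k X *s (A k *v X))"
    using reconstruction[OF card ij] by blast
  note J = multiview_ideal_props[OF A(1)]
  have van: "restr A f = 0" if "f \<in> I" "f \<in> graded_part fst u" for f u
    by (rule vanishes_on_reconstruction[OF dist A _ _ _ that]) (use m in blast)+
  have comp: "f \<in> I'" if "is_ideal I'" "\<And>u. hcomp fst u f \<in> I'" for f and I' :: "('n, 'k) xyz_poly set"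
    by (subst sum_hcomp[of f fst]) (intro pm.subspace_sum[OF ideal_subspace[OF that(1)]] that(2))
  have sub: "I \<subseteq> multiview_ideal A"
  proof
    fix f assume "f \<in> I"
    then have "restr A (hcomp fst u f) = 0" for u by (intro van[of _ u] hcomp_ideal[OF hom] hcomp_in_gp)
    then have "hcomp fst u f \<in> multiview_ideal A" for u
      using restr_eq_0_iff[OF A(1) hcomp_in_gp] by blast
    then show "f \<in> multiview_ideal A" by (rule comp[OF J(1)])
  qed
  moreover have "multiview_ideal A \<subseteq> I"
  proof
    fix f assume "f \<in> multiview_ideal A"
    then have "hcomp fst u f \<in> multiview_ideal A" for u by (rule hcomp_ideal[OF J(3)])
    then have "hcomp fst u f \<in> I" for u
      by (rule hilbert_eq_imp_supset[OF ideal hilbert J(1,2) sub _ hcomp_in_gp])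
    then show "f \<in> I" by (rule comp[OF ideal])
  qed
  ultimately show ?thesis using A(1) by blast
qed

end

section \<open>An open neighbourhood of a multiview ideal\<close>

text \<open>The rank is the dimension of the set of rows, in which equal rows coincide; independence
  of the indexed rows therefore also involves their distinctness.\<close>

lemma full_rank_iff_surj:
  fixes A :: "'a::field ^ 'n ^ 'm"
  shows "rank A = CARD('m) \<longleftrightarrow> surj ((*v) A)"
proof -
  have rows: "rows A = range (\<lambda>i. row i A)" by (auto simp: rows_def)
  have "rank A = CARD('m) \<longleftrightarrow> (\<forall>c. (\<Sum>i\<in>UNIV. c i *s row i A) = 0 \<longrightarrow> (\<forall>i. c i = 0))"
  proof
    assume r: "rank A = CARD('m)"
    have dim: "vec.dim (rows A) = CARD('m)" using r by (simp add: row_rank_def_gen)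
    have fin: "finite (rows A)" unfolding rows by simp
    have le: "card (rows A) \<le> CARD('m)" unfolding rows by (rule card_image_le) simp
    have "vec.independent (rows A)"
      by (rule vec.card_le_dim_spanning[of _ "rows A"]) (use fin le dim vec.span_superset in auto)
    moreover from this have "card (rows A) = CARD('m)" using vec.dim_eq_card_independent dim by metis
    then have inj: "inj (\<lambda>i. row i A)" unfolding rows by (simp add: eq_card_imp_inj_on)
    ultimately show "\<forall>c. (\<Sum>i\<in>UNIV. c i *s row i A) = 0 \<longrightarrow> (\<forall>i. c i = 0)"
    proof (intro allI impI)
      fix c i assume s: "(\<Sum>i\<in>UNIV. c i *s row i A) = 0"
      have "(\<Sum>x\<in>rows A. c (inv (\<lambda>i. row i A) x) *s x) = 0"
        unfolding rows by (subst sum.reindex[OF inj]) (simp add: s inv_f_f[OF inj])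
      then have "c (inv (\<lambda>i. row i A) (row i A)) = 0"
        by (rule vec.independentD[OF \<open>vec.independent (rows A)\<close> fin subset_refl, where u = "\<lambda>x. c (inv (\<lambda>i. row i A) x)"])
          (simp add: rows)
      then show "c i = 0" by (simp add: inv_f_f[OF inj])
    qed
  next
    assume ind: "\<forall>c. (\<Sum>i\<in>UNIV. c i *s row i A) = 0 \<longrightarrow> (\<forall>i. c i = 0)"
    have inj: "inj (\<lambda>i. row i A)"
    proof (rule injI, rule ccontr)
      fix i j assume ij: "row i A = row j A" "i \<noteq> j"
      let ?c = "\<lambda>l. if l = i then 1 else if l = j then - 1 else (0::'a)"
      have "(\<Sum>l\<in>UNIV. ?c l *s row l A) = (\<Sum>l\<in>UNIV. (if l = i then row i A else 0) + (if l = j then - row j A else 0))"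
        using ij(2) by (intro sum.cong) auto
      also have "\<dots> = 0" using ij(1) by (simp add: sum.distrib)
      finally have "?c i = 0" by (rule ind[rule_format, where c = ?c])
      then show False by simp
    qed
    have "vec.independent (rows A)"
    proof (rule vec.independent_if_scalars_zero)
      show "finite (rows A)" unfolding rows by simp
      fix f x assume s: "(\<Sum>x\<in>rows A. f x *s x) = 0" and x: "x \<in> rows A"
      have "(\<Sum>i\<in>UNIV. f (row i A) *s row i A) = 0"
        using s unfolding rows by (subst (asm) sum.reindex[OF inj]) simp
      then have "f (row i A) = 0" for i by (rule ind[rule_format, where c = "\<lambda>i. f (row i A)"])
      then show "f x = 0" using x unfolding rows by blast
    qed
    then have "vec.dim (rows A) = card (rows A)" by (rule vec.dim_eq_card_independent)
    then show "rank A = CARD('m)" unfolding row_rank_def_gen rows by (simp add: card_image[OF inj])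
  qed
  also have "\<dots> \<longleftrightarrow> surj ((*v) A)"
    unfolding matrix_right_invertible_independent_rows[symmetric] matrix_right_invertible_surjective ..
  finally show ?thesis .
qed

text \<open>The kernels are lines, so being distinct means meeting trivially. A trivial common
  kernel of two cameras already makes the four rows of the camera matrix independent.\<close>

lemma generic_cameras_iff:
  fixes A :: "('n::finite, 'k::field) cameras"
  assumes card: "CARD('n) \<ge> 3"
  shows "generic_cameras A \<longleftrightarrow> generic A"
proof -
  have rank: "rank (A i) = 3 \<longleftrightarrow> surj ((*v) (A i))" for i
    using full_rank_iff_surj[of "A i"] by simp
  show ?thesis
  proof
    assume g: "generic_cameras A"
    then have s: "surj ((*v) (A i))" for i using rank by (simp add: generic_cameras_def)
    have "X = 0" if ij: "i \<noteq> j" and X: "A i *v X = 0" "A j *v X = 0" for i j X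
    proof (rule ccontr)
      assume "X \<noteq> 0"
      have ker: "{x. A l *v x = 0} = range (\<lambda>c. c *s X)" if l: "A l *v X = 0" for l
      proof -
        obtain P where P: "\<forall>X. A l *v X = 0 \<longrightarrow> (\<exists>c. X = c *s P)" using surj_camera_kernel[OF s] by blast
        then obtain c where c: "X = c *s P" using l by blast
        then have "P = inverse c *s X" using \<open>X \<noteq> 0\<close> by (auto simp: vec_eq_iff)
        then have "\<exists>d. x = d *s X" if "A l *v x = 0" for x
          using P that by (metis vector_smult_assoc)
        moreover have "A l *v (d *s X) = 0" for d by (simp add: vector_scalar_commute l)
        ultimately show ?thesis by blast
      qed
      then have "{x. A i *v x = 0} = {x. A j *v x = 0}" using X by simp
      then show False using g ij unfolding generic_cameras_def by blast
    qed
    then show "generic A" unfolding generic_def using s by blast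
  next
    assume g: "generic A"
    have "row_space A \<in> grassmannian 4"
    proof -
      obtain i j :: 'n where ij: "i \<noteq> j"
        using card by (metis card_1_singletonE card_le_Suc0_iff_eq UNIV_I finite_class.finite_UNIV not_less_eq_eq numeral_3_eq_3 Suc_leD)
      have "(\<forall>c. (\<Sum>l\<in>UNIV. c l *s row l (camera_matrix A)) = 0 \<longrightarrow> (\<forall>l. c l = 0))"
      proof (intro allI impI)
        fix c l assume c: "(\<Sum>l\<in>UNIV. c l *s row l (camera_matrix A)) = 0"
        have "A h *v (\<chi> l. c l) = 0" for h
        proof -
          have "(A h *v (\<chi> l. c l)) $ r = (\<Sum>l\<in>UNIV. c l *s row l (camera_matrix A)) $ (h, r)" for r
            by (simp add: matrix_vector_mult_def row_def camera_matrix_def sum_component mult.commute)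
          then show ?thesis unfolding c by (simp add: vec_eq_iff)
        qed
        then have "(\<chi> l. c l) = 0" using g ij unfolding generic_def by blast
        then show "c l = 0" by (simp add: vec_eq_iff)
      qed
      then have "rank (camera_matrix A) = CARD(4)"
        unfolding full_rank_iff_surj matrix_right_invertible_surjective[symmetric] matrix_right_invertible_independent_rows .
      then show ?thesis
        by (simp add: grassmannian_def row_space_def row_rank_def_gen)
    qed
    moreover have "{x. A i *v x = 0} \<noteq> {x. A j *v x = 0}" if "i \<noteq> j" for i j
    proof
      assume e: "{x. A i *v x = 0} = {x. A j *v x = 0}"
      have "surj ((*v) (A i))" using g unfolding generic_def by blast
      from surj_camera_kernel[OF this] obtain P where P: "P \<noteq> 0" "A i *v P = 0" by blast
      with e have "A j *v P = 0" by blast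
      then show False using g that P unfolding generic_def by blast
    qed
    ultimately show "generic_cameras A" using g rank by (simp add: generic_cameras_def generic_def)
  qed
qed

section \<open>An explicit point and the nondegeneracy condition in Pluecker coordinates\<close>

lemma coef2_eq_peval:
  fixes f :: "('n::finite, 'k::field) xyz_poly"
  assumes "f \<in> graded_part fst (unit_deg i + unit_deg j)" "i \<noteq> j"
  shows "coef2 f i j r s = peval f (\<lambda>v. if v = (i, r) \<or> v = (j, s) then 1 else 0)"
proof -
  have "(\<chi> q. if (i, q) = (i, r) \<or> (i, q) = (j, s) then 1 else 0) = (axis r 1 :: 'k ^ 3)"
    "(\<chi> q. if (j, q) = (i, r) \<or> (j, q) = (j, s) then 1 else 0) = (axis s 1 :: 'k ^ 3)"
    using assms(2) by (auto simp: vec_eq_iff axis_def)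
  then show ?thesis unfolding peval_form2[OF assms] by (simp add: form2_axis)
qed

text \<open>The camera centres are the points \<open>(1, t l, (t l)\<^sup>2, 0)\<close> of a conic.\<close>

definition example_cameras :: "('n \<Rightarrow> 'k) \<Rightarrow> ('n::finite, 'k::field) cameras" where
  "example_cameras t l = vector [vector [- t l, 1, 0, 0], vector [- (t l)\<^sup>2, 0, 1, 0], vector [0, 0, 0, 1]]"

text \<open>On the image of camera j, the second coordinate minus \<open>t i + t j\<close> times the
  first is X_3 - (t_i + t_j) X_2 + t_i t_j X_1, symmetric in i and j, and the third coordinate is
  X_4 for every camera. Hence the difference of products vanishes.\<close>

definition example_form :: "('n \<Rightarrow> 'k) \<Rightarrow> 'n \<Rightarrow> 'n \<Rightarrow> ('n::finite, 'k::field) xyz_poly" where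
  "example_form t i j = Var (i, 3) * (Var (j, 2) - scale (t i + t j) (Var (j, 1)))
     - Var (j, 3) * (Var (i, 2) - scale (t i + t j) (Var (i, 1)))"

lemma vector_4:
  "(vector [w, x, y, z] :: 'a::zero ^ 4) $ 1 = w" "(vector [w, x, y, z] :: 'a ^ 4) $ 2 = x"
  "(vector [w, x, y, z] :: 'a ^ 4) $ 3 = y" "(vector [w, x, y, z] :: 'a ^ 4) $ 4 = z"
  unfolding vector_def by simp_all

lemma example_cameras_apply:
  "(example_cameras t l *v X) $ 1 = X $ 2 - t l * X $ 1"
  "(example_cameras t l *v X) $ 2 = X $ 3 - (t l)\<^sup>2 * X $ 1"
  "(example_cameras t l *v X) $ 3 = X $ 4"
  by (simp_all add: example_cameras_def matrix_vector_mult_def sum_4 vector_4)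

lemma generic_example_cameras:
  assumes "inj t"
  shows "generic (example_cameras t)"
  unfolding generic_def
proof (intro conjI allI impI)
  fix i
  have "example_cameras t i *v vector [0, y $ 1, y $ 2, y $ 3] = y" for y
    by (simp add: vec_eq_iff forall_3 example_cameras_apply vector_4)
  then show "surj ((*v) (example_cameras t i))"
    by (rule surjI[where f = "\<lambda>y. vector [0, y $ 1, y $ 2, y $ 3]"])
next
  fix i j X assume "i \<noteq> j" and X: "example_cameras t i *v X = 0" "example_cameras t j *v X = 0"
  then have t: "t i \<noteq> t j" using assms by (auto dest: injD)
  have z: "(example_cameras t i *v X) $ r = 0" "(example_cameras t j *v X) $ r = 0" for r
    using X by simp_all
  have e: "X $ 2 - t i * X $ 1 = 0" "X $ 3 - (t i)\<^sup>2 * X $ 1 = 0" "X $ 4 = 0" "X $ 2 - t j * X $ 1 = 0"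
    using z(1)[of 1] z(1)[of 2] z(1)[of 3] z(2)[of 1] unfolding example_cameras_apply by blast+
  then have "(t i - t j) * X $ 1 = 0" by (simp add: algebra_simps)
  then have "X $ 1 = 0" using t by simp
  with e show "X = 0" by (simp add: vec_eq_iff forall_4)
qed

lemma example_form_deg:
  fixes t :: "'n::finite \<Rightarrow> 'k::field"
  shows "example_form t i j \<in> graded_part fst (unit_deg i + unit_deg j)"
proof -
  have V: "(Var (l, r) :: ('n, 'k) xyz_poly) \<in> graded_part fst (unit_deg l)" for l r
    using gp_Var[of "(l, r)" fst] by simp
  have V2: "(Var (l, r) - scale c (Var (l, s)) :: ('n, 'k) xyz_poly) \<in> graded_part fst (unit_deg l)" for l r s c
    by (intro pm.subspace_diff[OF gp_subspace] pm.subspace_scale[OF gp_subspace] V)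
  have "Var (j, 3 :: 3) * (Var (i, 2) - scale (t i + t j) (Var (i, 1))) \<in> graded_part fst (unit_deg i + unit_deg j)"
    unfolding add.commute[of "unit_deg i"] by (rule gp_mult[OF V V2])
  then show ?thesis
    unfolding example_form_def by (intro pm.subspace_diff[OF gp_subspace] gp_mult[OF V V2])
qed

lemma peval_example_form:
  "peval (example_form t i j) p = p (i, 3) * (p (j, 2) - (t i + t j) * p (j, 1))
     - p (j, 3) * (p (i, 2) - (t i + t j) * p (i, 1))"
  by (simp add: example_form_def peval_diff peval_mult peval_scale)

lemma coef2_example_form:
  assumes "i \<noteq> j"
  shows "coef2 (example_form t i j) i j r 2 = (if r = 3 then 1 else 0)"
    "coef2 (example_form t i j) i j r 3 = (if r = 1 then t i + t j else if r = 2 then - 1 else 0)"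
  unfolding coef2_eq_peval[OF example_form_deg assms] peval_example_form using assms exhaust_3[of r] by auto

lemma example_form_mem:
  fixes t :: "'n::finite \<Rightarrow> 'k::alg_closed_field"
  assumes "inj t"
  shows "example_form t i j \<in> multiview_ideal (example_cameras t)"
  unfolding multiview_ideal_generic_iff[OF generic_example_cameras[OF assms] example_form_deg]
  by (simp add: peval_example_form cam_point_def
      example_cameras_apply power2_eq_square algebra_simps)

text \<open>In degree e_i + e_j the ideal is one-dimensional, so the Pluecker coordinates belong to
  lists of length 1 and are the coefficients of its generator.\<close>

definition pair_var :: "'n \<Rightarrow> 'n \<Rightarrow> 3 \<Rightarrow> 3 \<Rightarrow> (('n::finite \<Rightarrow> nat) \<times> ('n \<times> 3) monom list, 'k::field) mpoly" where
  "pair_var i j r s = Var (unit_deg i + unit_deg j, [Poly_Mapping.single (i, r) 1 + Poly_Mapping.single (j, s) 1])"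

definition det_poly :: "'n \<Rightarrow> 'n \<Rightarrow> 'n \<Rightarrow> (('n::finite \<Rightarrow> nat) \<times> ('n \<times> 3) monom list, 'k::field) mpoly" where
  "det_poly i j k =
    pair_var i j 1 2 * (pair_var i j 2 3 * pair_var i k 3 3 - pair_var i j 3 3 * pair_var i k 2 3) -
    pair_var i j 2 2 * (pair_var i j 1 3 * pair_var i k 3 3 - pair_var i j 3 3 * pair_var i k 1 3) +
    pair_var i j 3 2 * (pair_var i j 1 3 * pair_var i k 2 3 - pair_var i j 2 3 * pair_var i k 1 3)"

lemma multihomogeneous_det_poly:
  "multihomogeneous fst (det_poly i j k :: (('n::finite \<Rightarrow> nat) \<times> ('n \<times> 3) monom list, 'k::field) mpoly)"
proof -
  have V: "(pair_var a b r s :: (('n \<Rightarrow> nat) \<times> ('n \<times> 3) monom list, 'k) mpoly)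
      \<in> graded_part fst (unit_deg (unit_deg a + unit_deg b))" for a b :: 'n and r s
    unfolding pair_var_def
    by (rule gp_Var[of "(unit_deg a + unit_deg b, [Poly_Mapping.single (a, r) 1 + Poly_Mapping.single (b, s) 1])" fst, unfolded fst_conv])
  show ?thesis
    unfolding multihomogeneous_def det_poly_def
    by (rule exI[of _ "unit_deg (unit_deg i + unit_deg j) + (unit_deg (unit_deg i + unit_deg j) + unit_deg (unit_deg i + unit_deg k))"])
      (intro pm.subspace_diff[OF gp_subspace] pm.subspace_add[OF gp_subspace] gp_mult V)
qed

lemma peval_det_poly:
  "peval (det_poly i j k) P = det3 (\<lambda>r. peval (pair_var i j r 2) P) (\<lambda>r. peval (pair_var i j r 3) P)
    (\<lambda>r. peval (pair_var i k r 3) P)"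
  by (simp add: det_poly_def det3_def peval_diff peval_add peval_mult)

text \<open>There are 9 monomials and the Hilbert function is 8, which leaves dimension 1.\<close>

lemma pluecker_pair:
  fixes I :: "('n::finite, 'k::alg_closed_field) xyz_poly set"
  assumes I: "I \<in> hilbert_points" and P: "pluecker_vector I P" and dist: "distinct [i, j, k]"
  shows "\<exists>f. f \<noteq> 0 \<and> f \<in> I \<and> f \<in> graded_part fst (unit_deg i + unit_deg j) \<and>
    (\<forall>r s. peval (pair_var i j r s) P = coef2 f i j r s) \<and>
    (\<forall>g \<in> I \<inter> graded_part fst (unit_deg i + unit_deg j). \<exists>c. g = scale c f)"
proof -
  let ?d = "unit_deg i + unit_deg j"
  have ij: "i \<noteq> j" using dist by simp
  have ideal: "is_ideal I" and h: "has_hilbert_function fst I mv_hilbert_function"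
    using I by (auto simp: hilbert_points_def homogeneous_ideal_def)
  obtain fs where fs: "distinct fs" "pm.independent (set fs)" "pm.span (set fs) = I \<inter> graded_part fst ?d"
    and Pf: "\<And>ms. P (?d, ms) = (if length ms = length fs \<and> (\<forall>m\<in>set ms. multideg fst m = ?d) then minor fs ms else 0)"
    using P unfolding pluecker_vector_def by blast
  have sub: "set fs \<subseteq> I \<inter> graded_part fst ?d" unfolding fs(3)[symmetric] by (rule pm.span_superset)
  have "int (card {m :: ('n \<times> 3) monom. multideg fst m = ?d}) = mv_hilbert_function ?d + int (card {..<length fs})"
  proof (rule hilbert_basis_length[OF ideal h])
    show "pm.indep_mod {0} {..<length fs} ((!) fs)" by (rule pm.indep_mod_list[OF fs(1,2)])
    show "pm.spans_mod {0} {..<length fs} ((!) fs) (I \<inter> graded_part fst ?d)"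
      unfolding fs(3)[symmetric] by (rule pm.spans_mod_list[OF fs(1) refl])
  qed (use sub in auto)
  then have "length fs = 1"
    unfolding unit_deg_pair[OF ij, of k] card_deg3[OF dist] hilbert_deg3[OF dist]
    by (simp add: numeral_3_eq_3 numeral_2_eq_2)
  then obtain f where f: "fs = [f]" by (cases fs) auto
  have "f \<noteq> 0" using fs(2) pm.dependent_zero unfolding f by auto
  moreover have "f \<in> I" "f \<in> graded_part fst ?d" using sub by (auto simp: f)
  moreover have "peval (pair_var i j r s) P = coef2 f i j r s" for r s
  proof -
    have "minor [f] [m] = lookup f m" for m
    proof -
      have "{\<pi>. \<pi> permutes {..<length [f]}} = {id}" by (auto simp: lessThan_Suc permutes_sing)
      then show ?thesis unfolding minor_def by simp
    qed
    then show ?thesis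
      by (simp add: pair_var_def peval_Var Pf f coef2_def multideg_add multideg_single[unfolded One_nat_def])
  qed
  moreover have "\<exists>c. g = scale c f" if "g \<in> I \<inter> graded_part fst ?d" for g
    using that unfolding fs(3)[symmetric] f by (auto simp: pm.span_singleton)
  ultimately show ?thesis by blast
qed

text \<open>Other choices of \<open>f\<close>, \<open>g\<close> and of the Pluecker vector change
  the determinant by a nonzero factor only.\<close>

lemma det_poly_open_iff:
  fixes I :: "('n::finite, 'k::alg_closed_field) xyz_poly set"
  assumes I: "I \<in> hilbert_points" and dist: "distinct [i, j, k]"
    and f: "f \<noteq> 0" "f \<in> I" "f \<in> graded_part fst (unit_deg i + unit_deg j)"
    and g: "g \<noteq> 0" "g \<in> I" "g \<in> graded_part fst (unit_deg i + unit_deg k)"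
  shows "I \<in> hilbert_basic_open (det_poly i j k) \<longleftrightarrow>
    det3 (\<lambda>r. coef2 f i j r 2) (\<lambda>r. coef2 f i j r 3) (\<lambda>r. coef2 g i k r 3) \<noteq> 0"
proof -
  have dist': "distinct [i, k, j]" using dist by auto
  have *: "peval (det_poly i j k) P \<noteq> 0 \<longleftrightarrow>
      det3 (\<lambda>r. coef2 f i j r 2) (\<lambda>r. coef2 f i j r 3) (\<lambda>r. coef2 g i k r 3) \<noteq> 0"
    if P: "pluecker_vector I P" for P
  proof -
    obtain f0 where f0: "\<forall>r s. peval (pair_var i j r s) P = coef2 f0 i j r s"
      "\<forall>g \<in> I \<inter> graded_part fst (unit_deg i + unit_deg j). \<exists>c. g = scale c f0"
      using pluecker_pair[OF I P dist] by blast
    obtain g0 where g0: "\<forall>r s. peval (pair_var i k r s) P = coef2 g0 i k r s"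
      "\<forall>g \<in> I \<inter> graded_part fst (unit_deg i + unit_deg k). \<exists>c. g = scale c g0"
      using pluecker_pair[OF I P dist'] by blast
    obtain c where c: "f = scale c f0" using f0(2) f by blast
    obtain c' where c': "g = scale c' g0" using g0(2) g by blast
    have nz: "c \<noteq> 0" "c' \<noteq> 0" using f(1) g(1) c c' by auto
    have "det3 (\<lambda>r. coef2 f i j r 2) (\<lambda>r. coef2 f i j r 3) (\<lambda>r. coef2 g i k r 3) =
        c * c * c' * peval (det_poly i j k) P"
      unfolding peval_det_poly using f0(1) g0(1)
      by (simp add: c c' coef2_def lookup_scale det3_def algebra_simps)
    then show ?thesis using nz by simp
  qed
  have "\<exists>P. pluecker_vector I P"
    using I pluecker_vector_exists by (auto simp: hilbert_points_def homogeneous_ideal_def)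
  then show ?thesis using I * unfolding hilbert_basic_open_def by blast
qed

definition nondegenerate_open :: "('n::finite, 'k::field) xyz_poly set set" where
  "nondegenerate_open = (\<Inter>(i, j, k)\<in>{(i, j, k). distinct [i, j, k]}. hilbert_basic_open (det_poly i j k))"

lemma openin_nondegenerate_open:
  assumes "CARD('n::finite) \<ge> 3"
  shows "openin hilbert_scheme (nondegenerate_open :: ('n, 'k::field) xyz_poly set set)"
  unfolding nondegenerate_open_def
proof (rule openin_INT2)
  show "finite {(i :: 'n, j, k). distinct [i, j, k]}" by (rule finite_subset[OF subset_UNIV]) simp
  show "{(i :: 'n, j, k). distinct [i, j, k]} \<noteq> {}" using exists_distinct_triple[OF assms] by auto
  fix x :: "'n \<times> 'n \<times> 'n"
  show "openin hilbert_scheme ((case x of (i, j, k) \<Rightarrow> hilbert_basic_open (det_poly i j k)) :: ('n, 'k) xyz_poly set set)"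
    unfolding hilbert_scheme_def using multihomogeneous_det_poly
    by (cases x) (auto intro!: topology_generated_by_Basis)
qed

lemma example_mem_nondegenerate_open:
  fixes t :: "'n::finite \<Rightarrow> 'k::alg_closed_field"
  assumes "inj t"
  shows "multiview_ideal (example_cameras t) \<in> nondegenerate_open"
proof -
  have "multiview_ideal (example_cameras t) \<in> hilbert_basic_open (det_poly i j k)" if dist: "distinct [i, j, k]" for i j k
  proof -
    have ne: "i \<noteq> j" "i \<noteq> k" "j \<noteq> k" using dist by auto
    have nz: "example_form t a b \<noteq> 0" if "a \<noteq> b" for a b
      using coef2_example_form(1)[OF that, of t 3] by (auto simp: coef2_def)
    \<comment> \<open>The determinant for these cameras equals \<open>t k - t j\<close>.\<close>
    have "t j \<noteq> t k" using assms ne(3) by (auto dest: injD)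
    then show ?thesis
      unfolding det_poly_open_iff[OF multiview_ideal_hilbert_point[OF generic_example_cameras[OF assms]] dist
          nz[OF ne(1)] example_form_mem[OF assms] example_form_deg nz[OF ne(2)] example_form_mem[OF assms] example_form_deg]
      by (simp add: det3_def coef2_example_form ne)
  qed
  then show ?thesis unfolding nondegenerate_open_def by blast
qed

lemma nondegenerate_open_subset:
  fixes I :: "('n::finite, 'k::alg_closed_field) xyz_poly set"
  assumes card: "CARD('n) \<ge> 3" and I: "I \<in> nondegenerate_open"
  shows "\<exists>A. generic A \<and> I = multiview_ideal A"
proof -
  have opn: "I \<in> hilbert_basic_open (det_poly i j k)" if "distinct [i, j, k]" for i j k
    using I that unfolding nondegenerate_open_def by blast
  obtain i0 j0 k0 :: 'n where "distinct [i0, j0, k0]" using exists_distinct_triple[OF card] by blast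
  from opn[OF this] have hp: "I \<in> hilbert_points" by (simp add: hilbert_basic_open_def)
  then have I': "homogeneous_ideal fst I" "is_ideal I" "has_hilbert_function fst I mv_hilbert_function"
    by (auto simp: hilbert_points_def homogeneous_ideal_def)
  obtain P where P: "pluecker_vector I P" using pluecker_vector_exists[OF I'(2)] by blast
  \<comment> \<open>The choice depends on \<open>i\<close> and \<open>j\<close> only through the
    degree, which is symmetric; this gives \<open>F i j = F j i\<close>.\<close>
  define F where "F i j = (SOME f. f \<noteq> 0 \<and> f \<in> I \<and> f \<in> graded_part fst (unit_deg i + unit_deg j))" for i j
  have F: "F i j \<noteq> 0 \<and> F i j \<in> I \<and> F i j \<in> graded_part fst (unit_deg i + unit_deg j)" if "i \<noteq> j" for i j
  proof -
    have "\<exists>k. distinct [i, j, k]"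
    proof (rule ccontr)
      assume "\<not> ?thesis"
      then have "UNIV \<subseteq> {i, j}" using that by auto
      then have "CARD('n) \<le> card {i, j}" by (rule card_mono[rotated]) simp
      then show False using card that by simp
    qed
    then obtain k where "distinct [i, j, k]" by blast
    from pluecker_pair[OF hp P this] obtain f
      where f: "f \<noteq> 0 \<and> f \<in> I \<and> f \<in> graded_part fst (unit_deg i + unit_deg j)" by blast
    show ?thesis
      unfolding F_def
      by (rule someI[of "\<lambda>f. f \<noteq> 0 \<and> f \<in> I \<and> f \<in> graded_part fst (unit_deg i + unit_deg j)" f]) (rule f)
  qed
  interpret nondegenerate_point I F
  proof
    fix i j k :: 'n
    show "F i j \<in> I" "F i j \<in> graded_part fst (unit_deg i + unit_deg j)" if "i \<noteq> j" using F[OF that] by blast+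
    show "F i j = F j i" by (simp add: F_def add.commute)
    assume dist: "distinct [i, j, k]"
    then have ne: "i \<noteq> j" "i \<noteq> k" by auto
    have Fij: "F i j \<noteq> 0" "F i j \<in> I" "F i j \<in> graded_part fst (unit_deg i + unit_deg j)"
      and Fik: "F i k \<noteq> 0" "F i k \<in> I" "F i k \<in> graded_part fst (unit_deg i + unit_deg k)"
      using F[OF ne(1)] F[OF ne(2)] by blast+
    show "det3 (\<lambda>r. coef2 (F i j) i j r 2) (\<lambda>r. coef2 (F i j) i j r 3) (\<lambda>r. coef2 (F i k) i k r 3) \<noteq> 0"
      using opn[OF dist] unfolding det_poly_open_iff[OF hp dist Fij Fik] .
  qed (rule I')+
  show ?thesis by (rule eq_multiview_ideal[OF card I'(1)])
qed

theorem theorem6p3: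
  assumes "CARD('n::finite) \<ge> 3"
  shows "irreducible_component (hilbert_scheme :: ('n, 'k::alg_closed_field) xyz_poly set topology)
           camera_space"
proof -
  let ?X = "hilbert_scheme :: ('n, 'k) xyz_poly set topology"
  let ?S = "{multiview_ideal A | A :: ('n, 'k) cameras. generic A}"
  let ?C = "camera_space :: ('n, 'k) xyz_poly set set"
  have gamma: "gamma ` gamma_domain = ?S"
    unfolding gamma_image generic_cameras_iff[OF assms] ..
  obtain T :: "'k set" where "finite T" "card T = CARD('n)"
    using infinite_arbitrarily_large[OF infinite_UNIV_alg_closed] by blast
  then obtain t where "bij_betw t (UNIV :: 'n set) T"
    using finite_same_card_bij[of "UNIV :: 'n set" T] by auto
  then have t: "inj t" by (rule bij_betw_imp_inj_on)
  note gen = generic_example_cameras[OF t]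
  have irr: "irreducible_in ?X ?C"
    by (rule irreducible_camera_space[OF _ gamma]) (use gen in blast)
  have sub: "?S \<subseteq> topspace ?X"
    unfolding topspace_hilbert_scheme using multiview_ideal_hilbert_point by blast
  have SC: "?S \<subseteq> ?C" unfolding camera_space_def gamma by (rule closure_of_subset[OF sub])
  have NC: "nondegenerate_open \<subseteq> ?C" using nondegenerate_open_subset[OF assms] SC by blast
  have "U = ?C" if U: "irreducible_in ?X U" and CU: "?C \<subseteq> U" for U
  proof -
    have "closedin ?X ?C" unfolding camera_space_def by (rule closedin_closure_of)
    moreover have "closedin ?X (topspace ?X - nondegenerate_open)"
      by (rule closedin_diff[OF closedin_topspace openin_nondegenerate_open[OF assms]])
    \<comment> \<open>Two closed sets cover \<open>U\<close>, and the second misses the example,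
      which lies in \<open>U\<close>; so irreducibility leaves only the camera space.\<close>
    moreover have "U \<subseteq> ?C \<union> (topspace ?X - nondegenerate_open)"
      using U NC unfolding irreducible_in_def by blast
    ultimately have "U \<subseteq> ?C \<or> U \<subseteq> topspace ?X - nondegenerate_open"
      using U unfolding irreducible_in_def by blast
    moreover have "multiview_ideal (example_cameras t) \<in> U" using SC CU gen by blast
    ultimately show ?thesis using example_mem_nondegenerate_open[OF t] CU by blast
  qed
  then show ?thesis unfolding irreducible_component_def using irr by blast
qed

end
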